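(* For all integers $k,n>0$ there exists a non-positively curved orientable Ricci surface $M$ of genus $k$ with $n$ catenoidal ends; that is, there are a compact Riemann surface $S_k$ of genus $k$, distinct points $p_1,\dots,p_n\in S_k$, and a non-positively curved Ricci surface $M$ biholomorphic to $S_k\setminus\{p_1,\dots,p_n\}$ such that each $p_i$ is a catenoidal end of $M$.
   Context: Ricci surface: an orientable Riemannian surface $(M,g_M)$ whose Gauss curvature $K$ satisfies $K\Delta K+g_M(dK,dK)+4K^3=0$, where $\Delta=-\mathrm{div}\,\mathrm{grad}$ is the nonnegative Laplacian. It is non-positively curved if $K\le 0$. $M$ is regarded as a Riemann surface through the conformal class of $g_M$ and an orientation. Its total curvature is $\int_M K\,dA$. Weierstrass data: let $\pi:\tilde M\to M$ be the universal cover of a non-positively curved Ricci surface. There are a meromorphic function $g$ and a holomorphic 1-form $\eta$ (locally $\eta=\alpha\,dz$) on $\tilde M$, where $\eta$ has a zero of order $2m$ at each pole of $g$ of order $m$ and no other zeros, such that $\pi^*g_M=\frac14|\alpha|^2(1+|g|^2)^2|dz|^2$. The pair $(g,\eta)$ is called the Weierstrass data of $M$; it is unique up to $\eta\mapsto e^{i\theta}\eta$ and up to $(g,\eta)\mapsto(\tilde g,\tilde\eta)$ with $\tilde g=\sigma\cdot g$ ($\sigma\in PSU(2)$ acting by Möbius transformations) and $\tilde\eta=Q/d\tilde g$, where $Q:=dg\otimes\eta$ is the Hopf differential. Thus $Q$ is a holomorphic quadratic differential on $\tilde M$, unique up to a factor $e^{i\theta}$. Catenoidal end: suppose $M$ has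 finite total curvature and is biholomorphic to $S_k\setminus\{p_1,\dots,p_r\}$, with $S_k$ a compact Riemann surface of genus $k$. The puncture $p_i$ is a catenoidal end if it has a neighbourhood on which $Q$ is well defined (i.e. on a connected component of the preimage in $\tilde M$ of the punctured neighbourhood, $Q$ is invariant under the deck transformations preserving that component, hence descends) and meromorphic, with $\mathrm{ord}_{p_i}Q=-2$ (a pole of order exactly 2). *)

theory Defs
  imports "HOL-Complex_Analysis.Complex_Analysis" "HOL-Homology.Homology"
begin

section \<open>Charts and Riemann surfaces\<close>

text \<open>
  A chart is a pair of its domain and its coordinate map; the values of the coordinate map
  outside the domain are irrelevant.  Surfaces are abstract topologies, so that their points may
  form a proper subset of the carrier type.
\<close>

type_synonym 'a chart = "'a set \<times> ('a \<Rightarrow> complex)"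

definition chart_image :: "'a chart \<Rightarrow> complex set" where
  "chart_image c = snd c ` fst c"

definition chart_inv :: "'a chart \<Rightarrow> complex \<Rightarrow> 'a" where
  "chart_inv c = inv_into (fst c) (snd c)"

definition is_chart :: "'a topology \<Rightarrow> 'a chart \<Rightarrow> bool" where
  "is_chart X c \<longleftrightarrow> openin X (fst c) \<and> open (chart_image c) \<and>
     homeomorphic_map (subtopology X (fst c)) (top_of_set (chart_image c)) (snd c)"

definition coord :: "'a chart \<Rightarrow> ('a \<Rightarrow> 'b) \<Rightarrow> 'b chart \<Rightarrow> complex \<Rightarrow> complex" where
  "coord c f d = snd d \<circ> f \<circ> chart_inv c"

definition coord_dom :: "'a chart \<Rightarrow> ('a \<Rightarrow> 'b) \<Rightarrow> 'b chart \<Rightarrow> complex set" where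
  "coord_dom c f d = snd c ` (fst c \<inter> f -` fst d)"

text \<open>Second countability need not be demanded of a Riemann surface (Rado's theorem).\<close>

definition riemann_surface :: "'a topology \<Rightarrow> 'a chart set \<Rightarrow> bool" where
  "riemann_surface X A \<longleftrightarrow>
     topspace X \<noteq> {} \<and> connected_space X \<and> Hausdorff_space X \<and>
     (\<forall>c\<in>A. is_chart X c) \<and> topspace X = (\<Union>c\<in>A. fst c) \<and>
     (\<forall>c\<in>A. \<forall>d\<in>A. coord c id d holomorphic_on coord_dom c id d)"

definition restrict_charts :: "'a chart set \<Rightarrow> 'a set \<Rightarrow> 'a chart set" where
  "restrict_charts A W = (\<lambda>c. (fst c \<inter> W, snd c)) ` A"

definition holomorphic_map ::
  "'a topology \<Rightarrow> 'a chart set \<Rightarrow> 'b topology \<Rightarrow> 'b chart set \<Rightarrow> ('a \<Rightarrow> 'b) \<Rightarrow> bool" where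
  "holomorphic_map X A Y B f \<longleftrightarrow> continuous_map X Y f \<and>
     (\<forall>c\<in>A. \<forall>d\<in>B. coord c f d holomorphic_on coord_dom c f d)"

definition biholomorphism ::
  "'a topology \<Rightarrow> 'a chart set \<Rightarrow> 'b topology \<Rightarrow> 'b chart set \<Rightarrow> ('a \<Rightarrow> 'b) \<Rightarrow> bool" where
  "biholomorphism X A Y B f \<longleftrightarrow> riemann_surface X A \<and> riemann_surface Y B \<and>
     holomorphic_map X A Y B f \<and>
     (\<exists>f'. homeomorphic_maps X Y f f' \<and> holomorphic_map Y B X A f')"

text \<open>
  A connected closed orientable surface has genus \<open>k\<close> iff its first integral homology group is
  free abelian of rank \<open>2 * k\<close>.
\<close>

definition has_genus :: "'a topology \<Rightarrow> nat \<Rightarrow> bool" where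
  "has_genus X k \<longleftrightarrow> homology_group 1 X \<cong> free_Abelian_group {..<2 * k}"

section \<open>Holomorphic differentials\<close>

text \<open>
  A differential of weight \<open>k\<close> (\<open>k = 1\<close>: one-forms \<open>\<alpha> dz\<close>; \<open>k = 2\<close>: quadratic differentials
  \<open>q dz\<^sup>2\<close>) is given by its coefficient function in every chart.  The following says that
  the pullback along \<open>f\<close> of \<open>\<theta>\<close> (on the charts \<open>B\<close>) is \<open>\<omega>\<close> (on the charts \<open>A\<close>) at the points
  of \<open>W\<close>.
\<close>

definition pullback_on ::
  "nat \<Rightarrow> 'a chart set \<Rightarrow> 'b chart set \<Rightarrow> ('a \<Rightarrow> 'b) \<Rightarrow> 'a set
    \<Rightarrow> ('b chart \<Rightarrow> complex \<Rightarrow> complex) \<Rightarrow> ('a chart \<Rightarrow> complex \<Rightarrow> complex) \<Rightarrow> bool" where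
  "pullback_on k A B f W \<theta> \<omega> \<longleftrightarrow>
     (\<forall>c\<in>A. \<forall>d\<in>B. \<forall>z\<in>snd c ` (fst c \<inter> W \<inter> f -` fst d).
        \<theta> d (coord c f d z) * deriv (coord c f d) z ^ k = \<omega> c z)"

definition holomorphic_differential ::
  "nat \<Rightarrow> 'a chart set \<Rightarrow> 'a set \<Rightarrow> ('a chart \<Rightarrow> complex \<Rightarrow> complex) \<Rightarrow> bool" where
  "holomorphic_differential k A W \<omega> \<longleftrightarrow>
     (\<forall>c\<in>A. \<omega> c holomorphic_on snd c ` (fst c \<inter> W)) \<and> pullback_on k A A id W \<omega> \<omega>"

section \<open>Oriented Riemannian surfaces\<close>

text \<open>Partial (directional) derivatives in \<open>\<complex> = \<real>\<^sup>2\<close>, with coordinate directions \<open>1\<close> and \<open>\<i>\<close>.\<close>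

definition pd :: "complex \<Rightarrow> (complex \<Rightarrow> 'b::real_normed_vector) \<Rightarrow> complex \<Rightarrow> 'b" where
  "pd v f z = frechet_derivative f (at z) v"

fun C_on :: "nat \<Rightarrow> complex set \<Rightarrow> (complex \<Rightarrow> 'b::real_normed_vector) \<Rightarrow> bool" where
  "C_on 0 W f \<longleftrightarrow> continuous_on W f"
| "C_on (Suc k) W f \<longleftrightarrow>
     (\<forall>z\<in>W. f differentiable (at z)) \<and> C_on k W (pd 1 f) \<and> C_on k W (pd \<i> f)"

definition smooth_on :: "complex set \<Rightarrow> (complex \<Rightarrow> 'b::real_normed_vector) \<Rightarrow> bool" where
  "smooth_on W f \<longleftrightarrow> (\<forall>k. C_on k W f)"

definition jacobian_det :: "(complex \<Rightarrow> complex) \<Rightarrow> complex \<Rightarrow> real" where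
  "jacobian_det T z = Re (pd 1 T z) * Im (pd \<i> T z) - Im (pd 1 T z) * Re (pd \<i> T z)"

text \<open>
  The metric assigns to a chart \<open>c\<close> and a point \<open>z\<close> of its image a bilinear form on
  \<open>\<complex> = \<real>\<^sup>2\<close>.
\<close>

record 'a riem_surface =
  top_of :: "'a topology"
  atlas_of :: "'a chart set"
  metric_of :: "'a chart \<Rightarrow> complex \<Rightarrow> complex \<Rightarrow> complex \<Rightarrow> real"

definition second_countable_space :: "'a topology \<Rightarrow> bool" where
  "second_countable_space X \<longleftrightarrow>
     (\<exists>\<B>. countable \<B> \<and> (\<forall>V\<in>\<B>. openin X V) \<and>
       (\<forall>U x. openin X U \<and> x \<in> U \<longrightarrow> (\<exists>V\<in>\<B>. x \<in> V \<and> V \<subseteq> U)))"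

definition oriented_riemannian_surface :: "'a riem_surface \<Rightarrow> bool" where
  "oriented_riemannian_surface M \<longleftrightarrow>
     (let X = top_of M; A = atlas_of M; m = metric_of M in
      topspace X \<noteq> {} \<and> connected_space X \<and> Hausdorff_space X \<and> second_countable_space X \<and>
      (\<forall>c\<in>A. is_chart X c) \<and> topspace X = (\<Union>c\<in>A. fst c) \<and>
      (\<forall>c\<in>A. \<forall>d\<in>A. smooth_on (coord_dom c id d) (coord c id d) \<and>
         (\<forall>z\<in>coord_dom c id d. jacobian_det (coord c id d) z > 0)) \<and>
      (\<forall>c\<in>A. \<forall>z\<in>chart_image c. bilinear (m c z) \<and>
         (\<forall>v w. m c z v w = m c z w v) \<and> (\<forall>v. v \<noteq> 0 \<longrightarrow> m c z v v > 0)) \<and>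
      (\<forall>c\<in>A. \<forall>v w. smooth_on (chart_image c) (\<lambda>z. m c z v w)) \<and>
      (\<forall>c\<in>A. \<forall>d\<in>A. \<forall>z\<in>coord_dom c id d. \<forall>v w.
         m c z v w = m d (coord c id d z) (pd v (coord c id d) z) (pd w (coord c id d) z)))"

subsection \<open>Local Riemannian geometry\<close>

type_synonym local_metric = "complex \<Rightarrow> complex \<Rightarrow> complex \<Rightarrow> real"

definition gram_det :: "local_metric \<Rightarrow> complex \<Rightarrow> real" where
  "gram_det h z = h z 1 1 * h z \<i> \<i> - (h z 1 \<i>)\<^sup>2"

text \<open>The vector dual to the covector \<open>a dx + b dy\<close>.\<close>

definition sharp :: "local_metric \<Rightarrow> complex \<Rightarrow> real \<Rightarrow> real \<Rightarrow> complex" where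
  "sharp h z a b = Complex ((h z \<i> \<i> * a - h z 1 \<i> * b) / gram_det h z)
                           ((h z 1 1 * b - h z 1 \<i> * a) / gram_det h z)"

text \<open>
  Christoffel symbols of the first kind, evaluated on constant vector fields (Koszul formula),
  the Levi-Civita derivative of a vector field \<open>Y\<close> in the constant direction \<open>v\<close>, and
  the Gauss curvature \<open>h (R(e\<^sub>1, e\<^sub>2) e\<^sub>2, e\<^sub>1) / det h\<close> with \<open>e\<^sub>1 = 1\<close> and
  \<open>e\<^sub>2 = \<i>\<close>.
\<close>

definition christoffel1 :: "local_metric \<Rightarrow> complex \<Rightarrow> complex \<Rightarrow> complex \<Rightarrow> complex \<Rightarrow> real" where
  "christoffel1 h u v w z =
     (pd u (\<lambda>x. h x v w) z + pd v (\<lambda>x. h x u w) z - pd w (\<lambda>x. h x u v) z) / 2"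

definition nabla :: "local_metric \<Rightarrow> complex \<Rightarrow> (complex \<Rightarrow> complex) \<Rightarrow> complex \<Rightarrow> complex" where
  "nabla h v Y z =
     pd v Y z + sharp h z (christoffel1 h v (Y z) 1 z) (christoffel1 h v (Y z) \<i> z)"

definition local_gauss :: "local_metric \<Rightarrow> complex \<Rightarrow> real" where
  "local_gauss h z =
     h z (nabla h 1 (nabla h \<i> (\<lambda>_. \<i>)) z - nabla h \<i> (nabla h 1 (\<lambda>_. \<i>)) z) 1 / gram_det h z"

definition grad :: "local_metric \<Rightarrow> (complex \<Rightarrow> real) \<Rightarrow> complex \<Rightarrow> complex" where
  "grad h f z = sharp h z (pd 1 f z) (pd \<i> f z)"

definition divergence :: "local_metric \<Rightarrow> (complex \<Rightarrow> complex) \<Rightarrow> complex \<Rightarrow> real" where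
  "divergence h Y z =
     (pd 1 (\<lambda>x. sqrt (gram_det h x) * Re (Y x)) z + pd \<i> (\<lambda>x. sqrt (gram_det h x) * Im (Y x)) z)
       / sqrt (gram_det h z)"

definition laplacian :: "local_metric \<Rightarrow> (complex \<Rightarrow> real) \<Rightarrow> complex \<Rightarrow> real" where
  "laplacian h f z = - divergence h (grad h f) z"

subsection \<open>Ricci surfaces\<close>

text \<open>The choice of the chart is immaterial by the Theorema Egregium.\<close>

definition gauss_curvature :: "'a riem_surface \<Rightarrow> 'a \<Rightarrow> real" where
  "gauss_curvature M p =
     (let c = SOME c. c \<in> atlas_of M \<and> p \<in> fst c in local_gauss (metric_of M c) (snd c p))"

text \<open>Note \<open>g\<^sub>M(dK, dK) = g\<^sub>M(grad K, grad K)\<close>.\<close>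

definition ricci_surface :: "'a riem_surface \<Rightarrow> bool" where
  "ricci_surface M \<longleftrightarrow> oriented_riemannian_surface M \<and>
     (\<forall>c\<in>atlas_of M. \<forall>z\<in>chart_image c.
        let h = metric_of M c; K = gauss_curvature M \<circ> chart_inv c in
        K z * laplacian h K z + h z (grad h K z) (grad h K z) + 4 * K z ^ 3 = 0)"

definition nonpositively_curved :: "'a riem_surface \<Rightarrow> bool" where
  "nonpositively_curved M \<longleftrightarrow> (\<forall>p\<in>topspace (top_of M). gauss_curvature M p \<le> 0)"

text \<open>
  The Riemannian area measure on the Borel sets.  It is determined by the stated conditions
  because countably many charts cover the surface.
\<close>

definition area_measure :: "'a riem_surface \<Rightarrow> 'a measure \<Rightarrow> bool" where
  "area_measure M \<mu> \<longleftrightarrow>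
     space \<mu> = topspace (top_of M) \<and>
     sets \<mu> = sigma_sets (topspace (top_of M)) {U. openin (top_of M) U} \<and>
     (\<forall>c\<in>atlas_of M. \<forall>B\<in>sets \<mu>. B \<subseteq> fst c \<longrightarrow>
        emeasure \<mu> B = (\<integral>\<^sup>+z\<in>snd c ` B. ennreal (sqrt (gram_det (metric_of M c) z)) \<partial>lborel))"

definition finite_total_curvature :: "'a riem_surface \<Rightarrow> bool" where
  "finite_total_curvature M \<longleftrightarrow> (\<exists>\<mu>. area_measure M \<mu> \<and> integrable \<mu> (gauss_curvature M))"

text \<open>
  The complex structure of an oriented Riemannian surface: all charts that are smoothly
  compatible with the atlas, orientation preserving, and conformal.
\<close>

definition conformal_charts :: "'a riem_surface \<Rightarrow> 'a chart set" where
  "conformal_charts M = {c. is_chart (top_of M) c \<and>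
     (\<forall>d\<in>atlas_of M. smooth_on (coord_dom d id c) (coord d id c) \<and>
        (\<forall>z\<in>coord_dom d id c. jacobian_det (coord d id c) z > 0 \<and>
           (\<exists>\<rho>>0. \<forall>v. (norm (pd v (coord d id c) z))\<^sup>2 = \<rho> * metric_of M d z v v)))}"

section \<open>Weierstrass data and catenoidal ends\<close>

definition covering :: "'a topology \<Rightarrow> 'b topology \<Rightarrow> ('a \<Rightarrow> 'b) \<Rightarrow> bool" where
  "covering Y X p \<longleftrightarrow> continuous_map Y X p \<and> p ` topspace Y = topspace X \<and>
     (\<forall>x\<in>topspace X. \<exists>U. openin X U \<and> x \<in> U \<and>
        (\<exists>\<V>. \<Union>\<V> = topspace Y \<inter> p -` U \<and> pairwise disjnt \<V> \<and>
           (\<forall>V\<in>\<V>. openin Y V \<and> homeomorphic_map (subtopology Y V) (subtopology X U) p)))"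

definition simply_connected_space :: "'a topology \<Rightarrow> bool" where
  "simply_connected_space X \<longleftrightarrow> path_connected_space X \<and>
     (\<forall>f. continuous_map (top_of_set (sphere (0::complex) 1)) X f \<longrightarrow>
        (\<exists>a. homotopic_with (\<lambda>_. True) (top_of_set (sphere (0::complex) 1)) X f (\<lambda>_. a)))"

definition universal_cover ::
  "'b topology \<Rightarrow> 'b chart set \<Rightarrow> 'a topology \<Rightarrow> 'a chart set \<Rightarrow> ('b \<Rightarrow> 'a) \<Rightarrow> bool" where
  "universal_cover Y B X A \<pi> \<longleftrightarrow> riemann_surface Y B \<and> simply_connected_space Y \<and>
     covering Y X \<pi> \<and> holomorphic_map Y B X A \<pi>"

text \<open>
  The Weierstrass data \<open>(g, \<eta>)\<close> live on the universal cover \<open>\<pi>\<close> of \<open>M\<close>, which has topology \<open>Y\<close>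
  and holomorphic charts \<open>B\<close>.  The meromorphic function \<open>g\<close> takes the value \<open>0\<close> at its poles, as
  usual in the library; there the formula for the pulled back metric is understood by
  continuity, so that it need only be stated away from the (isolated) poles.
\<close>

definition weierstrass_data ::
  "'a riem_surface \<Rightarrow> 'b topology \<Rightarrow> 'b chart set \<Rightarrow> ('b \<Rightarrow> 'a) \<Rightarrow> ('b \<Rightarrow> complex)
    \<Rightarrow> ('b chart \<Rightarrow> complex \<Rightarrow> complex) \<Rightarrow> bool" where
  "weierstrass_data M Y B \<pi> g \<eta> \<longleftrightarrow>
     universal_cover Y B (top_of M) (conformal_charts M) \<pi> \<and>
     (\<forall>c\<in>B. (g \<circ> chart_inv c) nicely_meromorphic_on chart_image c) \<and>
     holomorphic_differential 1 B (topspace Y) \<eta> \<and>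
     (\<forall>c\<in>B. \<forall>z\<in>chart_image c.
        if is_pole (g \<circ> chart_inv c) z
        then \<eta> c z = 0 \<and> zorder (\<eta> c) z = 2 * (- zorder (g \<circ> chart_inv c) z)
        else \<eta> c z \<noteq> 0) \<and>
     (\<forall>c\<in>B. \<forall>d\<in>atlas_of M. \<forall>z\<in>coord_dom c \<pi> d. \<not> is_pole (g \<circ> chart_inv c) z \<longrightarrow>
        (\<forall>v w. metric_of M d (coord c \<pi> d z) (pd v (coord c \<pi> d) z) (pd w (coord c \<pi> d) z)
           = 1/4 * (norm (\<eta> c z))\<^sup>2 * (1 + (norm (g (chart_inv c z)))\<^sup>2)\<^sup>2 * (v \<bullet> w)))"

text \<open>
  The Hopf differential \<open>dg \<otimes> \<eta>\<close>; \<^const>\<open>remove_sings\<close> fills in its removable singularities at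
  the poles of \<open>g\<close>.
\<close>

definition hopf_differential ::
  "('b \<Rightarrow> complex) \<Rightarrow> ('b chart \<Rightarrow> complex \<Rightarrow> complex) \<Rightarrow> 'b chart \<Rightarrow> complex \<Rightarrow> complex" where
  "hopf_differential g \<eta> c = remove_sings (\<lambda>z. deriv (g \<circ> chart_inv c) z * \<eta> c z)"

definition deck_transformation :: "'b topology \<Rightarrow> ('b \<Rightarrow> 'a) \<Rightarrow> ('b \<Rightarrow> 'b) \<Rightarrow> bool" where
  "deck_transformation Y \<pi> \<gamma> \<longleftrightarrow>
     homeomorphic_map Y Y \<gamma> \<and> (\<forall>x\<in>topspace Y. \<pi> (\<gamma> x) = \<pi> x)"

definition has_order_at :: "'a chart set \<Rightarrow> ('a chart \<Rightarrow> complex \<Rightarrow> complex) \<Rightarrow> 'a \<Rightarrow> int \<Rightarrow> bool" where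
  "has_order_at A q p n \<longleftrightarrow>
     (\<forall>c\<in>A. p \<in> fst c \<longrightarrow> q c meromorphic_on {snd c p} \<and>
        (\<exists>\<^sub>F z in at (snd c p). q c z \<noteq> 0) \<and> zorder (q c) (snd c p) = n)"

text \<open>
  Let \<open>M\<close> be identified with the complement of \<open>P\<close> in the compact Riemann surface \<open>(S, A)\<close> by the
  biholomorphism \<open>F\<close>, and let \<open>p \<in> P\<close>.  Below, \<open>N - {p}\<close> is the punctured neighbourhood, \<open>C\<close> is a
  component of its preimage in the universal cover, and \<open>q\<close> is the quadratic differential to which
  \<open>Q\<close> descends.  The universal cover has its points in the type of sets of paths, where
  the standard construction by homotopy classes of paths takes place.  Since \<open>Q\<close> is unique up to a
  constant factor of modulus \<open>1\<close>, the choice of the Weierstrass data does not matter.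
\<close>

definition catenoidal_end ::
  "'a riem_surface \<Rightarrow> 's topology \<Rightarrow> 's chart set \<Rightarrow> 's set \<Rightarrow> ('a \<Rightarrow> 's) \<Rightarrow> 's \<Rightarrow> bool" where
  "catenoidal_end M S A P F p \<longleftrightarrow>
     (\<exists>(Y :: (real \<Rightarrow> 'a) set topology) B \<pi> g \<eta> N C q.
        weierstrass_data M Y B \<pi> g \<eta> \<and>
        openin S N \<and> N \<inter> P = {p} \<and> connectedin S (N - {p}) \<and>
        C \<in> connected_components_of (subtopology Y {y \<in> topspace Y. F (\<pi> y) \<in> N - {p}}) \<and>
        (\<forall>\<gamma>. deck_transformation Y \<pi> \<gamma> \<and> \<gamma> ` C = C \<longrightarrow>
           pullback_on 2 B B \<gamma> C (hopf_differential g \<eta>) (hopf_differential g \<eta>)) \<and>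
        holomorphic_differential 2 A (N - {p}) q \<and>
        pullback_on 2 B A (F \<circ> \<pi>) C q (hopf_differential g \<eta>) \<and>
        has_order_at A q p (-2))"

text \<open>
  Every surface has the cardinality of the continuum, so this carrier type is no restriction.
\<close>

type_synonym point = "complex \<times> nat"

end

theory Submission
 imports Defs "HOL-Probability.Sinc_Integral"
begin

text \<open>
 The curve \<open>y\<^sup>2 = x(x+1)\<dots>(x+2k)\<close> has genus \<open>k\<close> and one point at infinity.  Put \<open>w = \<surd>x\<close>,
 \<open>\<eta> = dx/y\<close> and let \<open>g\<close> be the odd rational function \<open>w^(2k-1) + \<Sum>\<^sub>j 1/(w - \<rho>\<^sub>j)\<close> with real
 \<open>\<rho>\<^sub>j\<close> placed symmetrically about \<open>0\<close>.  On the curve \<open>g\<close> is only defined up to sign, but the metric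
 \<open>1/4 |\<eta>|\<^sup>2 (1 + |g|\<^sup>2)\<^sup>2\<close> is well defined away from infinity and the \<open>n - 1\<close> points over the \<open>\<rho>\<^sub>j\<^sup>2\<close>.
 As \<open>\<eta>\<close> has no zeros there, the metric is a smooth Ricci metric with \<open>K = -16 |dg/\<eta>|\<^sup>2 / (1 + |g|\<^sup>2)^4\<close>.
 A simple pole of \<open>g\<close> where \<open>\<eta> \<noteq> 0\<close>, or a pole of order \<open>2k - 1\<close> where \<open>\<eta>\<close> vanishes to order \<open>2k - 2\<close>,
 makes \<open>dg \<otimes> \<eta>\<close> have a double pole.  The total curvature is a multiple of the spherical area covered by
 \<open>g\<close>, which is finite because \<open>g\<close> is rational in \<open>w\<close>.  The function \<open>g\<close> is single valued on the
 double cover with coordinates \<open>(w, y/w)\<close>, whose universal cover carries the Weierstrass data.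

 The genus is found by adding the branch points one at a time (Mayer-Vietoris).  The sheet exchange acts by
 \<open>-1\<close> on the first homology of the affine curve but fixes the loop at infinity, which is therefore null-homologous.
\<close>

subsection \<open>Homology of hyperelliptic curves\<close>

text \<open>The obstacle is the sign of \<open>g\<close>. The double cover of the curve is
  \<open>v^2 = cf1 (w^2)\<close> with \<open>x = w^2\<close>, \<open>y = w * v\<close>; its
  involution \<open>(w, v) -> (-w, -v)\<close> fixes the form \<open>dx/y = 2 dw/v\<close> and
  negates \<open>g\<close>, so the Hopf differential descends to the curve only up to sign. This is
  harmless because the double cover is unramified, even over the punctures: at \<open>x = 0\<close>
  the function \<open>w\<close> is a local coordinate, at infinity \<open>1/w\<close> is one. Near
  every end the cover therefore has a section, and the section fixes the sign. The symmetry of the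
  poles also allows every number of ends. A pair \<open>rho, -rho\<close> of poles accounts for the
  two points over \<open>rho^2\<close>, and a pole at \<open>0\<close> for the single point over the
  branch point \<open>0\<close>, so \<open>n - 1\<close> poles of \<open>g\<close> in the
  \<open>w\<close>-plane give \<open>n - 1\<close> punctures for either parity. All roots are real,
  so that branch points can be added by cutting the plane into vertical strips, and they are
  nonpositive, so that \<open>0\<close> is the only one that can be a puncture. Since all poles of
  \<open>g\<close> lie over punctures, \<open>g\<close> is holomorphic on the universal cover and
  the condition on its poles there is void.\<close>

abbreviation H1 :: "'a topology => 'a chain set monoid" where "H1 X \<equiv> homology_group 1 X"

abbreviation H1map :: "'a topology => 'b topology => ('a => 'b) => 'a chain set => 'b chain set"
 where "H1map X Y f \<equiv> hom_induced 1 X {} Y {} f"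

lemma group_hom_induced: "group_hom (relative_homology_group p X S) (relative_homology_group p Y T) (hom_induced p X S Y T f)"
 by (simp add: group_hom_axioms_def group_hom_def hom_induced_hom)

text \<open>The excised set is the complement of \<open>X\<close>. It is closed and, because the two
  open sets cover, contained in \<open>Y\<close>; removing it from the pair \<open>(Z, Y)\<close>
  leaves \<open>(X, X \<inter> Y)\<close>.\<close>

lemma excision_open_cover:
 assumes "openin Z X" "openin Z Y" "X \<union> Y = topspace Z"
 shows "hom_induced p (subtopology Z X) (X \<inter> Y) Z Y id
      \<in> iso (relative_homology_group p (subtopology Z X) (X \<inter> Y)) (relative_homology_group p Z Y)"
proof -
 let ?U = "topspace Z - X"
 have "closedin Z ?U" using assms by blast
 then have 1: "(Abstract_Topology.closure_of Z ?U) \<subseteq> Z interior_of Y"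
  using assms by (auto simp: closure_of_closedin interior_of_openin)
 have "Y \<subseteq> topspace Z" "X \<subseteq> topspace Z" using assms by auto
 then have 2: "topspace Z - ?U = X" "Y - ?U = X \<inter> Y" by auto
 show ?thesis using homology_excision_axiom [OF 1, of "topspace Z" p] \<open>Y \<subseteq> topspace Z\<close> unfolding 2 by simp
qed

text \<open>Exactness of the Mayer-Vietoris sequence in the middle, obtained by chasing the
  sequences of the pairs \<open>(X, X \<inter> Y)\<close> and \<open>(Z, Y)\<close>, which excision
  identifies. A class \<open>c\<close> that maps to \<open>a\<close> exists because \<open>a\<close>
  dies relative to \<open>Y\<close>; its image in \<open>Y\<close> is then corrected without
  changing its image in \<open>X\<close>.\<close>

lemma mayer_vietoris_kernel:
 assumes Z: "openin Z X" "openin Z Y" "X \<union> Y = topspace Z"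
  and a: "a \<in> carrier (homology_group p (subtopology Z X))"
  and b: "b \<in> carrier (homology_group p (subtopology Z Y))"
  and eq: "hom_induced p (subtopology Z X) {} Z {} id a = hom_induced p (subtopology Z Y) {} Z {} id b"
 obtains c where "c \<in> carrier (homology_group p (subtopology Z (X \<inter> Y)))"
  "hom_induced p (subtopology Z (X \<inter> Y)) {} (subtopology Z X) {} id c = a"
  "hom_induced p (subtopology Z (X \<inter> Y)) {} (subtopology Z Y) {} id c = b"
proof -
 let ?X = "subtopology Z X" and ?Y = "subtopology Z Y" and ?A = "subtopology Z (X \<inter> Y)"
 let ?iX = "hom_induced p ?X {} Z {} id" and ?iY = "hom_induced p ?Y {} Z {} id"
 let ?aX = "hom_induced p ?A {} ?X {} id" and ?aY = "hom_induced p ?A {} ?Y {} id"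
 let ?j = "hom_induced p Z {} Z Y id" and ?jX = "hom_induced p ?X {} ?X (X \<inter> Y) id"
 have subs: "X \<subseteq> topspace Z" "Y \<subseteq> topspace Z" using Z by auto
 have sub1: "subtopology ?X (X \<inter> Y) = ?A" by (simp add: subtopology_subtopology Int_absorb1 inf_left_idem)
 have contA: "continuous_map ?A ?X id" "continuous_map ?A ?Y id" "continuous_map ?X Z id" "continuous_map ?Y Z id"
  by (auto simp: continuous_map_from_subtopology_mono continuous_map_in_subtopology
    topspace_subtopology continuous_map_from_subtopology)
 have com: "?iX (?aX c) = ?iY (?aY c)" for c using contA by (simp add: hom_induced_compose')
 have exc: "hom_induced q ?X (X \<inter> Y) Z Y id
      \<in> iso (relative_homology_group q ?X (X \<inter> Y)) (relative_homology_group q Z Y)" for q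
  by (rule excision_open_cover [OF Z])
 interpret e: group_hom "relative_homology_group p ?X (X \<inter> Y)" "relative_homology_group p Z Y"
   "hom_induced p ?X (X \<inter> Y) Z Y id" by (rule group_hom_induced)
 have jb: "?j (?iY b) = \<one>\<^bsub>relative_homology_group p Z Y\<^esub>"
  using homology_exactness_axiom_3 [of p Z Y] b by (auto simp: kernel_def)
 have "?j (?iX a) = hom_induced p ?X (X \<inter> Y) Z Y id (?jX a)" using contA by (simp add: hom_induced_compose')
 then have "hom_induced p ?X (X \<inter> Y) Z Y id (?jX a) = \<one>\<^bsub>relative_homology_group p Z Y\<^esub>" using jb eq by simp
 moreover have "?jX a \<in> carrier (relative_homology_group p ?X (X \<inter> Y))" by (simp add: hom_induced_carrier)
 ultimately have "?jX a = \<one>\<^bsub>relative_homology_group p ?X (X \<inter> Y)\<^esub>"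
 proof -
  assume 1: "hom_induced p ?X (X \<inter> Y) Z Y id (?jX a) = \<one>\<^bsub>relative_homology_group p Z Y\<^esub>"
   and 2: "?jX a \<in> carrier (relative_homology_group p ?X (X \<inter> Y))"
  have "inj_on (hom_induced p ?X (X \<inter> Y) Z Y id) (carrier (relative_homology_group p ?X (X \<inter> Y)))"
   using exc [of p] by (simp add: Group.iso_iff)
  then show ?thesis using 1 2 by (simp add: e.inj_on_one_iff)
 qed
 then have "a \<in> kernel (homology_group p ?X) (relative_homology_group p ?X (X \<inter> Y)) ?jX"
  using a by (simp add: kernel_def)
 then obtain c where c: "c \<in> carrier (homology_group p ?A)" "?aX c = a"
  using homology_exactness_axiom_3 [of p ?X "X \<inter> Y"] unfolding sub1 by auto
 interpret GY: comm_group "homology_group p ?Y" by simp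
 interpret GX: comm_group "homology_group p ?X" by simp
 interpret GA: comm_group "homology_group p ?A" by simp
 interpret GZ: comm_group "homology_group p Z" by simp
 interpret iY: group_hom "homology_group p ?Y" "homology_group p Z" ?iY by (rule group_hom_induced)
 interpret aY: group_hom "homology_group p ?A" "homology_group p ?Y" ?aY by (rule group_hom_induced)
 interpret aX: group_hom "homology_group p ?A" "homology_group p ?X" ?aX by (rule group_hom_induced)
 \<comment> \<open>\<open>e\<close> is the error of \<open>c\<close> in \<open>Y\<close>. It dies in
   \<open>Z\<close>, hence is a boundary from \<open>(Z, Y)\<close>; excision moves this boundary to
   \<open>(X, X \<inter> Y)\<close>, where it gives a class that is trivial in \<open>X\<close> and
   equals \<open>e\<close> in \<open>Y\<close>.\<close>
 define e where "e = b \<otimes>\<^bsub>homology_group p ?Y\<^esub> inv\<^bsub>homology_group p ?Y\<^esub> (?aY c)"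
 have e: "e \<in> carrier (homology_group p ?Y)" using b c by (simp add: e_def)
 have "?iY e = \<one>\<^bsub>homology_group p Z\<^esub>" using b c eq com [of c] by (simp add: e_def)
 then have "e \<in> kernel (homology_group p ?Y) (homology_group p Z) ?iY" using e by (simp add: kernel_def)
 then obtain d where d: "d \<in> carrier (relative_homology_group (p+1) Z Y)" "hom_boundary (p+1) Z Y d = e"
  using homology_exactness_axiom_2 [of "p+1" Z Y] by auto
 obtain d' where d': "d' \<in> carrier (relative_homology_group (p+1) ?X (X \<inter> Y))"
   "hom_induced (p+1) ?X (X \<inter> Y) Z Y id d' = d"
  using exc [of "p+1"] d by (metis (no_types, lifting) Group.iso_iff imageE)
 define z where "z = hom_boundary (p+1) ?X (X \<inter> Y) d'"
 have z: "z \<in> carrier (homology_group p ?A)"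
  unfolding z_def using hom_boundary_carrier [of "p+1" ?X "X \<inter> Y" d'] unfolding sub1 by simp
 have zY: "?aY z = e" using naturality_hom_induced [of ?X Z id "X \<inter> Y" Y "p+1"] contA d d'
  unfolding sub1 by (auto simp: z_def fun_eq_iff)
 have "z \<in> kernel (homology_group p ?A) (homology_group p ?X) ?aX"
  using homology_exactness_axiom_2 [of "p+1" ?X "X \<inter> Y"] d' unfolding sub1 z_def by auto
 then have zX: "?aX z = \<one>\<^bsub>homology_group p ?X\<^esub>" by (simp add: kernel_def)
 show thesis
 proof
  show "c \<otimes>\<^bsub>homology_group p ?A\<^esub> z \<in> carrier (homology_group p ?A)" using c z by simp
  show "?aX (c \<otimes>\<^bsub>homology_group p ?A\<^esub> z) = a" using c z zX a by simp
  have "?aY c \<otimes>\<^bsub>homology_group p ?Y\<^esub> (b \<otimes>\<^bsub>homology_group p ?Y\<^esub> inv\<^bsub>homology_group p ?Y\<^esub> (?aY c)) = b"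
   using b c by (simp add: GY.m_comm GY.m_lcomm)
  then show "?aY (c \<otimes>\<^bsub>homology_group p ?A\<^esub> z) = b" using c z zY unfolding e_def by simp
 qed
qed

text \<open>The obstruction to splitting \<open>c\<close> is its connecting class in degree
  \<open>p - 1\<close> of the intersection. This class dies in \<open>X\<close>, so the injectivity
  assumption makes it vanish. Then \<open>a\<close> can be chosen to agree with \<open>c\<close>
  relative to \<open>Y\<close>, and the difference comes from \<open>Y\<close>.\<close>

lemma mayer_vietoris_surj:
 assumes Z: "openin Z X" "openin Z Y" "X \<union> Y = topspace Z"
  and inj: "inj_on (hom_induced (p-1) (subtopology Z (X \<inter> Y)) {} (subtopology Z X) {} id)
        (carrier (homology_group (p-1) (subtopology Z (X \<inter> Y))))"
  and c: "c \<in> carrier (homology_group p Z)"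
 obtains a b where "a \<in> carrier (homology_group p (subtopology Z X))"
  "b \<in> carrier (homology_group p (subtopology Z Y))"
  "c = hom_induced p (subtopology Z X) {} Z {} id a
      \<otimes>\<^bsub>homology_group p Z\<^esub> hom_induced p (subtopology Z Y) {} Z {} id b"
proof -
 let ?X = "subtopology Z X" and ?Y = "subtopology Z Y" and ?A = "subtopology Z (X \<inter> Y)"
 let ?iX = "hom_induced p ?X {} Z {} id" and ?iY = "hom_induced p ?Y {} Z {} id"
 let ?aX = "hom_induced (p-1) ?A {} ?X {} id"
 let ?j = "hom_induced p Z {} Z Y id" and ?jX = "hom_induced p ?X {} ?X (X \<inter> Y) id"
 have subs: "X \<subseteq> topspace Z" "Y \<subseteq> topspace Z" using Z by auto
 have sub1: "subtopology ?X (X \<inter> Y) = ?A" by (simp add: subtopology_subtopology Int_absorb1 inf_left_idem)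
 have contA: "continuous_map ?A ?X id" "continuous_map ?X Z id" "continuous_map ?Y Z id"
  by (auto simp: continuous_map_from_subtopology_mono continuous_map_in_subtopology
    topspace_subtopology continuous_map_from_subtopology)
 have exc: "hom_induced p ?X (X \<inter> Y) Z Y id
      \<in> iso (relative_homology_group p ?X (X \<inter> Y)) (relative_homology_group p Z Y)"
  by (rule excision_open_cover [OF Z])
 interpret h: group_hom "homology_group (p-1) ?A" "homology_group (p-1) ?X" ?aX by (rule group_hom_induced)
 have "?j c \<in> carrier (relative_homology_group p Z Y)" by (simp add: hom_induced_carrier)
 then obtain c' where c': "c' \<in> carrier (relative_homology_group p ?X (X \<inter> Y))"
   "hom_induced p ?X (X \<inter> Y) Z Y id c' = ?j c" using exc by (metis (no_types, lifting) Group.iso_iff imageE)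
 let ?z = "hom_boundary p ?X (X \<inter> Y) c'"
 have "?z \<in> kernel (homology_group (p-1) ?A) (homology_group (p-1) ?X) ?aX"
  using homology_exactness_axiom_2 [of p ?X "X \<inter> Y"] c' unfolding sub1 by auto
 then have "?aX ?z = \<one>\<^bsub>homology_group (p-1) ?X\<^esub>" by (simp add: kernel_def)
 moreover have "?z \<in> carrier (homology_group (p-1) ?A)"
  using hom_boundary_carrier [of p ?X "X \<inter> Y" c'] unfolding sub1 by simp
 ultimately have "?z = \<one>\<^bsub>homology_group (p-1) ?A\<^esub>" using inj h.inj_on_one_iff by blast
 then have "c' \<in> kernel (relative_homology_group p ?X (X \<inter> Y)) (homology_group (p-1) ?A) (hom_boundary p ?X (X \<inter> Y))"
  using c' by (simp add: kernel_def)
 then obtain a where a: "a \<in> carrier (homology_group p ?X)" "?jX a = c'"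
  using homology_exactness_axiom_1 [of p ?X "X \<inter> Y"] unfolding sub1 by auto
 have "?j (?iX a) = hom_induced p ?X (X \<inter> Y) Z Y id (?jX a)" using contA by (simp add: hom_induced_compose')
 then have ja: "?j (?iX a) = ?j c" using a c' by simp
 interpret GZ: comm_group "homology_group p Z" by simp
 interpret j: group_hom "homology_group p Z" "relative_homology_group p Z Y" ?j by (rule group_hom_induced)
 define e where "e = inv\<^bsub>homology_group p Z\<^esub> (?iX a) \<otimes>\<^bsub>homology_group p Z\<^esub> c"
 have ia: "?iX a \<in> carrier (homology_group p Z)" by (simp add: hom_induced_carrier)
 have "e \<in> kernel (homology_group p Z) (relative_homology_group p Z Y) ?j"
  using ja ia c by (simp add: kernel_def e_def)
 then obtain b where b: "b \<in> carrier (homology_group p ?Y)" "?iY b = e"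
  using homology_exactness_axiom_3 [of p Z Y] by auto
 show thesis
 proof
  show "c = ?iX a \<otimes>\<^bsub>homology_group p Z\<^esub> ?iY b"
   using ia c unfolding b e_def by (simp add: GZ.m_assoc[symmetric])
 qed (use a b in auto)
qed

text \<open>Both groups are infinite cyclic, generated by the class of any point, and the inclusion
  sends the class of a point to the class of the same point. An empty \<open>A\<close> has trivial
  homology and is treated separately.\<close>

lemma inj_on_zeroth_homology_path_connected:
 assumes "path_connected_space A" "path_connected_space X" "continuous_map A X id"
 shows "inj_on (hom_induced 0 A {} X {} id) (carrier (homology_group 0 A))"
proof (cases "topspace A = {}")
 case True
 then have "trivial_group (homology_group 0 A)" by (simp add: trivial_homology_group_empty)
 then show ?thesis by (simp add: trivial_group_def inj_on_def)
next
 case False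
 then obtain a where a: "a \<in> topspace A" by blast
 define s where "s = restrict (\<lambda>x. a) (standard_simplex 0)"
 have aX: "a \<in> topspace X" using assms(3) a by (auto simp: continuous_map_def)
 have sA: "singular_simplex 0 A s" and sX: "singular_simplex 0 X s"
  using a aX by (auto simp: singular_simplex_def s_def)
 let ?qA = "homologous_rel_set 0 A {} (frag_of s)" and ?qX = "homologous_rel_set 0 X {} (frag_of s)"
 let ?h = "hom_induced 0 A {} X {} id"
 have isoA: "pow (homology_group 0 A) ?qA \<in> iso integer_group (homology_group 0 A)"
  using iso_integer_zeroth_homology_group [OF assms(1) sA] .
 have isoX: "pow (homology_group 0 X) ?qX \<in> iso integer_group (homology_group 0 X)"
  using iso_integer_zeroth_homology_group [OF assms(2) sX] .
 have srA: "singular_relcycle 0 A {} (frag_of s)"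
  by (simp add: chain_boundary_def sA singular_chain_of singular_cycle)
 have qA: "?qA \<in> carrier (homology_group 0 A)" using srA by (simp add: carrier_relative_homology_group_0)
 have "?h ?qA = homologous_rel_set 0 X {} (chain_map 0 id (frag_of s))"
  using hom_induced_chain_map [of A X id "{}" "{}" 0 "frag_of s"] assms(3) srA by simp
 also have "chain_map 0 id (frag_of s) = frag_of s"
 proof -
  have "simplex_map 0 id s = s" unfolding s_def simplex_map_def by (auto simp: restrict_def fun_eq_iff)
  then show ?thesis by (simp add: chain_map_of)
 qed
 finally have hq: "?h ?qA = ?qX" .
 interpret h: group_hom "homology_group 0 A" "homology_group 0 X" ?h by (rule group_hom_induced)
 have pw: "?h (?qA [^]\<^bsub>homology_group 0 A\<^esub> (n::int)) = ?qX [^]\<^bsub>homology_group 0 X\<^esub> n" for n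
  using h.hom_int_pow [OF qA] hq by simp
 have gen: "carrier (homology_group 0 A) = range (\<lambda>n::int. ?qA [^]\<^bsub>homology_group 0 A\<^esub> n)"
  using isoA unfolding Group.iso_iff by (simp add: integer_group_def)
 have injX: "inj (\<lambda>n::int. ?qX [^]\<^bsub>homology_group 0 X\<^esub> n)"
  using isoX unfolding iso_def bij_betw_def by (simp add: integer_group_def)
 show ?thesis
 proof (rule inj_onI)
  fix x y assume x: "x \<in> carrier (homology_group 0 A)" and y: "y \<in> carrier (homology_group 0 A)"
   and xy: "?h x = ?h y"
  obtain m n where "x = ?qA [^]\<^bsub>homology_group 0 A\<^esub> (m::int)" "y = ?qA [^]\<^bsub>homology_group 0 A\<^esub> (n::int)"
   using x y unfolding gen by blast
  moreover from this(1,2) have "?qX [^]\<^bsub>homology_group 0 X\<^esub> m = ?qX [^]\<^bsub>homology_group 0 X\<^esub> n"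
   using xy pw by simp
  then have "m = n" using injX by (meson injD)
  ultimately show "x = y" by simp
 qed
qed

section \<open>Double covers \<open>y^2 = f x\<close> of convex sets and vertical strips\<close>

definition sqrt_curve :: "(complex => complex) => complex set => (complex \<times> complex) set" where
 "sqrt_curve f W = {(x, y). x \<in> W \<and> y\<^sup>2 = f x}"

abbreviation flip_sheet :: "complex \<times> complex => complex \<times> complex" where
 "flip_sheet \<equiv> \<lambda>(x, y). (x, - y)"

text \<open>Addition is injective because the difference of two decompositions of one element has
  its keys in both \<open>A\<close> and \<open>B\<close>, which are disjoint.\<close>

lemma free_Abelian_group_DirProd:
 assumes "A \<inter> B = {}"
 shows "free_Abelian_group A \<times>\<times> free_Abelian_group B \<cong> free_Abelian_group (A \<union> B)"
proof -
 let ?h = "\<lambda>(p, q). p + q :: 'a \<Rightarrow>\<^sub>0 int"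
 have "?h \<in> iso (free_Abelian_group A \<times>\<times> free_Abelian_group B) (free_Abelian_group (A \<union> B))"
 proof (rule isoI)
  show "?h \<in> hom (free_Abelian_group A \<times>\<times> free_Abelian_group B) (free_Abelian_group (A \<union> B))"
   using keys_add [where ?'a = 'a and ?'b = int] by (force simp: hom_def DirProd_def subset_iff)
  have inj: "p = p' \<and> q = q'"
   if "Poly_Mapping.keys p \<subseteq> A" "Poly_Mapping.keys p' \<subseteq> A" "Poly_Mapping.keys q \<subseteq> B" "Poly_Mapping.keys q' \<subseteq> B" "p + q = p' + q'"
   for p p' q q' :: "'a \<Rightarrow>\<^sub>0 int"
  proof -
   have e: "p - p' = q' - q" using that(5) by (simp add: algebra_simps)
   have "Poly_Mapping.keys (p - p') \<subseteq> A" "Poly_Mapping.keys (q' - q) \<subseteq> B"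
    using that keys_diff [of p p'] keys_diff [of q' q] by blast+
   then have "Poly_Mapping.keys (q' - q) \<subseteq> {}" using assms unfolding e by blast
   then have "q' - q = 0" by simp
   then show ?thesis using e by simp
  qed
  have surj: "\<exists>p q. Poly_Mapping.keys p \<subseteq> A \<and> Poly_Mapping.keys q \<subseteq> B \<and> x = p + q"
   if "Poly_Mapping.keys x \<subseteq> A \<union> B" for x :: "'a \<Rightarrow>\<^sub>0 int" using that
  proof (induction rule: frag_induction)
   case zero
   have "Poly_Mapping.keys 0 \<subseteq> A \<and> Poly_Mapping.keys 0 \<subseteq> B \<and> (0::'a \<Rightarrow>\<^sub>0 int) = 0 + 0" by simp
   then show ?case by blast
  next
   case (one x)
   show ?case
   proof (cases "x \<in> A")
    case True
    then have "Poly_Mapping.keys (frag_of x) \<subseteq> A \<and> Poly_Mapping.keys 0 \<subseteq> B \<and> frag_of x = frag_of x + 0" by simp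
    then show ?thesis by blast
   next
    case False
    then have "Poly_Mapping.keys 0 \<subseteq> A \<and> Poly_Mapping.keys (frag_of x) \<subseteq> B \<and> frag_of x = 0 + frag_of x" using one by auto
    then show ?thesis by blast
   qed
  next
   case (diff a b)
   then obtain p q p' q' where *: "Poly_Mapping.keys p \<subseteq> A" "Poly_Mapping.keys q \<subseteq> B" "a = p + q"
    "Poly_Mapping.keys p' \<subseteq> A" "Poly_Mapping.keys q' \<subseteq> B" "b = p' + q'" by blast
   have "Poly_Mapping.keys (p - p') \<subseteq> A" "Poly_Mapping.keys (q - q') \<subseteq> B"
    using * keys_diff [of p p'] keys_diff [of q q'] by blast+
   moreover have "a - b = (p - p') + (q - q')" using * by simp
   ultimately show ?case by blast
  qed
  show "bij_betw ?h (carrier (free_Abelian_group A \<times>\<times> free_Abelian_group B))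
      (carrier (free_Abelian_group (A \<union> B)))" unfolding bij_betw_def
  proof
   show "inj_on ?h (carrier (free_Abelian_group A \<times>\<times> free_Abelian_group B))"
    using inj by (auto simp: inj_on_def DirProd_def)
   show "?h ` carrier (free_Abelian_group A \<times>\<times> free_Abelian_group B) = carrier (free_Abelian_group (A \<union> B))"
   proof -
    have "Poly_Mapping.keys (p + q) \<subseteq> A \<union> B"
     if "Poly_Mapping.keys p \<subseteq> A" "Poly_Mapping.keys q \<subseteq> B" for p q :: "'a \<Rightarrow>\<^sub>0 int"
     using that keys_add [of p q] by blast
    then show ?thesis using surj by (auto simp: DirProd_def image_iff Bex_def)
   qed
  qed
 qed
 then show ?thesis by (rule is_isoI)
qed

lemma continuous_map_flip_sheet:
 "continuous_map (top_of_set (sqrt_curve f W)) (top_of_set (sqrt_curve f W)) flip_sheet"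
 unfolding continuous_map_subtopology_eu case_prod_unfold
 by (auto simp: sqrt_curve_def intro!: continuous_intros)

definition hom_flip :: "(complex => complex) => complex set => bool" where
 "hom_flip f W \<longleftrightarrow> (\<forall>c \<in> carrier (H1 (top_of_set (sqrt_curve f W))).
   H1map (top_of_set (sqrt_curve f W)) (top_of_set (sqrt_curve f W)) flip_sheet c
    = inv\<^bsub>H1 (top_of_set (sqrt_curve f W))\<^esub> c)"

text \<open>Let \<open>h\<close> be a square root of \<open>u\<close> on the convex set. The
  function \<open>y / h\<close> on the curve is a square root of \<open>x - a\<close>, so it
  identifies the curve with the preimage of \<open>W\<close> under \<open>y -> a + y^2\<close>,
  which is star-shaped about \<open>0\<close>.\<close>

lemma sqrt_curve_one_root:
 assumes W: "convex W" "a \<in> W" and u: "u holomorphic_on W" "\<And>x. x \<in> W ==> u x \<noteq> 0"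
  and f: "\<And>x. x \<in> W ==> f x = (x - a) * u x"
 shows "contractible (sqrt_curve f W)"
proof -
 obtain h where h: "h holomorphic_on W" "\<And>x. x \<in> W ==> u x = (h x)\<^sup>2"
  using contractible_imp_holomorphic_sqrt [OF u(1) convex_imp_contractible [OF W(1)] u(2)] by metis
 have h0: "h x \<noteq> 0" if "x \<in> W" for x using h u that by force
 have hc: "continuous_on W h" using h(1) holomorphic_on_imp_continuous_on by blast
 let ?T = "{y. a + y\<^sup>2 \<in> W}"
 have "homeomorphism (sqrt_curve f W) ?T (\<lambda>p. snd p / h (fst p)) (\<lambda>y. (a + y\<^sup>2, y * h (a + y\<^sup>2)))"
 proof (rule homeomorphismI)
  show "continuous_on (sqrt_curve f W) (\<lambda>p. snd p / h (fst p))"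
   using h0 by (auto simp: sqrt_curve_def intro!: continuous_intros continuous_on_compose2 [OF hc])
  show "continuous_on ?T (\<lambda>y. (a + y\<^sup>2, y * h (a + y\<^sup>2)))"
   by (auto intro!: continuous_intros continuous_on_compose2 [OF hc])
  have sq: "a + (y / h x)\<^sup>2 = x" if "x \<in> W" "y\<^sup>2 = f x" for x y
   using that h0 [OF that(1)] by (simp add: f h(2) power_divide)
  show "(\<lambda>p. snd p / h (fst p)) ` sqrt_curve f W \<subseteq> ?T" using sq by (auto simp: sqrt_curve_def)
  show "(\<lambda>y. (a + y\<^sup>2, y * h (a + y\<^sup>2))) ` ?T \<subseteq> sqrt_curve f W"
   by (auto simp: sqrt_curve_def f h(2) power_mult_distrib)
  show "\<And>x. x \<in> sqrt_curve f W ==> (a + (snd x / h (fst x))\<^sup>2, snd x / h (fst x) * h (a + (snd x / h (fst x))\<^sup>2)) = x"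
   using sq h0 by (auto simp: sqrt_curve_def)
  show "\<And>y. y \<in> ?T ==> snd (a + y\<^sup>2, y * h (a + y\<^sup>2)) / h (fst (a + y\<^sup>2, y * h (a + y\<^sup>2))) = y"
   using h0 by auto
 qed
 then have "sqrt_curve f W homeomorphic ?T" unfolding homeomorphic_def by blast
 moreover have "contractible ?T"
 proof (rule starlike_imp_contractible)
  have "closed_segment 0 y \<subseteq> ?T" if "a + y\<^sup>2 \<in> W" for y
  proof
   fix z assume "z \<in> closed_segment 0 y"
   then obtain t where t: "0 \<le> t" "t \<le> 1" "z = t *\<^sub>R y" by (auto simp: closed_segment_def)
   \<comment> \<open>Scaling by \<open>t\<close> upstairs moves the image along the segment from
     \<open>a\<close> with parameter \<open>t^2\<close>; convexity of \<open>W\<close> keeps it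
     inside.\<close>
   have "a + z\<^sup>2 = (1 - t\<^sup>2) *\<^sub>R a + t\<^sup>2 *\<^sub>R (a + y\<^sup>2)"
    by (simp add: t(3) scaleR_conv_of_real power_mult_distrib algebra_simps)
   also have "\<dots> \<in> W" using t by (intro convexD [OF W(1)] W(2) that) (auto simp: power_le_one)
   finally show "z \<in> ?T" by simp
  qed
  moreover have "0 \<in> ?T" using W(2) by simp
  ultimately show "starlike ?T" unfolding starlike_def by blast
 qed
 ultimately show ?thesis using homeomorphic_contractible_eq by blast
qed

text \<open>\<open>r + 1/r\<close> has its minimum \<open>2\<close> at \<open>r = 1\<close> and
  decreases towards it from either side. This controls the radial deformation onto the unit circle
  in the next lemma.\<close>

lemma add_inverse_between:
 fixes ro r :: real
 assumes "ro > 0" and r: "r \<in> closed_segment ro 1"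
 shows "2 \<le> r + 1/r" "r + 1/r \<le> ro + 1/ro" "r > 0"
proof -
 have "1 \<le> r \<and> r \<le> ro \<or> ro \<le> r \<and> r \<le> 1" using r by (auto simp: closed_segment_eq_real_ivl split: if_splits)
 then show r0: "r > 0" using assms(1) by auto
 have "r + 1/r - 2 = (r - 1)\<^sup>2 / r" using r0 by (simp add: field_simps power2_eq_square)
 then show "2 \<le> r + 1/r" using r0 by (smt (verit) divide_nonneg_pos zero_le_power2)
 have "(ro + 1/ro) - (r + 1/r) = (ro - r) * (ro * r - 1) / (ro * r)"
  using r0 assms(1) by (simp add: field_simps)
 moreover have "(ro - r) * (ro * r - 1) \<ge> 0" using \<open>1 \<le> r \<and> r \<le> ro \<or> _\<close>
 proof
  assume "1 \<le> r \<and> r \<le> ro"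
  then have "1 * 1 \<le> ro * r" by (intro mult_mono) auto
  then show ?thesis using \<open>1 \<le> r \<and> r \<le> ro\<close> by simp
 next
  assume "ro \<le> r \<and> r \<le> 1"
  then have "ro * r \<le> 1 * 1" using assms(1) r0 by (intro mult_mono) auto
  then show ?thesis using \<open>ro \<le> r \<and> r \<le> 1\<close> by (intro mult_nonpos_nonpos) auto
 qed
 ultimately show "r + 1/r \<le> ro + 1/ro" using r0 assms(1) by (smt (verit) divide_nonneg_pos mult_pos_pos)
qed

text \<open>With \<open>x = (a+b)/2 + (b-a)/4 (t + 1/t)\<close> the double cover branched at \<open>a < b\<close> becomes a
 neighbourhood of the unit circle in the \<open>t\<close>-plane, and the sheet exchange becomes \<open>t \<mapsto> 1/t\<close>.\<close>

lemma sqrt_curve_two_roots: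
 fixes a b :: real and I :: "real set" and u f :: "complex => complex"
 defines "W \<equiv> {x. Re x \<in> I}"
 assumes I: "is_interval I" "a \<in> I" "b \<in> I" "a < b"
  and u: "u holomorphic_on W" "\<And>x. x \<in> W ==> u x \<noteq> 0"
  and f: "\<And>x. x \<in> W ==> f x = (x - of_real a) * (x - of_real b) * u x"
 shows "H1 (top_of_set (sqrt_curve f W)) \<cong> integer_group" "hom_flip f W"
  "path_connected (sqrt_curve f W)"
proof -
 have "W = Re -` I" by (auto simp: W_def)
 then have "convex W" using I(1) by (simp add: is_interval_convex_1 convex_linear_vimage bounded_linear.linear bounded_linear_Re)
 then obtain h where h: "h holomorphic_on W" "\<And>x. x \<in> W ==> u x = (h x)\<^sup>2"
  using contractible_imp_holomorphic_sqrt [OF u(1) convex_imp_contractible u(2)] by metis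
 have h0: "h x \<noteq> 0" if "x \<in> W" for x using h u that by force
 have hc: "continuous_on W h" using h(1) holomorphic_on_imp_continuous_on by blast
 define m l :: complex where "m = of_real ((a + b)/2)" and "l = of_real ((b - a)/4)"
 have l0: "l \<noteq> 0" using I by (simp add: l_def)
 have ab: "of_real a = m - 2 * l" "of_real b = m + 2 * l" by (simp_all add: m_def l_def field_simps)
 define X where "X = (\<lambda>t. m + l * (t + 1/t))"
 define T where "T = {t. t \<noteq> 0 \<and> X t \<in> W}"
 define Y where "Y = (\<lambda>t. (X t, l * (t - 1/t) * h (X t)))"
 \<comment> \<open>The inverse of \<open>Y\<close>: from \<open>x - m = l (t + 1/t)\<close> and
   \<open>y / h = l (t - 1/t)\<close>, the sum is \<open>2 l t\<close>.\<close>
 define ta where "ta = (\<lambda>p. (fst p - m + snd p / h (fst p)) / (2 * l))"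
 let ?C = "sqrt_curve f W"
 \<comment> \<open>The two points over \<open>x\<close> have parameters \<open>t\<close> and
   \<open>1/t\<close>.\<close>
 have ta2: "ta (x, y) * ta (x, - y) = 1" if "x \<in> W" "y\<^sup>2 = f x" for x y
 proof -
  have "ta (x, y) * ta (x, - y) = ((x - m)\<^sup>2 - y\<^sup>2 / (h x)\<^sup>2) / (4 * l\<^sup>2)"
   using l0 h0 [OF that(1)] by (simp add: ta_def field_simps power2_eq_square)
  also have "y\<^sup>2 / (h x)\<^sup>2 = (x - m)\<^sup>2 - 4 * l\<^sup>2"
   using that h0 [OF that(1)] by (simp add: f h(2) ab) (simp add: algebra_simps power2_eq_square)
  finally show ?thesis using l0 by simp
 qed
 have tai: "1 / ta (x, y) = ta (x, - y)" "ta (x, y) \<noteq> 0" if "x \<in> W" "y\<^sup>2 = f x" for x y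
 proof -
  show "ta (x, y) \<noteq> 0" using ta2 [OF that] by (metis mult_zero_left zero_neq_one)
  then show "1 / ta (x, y) = ta (x, - y)" using ta2 [OF that] by (simp add: divide_eq_eq mult.commute)
 qed
 have Xta: "X (ta (x, y)) = x" if "x \<in> W" "y\<^sup>2 = f x" for x y
  unfolding X_def tai [OF that] using l0 by (simp add: ta_def field_simps)
 have hom: "homeomorphism ?C T ta Y"
 proof (rule homeomorphismI)
  show "continuous_on ?C ta" unfolding ta_def
   using h0 l0 by (auto simp: sqrt_curve_def intro!: continuous_intros continuous_on_compose2 [OF hc])
  show "continuous_on T Y" unfolding Y_def
   by (intro continuous_intros continuous_on_compose2 [OF hc]) (auto simp: T_def X_def intro!: continuous_intros)
  show "ta ` ?C \<subseteq> T" using tai Xta by (auto simp: T_def sqrt_curve_def)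
  show "Y ` T \<subseteq> ?C"
  proof (rule image_subsetI)
   fix t assume t: "t \<in> T"
   have "(X t - of_real a) * (X t - of_real b) = (l * (t - 1/t))\<^sup>2"
    using t unfolding ab X_def T_def by (simp add: field_simps power2_eq_square)
   then show "Y t \<in> ?C" using t by (simp add: sqrt_curve_def Y_def T_def f h(2) power_mult_distrib)
  qed
  show "Y (ta p) = p" if p: "p \<in> ?C" for p
  proof -
   obtain x y where xy: "p = (x, y)" "x \<in> W" "y\<^sup>2 = f x" using p by (auto simp: sqrt_curve_def)
   have "l * (ta (x, y) - 1 / ta (x, y)) = y / h x"
    unfolding tai [OF xy(2,3)] using l0 by (simp add: ta_def field_simps)
   then show ?thesis using Xta [OF xy(2,3)] h0 [OF xy(2)] by (simp add: Y_def xy(1))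
  qed
  show "ta (Y t) = t" if t: "t \<in> T" for t
   using t h0 [of "X t"] l0 by (simp add: ta_def Y_def T_def) (simp add: X_def field_simps)
 qed
 \<comment> \<open>On a fixed ray the real part of \<open>X t\<close> depends on the modulus only
   through \<open>|t| + 1/|t|\<close>, hence is monotone on either side of the unit circle.\<close>
 have ReX: "Re (X t) = (a + b)/2 + (b - a)/4 * ((cmod t + 1/cmod t) * Re (sgn t))" if "t \<noteq> 0" for t
 proof -
  have "Re (1/t) = Re (sgn t) / cmod t"
   using that cmod_power2 [of t] by (simp add: Re_divide sgn_div_norm power2_eq_square field_simps)
  then have 1: "Re (1/t) = 1 / cmod t * Re (sgn t)" by simp
  have 2: "Re t = cmod t * Re (sgn t)" using that by (simp add: sgn_div_norm)
  have "Re (t + 1/t) = Re t + Re (1/t)" by simp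
  also have "\<dots> = (cmod t + 1/cmod t) * Re (sgn t)" unfolding distrib_right 1 2 [symmetric] ..
  finally have 3: "Re (t + 1/t) = (cmod t + 1/cmod t) * Re (sgn t)" .
  have "Re (X t) = (a + b)/2 + (b - a)/4 * Re (t + 1/t)" unfolding X_def m_def l_def by simp
  then show ?thesis unfolding 3 .
 qed
 \<comment> \<open>Moving \<open>t\<close> radially towards the circle shrinks
   \<open>|t| + 1/|t|\<close>, so \<open>Re (X t)\<close> moves monotonically towards the midpoint
   of \<open>a\<close> and \<open>b\<close>. If \<open>c \<ge> 0\<close> it stays between
   \<open>a\<close> and its old value, otherwise between its old value and \<open>b\<close>; the
   interval contains both.\<close>
 have seg: "r *\<^sub>R sgn t \<in> T" if t: "t \<in> T" and r: "r \<in> closed_segment (cmod t) 1" for t r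
 proof -
  have t0: "cmod t > 0" "t \<noteq> 0" using t by (auto simp: T_def)
  note * = add_inverse_between [OF t0(1) r]
  define c where "c = Re (sgn t)"
  have c: "\<bar>c\<bar> \<le> 1" using abs_Re_le_cmod [of "sgn t"] t0 by (simp add: c_def norm_sgn)
  have "sgn (r *\<^sub>R sgn t) = sgn t" "cmod (r *\<^sub>R sgn t) = r" using t0 * by (simp_all add: sgn_scaleR norm_sgn)
  define Q Q0 where "Q = (b - a)/4 * ((r + 1/r) * c)" and "Q0 = (b - a)/4 * ((cmod t + 1/cmod t) * c)"
  from \<open>sgn (r *\<^sub>R sgn t) = sgn t\<close> \<open>cmod (r *\<^sub>R sgn t) = r\<close> have R: "Re (X (r *\<^sub>R sgn t)) = (a + b)/2 + Q"
   using ReX [of "r *\<^sub>R sgn t"] * t0 by (auto simp: c_def sgn_zero_iff Q_def)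
  have R0: "Re (X t) = (a + b)/2 + Q0" using ReX t0 by (simp add: c_def Q0_def)
  have I0: "Re (X t) \<in> I" using t by (auto simp: T_def W_def)
  have "Re (X (r *\<^sub>R sgn t)) \<in> I"
  proof (cases "c \<ge> 0")
   case True
   have 1: "(r + 1/r) * c \<le> (cmod t + 1/cmod t) * c" using * True by (intro mult_right_mono) auto
   have "0 \<le> (r + 1/r) * c" using * True by (intro mult_nonneg_nonneg) auto
   then have "0 \<le> Q" unfolding Q_def using I(4) mult_nonneg_nonneg [of "(b - a)/4" "(r + 1/r) * c"] by auto
   moreover have "Q \<le> Q0" unfolding Q_def Q0_def using 1 I by (intro mult_left_mono) auto
   ultimately have "a \<le> Re (X (r *\<^sub>R sgn t))" "Re (X (r *\<^sub>R sgn t)) \<le> Re (X t)"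
    using I(4) unfolding R R0 by (simp_all add: field_simps)
   then show ?thesis using I I0 mem_is_interval_1_I by blast
  next
   case False
   have 1: "(cmod t + 1/cmod t) * c \<le> (r + 1/r) * c" using * False by (intro mult_right_mono_neg) auto
   have "(r + 1/r) * c \<le> 0" using * False by (intro mult_nonneg_nonpos) auto
   then have "Q \<le> 0" unfolding Q_def using I(4) mult_nonneg_nonpos [of "(b - a)/4" "(r + 1/r) * c"] by auto
   moreover have "Q0 \<le> Q" unfolding Q_def Q0_def using 1 I by (intro mult_left_mono) auto
   ultimately have "Re (X (r *\<^sub>R sgn t)) \<le> b" "Re (X t) \<le> Re (X (r *\<^sub>R sgn t))"
    using I(4) unfolding R R0 by (simp_all add: field_simps)
   then show ?thesis using I I0 mem_is_interval_1_I by blast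
  qed
  then show ?thesis using * t0 by (auto simp: T_def W_def sgn_zero_iff)
 qed
 \<comment> \<open>For \<open>|t| = 1\<close> the formula gives
   \<open>(a + b)/2 + (b - a)/2 * Re t\<close>, a number between \<open>a\<close> and
   \<open>b\<close>.\<close>
 have circle: "t \<in> T" if "cmod t = 1" for t
 proof -
  have t0: "t \<noteq> 0" using that by auto
  have c: "\<bar>Re (sgn t)\<bar> \<le> 1" using abs_Re_le_cmod [of "sgn t"] t0 by (simp add: norm_sgn)
  define r where "r = Re (sgn t)"
  have "r \<le> 1" "- 1 \<le> r" using c unfolding r_def by arith+
  have 1: "(b - a)/2 * r \<le> (b - a)/2 * 1" by (rule mult_left_mono) (use \<open>r \<le> 1\<close> I(4) in auto)
  have 2: "(b - a)/2 * (- 1) \<le> (b - a)/2 * r" by (rule mult_left_mono) (use \<open>- 1 \<le> r\<close> I(4) in auto)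
  define S where "S = (b - a)/2 * r"
  have 3: "S \<le> (b - a)/2" using 1 unfolding S_def by linarith
  have 4: "- ((b - a)/2) \<le> S" using 2 unfolding S_def by linarith
  have 5: "Re (X t) = (a + b)/2 + S" unfolding ReX [OF t0] that S_def r_def by simp
  have "a \<le> Re (X t)" unfolding 5 using 4 by (simp add: field_simps)
  moreover have "Re (X t) \<le> b" unfolding 5 using 3 by (simp add: field_simps)
  ultimately have "a \<le> Re (X t)" "Re (X t) \<le> b" by blast+
  then show ?thesis using I t0 mem_is_interval_1_I unfolding T_def W_def by blast
 qed
 have deform: "homotopic_with_canon (\<lambda>z. True) T T id sgn"
 proof (rule homotopic_with_linear)
  show "continuous_on T sgn" by (intro continuous_intros) (auto simp: T_def)
  fix t assume t: "t \<in> T"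
  then have t0: "t \<noteq> 0" by (simp add: T_def)
  show "closed_segment (id t) (sgn t) \<subseteq> T"
  proof
   fix z assume "z \<in> closed_segment (id t) (sgn t)"
   then obtain s where s: "0 \<le> s" "s \<le> 1" "z = (1 - s) *\<^sub>R t + s *\<^sub>R sgn t"
    by (auto simp: closed_segment_def)
   have "cmod t *\<^sub>R sgn t = t" using t0 by (simp add: sgn_div_norm)
   then have "(1 - s) *\<^sub>R t = ((1 - s) * cmod t) *\<^sub>R sgn t" by (metis scaleR_scaleR)
   then have "z = ((1 - s) *\<^sub>R cmod t + s *\<^sub>R 1) *\<^sub>R sgn t" unfolding s(3) by (simp add: scaleR_left_distrib)
   moreover have "(1 - s) *\<^sub>R cmod t + s *\<^sub>R 1 \<in> closed_segment (cmod t) 1"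
    using s by (auto simp: closed_segment_def)
   ultimately show "z \<in> T" using seg t by metis
  qed
 qed (auto simp: id_def)
 let ?S = "nsphere 1"
 \<comment> \<open>The imaginary part is put at index \<open>0\<close> because the reflection of the
   sphere whose degree is known negates that coordinate, and \<open>t -> 1/t\<close> is complex
   conjugation on the circle.\<close>
 define toS :: "complex => nat => real" where
  "toS = (\<lambda>t i. if i = 0 then Im t else if i = 1 then Re t else 0)"
 define frS :: "(nat => real) => complex" where "frS = (\<lambda>v. Complex (v 1) (v 0))"
 have topS: "v \<in> topspace ?S \<longleftrightarrow> (\<forall>i\<ge>2. v i = 0) \<and> (v 0)\<^sup>2 + (v 1)\<^sup>2 = 1" for v
  by (auto simp: nsphere Euclidean_space_def numeral_2_eq_2)
 have contto: "continuous_map (top_of_set (sphere 0 1)) ?S toS"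
 proof -
  have "continuous_on (sphere (0::complex) 1) (\<lambda>t. toS t i)" for i
   by (cases "i = 0"; cases "i = 1") (auto simp: toS_def intro!: continuous_intros)
  then have "continuous_map (top_of_set (sphere 0 1)) (powertop_real UNIV) toS"
   unfolding continuous_map_componentwise_UNIV by simp
  moreover have "toS ` sphere 0 1 \<subseteq> topspace ?S"
  proof (rule image_subsetI)
   fix t :: complex assume "t \<in> sphere 0 1"
   then have "(Im t)\<^sup>2 + (Re t)\<^sup>2 = 1" using cmod_power2 [of t] by (simp add: add.commute)
   then show "toS t \<in> topspace ?S" unfolding topS by (simp add: toS_def)
  qed
  ultimately show ?thesis by (auto simp: nsphere_def Euclidean_space_def continuous_map_in_subtopology)
 qed
 note proj = continuous_map_nsphere_projection [of 1]
 have fr1: "cmod (frS v) = 1" if "v \<in> topspace ?S" for v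
 proof -
  have "(cmod (frS v))\<^sup>2 = 1" using that cmod_power2 [of "frS v"] unfolding topS by (simp add: frS_def add.commute)
  then show ?thesis by (metis norm_ge_zero one_power2 power2_eq_imp_eq zero_le_one)
 qed
 have contfr: "continuous_map ?S (top_of_set (sphere 0 1)) frS"
 proof -
  have 1: "continuous_map ?S (euclidean::complex topology) (\<lambda>v. of_real (v i))" for i
   using continuous_map_compose [OF proj [of i], of euclidean "of_real :: real => complex"]
   by (simp add: o_def continuous_on_of_real_id)
  have "continuous_map ?S euclidean (\<lambda>v. of_real (v 1) + \<i> * of_real (v 0))"
   using continuous_map_add [OF 1 continuous_map_compose [OF 1, of euclidean "\<lambda>z. \<i> * z", unfolded o_def]]
   by (simp add: continuous_on_mult_left)
  then have "continuous_map ?S euclidean frS" by (simp add: frS_def Complex_eq)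
  then show ?thesis using fr1 by (auto simp: continuous_map_in_subtopology)
 qed
 have toS_frS: "toS (frS v) = v" if "v \<in> topspace ?S" for v
 proof
  fix i show "toS (frS v) i = v i" using that unfolding topS toS_def frS_def
   by (cases i) (auto simp: numeral_2_eq_2 not_less_eq_eq Suc_le_eq)
 qed
 have frS_toS: "frS (toS t) = t" for t by (simp add: toS_def frS_def)
 let ?Z = "top_of_set ?C"
 have cta: "continuous_map ?Z (top_of_set T) ta" and cY: "continuous_map (top_of_set T) ?Z Y"
  using hom by (auto simp: homeomorphism_def continuous_map_subtopology_eu)
 have csgn: "continuous_map (top_of_set T) (top_of_set (sphere 0 1)) sgn"
  by (auto simp: continuous_map_subtopology_eu T_def norm_sgn intro!: continuous_intros)
 define q where "q = toS \<circ> sgn \<circ> ta"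
 define g where "g = Y \<circ> frS"
 have cq: "continuous_map ?Z ?S q" unfolding q_def
  by (rule continuous_map_compose [OF cta continuous_map_compose [OF csgn contto]])
 have "continuous_map ?S (top_of_set T) frS"
  using contfr circle fr1 by (simp add: continuous_map_in_subtopology image_subset_iff Pi_iff)
 then have cg: "continuous_map ?S ?Z g" unfolding g_def by (rule continuous_map_compose [OF _ cY])
 have gq: "homotopic_with (\<lambda>h. True) ?Z ?Z (g \<circ> q) id"
 proof -
  have "homotopic_with (\<lambda>h. True) ?Z ?Z (Y \<circ> (id \<circ> ta)) (Y \<circ> (sgn \<circ> ta))"
   by (intro homotopic_with_compose_continuous_map_left [OF _ cY]
     homotopic_with_compose_continuous_map_right [OF deform cta]) auto
  then have "homotopic_with (\<lambda>h. True) ?Z ?Z (Y \<circ> (sgn \<circ> ta)) (Y \<circ> (id \<circ> ta))"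
   by (simp add: homotopic_with_sym)
  then show ?thesis
  proof (rule homotopic_with_eq)
   show "\<And>x. x \<in> topspace ?Z ==> (g \<circ> q) x = (Y \<circ> (sgn \<circ> ta)) x" by (simp add: g_def q_def frS_toS)
   show "\<And>x. x \<in> topspace ?Z ==> id x = (Y \<circ> (id \<circ> ta)) x" using hom by (simp add: homeomorphism_def)
  qed auto
 qed
 have qg: "homotopic_with (\<lambda>h. True) ?S ?S (q \<circ> g) id"
 proof (rule homotopic_with_equal)
  show "continuous_map ?S ?S (q \<circ> g)" using continuous_map_compose cq cg by blast
  fix v assume v: "v \<in> topspace ?S"
  then have 1: "cmod (frS v) = 1" using contfr by (auto simp: continuous_map_def)
  then have "ta (Y (frS v)) = frS v" using hom circle by (simp add: homeomorphism_def)
  then show "(q \<circ> g) v = id v" using v 1 by (simp add: q_def g_def toS_frS sgn_div_norm)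
 qed auto
 have iso: "H1map ?Z ?S q \<in> iso (H1 ?Z) (H1 ?S)"
  by (rule homotopy_equivalence_homology_group_isomorphism [OF cq cg gq qg])
 have red: "reduced_homology_group 1 ?S = H1 ?S" by (simp add: un_reduced_homology_group)
 have "H1 ?S \<cong> integer_group" using reduced_homology_group_nsphere(1) [of 1] red by simp
 then show "H1 ?Z \<cong> integer_group" using iso is_isoI iso_trans by blast
 let ?r = "\<lambda>x i::nat. if i = 0 then - x i else (x i :: real)"
 have cr: "continuous_map ?S ?S ?r" by (rule continuous_map_nsphere_reflection)
 show "hom_flip f W" unfolding hom_flip_def
 proof
  fix c assume c: "c \<in> carrier (H1 ?Z)"
  interpret GS: comm_group "H1 ?S" by simp
  interpret GC: comm_group "H1 ?Z" by simp
  interpret q: group_hom "H1 ?Z" "H1 ?S" "H1map ?Z ?S q" by (rule group_hom_induced)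
  let ?F = "H1map ?Z ?Z flip_sheet"
  have sgn1: "sgn (1 / z) = cnj (sgn z)" if "z \<noteq> 0" for z :: complex
   using that complex_norm_square [of z] by (simp add: sgn_eq norm_divide field_simps power2_eq_square)
  \<comment> \<open>The sheet exchange is \<open>t -> 1/t\<close>, whose direction is the conjugate
    of that of \<open>t\<close>. After projection to the circle it is the reflection, which has
    degree \<open>-1\<close>.\<close>
  have eq: "(q \<circ> flip_sheet) p = (?r \<circ> q) p" if p: "p \<in> topspace ?Z" for p
  proof -
   obtain x y where xy: "p = (x, y)" "x \<in> W" "y\<^sup>2 = f x" using p by (auto simp: sqrt_curve_def)
   have "sgn (ta (x, - y)) = cnj (sgn (ta (x, y)))"
    unfolding tai(1) [OF xy(2,3), symmetric] by (rule sgn1 [OF tai(2) [OF xy(2,3)]])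
   then show ?thesis by (auto simp: xy(1) q_def toS_def fun_eq_iff)
  qed
  have "H1map ?Z ?S q (?F c) = H1map ?Z ?S (q \<circ> flip_sheet) c"
   by (simp only: hom_induced_compose_empty [OF continuous_map_flip_sheet cq] comp_apply)
  also have "\<dots> = H1map ?Z ?S (?r \<circ> q) c"
  proof -
   have "H1map ?Z ?S (q \<circ> flip_sheet) = H1map ?Z ?S (?r \<circ> q)" by (rule hom_induced_eq) (rule eq)
   then show ?thesis by simp
  qed
  also have "\<dots> = H1map ?S ?S ?r (H1map ?Z ?S q c)"
   by (simp only: hom_induced_compose_empty [OF cq cr] comp_apply)
  also have "\<dots> = inv\<^bsub>H1 ?S\<^esub> (H1map ?Z ?S q c)"
  proof -
   let ?u = "H1map ?Z ?S q c"
   have u: "?u \<in> carrier (H1 ?S)" by (rule hom_induced_carrier)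
   have "H1map ?S ?S ?r ?u = pow (H1 ?S) ?u (Brouwer_degree2 1 ?r)"
    using Brouwer_degree2 [where p = 1 and f = ?r, unfolded of_nat_1 red, OF u] .
   also have "\<dots> = pow (H1 ?S) ?u (- 1 :: int)" by (simp only: Brouwer_degree2_reflection)
   also have "\<dots> = inv\<^bsub>H1 ?S\<^esub> ?u" by (simp only: GS.int_pow_neg [OF u] GS.int_pow_1 [OF u])
   finally show ?thesis .
  qed
  also have "\<dots> = H1map ?Z ?S q (inv\<^bsub>H1 ?Z\<^esub> c)" by (rule q.hom_inv [OF c, symmetric])
  finally show "?F c = inv\<^bsub>H1 ?Z\<^esub> c" using iso c by (auto simp: Group.iso_iff inj_on_def hom_induced_carrier)
 qed
 have "path_connectedin ?S (toS ` sphere 0 1)" by (rule path_connectedin_continuous_map_image [OF contto])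
    (simp add: path_connectedin_subtopology path_connectedin_iff_path_connected_real path_connected_sphere)
 moreover have "toS ` sphere 0 1 = topspace ?S"
 proof
  show "toS ` sphere 0 1 \<subseteq> topspace ?S" using continuous_map_image_subset_topspace [OF contto] by simp
  show "topspace ?S \<subseteq> toS ` sphere 0 1"
  proof
   fix v assume v: "v \<in> topspace ?S"
   then have "frS v \<in> sphere 0 1" using continuous_map_image_subset_topspace [OF contfr] by auto
   then show "v \<in> toS ` sphere 0 1" using toS_frS [OF v] by (metis imageI)
  qed
 qed
 ultimately have "path_connected_space ?S" by (simp add: path_connectedin_topspace)
 \<comment> \<open>Path-connectedness is carried over from the circle through the zeroth homology of
   homotopy equivalent spaces.\<close>
 moreover have "homology_group 0 ?Z \<cong> homology_group 0 ?S"
  using gq qg cq cg homotopy_equivalent_space_imp_isomorphic_homology_groups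
  unfolding homotopy_equivalent_space_def by blast
 ultimately have "path_connected_space ?Z" using isomorphic_homology_imp_path_connectedness by blast
 then have "path_connectedin euclidean ?C" unfolding path_connectedin_def by simp
 then show "path_connected ?C" by (simp only: path_connectedin_euclidean)
qed

subsection \<open>Universal covers from homotopy classes of paths\<close>

text \<open>The local condition in \<open>covering\<close>, for one open set. A separate name is
  useful because charts of the base are lifted only over evenly covered domains.\<close>

definition evenly_covered :: "'b topology => 'a topology => ('b => 'a) => 'a set => bool" where
 "evenly_covered Y X p U \<longleftrightarrow> openin X U \<and> (\<exists>\<V>. \<Union>\<V> = topspace Y \<inter> p -` U \<and> pairwise disjnt \<V> \<and>
   (\<forall>V\<in>\<V>. openin Y V \<and> homeomorphic_map (subtopology Y V) (subtopology X U) p))"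

text \<open>The universal cover of \<open>T\<close> as the space of homotopy classes of paths from \<open>b\<close>, where \<open>L\<close>
 labels the classes by elements of an arbitrary type.\<close>

locale path_cover =
 fixes T :: "'a::real_normed_vector set" and b :: 'a and \<U> :: "'a set set"
  and L :: "(real => 'a) => 'b"
 assumes b: "b \<in> T" and pc: "path_connected T"
  and \<U>_open: "U \<in> \<U> ==> openin (top_of_set T) U"
  and \<U>_sc: "U \<in> \<U> ==> simply_connected U"
  and basis: "openin (top_of_set T) W ==> x \<in> W ==> \<exists>U\<in>\<U>. x \<in> U \<and> U \<subseteq> W"
  and L: "[|path g; path_image g \<subseteq> T; pathstart g = b; path h; path_image h \<subseteq> T; pathstart h = b|]
     ==> L g = L h \<longleftrightarrow> homotopic_paths T g h"
begin

definition PB :: "(real => 'a) set" where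
 "PB = {g. path g \<and> path_image g \<subseteq> T \<and> pathstart g = b}"

definition paths_in :: "'a set => 'a => (real => 'a) set" where
 "paths_in U x = {h. path h \<and> path_image h \<subseteq> U \<and> pathstart h = x}"

definition proj :: "'b => 'a" where
 "proj y = pathfinish (SOME g. g \<in> PB \<and> L g = y)"

text \<open>The candidate for the copy of \<open>U\<close> through the point \<open>L g\<close>:
  \<open>g\<close> is continued by paths that stay in \<open>U\<close>.\<close>

definition sheet :: "(real => 'a) => 'a set => 'b set" where
 "sheet g U = (\<lambda>h. L (g +++ h)) ` paths_in U (pathfinish g)"

definition cover_open :: "'b set => bool" where
 "cover_open W \<longleftrightarrow> W \<subseteq> L ` PB \<and>
   (\<forall>g\<in>PB. L g \<in> W \<longrightarrow> (\<exists>U\<in>\<U>. pathfinish g \<in> U \<and> sheet g U \<subseteq> W))"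

definition Cov :: "'b topology" where "Cov = topology cover_open"

lemma LPB: "g \<in> PB ==> h \<in> PB ==> L g = L h \<longleftrightarrow> homotopic_paths T g h" using L by (auto simp: PB_def)

lemma \<U>_sub: "U \<in> \<U> ==> U \<subseteq> T" using \<U>_open openin_imp_subset by blast

lemma proj_L: "g \<in> PB ==> proj (L g) = pathfinish g" unfolding proj_def
 by (rule someI2 [of "\<lambda>h. h \<in> PB \<and> L h = L g" g]) (auto simp: LPB dest: homotopic_paths_imp_pathfinish)

lemma \<U>_at: "x \<in> T ==> \<exists>U\<in>\<U>. x \<in> U" using basis [of T x] by auto

lemma pathfinish_PB: "g \<in> PB ==> pathfinish g \<in> T" unfolding PB_def using pathfinish_in_path_image by blast

lemma join_PB: "g \<in> PB ==> h \<in> paths_in U (pathfinish g) ==> U \<subseteq> T ==> g +++ h \<in> PB"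
 by (auto simp: PB_def paths_in_def path_image_join)

lemma sheet_mono: "U \<subseteq> U' ==> sheet g U \<subseteq> sheet g U'" unfolding sheet_def paths_in_def by blast

lemma L_const: "g \<in> PB ==> L (g +++ linepath (pathfinish g) (pathfinish g)) = L g"
 by (subst LPB) (auto simp: PB_def path_image_join pathfinish_in_path_image subset_iff
   intro!: homotopic_paths_rid)

lemma sheet_self: "g \<in> PB ==> pathfinish g \<in> U ==> L g \<in> sheet g U" unfolding sheet_def
 by (rule image_eqI [of _ _ "linepath (pathfinish g) (pathfinish g)"])
   (simp_all add: L_const paths_in_def)

lemma openin_Cov: "openin Cov W \<longleftrightarrow> cover_open W"
proof -
 have "istopology cover_open" unfolding istopology_def
 proof (intro conjI allI impI)
  fix V W assume V: "cover_open V" and W: "cover_open W"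
  show "cover_open (V \<inter> W)" unfolding cover_open_def
  proof (intro conjI ballI impI)
   fix g assume g: "g \<in> PB" "L g \<in> V \<inter> W"
   obtain U1 where U1: "U1 \<in> \<U>" "pathfinish g \<in> U1" "sheet g U1 \<subseteq> V"
    using V g unfolding cover_open_def by blast
   obtain U2 where U2: "U2 \<in> \<U>" "pathfinish g \<in> U2" "sheet g U2 \<subseteq> W"
    using W g unfolding cover_open_def by blast
   obtain U where U: "U \<in> \<U>" "pathfinish g \<in> U" "U \<subseteq> U1 \<inter> U2"
    using basis [of "U1 \<inter> U2" "pathfinish g"] U1 U2 \<U>_open by blast
   have "sheet g U \<subseteq> V \<inter> W" using sheet_mono U U1 U2 by blast
   then show "\<exists>U\<in>\<U>. pathfinish g \<in> U \<and> sheet g U \<subseteq> V \<inter> W" using U by blast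
  qed (use V in \<open>auto simp: cover_open_def\<close>)
 next
  fix K assume "\<forall>V\<in>K. cover_open V"
  then have K: "\<And>V. V \<in> K ==> cover_open V" by blast
  show "cover_open (\<Union>K)" unfolding cover_open_def
  proof (intro conjI ballI impI)
   show "\<Union>K \<subseteq> L ` PB" using K unfolding cover_open_def by blast
   fix g assume "g \<in> PB" "L g \<in> \<Union>K"
   then obtain V where V: "V \<in> K" "L g \<in> V" by blast
   then obtain U where "U \<in> \<U>" "pathfinish g \<in> U" "sheet g U \<subseteq> V"
    using K [OF V(1)] \<open>g \<in> PB\<close> unfolding cover_open_def by blast
   then show "\<exists>U\<in>\<U>. pathfinish g \<in> U \<and> sheet g U \<subseteq> \<Union>K" using V by blast
  qed
 qed
 then show ?thesis by (simp add: Cov_def)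
qed

text \<open>If \<open>g'\<close> is \<open>g\<close> followed by a path \<open>de\<close> in
  \<open>U\<close>, continuations of \<open>g'\<close> become continuations of \<open>g\<close> by
  prefixing \<open>de\<close>, and running \<open>de\<close> backwards recovers \<open>g\<close>
  from \<open>g'\<close>.\<close>

lemma sheet_eq_aux:
 assumes g: "g \<in> PB" "g' \<in> PB" and U: "U \<in> \<U>" and s: "L g' \<in> sheet g U"
 shows "sheet g' U \<subseteq> sheet g U" "L g \<in> sheet g' U"
proof -
 obtain de where de: "de \<in> paths_in U (pathfinish g)" "L g' = L (g +++ de)" using s by (auto simp: sheet_def)
 have UT: "U \<subseteq> T" using U \<U>_sub by blast
 have h: "homotopic_paths T g' (g +++ de)" using de LPB join_PB g UT by blast
 have fin: "pathfinish g' = pathfinish de" using homotopic_paths_imp_pathfinish [OF h] by simp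
 have pg: "path g" "path_image g \<subseteq> T" and pg': "path g'" "path_image g' \<subseteq> T"
  and pde: "path de" "path_image de \<subseteq> T" "pathstart de = pathfinish g"
  using g de UT by (auto simp: PB_def paths_in_def)
 show "sheet g' U \<subseteq> sheet g U"
 proof
  fix y assume "y \<in> sheet g' U"
  then obtain ep where ep: "ep \<in> paths_in U (pathfinish g')" "y = L (g' +++ ep)" by (auto simp: sheet_def)
  have pep: "path ep" "path_image ep \<subseteq> T" "pathstart ep = pathfinish de"
   using ep UT fin by (auto simp: paths_in_def)
  have "homotopic_paths T (g' +++ ep) ((g +++ de) +++ ep)"
   using h pep fin by (intro homotopic_paths_join) auto
  moreover have "homotopic_paths T (g +++ (de +++ ep)) ((g +++ de) +++ ep)"
   using pg pde pep by (intro homotopic_paths_assoc) auto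
  ultimately have "homotopic_paths T (g' +++ ep) (g +++ (de +++ ep))"
   using homotopic_paths_sym homotopic_paths_trans by blast
  moreover have in1: "de +++ ep \<in> paths_in U (pathfinish g)"
   using de ep fin by (auto simp: paths_in_def path_image_join)
  ultimately have "L (g' +++ ep) = L (g +++ (de +++ ep))" using LPB join_PB g ep(1) UT by blast
  then show "y \<in> sheet g U" using in1 ep(2) unfolding sheet_def by blast
 qed
 have r: "path (reversepath de)" "path_image (reversepath de) \<subseteq> T" using pde by auto
 have in2: "reversepath de \<in> paths_in U (pathfinish g')" using de fin by (auto simp: paths_in_def)
 have "homotopic_paths T (g' +++ reversepath de) ((g +++ de) +++ reversepath de)"
  using h r fin by (intro homotopic_paths_join) auto
 moreover have "homotopic_paths T (g +++ (de +++ reversepath de)) ((g +++ de) +++ reversepath de)"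
  using pg pde r by (intro homotopic_paths_assoc) auto
 moreover have "homotopic_paths T (g +++ (de +++ reversepath de)) (g +++ linepath (pathfinish g) (pathfinish g))"
  using homotopic_paths_rinv [of de T] pg pde by (intro homotopic_paths_join) auto
 moreover have "homotopic_paths T (g +++ linepath (pathfinish g) (pathfinish g)) g"
  using pg by (intro homotopic_paths_rid)
 ultimately have "homotopic_paths T g (g' +++ reversepath de)"
  by (meson homotopic_paths_sym homotopic_paths_trans)
 then have "L g = L (g' +++ reversepath de)" using LPB join_PB g in2 UT by blast
 then show "L g \<in> sheet g' U" using in2 unfolding sheet_def by blast
qed

lemma sheet_eq:
 assumes "g \<in> PB" "g' \<in> PB" "U \<in> \<U>" "L g' \<in> sheet g U"
 shows "sheet g' U = sheet g U" using sheet_eq_aux [OF assms] sheet_eq_aux [OF assms(2,1,3)] by blast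

lemma sheet_sub: "g \<in> PB ==> U \<subseteq> T ==> sheet g U \<subseteq> L ` PB" unfolding sheet_def using join_PB by blast

lemma proj_sheet:
 assumes "g \<in> PB" "U \<in> \<U>" "pathfinish g \<in> U"
 shows "proj ` sheet g U = U"
proof -
 have UT: "U \<subseteq> T" using assms \<U>_sub by blast
 have 1: "proj (L (g +++ h)) = pathfinish h" if "h \<in> paths_in U (pathfinish g)" for h
  using proj_L [OF join_PB [OF assms(1) that UT]] by simp
 have "pathfinish h \<in> U" if "h \<in> paths_in U (pathfinish g)" for h
  using that pathfinish_in_path_image by (auto simp: paths_in_def)
 moreover have "\<exists>h\<in>paths_in U (pathfinish g). pathfinish h = x" if "x \<in> U" for x
  using simply_connected_imp_path_connected [OF \<U>_sc [OF assms(2)]] that assms(3)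
  unfolding path_connected_def paths_in_def by blast
 ultimately show ?thesis unfolding sheet_def image_image using 1 by (auto simp: image_iff)
qed

text \<open>Two continuations in \<open>U\<close> with the same endpoint are homotopic because
  \<open>U\<close> is simply connected, so they give the same label.\<close>

lemma inj_on_sheet:
 assumes "g \<in> PB" "U \<in> \<U>"
 shows "inj_on proj (sheet g U)"
proof (rule inj_onI)
 fix y z assume "y \<in> sheet g U" "z \<in> sheet g U" and eq: "proj y = proj z"
 then obtain h r where h: "h \<in> paths_in U (pathfinish g)" "y = L (g +++ h)"
  and r: "r \<in> paths_in U (pathfinish g)" "z = L (g +++ r)" by (auto simp: sheet_def)
 have UT: "U \<subseteq> T" using assms \<U>_sub by blast
 note j = join_PB [OF assms(1) h(1) UT] join_PB [OF assms(1) r(1) UT]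
 have "pathfinish h = pathfinish r" using eq h r proj_L j by simp
 then have "homotopic_paths U h r"
  using \<U>_sc [OF assms(2)] h(1) r(1) unfolding simply_connected_eq_homotopic_paths paths_in_def by auto
 then have "homotopic_paths T h r" using UT homotopic_paths_subset by blast
 then have "homotopic_paths T (g +++ h) (g +++ r)"
  using assms(1) h(1) by (intro homotopic_paths_join) (auto simp: PB_def paths_in_def)
 then show "y = z" using h r LPB j by simp
qed

lemma openin_sheet:
 assumes "g \<in> PB" "U \<in> \<U>"
 shows "openin Cov (sheet g U)" unfolding openin_Cov cover_open_def
proof (intro conjI ballI impI)
 show "sheet g U \<subseteq> L ` PB" using sheet_sub assms \<U>_sub by blast
 fix g' assume g': "g' \<in> PB" "L g' \<in> sheet g U"
 then obtain h where h: "h \<in> paths_in U (pathfinish g)" "L g' = L (g +++ h)" by (auto simp: sheet_def)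
 then have "homotopic_paths T g' (g +++ h)" using LPB join_PB assms g' \<U>_sub by blast
 then have "pathfinish g' = pathfinish h" using homotopic_paths_imp_pathfinish by fastforce
 then have "pathfinish g' \<in> U" using h(1) pathfinish_in_path_image by (auto simp: paths_in_def)
 then show "\<exists>V\<in>\<U>. pathfinish g' \<in> V \<and> sheet g' V \<subseteq> sheet g U" using sheet_eq assms g' by blast
qed

lemma topspace_Cov: "topspace Cov = L ` PB"
proof
 show "topspace Cov \<subseteq> L ` PB" using openin_topspace [of Cov] unfolding openin_Cov cover_open_def by blast
 show "L ` PB \<subseteq> topspace Cov"
 proof clarify
  fix g assume g: "g \<in> PB"
  then obtain U where U: "U \<in> \<U>" "pathfinish g \<in> U" using \<U>_at pathfinish_PB by blast
  then show "L g \<in> topspace Cov" using openin_sheet [OF g] sheet_self [OF g] openin_subset by blast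
 qed
qed

lemma continuous_proj: "continuous_map Cov (top_of_set T) proj"
proof -
 have "openin Cov {y \<in> topspace Cov. proj y \<in> W}" if W: "openin (top_of_set T) W" for W
  unfolding openin_Cov cover_open_def
 proof (intro conjI ballI impI)
  fix g assume g: "g \<in> PB" and "L g \<in> {y \<in> topspace Cov. proj y \<in> W}"
  then have "pathfinish g \<in> W" by (simp add: proj_L)
  then obtain U where U: "U \<in> \<U>" "pathfinish g \<in> U" "U \<subseteq> W" using basis [OF W] by blast
  have "sheet g U \<subseteq> {y \<in> topspace Cov. proj y \<in> W}"
   using proj_sheet [OF g U(1,2)] U(3) sheet_sub [OF g \<U>_sub [OF U(1)]] by (auto simp: topspace_Cov)
  then show "\<exists>U\<in>\<U>. pathfinish g \<in> U \<and> sheet g U \<subseteq> {y \<in> topspace Cov. proj y \<in> W}" using U by blast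
 qed (auto simp: topspace_Cov)
 moreover have "proj \<in> topspace Cov \<rightarrow> T" by (auto simp: topspace_Cov proj_L pathfinish_PB)
 ultimately show ?thesis by (simp add: continuous_map)  (auto simp: continuous_map_def)
qed

lemma open_map_proj: "open_map Cov (top_of_set T) proj" unfolding open_map_def
proof (intro allI impI)
 fix V assume V: "openin Cov V"
 show "openin (top_of_set T) (proj ` V)"
 proof (subst openin_subopen, intro ballI)
  fix x assume "x \<in> proj ` V"
  then obtain g where g: "g \<in> PB" "L g \<in> V" "x = proj (L g)"
   using openin_subset [OF V] unfolding topspace_Cov by blast
  then obtain U where U: "U \<in> \<U>" "pathfinish g \<in> U" "sheet g U \<subseteq> V"
   using V unfolding openin_Cov cover_open_def by blast
  then show "\<exists>U. openin (top_of_set T) U \<and> x \<in> U \<and> U \<subseteq> proj ` V"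
   using g \<U>_open proj_sheet [OF g(1) U(1,2)] by (metis image_mono proj_L)
 qed
qed

lemma homeomorphic_map_sheet:
 assumes "g \<in> PB" "U \<in> \<U>" "pathfinish g \<in> U"
 shows "homeomorphic_map (subtopology Cov (sheet g U)) (subtopology (top_of_set T) U) proj"
proof (rule bijective_open_imp_homeomorphic_map)
 have ts: "topspace Cov \<inter> sheet g U = sheet g U" using openin_subset [OF openin_sheet [OF assms(1,2)]] by auto
 show "continuous_map (subtopology Cov (sheet g U)) (subtopology (top_of_set T) U) proj"
 proof -
  have "proj x \<in> U" if "x \<in> sheet g U" for x using proj_sheet [OF assms] that by blast
  then show ?thesis using continuous_proj \<U>_sub [OF assms(2)]
   by (auto simp: continuous_map_in_subtopology ts continuous_map_from_subtopology)
 qed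
 show "open_map (subtopology Cov (sheet g U)) (subtopology (top_of_set T) U) proj"
  using open_map_proj openin_sheet [OF assms(1,2)] \<U>_open [OF assms(2)] proj_sheet [OF assms]
  unfolding open_map_def openin_open_subtopology [OF openin_sheet [OF assms(1,2)]]
   openin_open_subtopology [OF \<U>_open [OF assms(2)]] by blast
 show "proj ` topspace (subtopology Cov (sheet g U)) = topspace (subtopology (top_of_set T) U)"
  using proj_sheet [OF assms] \<U>_sub [OF assms(2)] by (auto simp: ts)
 show "inj_on proj (topspace (subtopology Cov (sheet g U)))" using inj_on_sheet assms by (simp add: ts)
qed

lemma evenly_covered_\<U>:
 assumes U: "U \<in> \<U>"
 shows "evenly_covered Cov (top_of_set T) proj U" unfolding evenly_covered_def
proof (intro conjI exI)
 let ?V = "{sheet g U |g. g \<in> PB \<and> pathfinish g \<in> U}"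
 show "openin (top_of_set T) U" using \<U>_open U by blast
 show "\<Union>?V = topspace Cov \<inter> proj -` U"
 proof
  show "\<Union>?V \<subseteq> topspace Cov \<inter> proj -` U" using proj_sheet U sheet_sub \<U>_sub unfolding topspace_Cov by blast
  show "topspace Cov \<inter> proj -` U \<subseteq> \<Union>?V"
  proof
   fix y assume "y \<in> topspace Cov \<inter> proj -` U"
   then obtain g where "g \<in> PB" "y = L g" "pathfinish g \<in> U" by (auto simp: topspace_Cov proj_L)
   then show "y \<in> \<Union>?V" using sheet_self by blast
  qed
 qed
 show "pairwise disjnt ?V"
 proof (clarsimp simp: pairwise_def)
  fix g h assume *: "sheet g U \<noteq> sheet h U" "g \<in> PB" "h \<in> PB"
  show "disjnt (sheet g U) (sheet h U)"
  proof (rule ccontr)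
   assume "\<not> disjnt (sheet g U) (sheet h U)"
   then obtain y where "y \<in> sheet g U" "y \<in> sheet h U" by (auto simp: disjnt_def)
   moreover obtain r where "r \<in> PB" "y = L r" using calculation(1) sheet_sub [OF *(2) \<U>_sub [OF U]] by blast
   ultimately have "sheet r U = sheet g U" "sheet r U = sheet h U" using sheet_eq * U by blast+
   then show False using * by simp
  qed
 qed
 show "\<forall>V\<in>?V. openin Cov V \<and> homeomorphic_map (subtopology Cov V) (subtopology (top_of_set T) U) proj"
  using openin_sheet homeomorphic_map_sheet U by blast
qed

text \<open>Points with different projections are separated in the base. Points over one base point
  lie in sheets over a common \<open>U\<close>; two such sheets that meet coincide, and then
  injectivity of the projection would identify the points.\<close>

lemma Hausdorff_Cov: "Hausdorff_space Cov" unfolding Hausdorff_space_def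
proof (intro allI impI, elim conjE)
 fix y z assume y: "y \<in> topspace Cov" and z: "z \<in> topspace Cov" and "y \<noteq> z"
 obtain g h where g: "g \<in> PB" "y = L g" and h: "h \<in> PB" "z = L h" using y z by (auto simp: topspace_Cov)
 show "\<exists>U V. openin Cov U \<and> openin Cov V \<and> y \<in> U \<and> z \<in> V \<and> disjnt U V"
 proof (cases "proj y = proj z")
  case False
  then obtain A B where AB: "open A" "open B" "proj y \<in> A" "proj z \<in> B" "A \<inter> B = {}"
   using hausdorff [OF False] by metis
  have "openin Cov {x \<in> topspace Cov. proj x \<in> T \<inter> A}" "openin Cov {x \<in> topspace Cov. proj x \<in> T \<inter> B}"
   using openin_continuous_map_preimage [OF continuous_proj openin_open_Int [OF AB(1)]]
    openin_continuous_map_preimage [OF continuous_proj openin_open_Int [OF AB(2)]] by simp_all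
  then show ?thesis
  proof (intro exI conjI)
   show "y \<in> {x \<in> topspace Cov. proj x \<in> T \<inter> A}" "z \<in> {x \<in> topspace Cov. proj x \<in> T \<inter> B}"
    using y z AB g h by (auto simp: proj_L pathfinish_PB)
  qed (use AB in \<open>auto simp: disjnt_def\<close>)
 next
  case True
  then have fin: "pathfinish g = pathfinish h" using g h by (simp add: proj_L)
  obtain U where U: "U \<in> \<U>" "pathfinish g \<in> U" using \<U>_at pathfinish_PB g by blast
  have self: "y \<in> sheet g U" "z \<in> sheet h U" using sheet_self U fin g h by auto
  have "disjnt (sheet g U) (sheet h U)"
  proof (rule ccontr)
   assume "\<not> disjnt (sheet g U) (sheet h U)"
   then obtain x where x: "x \<in> sheet g U" "x \<in> sheet h U" by (auto simp: disjnt_def)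
   obtain r where "r \<in> PB" "x = L r" using x(1) sheet_sub [OF g(1) \<U>_sub [OF U(1)]] by blast
   then have "sheet g U = sheet h U" using sheet_eq g h U x by metis
   then show False using inj_onD [OF inj_on_sheet [OF g(1) U(1)] True] self \<open>y \<noteq> z\<close> by auto
  qed
  then show ?thesis using openin_sheet g h U self by blast
 qed
qed

text \<open>The explicit lift: the point over \<open>h z\<close> is the class of \<open>g0\<close>
  followed by the image of the segment from \<open>z0\<close> to \<open>z\<close>. It serves for
  intervals (path lifting) and for discs (lifting null-homotopies).\<close>

lemma lift_from_convex:
 fixes Z :: "'c::real_normed_vector set"
 assumes Z: "convex Z" "z0 \<in> Z" and h: "continuous_on Z h" "h ` Z \<subseteq> T"
  and g0: "g0 \<in> PB" "pathfinish g0 = h z0"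
 defines "H \<equiv> \<lambda>z. L (g0 +++ (h \<circ> linepath z0 z))"
 shows "continuous_map (top_of_set Z) Cov H" "\<And>z. z \<in> Z ==> proj (H z) = h z" "H z0 = L g0"
proof -
 have seg: "closed_segment z z' \<subseteq> Z" if "z \<in> Z" "z' \<in> Z" for z z' using Z that closed_segment_subset by blast
 have comp: "path (h \<circ> q) \<and> path_image (h \<circ> q) \<subseteq> T" if "path q" "path_image q \<subseteq> Z" for q
  using that h by (auto simp: path_image_compose intro!: path_continuous_image elim: continuous_on_subset)
 have pin: "h \<circ> linepath z0 z \<in> paths_in T (pathfinish g0)" if "z \<in> Z" for z
  using comp [of "linepath z0 z"] seg [OF Z(2) that] g0(2) by (auto simp: paths_in_def pathstart_compose)
 have inPB: "g0 +++ (h \<circ> linepath z0 z) \<in> PB" if "z \<in> Z" for z using join_PB [OF g0(1) pin [OF that]] by simp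
 show pH: "proj (H z) = h z" if "z \<in> Z" for z
  using proj_L [OF inPB [OF that]] by (simp add: H_def pathfinish_compose)
 have "h \<circ> linepath z0 z0 = linepath (h z0) (h z0)" by (auto simp: linepath_def fun_eq_iff simp flip: scaleR_left.add)
 then show "H z0 = L g0" using L_const [OF g0(1)] g0(2) by (simp add: H_def)
 \<comment> \<open>In a convex set the segment \<open>z0 z'\<close> is homotopic to the broken line
   \<open>z0 z z'\<close>. So the lift at a nearby \<open>z'\<close> is a short continuation of the
   lift at \<open>z\<close>, which gives continuity.\<close>
 have split: "H z' = L ((g0 +++ (h \<circ> linepath z0 z)) +++ (h \<circ> linepath z z'))" if z: "z \<in> Z" "z' \<in> Z" for z z'
 proof -
  have "homotopic_paths Z (linepath z0 z') (linepath z0 z +++ linepath z z')"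
   using convex_imp_simply_connected [OF Z(1)] seg z Z(2)
   unfolding simply_connected_eq_homotopic_paths by (auto simp: path_image_join)
  then have "homotopic_paths T (h \<circ> linepath z0 z') (h \<circ> (linepath z0 z +++ linepath z z'))"
   using h by (intro homotopic_paths_continuous_image) auto
  then have "homotopic_paths T (h \<circ> linepath z0 z') ((h \<circ> linepath z0 z) +++ (h \<circ> linepath z z'))"
   by (simp add: path_compose_join)
  then have 1: "homotopic_paths T (g0 +++ (h \<circ> linepath z0 z')) (g0 +++ ((h \<circ> linepath z0 z) +++ (h \<circ> linepath z z')))"
   using g0 by (intro homotopic_paths_join) (auto simp: PB_def pathstart_compose)
  have 2: "homotopic_paths T (g0 +++ ((h \<circ> linepath z0 z) +++ (h \<circ> linepath z z')))
    ((g0 +++ (h \<circ> linepath z0 z)) +++ (h \<circ> linepath z z'))"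
   using g0 comp [of "linepath z0 z"] comp [of "linepath z z'"] seg z Z(2)
   by (intro homotopic_paths_assoc) (auto simp: PB_def pathstart_compose pathfinish_compose)
  have "(g0 +++ (h \<circ> linepath z0 z)) +++ (h \<circ> linepath z z') \<in> PB" using comp [of "linepath z z'"] seg z
   by (intro join_PB [OF inPB [OF z(1)], of _ T]) (auto simp: paths_in_def pathstart_compose pathfinish_compose)
  then show ?thesis unfolding H_def using LPB inPB z homotopic_paths_trans [OF 1 2] by blast
 qed
 have "openin (top_of_set Z) {z \<in> Z. H z \<in> W}" if W: "openin Cov W" for W
 proof (subst openin_subopen, intro ballI)
  fix z assume z: "z \<in> {z \<in> Z. H z \<in> W}"
  let ?g = "g0 +++ (h \<circ> linepath z0 z)"
  have "pathfinish ?g = h z" by (simp add: pathfinish_compose)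
  then obtain U where U: "U \<in> \<U>" "h z \<in> U" "sheet ?g U \<subseteq> W"
   using W z inPB unfolding openin_Cov cover_open_def H_def by fastforce
  have "openin (top_of_set Z) (Z \<inter> h -` U)"
   using continuous_openin_preimage [OF h(1), of T U] h(2) \<U>_open [OF U(1)] by blast
  moreover have "z \<in> Z \<inter> h -` U" using z U by blast
  ultimately obtain e where e: "e > 0" "ball z e \<inter> Z \<subseteq> Z \<inter> h -` U" unfolding openin_contains_ball by blast
  have "H z' \<in> W" if z': "z' \<in> ball z e \<inter> Z" for z'
  proof -
   have "closed_segment z z' \<subseteq> ball z e \<inter> Z" using z z' e Z by (intro closed_segment_subset convex_Int) auto
   then have s: "path_image (h \<circ> linepath z z') \<subseteq> U" using e by (auto simp: path_image_compose)
   have "path (h \<circ> linepath z z')" using comp [of "linepath z z'"] seg z z' by simp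
   with s have "h \<circ> linepath z z' \<in> paths_in U (pathfinish ?g)"
    by (auto simp: paths_in_def pathstart_compose pathfinish_compose)
   then have "H z' \<in> sheet ?g U" using split [of z z'] z z' unfolding sheet_def by blast
   then show ?thesis using U by blast
  qed
  then show "\<exists>V. openin (top_of_set Z) V \<and> z \<in> V \<and> V \<subseteq> {z \<in> Z. H z \<in> W}"
   using e z by (intro exI [of _ "Z \<inter> ball z e"]) (auto simp: openin_open_Int)
 qed
 moreover have "H \<in> Z \<rightarrow> topspace Cov" using inPB by (auto simp: H_def topspace_Cov)
 ultimately show "continuous_map (top_of_set Z) Cov H"
  by (simp add: continuous_map)  (auto simp: continuous_map_def)
qed

text \<open>The set where the lifts agree is open since the projection is injective on sheets, and
  closed since the cover is Hausdorff.\<close>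

lemma lift_unique:
 assumes Q: "connected_space Q" and f: "continuous_map Q Cov f" and g: "continuous_map Q Cov g"
  and eq: "\<And>q. q \<in> topspace Q ==> proj (f q) = proj (g q)" and q0: "q0 \<in> topspace Q" "f q0 = g q0"
  and q: "q \<in> topspace Q"
 shows "f q = g q"
proof -
 let ?E = "{q \<in> topspace Q. f q = g q}"
 have "openin Q ?E"
 proof (subst openin_subopen, intro ballI)
  fix q assume q: "q \<in> ?E"
  then have "f q \<in> L ` PB" using continuous_map_funspace [OF f] unfolding topspace_Cov by blast
  then obtain c where c: "c \<in> PB" "f q = L c" by blast
  obtain U where U: "U \<in> \<U>" "pathfinish c \<in> U" using \<U>_at pathfinish_PB c by blast
  let ?N = "{q \<in> topspace Q. f q \<in> sheet c U} \<inter> {q \<in> topspace Q. g q \<in> sheet c U}"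
  have "openin Q ?N"
   using openin_sheet [OF c(1) U(1)] f g by (intro openin_Int) (auto simp: continuous_map_def)
  moreover have "q \<in> ?N" using q c sheet_self [OF c(1) U(2)] by auto
  moreover have "?N \<subseteq> ?E" using inj_onD [OF inj_on_sheet [OF c(1) U(1)]] eq by auto
  ultimately show "\<exists>N. openin Q N \<and> q \<in> N \<and> N \<subseteq> ?E" by blast
 qed
 moreover have "openin Q {q \<in> topspace Q. f q \<noteq> g q}"
 proof (subst openin_subopen, intro ballI)
  fix q assume q: "q \<in> {q \<in> topspace Q. f q \<noteq> g q}"
  then have "f q \<in> topspace Cov" "g q \<in> topspace Cov" "f q \<noteq> g q" using f g by (auto simp: continuous_map_def)
  then obtain A B where AB: "openin Cov A" "openin Cov B" "f q \<in> A" "g q \<in> B" "disjnt A B"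
   using Hausdorff_Cov unfolding Hausdorff_space_def by meson
  let ?N = "{q \<in> topspace Q. f q \<in> A} \<inter> {q \<in> topspace Q. g q \<in> B}"
  have "openin Q ?N" using AB f g by (intro openin_Int) (auto simp: continuous_map_def)
  moreover have "q \<in> ?N" "?N \<subseteq> {q \<in> topspace Q. f q \<noteq> g q}" using q AB by (auto simp: disjnt_iff)
  ultimately show "\<exists>N. openin Q N \<and> q \<in> N \<and> N \<subseteq> {q \<in> topspace Q. f q \<noteq> g q}" by blast
 qed
 moreover have "topspace Q - ?E = {q \<in> topspace Q. f q \<noteq> g q}" by auto
 ultimately have "openin Q ?E" "closedin Q ?E" by (auto simp: closedin_def)
 then have "?E = {} \<or> ?E = topspace Q" using Q unfolding connected_space_clopen_in by blast
 then show ?thesis using q0 q by blast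
qed

text \<open>A path \<open>ga\<close> from the base point lifts to the family of its own initial
  pieces, and this lift ends at the class of \<open>ga\<close>.\<close>

lemma path_connected_Cov: "path_connected_space Cov"
proof -
 define c where "c = linepath b b"
 have c: "c \<in> PB" using b by (auto simp: c_def PB_def)
 have "\<exists>g. pathin Cov g \<and> g 0 = L c \<and> g 1 = L ga" if ga: "ga \<in> PB" for ga
 proof -
  let ?H = "\<lambda>z::real. L (c +++ (ga \<circ> linepath 0 z))"
  have *: "continuous_map (top_of_set {0..1}) Cov ?H" "?H 0 = L c"
  proof -
   have "continuous_on {0..1} ga" "ga ` {0..1} \<subseteq> T" "pathfinish c = ga 0"
    using ga by (auto simp: PB_def path_def path_image_def c_def pathstart_def)
   then show "continuous_map (top_of_set {0..1}) Cov ?H" "?H 0 = L c"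
    using lift_from_convex(1,3) [of "{0..1::real}" 0 ga c] c by simp_all
  qed
  have "ga \<circ> linepath 0 1 = ga" by (auto simp: linepath_def)
  moreover have "L (c +++ ga) = L ga"
  proof (subst LPB)
   show "c +++ ga \<in> PB" using c ga by (intro join_PB [of _ _ T]) (auto simp: paths_in_def PB_def c_def)
   show "homotopic_paths T (c +++ ga) ga" using homotopic_paths_lid [of ga T] ga by (auto simp: c_def PB_def)
  qed (use ga in auto)
  ultimately have "?H 1 = L ga" by simp
  then show ?thesis using * unfolding pathin_def by (intro exI [of _ ?H]) auto
 qed
 then have conn: "path_component_of Cov (L c) y" if "y \<in> topspace Cov" for y
  using that unfolding path_component_of_def topspace_Cov by blast
 show ?thesis unfolding path_connected_space_iff_path_component
  using conn path_component_of_sym path_component_of_trans by metis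
qed

text \<open>A loop upstairs projects to a null-homotopic loop, the projected loop therefore extends
  over the disc, and the disc lifts. By uniqueness of lifts the lifted disc bounds the original
  loop, and contracting the disc to its centre finishes.\<close>

lemma simply_connected_Cov: "simply_connected_space Cov" unfolding simply_connected_space_def
proof (intro conjI allI impI)
 show "path_connected_space Cov" by (rule path_connected_Cov)
 fix f assume f: "continuous_map (top_of_set (sphere (0::complex) 1)) Cov f"
 have "f 1 \<in> L ` PB" using f topspace_Cov by (auto simp: continuous_map_def)
 then obtain g0 where g0: "g0 \<in> PB" "f 1 = L g0" by blast
 define F where "F = (\<lambda>s::real. f (exp (2 * of_real pi * \<i> * of_real s)))"
 have ce: "continuous_map (top_of_set {0..1}) (top_of_set (sphere (0::complex) 1)) (\<lambda>s::real. exp (2 * of_real pi * \<i> * of_real s))"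
  by (auto simp: continuous_map_subtopology_eu intro!: continuous_intros)
 have F: "continuous_map (top_of_set {0..1}) Cov F"
  unfolding F_def using continuous_map_compose [OF ce f] by (simp add: o_def)
 define h where "h = proj \<circ> F"
 have ch: "continuous_map (top_of_set {0..1}) (top_of_set T) h"
  unfolding h_def using continuous_map_compose [OF F continuous_proj] .
 then have h: "continuous_on {0..1} h" "h ` {0..1} \<subseteq> T" by (auto simp: continuous_map_subtopology_eu)
 have F01: "F 0 = L g0" "F 1 = L g0" using g0 exp_two_pi_i by (auto simp: F_def)
 have fin: "pathfinish g0 = h 0" using F01 g0 by (simp add: h_def proj_L)
 let ?H = "\<lambda>z::real. L (g0 +++ (h \<circ> linepath 0 z))"
 have H: "continuous_map (top_of_set {0..1}) Cov ?H" "\<And>z. z \<in> {0..1} ==> proj (?H z) = h z" "?H 0 = L g0"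
  using lift_from_convex [OF _ _ h g0(1) fin] by auto
 have "F 1 = ?H 1" by (rule lift_unique [OF _ F H(1), of 0 1])
    (use H F01 in \<open>auto simp: h_def connected_space_subtopology\<close>)
 moreover have "h \<circ> linepath 0 1 = h" by (auto simp: linepath_def)
 \<comment> \<open>The lift of \<open>h\<close> that starts at \<open>L g0\<close> is the closed
   loop itself, so appending \<open>h\<close> does not change the class of \<open>g0\<close>;
   cancelling \<open>g0\<close> makes \<open>h\<close> null-homotopic.\<close>
 ultimately have "L (g0 +++ h) = L g0" using F01 by simp
 have ph: "path h" "path_image h \<subseteq> T" "pathstart h = pathfinish g0" "pathfinish h = pathfinish g0"
  using h F01 fin g0 by (auto simp: path_def path_image_def pathstart_def h_def proj_L) (auto simp: pathfinish_def proj_L F01)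
 have pg: "path g0" "path_image g0 \<subseteq> T" using g0 by (auto simp: PB_def)
 have "g0 +++ h \<in> PB" by (rule join_PB [OF g0(1), of _ T]) (use ph in \<open>auto simp: paths_in_def\<close>)
 then have hp: "homotopic_paths T (g0 +++ h) g0" using \<open>L (g0 +++ h) = L g0\<close> LPB g0 by blast
 let ?r = "reversepath g0"
 have "homotopic_paths T (?r +++ (g0 +++ h)) (?r +++ g0)" using hp pg by (intro homotopic_paths_join) auto
 moreover have "homotopic_paths T (?r +++ (g0 +++ h)) ((?r +++ g0) +++ h)"
  using pg ph by (intro homotopic_paths_assoc) auto
 moreover have l: "homotopic_paths T (?r +++ g0) (linepath (h 0) (h 0))"
  using homotopic_paths_linv [of g0 T] pg fin by simp
 moreover have "homotopic_paths T ((?r +++ g0) +++ h) (linepath (h 0) (h 0) +++ h)"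
  using l ph fin by (intro homotopic_paths_join) auto
 moreover have "homotopic_paths T (linepath (h 0) (h 0) +++ h) h"
  using homotopic_paths_lid [of h T] ph fin by simp
 ultimately have "homotopic_paths T h (linepath (h 0) (h 0))"
  by (meson homotopic_paths_sym homotopic_paths_trans)
 then have "homotopic_loops T h (linepath (h 0) (h 0))"
  using ph fin by (intro homotopic_paths_imp_homotopic_loops) auto
 from homotopic_loops_imp_homotopic_circlemaps [OF this]
 have "homotopic_with_canon (\<lambda>h. True) (sphere 0 1) T (proj \<circ> f) (\<lambda>z. h 0)"
 proof (rule homotopic_with_eq)
  fix z :: complex assume "z \<in> topspace (top_of_set (sphere 0 1))"
  then have "cmod z = 1" by simp
  then have "exp (\<i> * of_real (Arg2pi z)) = z" using Arg2pi_eq [of z] by simp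
  then show "(proj \<circ> f) z = (h \<circ> (\<lambda>z. Arg2pi z / (2 * pi))) z" by (simp add: h_def F_def mult.commute)
  show "h 0 = (linepath (h 0) (h 0) \<circ> (\<lambda>z. Arg2pi z / (2 * pi))) z"
   by (simp add: linepath_def flip: scaleR_left.add)
 qed auto
 then have "\<exists>g. continuous_on (cball (0::complex) 1) g \<and> g \<in> cball 0 1 \<rightarrow> T \<and> (\<forall>z\<in>sphere 0 1. g z = (proj \<circ> f) z)"
  using nullhomotopic_from_sphere_extension [of 0 "1::real" T "proj \<circ> f"] by blast
 then obtain g where g: "continuous_on (cball (0::complex) 1) g" "g \<in> cball 0 1 \<rightarrow> T"
   "\<And>z. z \<in> sphere 0 1 ==> g z = proj (f z)" by auto
 let ?G = "\<lambda>z. L (g0 +++ (g \<circ> linepath 1 z))"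
 have fin1: "pathfinish g0 = g 1" using g(3) [of 1] g0 by (simp add: proj_L)
 have G: "continuous_map (top_of_set (cball 0 1)) Cov ?G" "\<And>z. z \<in> cball 0 1 ==> proj (?G z) = g z" "?G 1 = L g0"
  using lift_from_convex [OF _ _ g(1) _ g0(1) fin1] g(2) by (auto simp: Pi_iff image_subset_iff)
 have Gs: "continuous_map (top_of_set (sphere 0 1)) Cov ?G"
  using G(1) continuous_map_from_subtopology_mono sphere_cball by blast
 have "connected (sphere (0::complex) 1)" by (simp add: connected_sphere)
 then have cs: "connected_space (top_of_set (sphere (0::complex) 1))" by (simp add: connected_space_subtopology)
 have fG: "f z = ?G z" if z: "z \<in> sphere 0 1" for z
 proof (rule lift_unique [OF cs f Gs, of 1])
  show "proj (f q) = proj (?G q)" if "q \<in> topspace (top_of_set (sphere 0 1))" for q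
   using that G(2) [of q] g(3) [of q] by simp
  show "f 1 = ?G 1" using G(3) g0(2) by simp
 qed (use z in auto)
 have "homotopic_with_canon (\<lambda>z. True) (sphere (0::complex) 1) (cball 0 1) id (\<lambda>_. 0)"
 proof (rule homotopic_with_linear)
  fix x :: complex assume "x \<in> sphere 0 1"
  then show "closed_segment (id x) 0 \<subseteq> cball 0 1" by (intro closed_segment_subset) auto
 qed auto
 then have "homotopic_with (\<lambda>_. True) (top_of_set (sphere 0 1)) Cov (?G \<circ> id) (?G \<circ> (\<lambda>_. 0))"
  by (rule homotopic_with_compose_continuous_map_left [OF _ G(1)]) auto
 then have "homotopic_with (\<lambda>_. True) (top_of_set (sphere 0 1)) Cov f (\<lambda>_. ?G 0)"
  by (rule homotopic_with_eq) (auto simp: fG)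
 then show "\<exists>a. homotopic_with (\<lambda>_. True) (top_of_set (sphere (0::complex) 1)) Cov f (\<lambda>_. a)" by blast
qed

end

lemma path_connected_space_top_of_set: "path_connected_space (top_of_set S) \<longleftrightarrow> path_connected S"
 unfolding path_connectedin_euclidean [symmetric] path_connectedin_def by simp

lemma trivial_homology_contractible:
 "contractible S ==> carrier (H1 (top_of_set S)) = {\<one>\<^bsub>H1 (top_of_set S)\<^esub>}"
 using trivial_reduced_homology_group_contractible_space [of "top_of_set S" 1]
 by (simp add: un_reduced_homology_group trivial_group_def)

text \<open>A trivial first homology of the intersection gives injectivity, and connectedness of the
  intersection kills the connecting map; what remains of Mayer-Vietoris is a direct sum.\<close>

lemma mayer_vietoris_iso:
 assumes Z: "openin Z X" "openin Z Y" "X \<union> Y = topspace Z"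
  and triv: "carrier (H1 (subtopology Z (X \<inter> Y))) = {\<one>\<^bsub>H1 (subtopology Z (X \<inter> Y))\<^esub>}"
  and pc: "path_connected_space (subtopology Z (X \<inter> Y))" "path_connected_space (subtopology Z X)"
 shows "(\<lambda>(a, b). H1map (subtopology Z X) Z id a \<otimes>\<^bsub>H1 Z\<^esub>
          H1map (subtopology Z Y) Z id b)
  \<in> iso (H1 (subtopology Z X) \<times>\<times> H1 (subtopology Z Y)) (H1 Z)"
proof -
 let ?X = "subtopology Z X" and ?Y = "subtopology Z Y" and ?A = "subtopology Z (X \<inter> Y)"
 let ?iX = "H1map ?X Z id" and ?iY = "H1map ?Y Z id"
 interpret GX: comm_group "H1 ?X" by simp
 interpret GY: comm_group "H1 ?Y" by simp
 interpret GZ: comm_group "H1 Z" by simp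
 interpret iX: group_hom "H1 ?X" "H1 Z" ?iX by (rule group_hom_induced)
 interpret iY: group_hom "H1 ?Y" "H1 Z" ?iY by (rule group_hom_induced)
 interpret aX: group_hom "H1 ?A" "H1 ?X" "H1map ?A ?X id" by (rule group_hom_induced)
 interpret aY: group_hom "H1 ?A" "H1 ?Y" "H1map ?A ?Y id" by (rule group_hom_induced)
 let ?h = "\<lambda>(a, b). ?iX a \<otimes>\<^bsub>H1 Z\<^esub> ?iY b"
 let ?P = "H1 ?X \<times>\<times> H1 ?Y"
 interpret P: group ?P by (simp add: DirProd_group)
 have hom: "?h \<in> hom ?P (H1 Z)" by (auto simp: hom_def DirProd_def GZ.m_ac)
 interpret h: group_hom ?P "H1 Z" ?h using hom by (simp add: group_hom_axioms_def group_hom_def DirProd_group)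
 have "inj_on ?h (carrier ?P)" unfolding h.inj_on_one_iff
 proof (clarsimp simp: DirProd_def)
  fix a b assume ab: "a \<in> carrier (H1 ?X)" "b \<in> carrier (H1 ?Y)"
   and "?iX a \<otimes>\<^bsub>H1 Z\<^esub> ?iY b = \<one>\<^bsub>H1 Z\<^esub>"
  then have "?iX a = inv\<^bsub>H1 Z\<^esub> (?iY b)" by (simp add: GZ.inv_equality)
  then have eq: "?iX a = ?iY (inv\<^bsub>H1 ?Y\<^esub> b)" using ab by simp
  obtain c where c: "c \<in> carrier (H1 ?A)"
   "H1map ?A ?X id c = a" "H1map ?A ?Y id c = inv\<^bsub>H1 ?Y\<^esub> b"
   by (rule mayer_vietoris_kernel [OF Z ab(1) _ eq]) (use ab in auto)
  then have "c = \<one>\<^bsub>H1 ?A\<^esub>" using triv by blast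
  with c have "a = \<one>\<^bsub>H1 ?X\<^esub>" "inv\<^bsub>H1 ?Y\<^esub> b = \<one>\<^bsub>H1 ?Y\<^esub>" by simp_all
  then show "a = \<one>\<^bsub>H1 ?X\<^esub> \<and> b = \<one>\<^bsub>H1 ?Y\<^esub>" using ab GY.inv_eq_1_iff by blast
 qed
 moreover have "?h ` carrier ?P = carrier (H1 Z)"
 proof
  show "?h ` carrier ?P \<subseteq> carrier (H1 Z)" using hom by (auto simp: hom_def)
  show "carrier (H1 Z) \<subseteq> ?h ` carrier ?P"
  proof
   fix c assume c: "c \<in> carrier (H1 Z)"
   have "continuous_map ?A ?X id"
    by (simp add: continuous_map_from_subtopology_mono continuous_map_in_subtopology continuous_map_from_subtopology)
   then have "inj_on (hom_induced (1 - 1) ?A {} ?X {} id) (carrier (homology_group (1 - 1) ?A))"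
    using inj_on_zeroth_homology_path_connected pc by simp
   from mayer_vietoris_surj [OF Z this c]
   obtain a b where "a \<in> carrier (H1 ?X)" "b \<in> carrier (H1 ?Y)"
    "c = ?iX a \<otimes>\<^bsub>H1 Z\<^esub> ?iY b" by metis
   then show "c \<in> ?h ` carrier ?P" by (intro image_eqI [of _ _ "(a, b)"]) (auto simp: DirProd_def)
  qed
 qed
 ultimately show ?thesis using hom by (simp add: iso_def bij_betw_def)
qed

lemma sqrt_curve_mono: "W' \<subseteq> W ==> sqrt_curve f W' \<subseteq> sqrt_curve f W" by (auto simp: sqrt_curve_def)

text \<open>Adding one branch point glues an annulus along a disc.\<close>

lemma strip_homology:
 fixes R :: "real set"
 defines "f \<equiv> \<lambda>x. \<Prod>r\<in>R. x - complex_of_real r"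
 assumes fin: "finite R"
 shows "[|is_interval I; open I; card (R \<inter> I) = Suc j|] ==>
  H1 (top_of_set (sqrt_curve f {x. Re x \<in> I})) \<cong> free_Abelian_group {..<j} \<and>
  hom_flip f {x. Re x \<in> I} \<and> path_connected (sqrt_curve f {x. Re x \<in> I})"
proof (induction j arbitrary: I)
 case 0
 then obtain a where a: "R \<inter> I = {a}" by (metis card_1_singletonE One_nat_def)
 let ?W = "{x. Re x \<in> I}" let ?u = "\<lambda>x. \<Prod>r\<in>R - {a}. x - complex_of_real r"
 have "{x. Re x \<in> I} = Re -` I" by auto
 then have cW: "convex ?W"
  using 0(1) by (simp add: is_interval_convex_1 convex_linear_vimage bounded_linear.linear bounded_linear_Re)
 have con: "contractible (sqrt_curve f ?W)"
 proof (rule sqrt_curve_one_root [OF cW, of "of_real a" ?u])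
  show "?u holomorphic_on ?W" by (intro holomorphic_intros)
  show "?u x \<noteq> 0" if x: "x \<in> ?W" for x
  proof -
   have "x - complex_of_real r \<noteq> 0" if r: "r \<in> R - {a}" for r
   proof
    assume "x - complex_of_real r = 0"
    then have "r \<in> R \<inter> I" using x r by auto
    then show False using r unfolding a by blast
   qed
   then show ?thesis using fin by (simp add: prod_zero_iff)
  qed
  have "a \<in> R" using a by blast
  then show "f x = (x - of_real a) * ?u x" for x unfolding f_def by (rule prod.remove [OF fin])
 qed (use a in auto)
 let ?H = "H1 (top_of_set (sqrt_curve f ?W))"
 interpret H: comm_group ?H by simp
 have triv: "carrier ?H = {\<one>\<^bsub>?H\<^esub>}" using trivial_homology_contractible con by blast
 have "carrier (free_Abelian_group {..<0::nat}) = {0}" by (auto simp: free_Abelian_group_def)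
 then have "(\<lambda>_. \<one>\<^bsub>?H\<^esub>) \<in> iso (free_Abelian_group {..<0::nat}) ?H"
  using triv by (auto simp: iso_def hom_def bij_betw_def inj_on_def)
 then have "free_Abelian_group {..<0::nat} \<cong> ?H" by (rule is_isoI)
 then have "?H \<cong> free_Abelian_group {..<0::nat}" using group.iso_sym group_free_Abelian_group by blast
 moreover have "hom_flip f ?W" unfolding hom_flip_def
 proof
  fix c assume "c \<in> carrier ?H"
  then have "c = \<one>\<^bsub>?H\<^esub>" using triv by blast
  moreover have "H1map (top_of_set (sqrt_curve f ?W)) (top_of_set (sqrt_curve f ?W)) flip_sheet c \<in> carrier ?H"
   by (simp add: hom_induced_carrier)
  ultimately show "H1map (top_of_set (sqrt_curve f ?W)) (top_of_set (sqrt_curve f ?W)) flip_sheet c = inv\<^bsub>?H\<^esub> c"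
   using triv by auto
 qed
 ultimately show ?case using contractible_imp_path_connected con by blast
next
 case (Suc j)
 \<comment> \<open>The two leftmost roots \<open>a < b\<close> are used. \<open>I1\<close>, to the
   right of \<open>a\<close>, omits only \<open>a\<close> and falls under the induction hypothesis;
   \<open>I2\<close> stops before the third root, if there is one, and contains exactly
   \<open>a\<close> and \<open>b\<close>. Their overlap contains only the root \<open>b\<close>, so
   the curve over it is contractible.\<close>
 define a where "a = Min (R \<inter> I)"
 define R1 where "R1 = (R \<inter> I) - {a}"
 have finR: "finite (R \<inter> I)" and neR: "R \<inter> I \<noteq> {}" using fin Suc.prems(3) by auto
 have a: "a \<in> R" "a \<in> I" "\<And>r. r \<in> R \<inter> I ==> a \<le> r" using Min_in [OF finR neR] finR by (auto simp: a_def)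
 have cR1: "card R1 = Suc j" using Suc.prems(3) a finR by (simp add: R1_def)
 have R1: "finite R1" "R1 \<noteq> {}" using finR cR1 by (simp add: R1_def) (use cR1 in auto)
 define b where "b = Min R1"
 have b: "b \<in> R" "b \<in> I" "b \<noteq> a" "\<And>r. r \<in> R1 ==> b \<le> r" using Min_in [OF R1] R1 by (auto simp: b_def R1_def)
 have ab: "a < b" using a(3) [of b] b by auto
 define I2 where "I2 = (if R1 = {b} then I else I \<inter> {..<Min (R1 - {b})})"
 define I1 where "I1 = I \<inter> {a<..}"
 let ?W = "{x. Re x \<in> I}" and ?W1 = "{x. Re x \<in> I1}" and ?W2 = "{x. Re x \<in> I2}" and ?W12 = "{x. Re x \<in> I1 \<inter> I2}"
 have R12: "R \<inter> I1 = R1" using a by (force simp: I1_def R1_def)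
 have I2: "is_interval I2" "open I2" "R \<inter> I2 = {a, b}" "I1 \<union> I2 = I" "\<exists>c>b. I2 = I \<inter> {..<c} \<or> I2 = I"
 proof -
  show "is_interval I2" "open I2"
   using Suc.prems by (auto simp: I2_def is_interval_convex_1 convex_Int convex_real_interval)
  have "R \<inter> I2 = {a, b} \<and> I1 \<union> I2 = I \<and> (\<exists>c>b. I2 = I \<inter> {..<c} \<or> I2 = I)"
  proof (cases "R1 = {b}")
   case True
   then show ?thesis using a b by (auto simp: I2_def I1_def R1_def intro: gt_ex)
  next
   case False
   then have ne: "R1 - {b} \<noteq> {}" "finite (R1 - {b})" using R1 by auto
   define c where "c = Min (R1 - {b})"
   have c: "c \<in> R1" "c \<noteq> b" "\<And>r. r \<in> R1 - {b} ==> c \<le> r" using Min_in [OF ne(2,1)] ne by (auto simp: c_def)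
   then have bc: "b < c" using b(4) [of c] by auto
   have I2: "I2 = I \<inter> {..<c}" using False by (simp add: I2_def c_def)
   have "R \<inter> I2 = {a, b}"
   proof
    show "R \<inter> I2 \<subseteq> {a, b}" using c(3) unfolding I2 R1_def by force
    show "{a, b} \<subseteq> R \<inter> I2" using a b ab bc unfolding I2 by auto
   qed
   moreover have "I1 \<union> I2 = I" using ab bc unfolding I1_def I2 by auto
   ultimately show ?thesis using bc I2 by blast
  qed
  then show "R \<inter> I2 = {a, b}" "I1 \<union> I2 = I" "\<exists>c>b. I2 = I \<inter> {..<c} \<or> I2 = I" by auto
 qed
 have I1: "is_interval I1" "open I1" using Suc.prems by (auto simp: I1_def is_interval_convex_1 convex_Int convex_real_interval)
 have IH: "H1 (top_of_set (sqrt_curve f ?W1)) \<cong> free_Abelian_group {..<j}"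
  "hom_flip f ?W1" "path_connected (sqrt_curve f ?W1)" using Suc.IH [OF I1] R12 cR1 by auto
 let ?u = "\<lambda>x. \<Prod>r\<in>R - {a} - {b}. x - complex_of_real r"
 have uhol: "?u holomorphic_on ?W2" by (intro holomorphic_intros)
 have u0: "?u x \<noteq> 0" if x: "x \<in> ?W2" for x
 proof -
  have "x - complex_of_real r \<noteq> 0" if r: "r \<in> R - {a} - {b}" for r
  proof
   assume "x - complex_of_real r = 0"
   then have "r \<in> R \<inter> I2" using x r by auto
   then show False using r unfolding I2(3) by blast
  qed
  then show ?thesis using fin by (simp add: prod_zero_iff)
 qed
 have fu: "f x = (x - of_real a) * (x - of_real b) * ?u x" for x
 proof -
  have "f x = (x - of_real a) * (\<Prod>r\<in>R - {a}. x - complex_of_real r)"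
   unfolding f_def by (rule prod.remove [OF fin a(1)])
  also have "(\<Prod>r\<in>R - {a}. x - complex_of_real r) = (x - of_real b) * ?u x"
   by (rule prod.remove) (use b fin in auto)
  finally show ?thesis by simp
 qed
 have two: "H1 (top_of_set (sqrt_curve f ?W2)) \<cong> integer_group" "hom_flip f ?W2"
   "path_connected (sqrt_curve f ?W2)" using sqrt_curve_two_roots [OF I2(1) _ _ ab uhol u0 fu] I2(3) by auto
 have iI: "is_interval (I1 \<inter> I2)" using I1 I2 by (simp add: is_interval_Int)
 have "{x. Re x \<in> I1 \<inter> I2} = Re -` (I1 \<inter> I2)" by auto
 then have cW: "convex ?W12"
  using iI by (simp only: is_interval_convex_1 convex_linear_vimage bounded_linear.linear bounded_linear_Re)
 have con: "contractible (sqrt_curve f ?W12)"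
 proof (rule sqrt_curve_one_root [OF cW, of "of_real b" "\<lambda>x. (x - of_real a) * ?u x"])
  show "(\<lambda>x. (x - of_real a) * ?u x) holomorphic_on ?W12" by (intro holomorphic_intros)
  show "(x - of_real a) * ?u x \<noteq> 0" if "x \<in> ?W12" for x using u0 [of x] that by (auto simp: I1_def)
  show "f x = (x - of_real b) * ((x - of_real a) * ?u x)" for x by (simp add: fu)
  have "b \<in> I1" using b ab by (simp add: I1_def)
  then show "of_real b \<in> ?W12" using I2(3) by auto
 qed
 let ?Z = "top_of_set (sqrt_curve f ?W)" and ?X = "sqrt_curve f ?W1" and ?Y = "sqrt_curve f ?W2"
 have oX: "openin ?Z ?X"
 proof -
  have "?X = sqrt_curve f ?W \<inter> (Re \<circ> fst) -` {a<..}" by (auto simp: sqrt_curve_def I1_def)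
  moreover have "open ((Re \<circ> fst) -` {a<..} :: (complex \<times> complex) set)"
   by (intro open_vimage) (auto intro!: continuous_intros)
  ultimately show ?thesis by (metis openin_open_Int)
 qed
 have oY: "openin ?Z ?Y"
 proof -
  obtain c where "I2 = I \<inter> {..<c} \<or> I2 = I" using I2(5) by blast
  then show ?thesis
  proof
   assume "I2 = I \<inter> {..<c}"
   then have "?Y = sqrt_curve f ?W \<inter> (Re \<circ> fst) -` {..<c}" by (auto simp: sqrt_curve_def)
   moreover have "open ((Re \<circ> fst) -` {..<c} :: (complex \<times> complex) set)"
    by (intro open_vimage) (auto intro!: continuous_intros)
   ultimately show ?thesis by (metis openin_open_Int)
  qed auto
 qed
 have XY: "?X \<union> ?Y = topspace ?Z" "?X \<inter> ?Y = sqrt_curve f ?W12" using I2(4) by (auto simp: sqrt_curve_def)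
 have "?W1 \<subseteq> ?W" "?W2 \<subseteq> ?W" using I2(4) by auto
 then have sXY: "?X \<subseteq> sqrt_curve f ?W" "?Y \<subseteq> sqrt_curve f ?W" by (simp_all only: sqrt_curve_mono)
 have sub: "subtopology ?Z ?X = top_of_set ?X" "subtopology ?Z ?Y = top_of_set ?Y"
  "subtopology ?Z (?X \<inter> ?Y) = top_of_set (?X \<inter> ?Y)"
 proof -
  have *: "subtopology ?Z T = top_of_set T" if "T \<subseteq> sqrt_curve f ?W" for T
   using that by (simp only: subtopology_subtopology Int_absorb1)
  note s = sXY
  have "?X \<inter> ?Y \<subseteq> sqrt_curve f ?W" using s(1) by (rule le_infI1)
  then show "subtopology ?Z ?X = top_of_set ?X" "subtopology ?Z ?Y = top_of_set ?Y"
   "subtopology ?Z (?X \<inter> ?Y) = top_of_set (?X \<inter> ?Y)" using s by (simp_all only: *)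
 qed
 have triv: "carrier (H1 (subtopology ?Z (?X \<inter> ?Y))) = {\<one>\<^bsub>H1 (subtopology ?Z (?X \<inter> ?Y))\<^esub>}"
  unfolding sub unfolding XY(2) by (rule trivial_homology_contractible [OF con])
 have pc: "path_connected_space (subtopology ?Z (?X \<inter> ?Y))" "path_connected_space (subtopology ?Z ?X)"
  unfolding sub unfolding XY(2) using contractible_imp_path_connected [OF con] IH(3)
  by (simp_all add: path_connected_space_top_of_set)
 note iso = mayer_vietoris_iso [OF oX oY XY(1) triv pc]
 have "H1 (top_of_set ?X) \<times>\<times> H1 (top_of_set ?Y) \<cong> H1 ?Z" using iso unfolding sub by (rule is_isoI)
 then have "H1 ?Z \<cong> H1 (top_of_set ?X) \<times>\<times> H1 (top_of_set ?Y)"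
  by (rule group.iso_sym [OF DirProd_group [OF group_relative_homology_group group_relative_homology_group]])
 moreover have "H1 (top_of_set ?Y) \<cong> free_Abelian_group {j}"
  by (rule iso_trans [OF two(1) isomorphic_group_integer_free_Abelian_group_singleton])
 then have "H1 (top_of_set ?X) \<times>\<times> H1 (top_of_set ?Y)
   \<cong> free_Abelian_group {..<j} \<times>\<times> free_Abelian_group {j}"
  by (rule group.DirProd_iso_trans [OF group_relative_homology_group IH(1)])
 moreover have "free_Abelian_group {..<j} \<times>\<times> free_Abelian_group {j} \<cong> free_Abelian_group {..<Suc j}"
  using free_Abelian_group_DirProd [of "{..<j}" "{j}"] by (simp add: lessThan_Suc)
 ultimately have 1: "H1 ?Z \<cong> free_Abelian_group {..<Suc j}" by (rule iso_trans [OF _ iso_trans])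
 \<comment> \<open>The sheet exchange commutes with both inclusions and acts by \<open>-1\<close> on
   both pieces, whose images generate.\<close>
 have 2: "hom_flip f ?W" unfolding hom_flip_def
 proof
  fix c assume c: "c \<in> carrier (H1 ?Z)"
  let ?iX = "H1map (top_of_set ?X) ?Z id" and ?iY = "H1map (top_of_set ?Y) ?Z id"
  let ?F = "\<lambda>W. H1map (top_of_set (sqrt_curve f W)) (top_of_set (sqrt_curve f W)) flip_sheet"
  interpret GX: comm_group "H1 (top_of_set ?X)" by simp
  interpret GY: comm_group "H1 (top_of_set ?Y)" by simp
  interpret GZ: comm_group "H1 ?Z" by simp
  interpret iX: group_hom "H1 (top_of_set ?X)" "H1 ?Z" ?iX by (rule group_hom_induced)
  interpret iY: group_hom "H1 (top_of_set ?Y)" "H1 ?Z" ?iY by (rule group_hom_induced)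
  interpret F: group_hom "H1 ?Z" "H1 ?Z" "?F ?W" by (rule group_hom_induced)
  obtain a b where ab: "a \<in> carrier (H1 (top_of_set ?X))" "b \<in> carrier (H1 (top_of_set ?Y))"
   "c = ?iX a \<otimes>\<^bsub>H1 ?Z\<^esub> ?iY b"
  proof -
   have "c \<in> (\<lambda>(a, b). ?iX a \<otimes>\<^bsub>H1 ?Z\<^esub> ?iY b) `
     carrier (H1 (top_of_set ?X) \<times>\<times> H1 (top_of_set ?Y))"
    using iso c unfolding sub by (simp add: Group.iso_iff)
   then show ?thesis using that by (auto simp: DirProd_def)
  qed
  have inc0: "continuous_map (top_of_set S) (top_of_set T) id" if "S \<subseteq> T" for S T :: "(complex \<times> complex) set"
   using that by (auto simp: continuous_map_subtopology_eu)
  have inc: "continuous_map (top_of_set ?X) ?Z id" "continuous_map (top_of_set ?Y) ?Z id"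
   using inc0 [OF sXY(1)] inc0 [OF sXY(2)] .
  have natX: "?F ?W (?iX a) = ?iX (?F ?W1 a)"
   using fun_cong [OF hom_induced_compose_empty [where p = 1, OF inc(1) continuous_map_flip_sheet], of a]
    fun_cong [OF hom_induced_compose_empty [where p = 1, OF continuous_map_flip_sheet inc(1)], of a]
   by (simp only: comp_apply comp_id id_comp)
  have natY: "?F ?W (?iY b) = ?iY (?F ?W2 b)"
   using fun_cong [OF hom_induced_compose_empty [where p = 1, OF inc(2) continuous_map_flip_sheet], of b]
    fun_cong [OF hom_induced_compose_empty [where p = 1, OF continuous_map_flip_sheet inc(2)], of b]
   by (simp only: comp_apply comp_id id_comp)
  have "?F ?W c = ?iX (?F ?W1 a) \<otimes>\<^bsub>H1 ?Z\<^esub> ?iY (?F ?W2 b)" using ab by (simp add: natX natY)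
  also have "\<dots> = inv\<^bsub>H1 ?Z\<^esub> c" using ab IH(2) two(2) by (simp add: hom_flip_def GZ.inv_mult)
  finally show "?F ?W c = inv\<^bsub>H1 ?Z\<^esub> c" .
 qed
 have 3: "path_connected (sqrt_curve f ?W)"
 proof -
  have "?X \<inter> ?Y \<noteq> {}" unfolding XY(2)
  proof -
   have "b \<in> I1 \<inter> I2" using b ab I2(3) by (auto simp: I1_def)
   moreover have "f (of_real b) = 0" by (simp add: fu)
   ultimately have "(of_real b, 0) \<in> sqrt_curve f ?W12" by (simp add: sqrt_curve_def)
   then show "sqrt_curve f ?W12 \<noteq> {}" by blast
  qed
  then show ?thesis using path_connected_Un [OF IH(3) two(3)] XY(1) by simp
 qed
 show ?case using 1 2 3 by blast
qed

text \<open>Capping off a puncture: the loop around it is invariant under \<open>\<iota>\<close>, which acts by \<open>-1\<close> on a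
 torsion free group, hence the loop is null-homologous.\<close>

lemma homology_cap_disc:
 assumes op: "openin S C" "openin S D" "C \<union> D = topspace S"
  and D: "path_connected_space (subtopology S D)"
   "carrier (H1 (subtopology S D)) = {\<one>\<^bsub>H1 (subtopology S D)\<^esub>}"
  and A: "path_connected_space (subtopology S (D \<inter> C))"
  and iso: "H1 (subtopology S C) \<cong> free_Abelian_group (B :: 'b set)"
  and j: "continuous_map (subtopology S C) (subtopology S C) j"
   "homotopic_with (\<lambda>_. True) (subtopology S (D \<inter> C)) (subtopology S (D \<inter> C)) j id"
   "\<And>c. c \<in> carrier (H1 (subtopology S C)) ==>
     H1map (subtopology S C) (subtopology S C) j c = inv\<^bsub>H1 (subtopology S C)\<^esub> c"
 shows "H1 S \<cong> free_Abelian_group B"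
proof -
 let ?C = "subtopology S C" and ?D = "subtopology S D" and ?A = "subtopology S (D \<inter> C)"
 let ?iC = "H1map ?C S id" and ?iD = "H1map ?D S id"
 have op': "D \<union> C = topspace S" using op(3) by blast
 interpret GC: comm_group "H1 ?C" by simp
 interpret GS: comm_group "H1 S" by simp
 interpret GD: comm_group "H1 ?D" by simp
 interpret iC: group_hom "H1 ?C" "H1 S" ?iC by (rule group_hom_induced)
 interpret iD: group_hom "H1 ?D" "H1 S" ?iD by (rule group_hom_induced)
 have inc: "continuous_map ?A ?C id" "continuous_map ?A ?D id"
  by (auto simp: continuous_map_from_subtopology_mono continuous_map_in_subtopology continuous_map_from_subtopology)
 have cA: "continuous_map ?A ?A j" using homotopic_with_imp_continuous_maps [OF j(2)] by blast
 obtain ph where ph: "ph \<in> iso (H1 ?C) (free_Abelian_group B)" using iso by (auto simp: is_iso_def)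
 interpret ph: group_hom "H1 ?C" "free_Abelian_group B" ph
  using ph by (simp add: group_hom_axioms_def group_hom_def iso_def)
 \<comment> \<open>A free abelian group has no 2-torsion: a class equal to its own inverse is
   trivial.\<close>
 have tf: "c = \<one>\<^bsub>H1 ?C\<^esub>"
  if c: "c \<in> carrier (H1 ?C)" "inv\<^bsub>H1 ?C\<^esub> c = c" for c
 proof -
  have "ph c \<in> carrier (free_Abelian_group B)" by (rule ph.hom_closed [OF c(1)])
  moreover have "ph c = inv\<^bsub>free_Abelian_group B\<^esub> (ph c)" using c ph.hom_inv [OF c(1)] by simp
  ultimately have "ph c = - ph c" by simp
  then have *: "ph c = - ph c" .
  have "ph c = 0"
  proof (rule poly_mapping_eqI)
   fix x
   have "Poly_Mapping.lookup (ph c) x = - Poly_Mapping.lookup (ph c) x"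
    using arg_cong [OF *, of "\<lambda>p. Poly_Mapping.lookup p x"] by simp
   then show "Poly_Mapping.lookup (ph c) x = Poly_Mapping.lookup 0 x" by simp
  qed
  then show ?thesis using ph c ph.inj_on_one_iff by (simp add: iso_def bij_betw_def)
 qed
 have "inj_on ?iC (carrier (H1 ?C))" unfolding iC.inj_on_one_iff
 proof (intro allI impI)
  fix c assume c: "c \<in> carrier (H1 ?C)" "?iC c = \<one>\<^bsub>H1 S\<^esub>"
  have eq: "?iD \<one>\<^bsub>H1 ?D\<^esub> = ?iC c" using c by simp
  \<comment> \<open>A class of \<open>C\<close> that dies after capping already comes from the
    annulus. There \<open>j\<close> is homotopic to the identity, so \<open>j\<close> fixes the
    class, while on \<open>C\<close> it inverts it.\<close>
  obtain al where al: "al \<in> carrier (H1 ?A)" "H1map ?A ?C id al = c"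
   by (rule mayer_vietoris_kernel [OF op(2,1) op' _ c(1) eq]) auto
  have "H1map ?C ?C j c = H1map ?A ?C id (H1map ?A ?A j al)"
   using fun_cong [OF hom_induced_compose_empty [where p = 1, OF inc(1) j(1)], of al]
    fun_cong [OF hom_induced_compose_empty [where p = 1, OF cA inc(1)], of al]
   unfolding al(2) [symmetric] by (simp only: comp_apply comp_id id_comp)
  also have "H1map ?A ?A j al = al" using homology_homotopy_empty [OF j(2)] al by (simp add: hom_induced_id)
  finally have "inv\<^bsub>H1 ?C\<^esub> c = c" unfolding al(2) j(3) [OF c(1)] .
  then show "c = \<one>\<^bsub>H1 ?C\<^esub>" using tf c by blast
 qed
 moreover have "?iC ` carrier (H1 ?C) = carrier (H1 S)"
 proof
  show "?iC ` carrier (H1 ?C) \<subseteq> carrier (H1 S)" by auto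
  show "carrier (H1 S) \<subseteq> ?iC ` carrier (H1 ?C)"
  proof
   fix c assume c: "c \<in> carrier (H1 S)"
   have inj: "inj_on (hom_induced (1 - 1) ?A {} ?D {} id) (carrier (homology_group (1 - 1) ?A))"
    using inj_on_zeroth_homology_path_connected [OF A D(1) inc(2)] by simp
   obtain a b where ab: "a \<in> carrier (H1 ?D)" "b \<in> carrier (H1 ?C)"
    "c = ?iD a \<otimes>\<^bsub>H1 S\<^esub> ?iC b" by (rule mayer_vietoris_surj [OF op(2,1) op' inj c])
   then have "c = ?iC b" using D(2) by auto
   then show "c \<in> ?iC ` carrier (H1 ?C)" using ab by blast
  qed
 qed
 ultimately have "?iC \<in> iso (H1 ?C) (H1 S)" by (simp add: iso_def bij_betw_def iC.homh)
 then have "H1 S \<cong> H1 ?C" by (metis GC.group_axioms group.iso_sym is_isoI)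
 then show ?thesis using iso iso_trans by blast
qed

section \<open>Partial derivatives and smooth functions on plane domains\<close>

lemma pd_eq: "(f has_derivative D) (at z) ==> pd v f z = D v"
 unfolding pd_def using frechet_derivative_at by metis

text \<open>The Frechet derivative is a choice among all derivatives, so equality follows as soon as
  both functions have the same candidates; differentiability does not enter.\<close>

lemma pd_cong:
 assumes "open W" "z \<in> W" "\<And>x. x \<in> W ==> f x = g x"
 shows "pd v f z = pd v g z"
proof -
 have "(f has_derivative D) (at z) \<longleftrightarrow> (g has_derivative D) (at z)" for D
  using has_derivative_transform_within_open [OF _ assms(1,2)] assms(3) by metis
 then show ?thesis by (simp add: pd_def frechet_derivative_def)
qed

lemma pd_const [simp]: "pd v (\<lambda>_. c) z = 0" by (rule pd_eq) (rule has_derivative_const)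

lemma pd_add:
 "f differentiable at z ==> g differentiable at z ==> pd v (\<lambda>x. f x + g x) z = pd v f z + pd v g z"
 unfolding pd_def [of _ f] pd_def [of _ g]
 by (rule pd_eq) (intro has_derivative_add; simp add: frechet_derivative_works [symmetric])

lemma (in bounded_bilinear) pd_prod:
 "f differentiable at z ==> g differentiable at z ==>
   pd v (\<lambda>x. prod (f x) (g x)) z = prod (f z) (pd v g z) + prod (pd v f z) (g z)"
 unfolding pd_def [of _ f] pd_def [of _ g]
 by (rule pd_eq) (rule FDERIV; simp add: frechet_derivative_works [symmetric])

lemma (in bounded_linear) pd_linear:
 "g differentiable at z ==> pd v (\<lambda>x. f (g x)) z = f (pd v g z)" unfolding pd_def [of _ g]
 by (rule pd_eq) (rule has_derivative; simp add: frechet_derivative_works [symmetric])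

lemmas pd_minus = bounded_linear.pd_linear [OF bounded_linear_minus [OF bounded_linear_ident]]

lemmas pd_mult = bounded_bilinear.pd_prod [OF bounded_bilinear_mult]

lemma pd_direction:
 assumes "f differentiable at z"
 shows "pd v f z = Re v *\<^sub>R pd 1 f z + Im v *\<^sub>R pd \<i> f z"
proof -
 have l: "linear (frechet_derivative f (at z))" using assms linear_frechet_derivative by blast
 have "v = Re v *\<^sub>R 1 + Im v *\<^sub>R \<i>" by (simp add: complex_eq_iff)
 then have "pd v f z = frechet_derivative f (at z) (Re v *\<^sub>R 1 + Im v *\<^sub>R \<i>)" by (simp add: pd_def)
 then show ?thesis unfolding linear_add [OF l] linear_scale [OF l] by (simp add: pd_def)
qed

lemma C_on_cong:
 assumes "open W" "\<And>z. z \<in> W ==> f z = g z"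
 shows "C_on k W f \<longleftrightarrow> C_on k W g" using assms(2)
proof (induction k arbitrary: f g)
 case 0
 then show ?case using continuous_on_cong [of W W f g] by simp
next
 case (Suc k)
 have "f differentiable at z \<longleftrightarrow> g differentiable at z" if "z \<in> W" for z unfolding differentiable_def
  using has_derivative_transform_within_open [OF _ assms(1) that] Suc.prems by metis
 moreover have "C_on k W (pd v f) \<longleftrightarrow> C_on k W (pd v g)" for v
  using pd_cong [OF assms(1)] Suc.prems by (intro Suc.IH) blast
 ultimately show ?case by simp
qed

lemma C_on_SucD: "C_on (Suc k) W f ==> C_on k W f"
proof (induction k arbitrary: f)
 case 0
 then show ?case by (auto intro!: continuous_at_imp_continuous_on differentiable_imp_continuous_within)
next
 case (Suc k)
 then show ?case using C_on.simps(2) by blast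
qed

text \<open>Derivatives of concrete functions are known by formulas that hold on \<open>W\<close>
  only. The smoothness of the formulas is what gets checked.\<close>

lemma C_on_SucI:
 assumes "open W" "\<And>z. z \<in> W ==> f differentiable at z" "C_on k W g" "C_on k W h"
  and "\<And>z. z \<in> W ==> pd 1 f z = g z" "\<And>z. z \<in> W ==> pd \<i> f z = h z"
 shows "C_on (Suc k) W f"
proof -
 have "C_on k W (pd 1 f)" by (rule iffD2 [OF C_on_cong assms(3)]) (use assms in blast)+
 moreover have "C_on k W (pd \<i> f)" by (rule iffD2 [OF C_on_cong assms(4)]) (use assms in blast)+
 ultimately show ?thesis using assms(2) unfolding C_on.simps(2) by blast
qed

lemma C_on_Suc_iffs:
 assumes "C_on (Suc k) W f"
 shows "z \<in> W ==> f differentiable at z" "C_on k W (pd 1 f)" "C_on k W (pd \<i> f)"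
 using assms unfolding C_on.simps(2) by blast+

lemma C_on_const: "open W ==> C_on k W (\<lambda>_. c)"
proof (induction k arbitrary: c)
 case (Suc k)
 show ?case by (rule C_on_SucI [where g = "\<lambda>_. 0" and h = "\<lambda>_. 0"]) (use Suc in simp_all)
qed simp

lemma C_on_add:
 assumes "open W"
 shows "C_on k W f ==> C_on k W g ==> C_on k W (\<lambda>x. f x + g x)"
proof (induction k arbitrary: f g)
 case 0
 then show ?case by (simp add: continuous_on_add)
next
 case (Suc k)
 note F = C_on_Suc_iffs [OF Suc.prems(1)] and G = C_on_Suc_iffs [OF Suc.prems(2)]
 show ?case
 proof (rule C_on_SucI [OF assms])
  show "C_on k W (\<lambda>x. pd 1 f x + pd 1 g x)" by (rule Suc.IH [OF F(2) G(2)])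
  show "C_on k W (\<lambda>x. pd \<i> f x + pd \<i> g x)" by (rule Suc.IH [OF F(3) G(3)])
  fix z assume z: "z \<in> W"
  show "(\<lambda>x. f x + g x) differentiable at z" by (rule differentiable_add [OF F(1) [OF z] G(1) [OF z]])
  show "pd 1 (\<lambda>x. f x + g x) z = pd 1 f z + pd 1 g z" "pd \<i> (\<lambda>x. f x + g x) z = pd \<i> f z + pd \<i> g z"
   by (rule pd_add [OF F(1) [OF z] G(1) [OF z]])+
 qed
qed

lemma (in bounded_bilinear) differentiable_prod:
 "f differentiable at z ==> g differentiable at z ==> (\<lambda>x. prod (f x) (g x)) differentiable at z"
 unfolding differentiable_def using FDERIV by blast

lemma (in bounded_bilinear) C_on_prod:
 assumes "open W"
 shows "C_on k W f ==> C_on k W g ==> C_on k W (\<lambda>x. prod (f x) (g x))"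
proof (induction k arbitrary: f g)
 case 0
 then show ?case by (simp add: continuous_on)
next
 case (Suc k)
 note F = C_on_Suc_iffs [OF Suc.prems(1)] and G = C_on_Suc_iffs [OF Suc.prems(2)]
 note f = C_on_SucD [OF Suc.prems(1)] and g = C_on_SucD [OF Suc.prems(2)]
 show ?case
 proof (rule C_on_SucI [OF assms])
  show "C_on k W (\<lambda>x. prod (f x) (pd 1 g x) + prod (pd 1 f x) (g x))"
   by (rule C_on_add [OF assms Suc.IH [OF f G(2)] Suc.IH [OF F(2) g]])
  show "C_on k W (\<lambda>x. prod (f x) (pd \<i> g x) + prod (pd \<i> f x) (g x))"
   by (rule C_on_add [OF assms Suc.IH [OF f G(3)] Suc.IH [OF F(3) g]])
  fix z assume z: "z \<in> W"
  show "(\<lambda>x. prod (f x) (g x)) differentiable at z" by (rule differentiable_prod [OF F(1) [OF z] G(1) [OF z]])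
  show "pd 1 (\<lambda>x. prod (f x) (g x)) z = prod (f z) (pd 1 g z) + prod (pd 1 f z) (g z)"
   "pd \<i> (\<lambda>x. prod (f x) (g x)) z = prod (f z) (pd \<i> g z) + prod (pd \<i> f z) (g z)"
   by (rule pd_prod [OF F(1) [OF z] G(1) [OF z]])+
 qed
qed

lemmas C_on_mult = bounded_bilinear.C_on_prod [OF bounded_bilinear_mult]

lemma (in bounded_linear) C_on_linear:
 assumes "open W"
 shows "C_on k W g ==> C_on k W (\<lambda>x. f (g x))"
proof (induction k arbitrary: g)
 case 0
 then show ?case by (simp add: continuous_on)
next
 case (Suc k)
 note G = C_on_Suc_iffs [OF Suc.prems]
 show ?case
 proof (rule C_on_SucI [OF assms])
  show "C_on k W (\<lambda>x. f (pd 1 g x))" by (rule Suc.IH [OF G(2)])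
  show "C_on k W (\<lambda>x. f (pd \<i> g x))" by (rule Suc.IH [OF G(3)])
  fix z assume z: "z \<in> W"
  show "(\<lambda>x. f (g x)) differentiable at z"
   using G(1) [OF z] has_derivative unfolding differentiable_def by blast
  show "pd 1 (\<lambda>x. f (g x)) z = f (pd 1 g z)" "pd \<i> (\<lambda>x. f (g x)) z = f (pd \<i> g z)"
   by (rule pd_linear [OF G(1) [OF z]])+
 qed
qed

lemma pd_holomorphic:
 assumes "f holomorphic_on W" "open W" "z \<in> W"
 shows "pd v f z = v * deriv f z"
proof -
 have "(f has_field_derivative deriv f z) (at z)" using assms holomorphic_derivI by blast
 then have "(f has_derivative (\<lambda>v. deriv f z * v)) (at z)" by (simp add: has_field_derivative_def)
 then show ?thesis using pd_eq [of f "\<lambda>v. deriv f z * v" z v] by (simp add: mult.commute)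
qed

text \<open>The partial derivatives are the constant multiples \<open>1\<close> and
  \<open>\<i>\<close> of the complex derivative, which is again holomorphic, so the induction
  closes.\<close>

lemma C_on_holomorphic:
 assumes "open W"
 shows "f holomorphic_on W ==> C_on k W f"
proof (induction k arbitrary: f)
 case 0
 then show ?case by (simp add: holomorphic_on_imp_continuous_on)
next
 case (Suc k)
 have h: "(\<lambda>z. v * deriv f z) holomorphic_on W" for v using Suc.prems assms by (intro holomorphic_intros)
 show ?case
 proof (rule C_on_SucI [OF assms _ Suc.IH [OF h] Suc.IH [OF h]])
  fix z assume z: "z \<in> W"
  show "f differentiable at z"
   by (rule field_differentiable_imp_differentiable [OF holomorphic_on_imp_differentiable_at [OF Suc.prems assms z]])
  show "pd 1 f z = 1 * deriv f z" "pd \<i> f z = \<i> * deriv f z" by (rule pd_holomorphic [OF Suc.prems assms z])+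
 qed
qed

lemma C_on_inverse:
 fixes f :: "complex => real"
 assumes "open W" "\<And>z. z \<in> W ==> f z \<noteq> 0"
 shows "C_on k W f ==> C_on k W (\<lambda>x. inverse (f x))"
proof (induction k)
 case 0
 then show ?case using assms by (auto intro: continuous_on_inverse)
next
 case (Suc k)
 note F = C_on_Suc_iffs [OF Suc.prems]
 have i: "C_on k W (\<lambda>x. inverse (f x))" by (rule Suc.IH [OF C_on_SucD [OF Suc.prems]])
 have d: "((\<lambda>x. inverse (f x)) has_derivative (\<lambda>v. - (inverse (f z) * pd v f z * inverse (f z)))) (at z)"
  if z: "z \<in> W" for z
 proof -
  have "(f has_derivative (\<lambda>v. pd v f z)) (at z)"
   using F(1) [OF z] unfolding pd_def frechet_derivative_works [symmetric] .
  from Deriv.has_derivative_inverse [where S = UNIV, OF assms(2) [OF z] this] show ?thesis .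
 qed
 have c: "C_on k W (\<lambda>x. (- 1) * (inverse (f x) * p x * inverse (f x)))" if "C_on k W p" for p
  by (intro C_on_mult [OF assms(1)] C_on_const assms(1) i that)
 show ?case
 proof (rule C_on_SucI [OF assms(1) _ c [OF F(2)] c [OF F(3)]])
  fix z assume z: "z \<in> W"
  show "(\<lambda>x. inverse (f x)) differentiable at z" using d [OF z] unfolding differentiable_def by blast
  show "pd 1 (\<lambda>x. inverse (f x)) z = (- 1) * (inverse (f z) * pd 1 f z * inverse (f z))"
   "pd \<i> (\<lambda>x. inverse (f x)) z = (- 1) * (inverse (f z) * pd \<i> f z * inverse (f z))"
   using pd_eq [OF d [OF z]] by simp_all
 qed
qed

lemma smooth_on_const: "open W ==> smooth_on W (\<lambda>_. c)" by (simp add: smooth_on_def C_on_const)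

lemma smooth_on_holomorphic: "open W ==> f holomorphic_on W ==> smooth_on W f"
 by (simp add: smooth_on_def C_on_holomorphic)

lemma smooth_on_add: "open W ==> smooth_on W f ==> smooth_on W g ==> smooth_on W (\<lambda>x. f x + g x)"
 by (simp add: smooth_on_def C_on_add)

lemma smooth_on_mult:
 fixes f g :: "complex => 'a::real_normed_algebra"
 shows "open W ==> smooth_on W f ==> smooth_on W g ==> smooth_on W (\<lambda>x. f x * g x)"
 by (simp add: smooth_on_def C_on_mult)

lemma smooth_on_power:
 fixes f :: "complex => 'a::real_normed_algebra_1"
 shows "open W ==> smooth_on W f ==> smooth_on W (\<lambda>x. f x ^ n)"
 by (induction n) (simp_all add: smooth_on_const smooth_on_mult)

lemma smooth_on_inverse:
 fixes f :: "complex => real"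
 shows "open W ==> smooth_on W f ==> (\<And>z. z \<in> W ==> f z \<noteq> 0) ==> smooth_on W (\<lambda>x. inverse (f x))"
 by (simp add: smooth_on_def C_on_inverse)

lemma smooth_on_cong: "open W ==> (\<And>z. z \<in> W ==> f z = g z) ==> smooth_on W f \<longleftrightarrow> smooth_on W g"
 unfolding smooth_on_def using C_on_cong [of W f g] by blast

lemma smooth_on_Re: "open W ==> smooth_on W f ==> smooth_on W (\<lambda>x. Re (f x))"
 and smooth_on_Im: "open W ==> smooth_on W f ==> smooth_on W (\<lambda>x. Im (f x))"
 by (simp_all add: smooth_on_def bounded_linear.C_on_linear [OF bounded_linear_Re]
   bounded_linear.C_on_linear [OF bounded_linear_Im])

lemma smooth_on_differentiable: "smooth_on W f ==> z \<in> W ==> f differentiable at z"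
 unfolding smooth_on_def using C_on.simps(2) by blast

lemma smooth_on_pd:
 assumes "smooth_on W f" "v = 1 \<or> v = \<i>"
 shows "smooth_on W (pd v f)" using assms unfolding smooth_on_def by (metis C_on.simps(2))

lemma smooth_on_cmod_sq:
 assumes "open W" "f holomorphic_on W"
 shows "smooth_on W (\<lambda>z. (cmod (f z))\<^sup>2)"
proof -
 have "smooth_on W (\<lambda>z. (Re (f z))\<^sup>2 + (Im (f z))\<^sup>2)"
  using assms by (intro smooth_on_add smooth_on_power smooth_on_Re smooth_on_Im smooth_on_holomorphic)
 then show ?thesis by (simp add: cmod_power2)
qed

section \<open>Calculus of the operator \<open>F * lap0 F - |grad F|^2\<close>\<close>

definition lap0 :: "(complex => real) => complex => real" where
 "lap0 F z = pd 1 (pd 1 F) z + pd \<i> (pd \<i> F) z"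

text \<open>For positive \<open>F\<close> this is \<open>F\<^sup>2 \<Delta> log F\<close>, which makes the product rule below plausible;
 unlike the logarithm it is also defined where \<open>F\<close> vanishes.\<close>

definition logbr :: "(complex => real) => complex => real" where
 "logbr F z = F z * lap0 F z - (pd 1 F z)\<^sup>2 - (pd \<i> F z)\<^sup>2"

lemma logbr_cong:
 assumes "open W" "z \<in> W" "\<And>x. x \<in> W ==> F x = G x"
 shows "logbr F z = logbr G z" "lap0 F z = lap0 G z"
proof -
 have p: "pd v F x = pd v G x" if "x \<in> W" for v x using pd_cong [OF assms(1) that assms(3)] .
 have "pd v (pd v F) z = pd v (pd v G) z" for v using pd_cong [OF assms(1,2) p] .
 then show "logbr F z = logbr G z" "lap0 F z = lap0 G z" using p assms by (simp_all add: logbr_def lap0_def)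
qed

lemma pd2_mult:
 fixes F G :: "complex => real"
 assumes W: "open W" "z \<in> W" and F: "smooth_on W F" and G: "smooth_on W G" and v: "v = 1 \<or> v = \<i>"
 shows "pd v (pd v (\<lambda>x. F x * G x)) z = F z * pd v (pd v G) z + 2 * pd v F z * pd v G z + pd v (pd v F) z * G z"
proof -
 have 1: "pd v (\<lambda>x. F x * G x) x = F x * pd v G x + pd v F x * G x" if "x \<in> W" for x
  using that F G by (intro pd_mult smooth_on_differentiable)
 have "pd v (pd v (\<lambda>x. F x * G x)) z = pd v (\<lambda>x. F x * pd v G x + pd v F x * G x) z" using pd_cong [OF W 1] .
 also have "\<dots> = pd v (\<lambda>x. F x * pd v G x) z + pd v (\<lambda>x. pd v F x * G x) z"
  using W F G v smooth_on_pd smooth_on_mult smooth_on_differentiable by (intro pd_add) blast+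
 also have "\<dots> = (F z * pd v (pd v G) z + pd v F z * pd v G z) + (pd v F z * pd v G z + pd v (pd v F) z * G z)"
  using W F G v smooth_on_pd smooth_on_differentiable by (intro arg_cong2 [where f = "(+)"] pd_mult) blast+
 finally show ?thesis by simp
qed

lemma logbr_mult:
 assumes W: "open W" "z \<in> W" and F: "smooth_on W F" and G: "smooth_on W G"
 shows "logbr (\<lambda>x. F x * G x) z = (F z)\<^sup>2 * logbr G z + (G z)\<^sup>2 * logbr F z"
proof -
 have p: "pd v (\<lambda>x. F x * G x) z = F z * pd v G z + pd v F z * G z" for v
  using W F G by (intro pd_mult smooth_on_differentiable)
 show ?thesis unfolding logbr_def lap0_def using pd2_mult [OF W F G, of 1] pd2_mult [OF W F G, of \<i>]
  by (simp add: p power2_eq_square algebra_simps)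
qed

lemma logbr_const [simp]: "logbr (\<lambda>_. c) z = 0"
proof -
 have "pd v (\<lambda>_. c) = (\<lambda>_. 0)" for v by (simp add: fun_eq_iff)
 then show ?thesis by (simp add: logbr_def lap0_def)
qed

lemma logbr_cmult:
 assumes W: "open W" "z \<in> W" and F: "smooth_on W F"
 shows "logbr (\<lambda>x. c * F x) z = c\<^sup>2 * logbr F z"
 using logbr_mult [OF W smooth_on_const [OF W(1), of c] F] by simp

lemma logbr_power:
 assumes W: "open W" "z \<in> W" and F: "smooth_on W F"
 shows "logbr (\<lambda>x. F x ^ Suc n) z = real (Suc n) * F z ^ (2 * n) * logbr F z"
proof (induction n)
 case (Suc n)
 have "logbr (\<lambda>x. F x ^ Suc (Suc n)) z = logbr (\<lambda>x. F x * F x ^ Suc n) z" by simp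
 also have "\<dots> = (F z)\<^sup>2 * logbr (\<lambda>x. F x ^ Suc n) z + (F z ^ Suc n)\<^sup>2 * logbr F z"
  by (rule logbr_mult [OF W F smooth_on_power [OF W(1) F]])
 also have "\<dots> = real (Suc (Suc n)) * F z ^ (2 * Suc n) * logbr F z"
 proof -
  have 1: "(F z ^ Suc n)\<^sup>2 = F z ^ (2 * Suc n)" by (metis mult.commute power_mult)
  have 2: "(F z)\<^sup>2 * F z ^ (2 * n) = F z ^ (2 * Suc n)" by (metis add_2_eq_Suc mult_2 mult_Suc_right power_add)
  have "(F z)\<^sup>2 * (real (Suc n) * F z ^ (2 * n) * logbr F z) + F z ^ (2 * Suc n) * logbr F z
    = (real (Suc n) + 1) * ((F z)\<^sup>2 * F z ^ (2 * n)) * logbr F z" unfolding 2 [symmetric] by (simp only: ring_distribs ac_simps mult_1)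
  also have "real (Suc n) + 1 = real (Suc (Suc n))" by simp
  finally show ?thesis unfolding Suc.IH 1 2 .
 qed
 finally show ?case .
qed simp

text \<open>The product rule applied to \<open>F * (1/F) = 1\<close>.\<close>

lemma logbr_inverse:
 assumes W: "open W" "z \<in> W" and F: "smooth_on W F" "\<And>x. x \<in> W ==> F x \<noteq> 0"
 shows "logbr (\<lambda>x. inverse (F x)) z = - logbr F z / F z ^ 4"
proof -
 have "0 = logbr (\<lambda>x. 1) z" by simp
 also have "\<dots> = logbr (\<lambda>x. F x * inverse (F x)) z" using F by (intro logbr_cong [OF W]) auto
 also have "\<dots> = (F z)\<^sup>2 * logbr (\<lambda>x. inverse (F x)) z + (inverse (F z))\<^sup>2 * logbr F z"
  by (rule logbr_mult [OF W F(1) smooth_on_inverse [OF W(1) F]])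
 finally show ?thesis using F(2) [OF W(2)] by (simp add: field_simps power2_eq_square eval_nat_numeral)
qed

lemma pd_cmod_sq:
 assumes W: "open W" "z \<in> W" and f: "f holomorphic_on W"
 shows "pd v (\<lambda>z. c + (cmod (f z))\<^sup>2) z = 2 * Re (v * (deriv f z * cnj (f z)))"
proof -
 have "(f has_field_derivative deriv f z) (at z)" using assms holomorphic_derivI by blast
 then have d: "(f has_derivative (\<lambda>v. deriv f z * v)) (at z)" by (simp add: has_field_derivative_def)
 have "((\<lambda>z. c + ((Re (f z))\<^sup>2 + (Im (f z))\<^sup>2)) has_derivative
   (\<lambda>v. 2 * Re (f z) * Re (deriv f z * v) + 2 * Im (f z) * Im (deriv f z * v))) (at z)"
  by (auto intro!: derivative_eq_intros d simp: fun_eq_iff algebra_simps)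
 then show ?thesis unfolding cmod_power2 by (subst pd_eq) (auto simp: algebra_simps)
qed

lemma lap0_cmod_sq:
 assumes W: "open W" "z \<in> W" and f: "f holomorphic_on W"
 shows "lap0 (\<lambda>z. c + (cmod (f z))\<^sup>2) z = 4 * (cmod (deriv f z))\<^sup>2"
proof -
 have d: "(f has_derivative (\<lambda>v. deriv f z * v)) (at z)"
  using assms holomorphic_derivI by (auto simp flip: has_field_derivative_def)
 have "(deriv f has_field_derivative deriv (deriv f) z) (at z)"
  by (rule holomorphic_derivI [OF holomorphic_deriv [OF f W(1)] W])
 then have d2: "(deriv f has_derivative (\<lambda>v. deriv (deriv f) z * v)) (at z)" by (simp add: has_field_derivative_def)
 have e: "pd v (pd v (\<lambda>z. c + (cmod (f z))\<^sup>2)) z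
   = 2 * Re (v * (deriv (deriv f) z * v * cnj (f z) + deriv f z * cnj (deriv f z * v)))" for v
 proof -
  have "pd v (pd v (\<lambda>z. c + (cmod (f z))\<^sup>2)) z = pd v (\<lambda>z. 2 * Re (v * (deriv f z * cnj (f z)))) z"
   using pd_cmod_sq [OF W(1) _ f] by (intro pd_cong [OF W]) auto
  also have "\<dots> = 2 * Re (v * (deriv (deriv f) z * v * cnj (f z) + deriv f z * cnj (deriv f z * v)))"
   by (rule pd_eq) (auto intro!: derivative_eq_intros d d2 has_derivative_cnj simp: algebra_simps)
  finally show ?thesis .
 qed
 show ?thesis unfolding lap0_def e unfolding cmod_power2 by (simp add: power2_eq_square algebra_simps)
qed

text \<open>For \<open>c = 0\<close> the result vanishes, which is harmonicity of
  \<open>log |f|\<close> in a form that tolerates zeros of \<open>f\<close>. For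
  \<open>c = 1\<close> it is the density of the spherical metric pulled back by \<open>f\<close>, up
  to a factor.\<close>

lemma logbr_cmod_sq:
 assumes W: "open W" "z \<in> W" and f: "f holomorphic_on W"
 shows "logbr (\<lambda>z. c + (cmod (f z))\<^sup>2) z = 4 * c * (cmod (deriv f z))\<^sup>2"
proof -
 let ?A = "deriv f z * cnj (f z)"
 have 1: "(2 * Re (1 * A))\<^sup>2 + (2 * Re (\<i> * A))\<^sup>2 = 4 * (cmod A)\<^sup>2" for A :: complex
  unfolding cmod_power2 by (simp add: power2_eq_square algebra_simps)
 have "(cmod ?A)\<^sup>2 = (cmod (deriv f z))\<^sup>2 * (cmod (f z))\<^sup>2" by (simp add: norm_mult power_mult_distrib)
 then have "x - (2 * Re (1 * ?A))\<^sup>2 - (2 * Re (\<i> * ?A))\<^sup>2 = x - 4 * ((cmod (deriv f z))\<^sup>2 * (cmod (f z))\<^sup>2)" for x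
  using 1 [of ?A] by linarith
 then show ?thesis
  unfolding logbr_def lap0_cmod_sq [OF assms] pd_cmod_sq [OF assms] by (simp only: ring_distribs ac_simps)
qed

subsection \<open>Conformal metrics\<close>

context
 fixes W :: "complex set" and lam :: "complex => real" and h :: local_metric
 assumes W: "open W" and lam: "smooth_on W lam" "\<And>z. z \<in> W ==> lam z > 0"
  and h: "h = (\<lambda>z v w. lam z * (v \<bullet> w))"
begin

lemma gram_det_conformal: "gram_det h z = (lam z)\<^sup>2"
 by (simp add: gram_det_def h power2_eq_square inner_complex_def)

lemma sharp_conformal: "z \<in> W ==> sharp h z a b = Complex (a / lam z) (b / lam z)"
 using lam(2) [of z] unfolding sharp_def gram_det_conformal unfolding h
 by (simp add: inner_complex_def power2_eq_square)

lemma pd_lam_mult: "z \<in> W ==> pd v (\<lambda>x. lam x * c) z = pd v lam z * c"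
 using pd_mult [OF smooth_on_differentiable [OF lam(1)], of z "\<lambda>_. c" v] by simp

lemma christoffel1_conformal:
 "z \<in> W ==> christoffel1 h u v w z =
   (pd u lam z * (v \<bullet> w) + pd v lam z * (u \<bullet> w) - pd w lam z * (u \<bullet> v)) / 2"
 unfolding christoffel1_def h by (simp only: pd_lam_mult)

text \<open>This is the classical \<open>K = - lap (log lam) / (2 lam)\<close>, since
  \<open>logbr lam = lam^2 * lap (log lam)\<close>.\<close>

lemma local_gauss_conformal:
 assumes z: "z \<in> W"
 shows "local_gauss h z = - logbr lam z / (2 * lam z ^ 3)"
proof -
 let ?p = "pd 1 lam" and ?q = "pd \<i> lam"
 have l0: "lam z > 0" using lam z by blast
 \<comment> \<open>The two covariant derivatives of the coordinate field \<open>\<i>\<close>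
   occurring in the curvature, in terms of the first derivatives of \<open>lam\<close>.\<close>
 have Y1: "nabla h \<i> (\<lambda>_. \<i>) x = Complex (- (?p x * inverse (2 * lam x))) (?q x * inverse (2 * lam x))" if "x \<in> W" for x
  using that lam(2) [OF that] unfolding nabla_def
  by (simp add: sharp_conformal christoffel1_conformal inner_complex_def complex_eq_iff field_simps)
 have Y2: "nabla h 1 (\<lambda>_. \<i>) x = Complex (?q x * inverse (2 * lam x)) (?p x * inverse (2 * lam x))" if "x \<in> W" for x
  using that lam(2) [OF that] unfolding nabla_def
  by (simp add: sharp_conformal christoffel1_conformal inner_complex_def complex_eq_iff field_simps)
 have dir: "pd v lam z = Re v * ?p z + Im v * ?q z" for v
  using pd_direction [OF smooth_on_differentiable [OF lam(1) z], of v] by simp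
 have sp: "smooth_on W ?p" "smooth_on W ?q" using smooth_on_pd lam by auto
 have si: "smooth_on W (\<lambda>x. inverse (2 * lam x))"
  using lam by (intro smooth_on_inverse smooth_on_mult W smooth_on_const) force+
 have spi: "smooth_on W (\<lambda>x. ?p x * inverse (2 * lam x))" "smooth_on W (\<lambda>x. ?q x * inverse (2 * lam x))"
  by (rule smooth_on_mult [OF W sp(1) si]) (rule smooth_on_mult [OF W sp(2) si])
 have dinv: "pd v (\<lambda>x. inverse (2 * lam x)) z = - pd v lam z / (2 * (lam z)\<^sup>2)" for v
 proof -
  have "(lam has_derivative (\<lambda>v. pd v lam z)) (at z)"
   using smooth_on_differentiable [OF lam(1) z] by (simp add: pd_def frechet_derivative_works [symmetric])
  then have "((\<lambda>x. inverse (2 * lam x)) has_derivative (\<lambda>v. - (inverse (2 * lam z) * (2 * pd v lam z) * inverse (2 * lam z)))) (at z)"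
   using l0 by (intro Deriv.has_derivative_inverse has_derivative_mult_right) auto
  then show ?thesis using pd_eq l0 by (fastforce simp: field_simps power2_eq_square)
 qed
 have d1: "pd v (\<lambda>x. ?p x * inverse (2 * lam x)) z = ?p z * (- pd v lam z / (2 * (lam z)\<^sup>2)) + pd v ?p z * inverse (2 * lam z)" for v
  using pd_mult [OF smooth_on_differentiable [OF sp(1) z] smooth_on_differentiable [OF si z], of v] by (simp only: dinv)
 have d2: "pd v (\<lambda>x. ?q x * inverse (2 * lam x)) z = ?q z * (- pd v lam z / (2 * (lam z)\<^sup>2)) + pd v ?q z * inverse (2 * lam z)" for v
  using pd_mult [OF smooth_on_differentiable [OF sp(2) z] smooth_on_differentiable [OF si z], of v] by (simp only: dinv)
 \<comment> \<open>The curvature vector is paired with the direction \<open>1\<close>, so only real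
   parts of the second covariant derivatives have to be computed.\<close>
 have Cdiff: "(\<lambda>x. Complex (F x) (G x)) differentiable at z \<and> Re (pd v (\<lambda>x. Complex (F x) (G x)) z) = pd v F z"
  if "F differentiable at z" "G differentiable at z" for F G v
 proof -
  have "(F has_derivative (\<lambda>v. pd v F z)) (at z)" "(G has_derivative (\<lambda>v. pd v G z)) (at z)"
   using that by (simp_all add: pd_def frechet_derivative_works [symmetric])
  then have "((\<lambda>x. of_real (F x) + \<i> * of_real (G x)) has_derivative (\<lambda>v. of_real (pd v F z) + \<i> * of_real (pd v G z))) (at z)"
   by (intro derivative_intros)
  then have *: "((\<lambda>x. Complex (F x) (G x)) has_derivative (\<lambda>v. Complex (pd v F z) (pd v G z))) (at z)"
   by (simp add: Complex_eq)
  then show ?thesis using pd_eq [OF *] differentiable_def by auto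
 qed
 have dm: "(\<lambda>x. - (?p x * inverse (2 * lam x))) differentiable at z"
  by (rule differentiable_minus [OF smooth_on_differentiable [OF spi(1) z]])
 have t1: "pd 1 (nabla h \<i> (\<lambda>_. \<i>)) z
   = pd 1 (\<lambda>x. Complex (- (?p x * inverse (2 * lam x))) (?q x * inverse (2 * lam x))) z"
  by (rule pd_cong [OF W z Y1])
 have t2: "pd \<i> (nabla h 1 (\<lambda>_. \<i>)) z
   = pd \<i> (\<lambda>x. Complex (?q x * inverse (2 * lam x)) (?p x * inverse (2 * lam x))) z"
  by (rule pd_cong [OF W z Y2])
 note c1 = Cdiff [OF dm smooth_on_differentiable [OF spi(2) z], where v = 1]
 have r1: "Re (pd 1 (nabla h \<i> (\<lambda>_. \<i>)) z) = - pd 1 (\<lambda>x. ?p x * inverse (2 * lam x)) z"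
  using c1 unfolding t1 pd_minus [OF smooth_on_differentiable [OF spi(1) z]] by (rule conjunct2)
 note c2 = Cdiff [OF smooth_on_differentiable [OF spi(2) z] smooth_on_differentiable [OF spi(1) z], where v = \<i>]
 have r2: "Re (pd \<i> (nabla h 1 (\<lambda>_. \<i>)) z) = pd \<i> (\<lambda>x. ?q x * inverse (2 * lam x)) z"
  using c2 unfolding t2 by (rule conjunct2)
 have n1: "Re (nabla h 1 (nabla h \<i> (\<lambda>_. \<i>)) z) = - pd 1 (\<lambda>x. ?p x * inverse (2 * lam x)) z
   + (- (?p z)\<^sup>2 + (?q z)\<^sup>2) / (4 * (lam z)\<^sup>2)"
 proof -
  have ch: "christoffel1 h 1 v 1 z = (Re v * ?p z + Im v * ?q z) / 2" for v
   unfolding christoffel1_conformal [OF z] dir [of v] by (simp add: inner_complex_def)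
  then show ?thesis
   using l0 unfolding nabla_def [of h 1 "nabla h \<i> (\<lambda>_. \<i>)"] sharp_conformal [OF z] plus_complex.sel r1 complex.sel ch Y1 [OF z]
   by (simp add: field_simps power2_eq_square)
 qed
 have n2: "Re (nabla h \<i> (nabla h 1 (\<lambda>_. \<i>)) z) = pd \<i> (\<lambda>x. ?q x * inverse (2 * lam x)) z
   + (- (?p z)\<^sup>2 + (?q z)\<^sup>2) / (4 * (lam z)\<^sup>2)"
 proof -
  have ch: "christoffel1 h \<i> v 1 z = (?q z * Re v - ?p z * Im v) / 2" for v
   unfolding christoffel1_conformal [OF z] by (simp add: inner_complex_def)
  then show ?thesis
   using l0 unfolding nabla_def [of h \<i> "nabla h 1 (\<lambda>_. \<i>)"] sharp_conformal [OF z] plus_complex.sel r2 complex.sel ch Y2 [OF z]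
   by (simp add: field_simps power2_eq_square)
 qed
 have "local_gauss h z = Re (nabla h 1 (nabla h \<i> (\<lambda>_. \<i>)) z - nabla h \<i> (nabla h 1 (\<lambda>_. \<i>)) z) / lam z"
 proof -
  have "h z u 1 = lam z * Re u" for u by (simp add: h inner_complex_def)
  then show ?thesis using l0 unfolding local_gauss_def gram_det_conformal by (simp add: power2_eq_square)
 qed
 also have "\<dots> = (- pd 1 (\<lambda>x. ?p x * inverse (2 * lam x)) z - pd \<i> (\<lambda>x. ?q x * inverse (2 * lam x)) z) / lam z"
  by (simp add: n1 n2)
 also have "\<dots> = - logbr lam z / (2 * lam z ^ 3)"
 proof -
  have "(- (p * (- p / (2 * l\<^sup>2)) + pp * inverse (2 * l)) - (q * (- q / (2 * l\<^sup>2)) + qq * inverse (2 * l))) / l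
    = - (l * (pp + qq) - p\<^sup>2 - q\<^sup>2) / (2 * l ^ 3)" if "l > 0" for p q pp qq l :: real
   using that by (simp add: field_simps power2_eq_square power3_eq_cube)
  from this [OF l0] show ?thesis unfolding d1 d2 logbr_def lap0_def .
 qed
 finally show ?thesis .
qed

text \<open>In dimension two the factor \<open>lam\<close> cancels inside the divergence, so the
  Laplacian is \<open>- lap0 / lam\<close>; the gradient term has the same factor. The Ricci
  condition thus becomes \<open>logbr K = 4 * lam * K^3\<close>.\<close>

lemma ricci_operator_conformal:
 assumes z: "z \<in> W" and K: "smooth_on W K"
 shows "K z * laplacian h K z + h z (grad h K z) (grad h K z) = - logbr K z / lam z"
proof -
 have l0: "lam z > 0" using lam z by blast
 have g: "grad h K x = Complex (pd 1 K x / lam x) (pd \<i> K x / lam x)" if "x \<in> W" for x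
  by (simp add: grad_def sharp_conformal that)
 have s: "sqrt (gram_det h x) = lam x" if "x \<in> W" for x
  using lam(2) [OF that] by (simp add: gram_det_conformal)
 have "pd 1 (\<lambda>x. sqrt (gram_det h x) * Re (grad h K x)) z = pd 1 (pd 1 K) z"
  using lam(2) by (intro pd_cong [OF W z]) (force simp: s g)
 moreover have "pd \<i> (\<lambda>x. sqrt (gram_det h x) * Im (grad h K x)) z = pd \<i> (pd \<i> K) z"
  using lam(2) by (intro pd_cong [OF W z]) (force simp: s g)
 ultimately have "laplacian h K z = - (lap0 K z / lam z)"
  by (simp add: laplacian_def divergence_def s z lap0_def)
 moreover have "h z (grad h K z) (grad h K z) = ((pd 1 K z)\<^sup>2 + (pd \<i> K z)\<^sup>2) / lam z"
 proof -
  have "h z u w = lam z * (Re u * Re w + Im u * Im w)" for u w by (simp add: h inner_complex_def)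
  then show ?thesis using l0 unfolding g [OF z] by (simp add: field_simps power2_eq_square)
 qed
 ultimately show ?thesis using l0 by (simp add: logbr_def field_simps)
qed

end

text \<open>Up to constants \<open>lam\<close> is \<open>E * D^2\<close> and \<open>K\<close> is
  \<open>P / D^4\<close> with \<open>E\<close>, \<open>P\<close> squared moduli of holomorphic
  functions and \<open>D = 1 + |g|^2\<close>. \<open>logbr\<close> vanishes on \<open>E\<close> and
  \<open>P\<close>, so everything is reduced to \<open>logbr D = 4 * P * E\<close>. Zeros of
  \<open>a\<close>, that is, flat points, need no separate treatment.\<close>

lemma weierstrass_metric_ricci:
 assumes W: "open W" and hol: "\<eta> holomorphic_on W" "g holomorphic_on W" "a holomorphic_on W"
  and \<eta>0: "\<And>z. z \<in> W ==> \<eta> z \<noteq> 0" and dg: "\<And>z. z \<in> W ==> deriv g z = a z * \<eta> z"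
  and lam: "\<And>z. z \<in> W ==> lam z = 1/4 * (cmod (\<eta> z))\<^sup>2 * (1 + (cmod (g z))\<^sup>2)\<^sup>2"
  and h: "h = (\<lambda>z v w. lam z * (v \<bullet> w))" and z: "z \<in> W"
 shows "smooth_on W lam" "lam z > 0"
  "local_gauss h z = - 16 * (cmod (a z))\<^sup>2 / (1 + (cmod (g z))\<^sup>2) ^ 4"
  "(\<And>x. x \<in> W ==> K x = - 16 * (cmod (a x))\<^sup>2 / (1 + (cmod (g x))\<^sup>2) ^ 4) ==>
    K z * laplacian h K z + h z (grad h K z) (grad h K z) + 4 * K z ^ 3 = 0"
proof -
 define E D P where "E = (\<lambda>z. 0 + (cmod (\<eta> z))\<^sup>2)" and "D = (\<lambda>z. 1 + (cmod (g z))\<^sup>2)" and "P = (\<lambda>z. 0 + (cmod (a z))\<^sup>2)"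
 have D0: "D x > 0" "D x \<noteq> 0" for x using zero_le_power2 [of "cmod (g x)"] unfolding D_def by linarith+
 have sm: "smooth_on W E" "smooth_on W D" "smooth_on W P"
  unfolding E_def D_def P_def using W hol by (auto intro!: smooth_on_add smooth_on_const smooth_on_cmod_sq)
 have E0: "E x > 0" if "x \<in> W" for x using \<eta>0 [OF that] by (simp add: E_def)
 have bE: "logbr E z = 0" and bP: "logbr P z = 0"
  unfolding E_def P_def using logbr_cmod_sq [OF W z hol(1), of 0] logbr_cmod_sq [OF W z hol(3), of 0] by simp_all
 have bD: "logbr D z = 4 * P z * E z"
  unfolding D_def P_def E_def using logbr_cmod_sq [OF W z hol(2), of 1] dg [OF z]
  by (simp add: norm_mult power_mult_distrib)
 have lE: "lam x = 1/4 * (E x * D x ^ Suc 1)" if "x \<in> W" for x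
  using lam [OF that] by (simp add: E_def D_def power2_eq_square)
 have sED: "smooth_on W (\<lambda>x. E x * D x ^ Suc 1)" by (intro smooth_on_mult smooth_on_power sm W)
 have "smooth_on W (\<lambda>x. 1/4 * (E x * D x ^ Suc 1))" by (intro smooth_on_mult sED smooth_on_const W)
 moreover have "smooth_on W lam \<longleftrightarrow> smooth_on W (\<lambda>x. 1/4 * (E x * D x ^ Suc 1))"
  by (rule smooth_on_cong [OF W]) (rule lE)
 ultimately show sl: "smooth_on W lam" by blast
 have lpos: "lam x > 0" if "x \<in> W" for x unfolding lE [OF that] using E0 [OF that] D0 [of x] by simp
 then show l0: "lam z > 0" using z by blast
 have "logbr lam z = logbr (\<lambda>x. 1/4 * (E x * D x ^ Suc 1)) z" by (rule logbr_cong [OF W z]) (rule lE)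
 also have "\<dots> = (1/4)\<^sup>2 * logbr (\<lambda>x. E x * D x ^ Suc 1) z" by (rule logbr_cmult [OF W z sED])
 also have "logbr (\<lambda>x. E x * D x ^ Suc 1) z = (E z)\<^sup>2 * logbr (\<lambda>x. D x ^ Suc 1) z"
  using logbr_mult [OF W z sm(1) smooth_on_power [OF W sm(2), of "Suc 1"]]
  by (simp only: bE mult_zero_right add_0_right)
 also have "logbr (\<lambda>x. D x ^ Suc 1) z = 2 * (D z)\<^sup>2 * (4 * P z * E z)"
  using logbr_power [OF W z sm(2), of 1] bD by simp
 finally have bl: "logbr lam z = 1/2 * (E z)^3 * (D z)\<^sup>2 * P z" by (simp add: power2_eq_square power3_eq_cube)
 have "local_gauss h z = - logbr lam z / (2 * lam z ^ 3)" by (rule local_gauss_conformal [OF W sl lpos h z])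
 also have "\<dots> = - 16 * P z / D z ^ 4"
  unfolding bl lE [OF z] using E0 [OF z] D0 [of z] by (simp add: field_simps power2_eq_square power3_eq_cube eval_nat_numeral)
 finally show "local_gauss h z = - 16 * (cmod (a z))\<^sup>2 / (1 + (cmod (g z))\<^sup>2) ^ 4" by (simp add: P_def D_def)
 assume K: "\<And>x. x \<in> W ==> K x = - 16 * (cmod (a x))\<^sup>2 / (1 + (cmod (g x))\<^sup>2) ^ 4"
 have K1: "K x = - 16 * (P x * inverse (D x ^ Suc 3))" if "x \<in> W" for x
  using K [OF that] by (simp add: P_def D_def field_simps eval_nat_numeral)
 have s4: "smooth_on W (\<lambda>x. D x ^ Suc 3)" by (intro smooth_on_power sm W)
 have si: "smooth_on W (\<lambda>x. inverse (D x ^ Suc 3))" using D0 by (intro smooth_on_inverse s4 W) simp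
 have sPi: "smooth_on W (\<lambda>x. P x * inverse (D x ^ Suc 3))" by (intro smooth_on_mult sm si W)
 have "smooth_on W (\<lambda>x. - 16 * (P x * inverse (D x ^ Suc 3)))" by (intro smooth_on_mult sPi smooth_on_const W)
 moreover have "smooth_on W K \<longleftrightarrow> smooth_on W (\<lambda>x. - 16 * (P x * inverse (D x ^ Suc 3)))"
  by (rule smooth_on_cong [OF W]) (rule K1)
 ultimately have sK: "smooth_on W K" by blast
 have "logbr K z = logbr (\<lambda>x. - 16 * (P x * inverse (D x ^ Suc 3))) z" by (rule logbr_cong [OF W z]) (rule K1)
 also have "\<dots> = (- 16)\<^sup>2 * logbr (\<lambda>x. P x * inverse (D x ^ Suc 3)) z" by (rule logbr_cmult [OF W z sPi])
 also have "logbr (\<lambda>x. P x * inverse (D x ^ Suc 3)) z = (P z)\<^sup>2 * logbr (\<lambda>x. inverse (D x ^ Suc 3)) z"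
  using logbr_mult [OF W z sm(3) si] bP by simp
 also have "logbr (\<lambda>x. inverse (D x ^ Suc 3)) z = - logbr (\<lambda>x. D x ^ Suc 3) z / (D z ^ Suc 3) ^ 4"
  using D0 by (intro logbr_inverse [OF W z s4]) simp
 also have "logbr (\<lambda>x. D x ^ Suc 3) z = 4 * D z ^ 6 * (4 * P z * E z)"
  using logbr_power [OF W z sm(2), of 3] bD by simp
 finally have bK: "logbr K z = - 4096 * (P z)^3 * E z / D z ^ 10"
  using D0 [of z] by (simp add: field_simps power2_eq_square power3_eq_cube eval_nat_numeral)
 have "4 * lam z * K z ^ 3 = logbr K z"
  unfolding bK lE [OF z] K1 [OF z] using D0 [of z] by (simp add: field_simps power2_eq_square power3_eq_cube eval_nat_numeral)
 then have "- logbr K z / lam z + 4 * K z ^ 3 = 0" using l0 by (simp add: field_simps)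
 then show "K z * laplacian h K z + h z (grad h K z) (grad h K z) + 4 * K z ^ 3 = 0"
  using ricci_operator_conformal [OF W sl lpos h z sK] by simp
qed

section \<open>Change of variables for injective holomorphic maps\<close>

definition vec2_complex :: "real^2 => complex" where "vec2_complex v = Complex (v $ 1) (v $ 2)"
definition complex_vec2 :: "complex => real^2" where "complex_vec2 z = (\<chi> i. if i = 1 then Re z else Im z)"

lemma vec2_complex_inverse [simp]: "complex_vec2 (vec2_complex v) = v"
 by (simp add: complex_vec2_def vec2_complex_def vec_eq_iff forall_2)

lemma complex_vec2_inverse [simp]: "vec2_complex (complex_vec2 z) = z"
 by (simp add: complex_vec2_def vec2_complex_def)

lemma bounded_linear_vec2_complex: "bounded_linear vec2_complex"
proof (rule linear_conv_bounded_linear [THEN iffD1])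
 show "linear vec2_complex" by (rule linearI) (simp_all add: vec2_complex_def complex_eq_iff)
qed

lemma bounded_linear_complex_vec2: "bounded_linear complex_vec2"
proof (rule linear_conv_bounded_linear [THEN iffD1])
 show "linear complex_vec2" by (rule linearI) (simp_all add: complex_vec2_def vec_eq_iff)
qed

lemma vec2_complex_measurable [measurable]: "vec2_complex \<in> borel_measurable borel"
 using bounded_linear_vec2_complex linear_continuous_on borel_measurable_continuous_onI by blast

text \<open>Lebesgue measure is determined by its values on boxes. The identification with
  \<open>real^2\<close> is made because the Jacobian formula for measures of images is available
  there.\<close>

lemma lborel_distr_vec2_complex: "lborel = distr lborel borel vec2_complex"
proof (rule lborel_eqI)
 fix l u :: complex assume le: "\<And>b. b \<in> Basis ==> l \<bullet> b \<le> u \<bullet> b"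
 have "vec2_complex -` box l u = box (complex_vec2 l) (complex_vec2 u)"
  by (auto simp: box_def vec2_complex_def complex_vec2_def Basis_complex_def Basis_vec_def inner_axis
    UNIV_2 inner_complex_def)
 moreover have "Re l \<le> Re u" "Im l \<le> Im u" using le [of 1] le [of \<i>] by (auto simp: Basis_complex_def)
 then have "emeasure lborel (box (complex_vec2 l) (complex_vec2 u)) = ennreal ((Re u - Re l) * (Im u - Im l))"
  by (subst emeasure_lborel_box)
    (auto simp: Basis_vec_def UNIV_2 inner_axis complex_vec2_def axis_eq_axis algebra_simps)
 ultimately show "emeasure (distr lborel borel vec2_complex) (box l u) = (\<Prod>b\<in>Basis. (u - l) \<bullet> b)"
  by (subst emeasure_distr) (auto simp: Basis_complex_def complex_i_not_one)
qed simp

lemma emeasure_lborel_vec2: "B \<in> sets borel ==> emeasure lborel B = emeasure lborel (vec2_complex -` B)"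
 by (subst lborel_distr_vec2_complex, subst emeasure_distr) auto

lemma nn_integral_lborel_vec2:
 "f \<in> borel_measurable borel ==> (\<integral>\<^sup>+z. f z \<partial>lborel) = (\<integral>\<^sup>+v. f (vec2_complex v) \<partial>lborel)"
 by (subst lborel_distr_vec2_complex, subst nn_integral_distr) auto

context
 fixes U :: "complex set" and T :: "complex => complex"
 assumes U: "open U" and T: "T holomorphic_on U" and inj: "inj_on T U"
begin

text \<open>Outside \<open>U\<close> the value of \<open>deriv T\<close> is arbitrary, so it is
  replaced by \<open>0\<close> wherever measurability on the whole plane is required.\<close>

lemma deriv_norm_measurable:
 "(\<lambda>z. if z \<in> U then (cmod (deriv T z))\<^sup>2 else 0) \<in> borel_measurable borel"
 using U T by (intro borel_measurable_continuous_on_if)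
  (auto intro!: continuous_intros holomorphic_on_imp_continuous_on holomorphic_deriv)

lemma open_holomorphic_image: "open (T ` U)" using open_mapping_thm3 [OF T U inj] by blast

text \<open>The image is a preimage under the holomorphic inverse of \<open>T\<close>.\<close>

lemma holomorphic_image_measurable:
 assumes B: "B \<in> sets borel" "B \<subseteq> U"
 shows "T ` B \<in> sets borel"
proof -
 obtain g where g: "g holomorphic_on (T ` U)" "\<And>z. z \<in> U ==> g (T z) = z"
  using holomorphic_has_inverse [OF T U inj] by metis
 define g' where "g' = (\<lambda>y. if y \<in> T ` U then g y else 0)"
 have "g' \<in> borel_measurable borel" unfolding g'_def using open_holomorphic_image g(1)
  by (intro borel_measurable_continuous_on_if) (auto intro!: holomorphic_on_imp_continuous_on)
 then have "g' -` B \<inter> T ` U \<in> sets borel"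
  using B(1) open_holomorphic_image measurable_sets [of g' borel borel B] by auto
 moreover have "T ` B = g' -` B \<inter> T ` U" using B(2) g(2) by (auto simp: g'_def)
 ultimately show ?thesis by simp
qed

text \<open>The bound on \<open>|z|\<close> makes the set have finite measure and the bound on the
  derivative makes the Jacobian integrable, so that the real area formula applies. By the
  Cauchy-Riemann equations the Jacobian is \<open>|T'|^2\<close>.\<close>

lemma emeasure_holomorphic_image_bounded:
 assumes B: "B \<in> sets borel" "B \<subseteq> U" and bd: "\<And>z. z \<in> B ==> cmod z + cmod (deriv T z) \<le> c"
 shows "emeasure lborel (T ` B) = (\<integral>\<^sup>+z. ennreal ((cmod (deriv T z))\<^sup>2) * indicator B z \<partial>lborel)"
proof -
 define S where "S = vec2_complex -` B"
 define f where "f = complex_vec2 \<circ> T \<circ> vec2_complex"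
 define f' where "f' = (\<lambda>v w. complex_vec2 (deriv T (vec2_complex v) * vec2_complex w))"
 define dt where "dt = (\<lambda>v. (cmod (deriv T (vec2_complex v)))\<^sup>2)"
 have Sb: "S \<in> sets borel" unfolding S_def using B(1) measurable_sets [OF vec2_complex_measurable] by fastforce
 have S: "S \<in> sets lebesgue" using Sb by simp
 have der: "(f has_derivative f' v) (at v within S)" if "v \<in> S" for v
 proof -
  have "(T has_field_derivative deriv T (vec2_complex v)) (at (vec2_complex v))"
   using that B(2) U T holomorphic_derivI unfolding S_def by blast
  then have 1: "(T has_derivative (\<lambda>w. deriv T (vec2_complex v) * w)) (at (vec2_complex v))"
   by (simp add: has_field_derivative_def)
  have 2: "(vec2_complex has_derivative vec2_complex) (at v)"
   using bounded_linear_vec2_complex bounded_linear_imp_has_derivative by blast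
  have 3: "(complex_vec2 has_derivative complex_vec2) (at y)" for y
   using bounded_linear_complex_vec2 bounded_linear_imp_has_derivative by blast
  have "(f has_derivative (complex_vec2 \<circ> (\<lambda>w. deriv T (vec2_complex v) * w) \<circ> vec2_complex)) (at v)"
   unfolding f_def by (intro diff_chain_at 1 2 3)
  then show ?thesis unfolding f'_def by (simp add: o_def has_derivative_at_withinI)
 qed
 have det: "\<bar>det (matrix (f' v))\<bar> = dt v" for v
 proof -
  have "vec2_complex (axis 1 1) = 1" "vec2_complex (axis 2 1) = \<i>"
   by (auto simp: vec2_complex_def axis_def complex_eq_iff)
  then have "det (matrix (f' v)) = Re (deriv T (vec2_complex v)) * Re (deriv T (vec2_complex v))
    + Im (deriv T (vec2_complex v)) * Im (deriv T (vec2_complex v))"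
   by (simp add: det_2 matrix_def f'_def complex_vec2_def)
  then have "det (matrix (f' v)) = dt v" unfolding dt_def cmod_power2 by (simp add: power2_eq_square)
  then show ?thesis by (simp add: dt_def)
 qed
 have injf: "inj_on f S"
 proof (rule inj_onI)
  fix v w assume "v \<in> S" "w \<in> S" "f v = f w"
  then have "T (vec2_complex v) = T (vec2_complex w)" unfolding f_def o_def by (metis complex_vec2_inverse)
  then have "vec2_complex v = vec2_complex w" using inj B(2) \<open>v \<in> S\<close> \<open>w \<in> S\<close> unfolding S_def inj_on_def by blast
  then show "v = w" by (metis vec2_complex_inverse)
 qed
 have "bounded B" using bd by (intro boundedI [of _ c]) (smt (verit) norm_ge_zero)
 moreover have "S = complex_vec2 ` B" unfolding S_def by (auto simp: image_iff) (metis vec2_complex_inverse complex_vec2_inverse)+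
 ultimately have "bounded S" using bounded_linear_image bounded_linear_complex_vec2 by blast
 then have Sm: "S \<in> lmeasurable" using S by (simp add: bounded_set_imp_lmeasurable)
 have int: "(\<lambda>v. \<bar>det (matrix (f' v))\<bar>) integrable_on S"
 proof (rule measurable_bounded_by_integrable_imp_integrable)
  have "(\<lambda>v. if vec2_complex v \<in> U then (cmod (deriv T (vec2_complex v)))\<^sup>2 else 0) \<in> borel_measurable borel"
   using measurable_compose [OF vec2_complex_measurable deriv_norm_measurable] by simp
  then have "(\<lambda>v. if vec2_complex v \<in> U then (cmod (deriv T (vec2_complex v)))\<^sup>2 else 0) \<in> borel_measurable (lebesgue_on S)"
   by (intro measurable_restrict_space1 measurable_completion) simp
  moreover have "space (lebesgue_on S) = S" by simp
  ultimately show "(\<lambda>v. \<bar>det (matrix (f' v))\<bar>) \<in> borel_measurable (lebesgue_on S)"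
   unfolding det dt_def using B(2) by (subst measurable_cong [where g = "\<lambda>v. if vec2_complex v \<in> U then (cmod (deriv T (vec2_complex v)))\<^sup>2 else 0"]) (auto simp: S_def)
  show "(\<lambda>v. c\<^sup>2) integrable_on S" using Sm by (simp add: integrable_on_const)
  show "norm \<bar>det (matrix (f' v))\<bar> \<le> c\<^sup>2" if "v \<in> S" for v
  proof -
   have "cmod (deriv T (vec2_complex v)) \<le> c" using bd [of "vec2_complex v"] that norm_ge_zero [of "vec2_complex v"]
    unfolding S_def by (simp del: norm_ge_zero)
   then show ?thesis unfolding det dt_def by (simp add: power_mono)
  qed
 qed (use S in auto)
 define m where "m = integral S dt"
 have hi: "(dt has_integral m) S" using int unfolding det m_def by (simp add: integrable_integral)
 have "f ` S \<in> lmeasurable \<and> measure lebesgue (f ` S) = m"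
  using has_measure_differentiable_image [OF S der injf, of m] hi unfolding det by blast
 then have 1: "emeasure lebesgue (f ` S) = ennreal m" by (metis emeasure_eq_measure2 fmeasurableD2)
 have "f ` S = vec2_complex -` (T ` B)"
 proof (intro equalityI subsetI)
  fix v assume "v \<in> f ` S"
  then obtain s where "vec2_complex s \<in> B" "v = complex_vec2 (T (vec2_complex s))" by (auto simp: f_def S_def)
  then show "v \<in> vec2_complex -` (T ` B)" by simp
 next
  fix v assume "v \<in> vec2_complex -` (T ` B)"
  then obtain b where b: "b \<in> B" "vec2_complex v = T b" by auto
  have "complex_vec2 b \<in> S" using b(1) by (simp add: S_def)
  moreover have "f (complex_vec2 b) = v" using b(2) by (metis comp_apply complex_vec2_inverse f_def vec2_complex_inverse)
  ultimately show "v \<in> f ` S" by (metis imageI)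
 qed
 moreover have "vec2_complex -` (T ` B) \<in> sets borel"
  using holomorphic_image_measurable [OF B] measurable_sets [OF vec2_complex_measurable] by fastforce
 ultimately have "emeasure lborel (T ` B) = ennreal m"
  using 1 emeasure_lborel_vec2 [OF holomorphic_image_measurable [OF B]] by simp
 also have "ennreal m = (\<integral>\<^sup>+v. ennreal (dt v) * indicator S v \<partial>lborel)"
 proof -
  have "(\<integral>\<^sup>+v. ennreal (indicator S v * dt v) \<partial>lborel) = ennreal m"
   by (rule nn_integral_has_integral_lebesgue [OF _ hi]) (simp add: dt_def)
  moreover have "ennreal (indicator S v * dt v) = ennreal (dt v) * indicator S v" for v
   by (simp add: indicator_def)
  ultimately show ?thesis by simp
 qed
 also have "\<dots> = (\<integral>\<^sup>+v. ennreal (if vec2_complex v \<in> U then (cmod (deriv T (vec2_complex v)))\<^sup>2 else 0) * indicator B (vec2_complex v) \<partial>lborel)"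
  using B(2) by (intro nn_integral_cong) (auto simp: S_def dt_def indicator_def)
 also have "\<dots> = (\<integral>\<^sup>+z. ennreal (if z \<in> U then (cmod (deriv T z))\<^sup>2 else 0) * indicator B z \<partial>lborel)"
  using deriv_norm_measurable B(1) by (subst nn_integral_lborel_vec2) auto
 also have "\<dots> = (\<integral>\<^sup>+z. ennreal ((cmod (deriv T z))\<^sup>2) * indicator B z \<partial>lborel)"
  using B(2) by (intro nn_integral_cong) (auto simp: indicator_def)
 finally show ?thesis .
qed

lemma emeasure_holomorphic_image:
 assumes B: "B \<in> sets borel" "B \<subseteq> U"
 shows "emeasure lborel (T ` B) = (\<integral>\<^sup>+z. ennreal ((cmod (deriv T z))\<^sup>2) * indicator B z \<partial>lborel)"
proof -
 define p where "p = (\<lambda>z. if z \<in> U then cmod z + cmod (deriv T z) else 0)"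
 \<comment> \<open>\<open>B\<close> is cut into countably many pieces by the integer part of
   \<open>|z| + |T' z|\<close>; each piece satisfies the bounds of the previous lemma, and both
   sides are countably additive.\<close>
 define D where "D = (\<lambda>n::nat. {z \<in> B. nat \<lfloor>p z\<rfloor> = n})"
 have pm' [measurable]: "p \<in> borel_measurable borel" unfolding p_def
  using U T by (intro borel_measurable_continuous_on_if)
   (auto intro!: continuous_intros holomorphic_on_imp_continuous_on holomorphic_deriv)
 have Dm [measurable]: "D n \<in> sets borel" for n unfolding D_def using B(1) by measurable
 have DB: "D n \<subseteq> B" for n by (auto simp: D_def)
 have dis: "disjoint_family D" by (auto simp: disjoint_family_on_def D_def)
 have UD: "(\<Union>n. D n) = B" by (auto simp: D_def)
 have "inj_on T B" using inj B(2) inj_on_subset by blast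
 then have disT: "disjoint_family (\<lambda>n. T ` D n)"
  using dis DB unfolding disjoint_family_on_def by (metis inj_on_image_Int image_empty)
 define G where "G = (\<lambda>z. ennreal (if z \<in> U then (cmod (deriv T z))\<^sup>2 else 0))"
 have Gm [measurable]: "G \<in> borel_measurable borel" unfolding G_def using deriv_norm_measurable by simp
 have Geq: "(\<integral>\<^sup>+z. ennreal ((cmod (deriv T z))\<^sup>2) * indicator A z \<partial>lborel) = (\<integral>\<^sup>+z. G z * indicator A z \<partial>lborel)"
  if "A \<subseteq> U" for A using that by (intro nn_integral_cong) (auto simp: G_def indicator_def)
 have "emeasure lborel (T ` B) = emeasure lborel (\<Union>n. T ` D n)" using UD by (simp flip: image_UN)
 also have "\<dots> = suminf (\<lambda>n. emeasure lborel (T ` D n))"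
  using disT holomorphic_image_measurable [OF Dm] DB B(2) by (intro suminf_emeasure [symmetric]) auto
 also have "\<dots> = suminf (\<lambda>n. \<integral>\<^sup>+z. G z * indicator (D n) z \<partial>lborel)"
 proof (rule suminf_cong)
  fix n
  have "emeasure lborel (T ` D n) = (\<integral>\<^sup>+z. ennreal ((cmod (deriv T z))\<^sup>2) * indicator (D n) z \<partial>lborel)"
  proof (rule emeasure_holomorphic_image_bounded [OF Dm])
   show "D n \<subseteq> U" using DB B(2) by blast
   fix z assume z: "z \<in> D n"
   then have "z \<in> U" using DB B(2) by blast
   then show "cmod z + cmod (deriv T z) \<le> real n + 1" using z unfolding D_def p_def by (auto; linarith)
  qed
  then show "emeasure lborel (T ` D n) = (\<integral>\<^sup>+z. G z * indicator (D n) z \<partial>lborel)"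
   using Geq [of "D n"] DB [of n] B(2) by auto
 qed
 also have "\<dots> = (\<integral>\<^sup>+z. suminf (\<lambda>n. G z * indicator (D n) z) \<partial>lborel)"
  by (intro nn_integral_suminf [symmetric]) measurable
 also have "\<dots> = (\<integral>\<^sup>+z. G z * indicator B z \<partial>lborel)"
  using dis by (intro nn_integral_cong) (simp add: ennreal_suminf_cmult suminf_indicator UD)
 finally show ?thesis using Geq [OF B(2)] by simp
qed

lemma nn_integral_holomorphic_substitution:
 assumes p [measurable]: "p \<in> borel_measurable borel"
 shows "(\<integral>\<^sup>+x. p x * indicator (T ` U) x \<partial>lborel)
   = (\<integral>\<^sup>+z. p (T z) * (ennreal ((cmod (deriv T z))\<^sup>2) * indicator U z) \<partial>lborel)"
proof -
 have [measurable]: "U \<in> sets borel" "T ` U \<in> sets borel" using U open_holomorphic_image by auto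
 define T' where "T' = (\<lambda>z. if z \<in> U then T z else 0)"
 have [measurable]: "T' \<in> borel_measurable borel" unfolding T'_def using U T
  by (intro borel_measurable_continuous_on_if) (auto intro!: holomorphic_on_imp_continuous_on)
 define G where "G = (\<lambda>z. ennreal (if z \<in> U then (cmod (deriv T z))\<^sup>2 else 0))"
 have [measurable]: "G \<in> borel_measurable borel" unfolding G_def using deriv_norm_measurable by simp
 let ?\<nu> = "density lborel (indicator (T ` U))" and ?\<nu>' = "distr (density lborel G) borel T'"
 have "?\<nu> = ?\<nu>'"
 proof (rule measure_eqI)
  fix E assume "E \<in> sets ?\<nu>"
  then have E [measurable]: "E \<in> sets borel" by simp
  let ?B = "T' -` E \<inter> U"
  have Bm: "?B \<in> sets borel" using measurable_sets [of T' borel borel E] by auto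
  have TB: "T ` ?B = E \<inter> T ` U" by (auto simp: T'_def)
  have "emeasure ?\<nu> E = emeasure lborel (E \<inter> T ` U)"
   by (subst emeasure_density) (auto simp: nn_integral_indicator [symmetric] indicator_inter_arith mult.commute simp del: nn_integral_indicator)
  also have "\<dots> = (\<integral>\<^sup>+z. ennreal ((cmod (deriv T z))\<^sup>2) * indicator ?B z \<partial>lborel)"
   using emeasure_holomorphic_image [OF Bm] TB by simp
  also have "\<dots> = (\<integral>\<^sup>+z. G z * indicator (T' -` E) z \<partial>lborel)"
   by (intro nn_integral_cong) (auto simp: G_def indicator_def)
  also have "\<dots> = emeasure ?\<nu>' E"
   using measurable_sets [of T' borel borel E] by (subst emeasure_distr, simp, simp, subst emeasure_density) auto
  finally show "emeasure ?\<nu> E = emeasure ?\<nu>' E" .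
 qed simp
 then have "(\<integral>\<^sup>+x. p x \<partial>?\<nu>) = (\<integral>\<^sup>+x. p x \<partial>?\<nu>')" by simp
 moreover have "(\<integral>\<^sup>+x. p x \<partial>?\<nu>) = (\<integral>\<^sup>+x. p x * indicator (T ` U) x \<partial>lborel)"
  by (subst nn_integral_density) (auto simp: mult.commute)
 moreover have "(\<integral>\<^sup>+x. p x \<partial>?\<nu>') = (\<integral>\<^sup>+z. G z * p (T' z) \<partial>lborel)"
  by (subst nn_integral_distr, simp, simp, subst nn_integral_density) auto
 moreover have "\<dots> = (\<integral>\<^sup>+z. p (T z) * (ennreal ((cmod (deriv T z))\<^sup>2) * indicator U z) \<partial>lborel)"
  by (intro nn_integral_cong) (auto simp: G_def T'_def indicator_def mult.commute)
 ultimately show ?thesis by simp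
qed

end

lemma null_sets_hyperplane: "a \<noteq> 0 \<or> b \<noteq> 0 ==> {x. a \<bullet> x = b} \<in> null_sets (lborel :: 'a::euclidean_space measure)"
proof -
 assume *: "a \<noteq> 0 \<or> b \<noteq> 0"
 have "{x. a \<bullet> x = b} \<in> sets borel" by (rule borel_closed [OF closed_hyperplane])
 then show ?thesis using negligible_hyperplane [OF *] by (simp add: negligible_iff_null_sets null_sets_completion_iff)
qed

text \<open>The principal root jumps only across the closed negative axis, on which it equals
  \<open>\<i> * sqrt |Re x|\<close>.\<close>

lemma csqrt_measurable [measurable]: "csqrt \<in> borel_measurable borel"
proof -
 have "(\<lambda>x. if x \<in> \<real>\<^sub>\<le>\<^sub>0 then \<i> * of_real (sqrt \<bar>Re x\<bar>) else csqrt x) \<in> borel_measurable borel"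
  by (intro borel_measurable_continuous_on_if) (auto intro!: continuous_intros simp: closed_nonpos_Reals_complex)
 moreover have "(\<lambda>x. if x \<in> \<real>\<^sub>\<le>\<^sub>0 then \<i> * of_real (sqrt \<bar>Re x\<bar>) else csqrt x) = csqrt"
  by (auto simp: complex_nonpos_Reals_iff fun_eq_iff simp del: csqrt.simps)
 ultimately show ?thesis by simp
qed

lemma Re_csqrt_pos: "x \<notin> \<real>\<^sub>\<le>\<^sub>0 ==> Re (csqrt x) > 0"
proof -
 assume x: "x \<notin> \<real>\<^sub>\<le>\<^sub>0"
 have "cmod x + Re x > 0"
 proof (rule ccontr)
  assume "\<not> cmod x + Re x > 0"
  then have e: "cmod x = - Re x" using abs_Re_le_cmod [of x] by linarith
  then have "(cmod x)\<^sup>2 = (Re x)\<^sup>2" by simp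
  then have "Im x = 0" by (simp add: cmod_power2)
  moreover have "Re x \<le> 0" using e norm_ge_zero [of x] by linarith
  ultimately show False using x by (simp add: complex_nonpos_Reals_iff)
 qed
 then show ?thesis by simp
qed

text \<open>The map \<open>z -> a + z^2\<close> is injective on each of the half planes
  \<open>Re z > 0\<close> and \<open>Re z < 0\<close>, with image the plane slit along a ray, and
  the two inverses are the two square roots. The imaginary axis and the slit are null sets.\<close>

lemma nn_integral_complex_square:
 assumes p [measurable]: "p \<in> borel_measurable borel"
 shows "(\<integral>\<^sup>+z. p z * ennreal (4 * (cmod z)\<^sup>2) \<partial>lborel)
   = (\<integral>\<^sup>+x. p (csqrt (x - a)) + p (- csqrt (x - a)) \<partial>lborel)"
proof -
 define T where "T = (\<lambda>z::complex. a + z\<^sup>2)"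
 define S where "S = {x. x - a \<notin> \<real>\<^sub>\<le>\<^sub>0}"
 have dT: "deriv T z = 2 * z" for z
  unfolding T_def by (rule DERIV_imp_deriv) (auto intro!: derivative_eq_intros)
 have hol: "T holomorphic_on A" for A unfolding T_def by (intro holomorphic_intros)
 have N1: "{z::complex. Re z = 0} \<in> null_sets lborel"
  using null_sets_hyperplane [of "1::complex" 0] by (simp add: inner_complex_def)
 have N2: "{x. Im x = Im a} \<in> null_sets lborel"
  using null_sets_hyperplane [of "\<i>" "Im a"] by (simp add: inner_complex_def)
 have half: "(\<integral>\<^sup>+z. p z * (ennreal (4 * (cmod z)\<^sup>2) * indicator {z. s * Re z > 0} z) \<partial>lborel)
   = (\<integral>\<^sup>+x. p (of_real s * csqrt (x - a)) \<partial>lborel)" if s: "s = 1 \<or> s = -1" for s :: real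
 proof -
  let ?U = "{z. s * Re z > 0}"
  have U: "open ?U" by (intro open_Collect_less continuous_intros)
  have cs: "of_real s * csqrt (z\<^sup>2) = z" if "z \<in> ?U" for z
   using that s csqrt_square [of z] csqrt_square [of "- z"] by auto
  have inj: "inj_on T ?U" using cs by (intro inj_onI) (metis T_def add_left_cancel)
  have "T ` ?U = S"
  proof
   show "T ` ?U \<subseteq> S"
   proof
    fix x assume "x \<in> T ` ?U"
    then obtain z where z: "z \<in> ?U" "x = a + z\<^sup>2" by (auto simp: T_def)
    have "z\<^sup>2 \<notin> \<real>\<^sub>\<le>\<^sub>0"
    proof
     assume "z\<^sup>2 \<in> \<real>\<^sub>\<le>\<^sub>0"
     then have "Re z * Im z = 0" "(Re z)\<^sup>2 \<le> (Im z)\<^sup>2" by (auto simp: complex_nonpos_Reals_iff power2_eq_square)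
     then show False using z(1) by auto
    qed
    then show "x \<in> S" using z by (simp add: S_def)
   qed
   show "S \<subseteq> T ` ?U"
   proof
    fix x assume "x \<in> S"
    then have "Re (csqrt (x - a)) > 0" using Re_csqrt_pos [of "x - a"] unfolding S_def by blast
    then have "of_real s * csqrt (x - a) \<in> ?U" "T (of_real s * csqrt (x - a)) = x"
     using s by (auto simp: T_def power_mult_distrib simp del: csqrt.simps)
    then show "x \<in> T ` ?U" by (metis imageI)
   qed
  qed
  then have "(\<integral>\<^sup>+x. p (of_real s * csqrt (x - a)) * indicator S x \<partial>lborel)
   = (\<integral>\<^sup>+z. p (of_real s * csqrt (T z - a)) * (ennreal ((cmod (deriv T z))\<^sup>2) * indicator ?U z) \<partial>lborel)"
   using nn_integral_holomorphic_substitution [OF U hol inj, of "\<lambda>x. p (of_real s * csqrt (x - a))"] by simp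
  also have "\<dots> = (\<integral>\<^sup>+z. p z * (ennreal (4 * (cmod z)\<^sup>2) * indicator ?U z) \<partial>lborel)"
  proof (rule nn_integral_cong)
   fix z
   have "T z - a = z\<^sup>2" by (simp add: T_def)
   then show "p (of_real s * csqrt (T z - a)) * (ennreal ((cmod (deriv T z))\<^sup>2) * indicator ?U z)
     = p z * (ennreal (4 * (cmod z)\<^sup>2) * indicator ?U z)"
    using cs [of z] by (cases "z \<in> ?U") (simp_all add: dT norm_mult power_mult_distrib del: csqrt.simps)
  qed
  finally have "(\<integral>\<^sup>+z. p z * (ennreal (4 * (cmod z)\<^sup>2) * indicator ?U z) \<partial>lborel)
    = (\<integral>\<^sup>+x. p (of_real s * csqrt (x - a)) * indicator S x \<partial>lborel)" by simp
  also have "\<dots> = (\<integral>\<^sup>+x. p (of_real s * csqrt (x - a)) \<partial>lborel)"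
  proof (rule nn_integral_cong_AE)
   show "AE x in lborel. p (of_real s * csqrt (x - a)) * indicator S x = p (of_real s * csqrt (x - a))"
    using AE_not_in [OF N2] by eventually_elim (auto simp: S_def complex_nonpos_Reals_iff indicator_def)
  qed
  finally show ?thesis .
 qed
 have "(\<integral>\<^sup>+z. p z * ennreal (4 * (cmod z)\<^sup>2) \<partial>lborel)
   = (\<integral>\<^sup>+z. p z * (ennreal (4 * (cmod z)\<^sup>2) * indicator {z. 1 * Re z > 0} z)
     + p z * (ennreal (4 * (cmod z)\<^sup>2) * indicator {z. - 1 * Re z > 0} z) \<partial>lborel)"
 proof (rule nn_integral_cong_AE)
  show "AE z in lborel. p z * ennreal (4 * (cmod z)\<^sup>2)
   = p z * (ennreal (4 * (cmod z)\<^sup>2) * indicator {z. 1 * Re z > 0} z)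
     + p z * (ennreal (4 * (cmod z)\<^sup>2) * indicator {z. - 1 * Re z > 0} z)"
   using AE_not_in [OF N1] by eventually_elim (auto simp: indicator_def)
 qed
 also have "\<dots> = (\<integral>\<^sup>+z. p z * (ennreal (4 * (cmod z)\<^sup>2) * indicator {z. 1 * Re z > 0} z) \<partial>lborel)
   + (\<integral>\<^sup>+z. p z * (ennreal (4 * (cmod z)\<^sup>2) * indicator {z. - 1 * Re z > 0} z) \<partial>lborel)"
  by (rule nn_integral_add) measurable
 also have "\<dots> = (\<integral>\<^sup>+x. p (of_real 1 * csqrt (x - a)) \<partial>lborel) + (\<integral>\<^sup>+x. p (of_real (- 1) * csqrt (x - a)) \<partial>lborel)"
  by (simp only: half [OF disjI1 [OF refl]] half [OF disjI2 [OF refl]])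
 also have "\<dots> = (\<integral>\<^sup>+x. p (of_real 1 * csqrt (x - a)) + p (of_real (- 1) * csqrt (x - a)) \<partial>lborel)"
  by (subst nn_integral_add) auto
 finally show ?thesis by simp
qed

text \<open>The integrand is at most the product of \<open>1/(1 + x^2)\<close> and
  \<open>1/(1 + y^2)\<close>, whose integral is the square of that of
  \<open>1/(1 + x^2)\<close>.\<close>

lemma nn_integral_spherical_area_finite:
 "(\<integral>\<^sup>+z. ennreal (1 / (1 + (cmod z)\<^sup>2)\<^sup>2) \<partial>lborel) < \<infinity>"
proof -
 have fin: "(\<integral>\<^sup>+x. ennreal (inverse (1 + x\<^sup>2)) \<partial>lborel) < \<infinity>"
 proof -
  have "integrable lborel (\<lambda>x::real. inverse (1 + x\<^sup>2))"
   using integrable_inverse_1_plus_square by (simp add: set_integrable_def einterval_def)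
  then show ?thesis by (simp add: integrable_iff_bounded)
 qed
 have "(\<integral>\<^sup>+z. ennreal (1 / (1 + (cmod z)\<^sup>2)\<^sup>2) \<partial>lborel)
   \<le> (\<integral>\<^sup>+z. (\<Prod>b\<in>Basis. ennreal (inverse (1 + (z \<bullet> b)\<^sup>2))) \<partial>(lborel :: complex measure))"
 proof (rule nn_integral_mono)
  fix z :: complex
  have "(1 + a) * (1 + b) \<le> (1 + (a + b))\<^sup>2" if "a \<ge> 0" "b \<ge> 0" for a b :: real
  proof -
   have "0 \<le> a * a + b * b + a * b + a + b" using that by simp
   then show ?thesis by (simp add: power2_eq_square algebra_simps)
  qed
  then have "(1 + (Re z)\<^sup>2) * (1 + (Im z)\<^sup>2) \<le> (1 + (cmod z)\<^sup>2)\<^sup>2" unfolding cmod_power2 by simp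
  moreover have "0 < (1 + (Re z)\<^sup>2) * (1 + (Im z)\<^sup>2)" by (intro mult_pos_pos) (auto intro: add_pos_nonneg)
  ultimately have "1 / (1 + (cmod z)\<^sup>2)\<^sup>2 \<le> inverse (1 + (Re z)\<^sup>2) * inverse (1 + (Im z)\<^sup>2)"
   unfolding divide_inverse mult_1_left inverse_mult_distrib [symmetric] by (rule le_imp_inverse_le)
  then show "ennreal (1 / (1 + (cmod z)\<^sup>2)\<^sup>2) \<le> (\<Prod>b\<in>Basis. ennreal (inverse (1 + (z \<bullet> b)\<^sup>2)))"
   by (simp add: Basis_complex_def complex_i_not_one inner_complex_def ennreal_mult' [symmetric] ennreal_leI)
 qed
 also have "\<dots> = (\<Prod>b\<in>(Basis::complex set). (\<integral>\<^sup>+x. ennreal (inverse (1 + x\<^sup>2)) \<partial>lborel))"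
  by (rule nn_integral_lborel_prod) auto
 also have "\<dots> < \<infinity>" using fin by (simp add: Basis_complex_def complex_i_not_one ennreal_mult_less_top)
 finally show ?thesis .
qed

section \<open>Charts, compatible charts and conformal structure\<close>

lemma is_chartD:
 assumes "is_chart X c"
 shows "openin X (fst c)" "fst c \<subseteq> topspace X" "open (chart_image c)" "inj_on (snd c) (fst c)"
  "\<And>p. p \<in> fst c ==> snd c p \<in> chart_image c"
  "\<And>z. z \<in> chart_image c ==> chart_inv c z \<in> fst c"
  "\<And>z. z \<in> chart_image c ==> snd c (chart_inv c z) = z"
  "\<And>p. p \<in> fst c ==> chart_inv c (snd c p) = p"
  "continuous_map (subtopology X (fst c)) (top_of_set (chart_image c)) (snd c)"
  "continuous_map (top_of_set (chart_image c)) X (chart_inv c)"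
proof -
 show o: "openin X (fst c)" "open (chart_image c)" using assms by (auto simp: is_chart_def)
 show s: "fst c \<subseteq> topspace X" using openin_subset [OF o(1)] .
 then have ts: "topspace (subtopology X (fst c)) = fst c" by auto
 have hm: "homeomorphic_map (subtopology X (fst c)) (top_of_set (chart_image c)) (snd c)"
  using assms by (simp add: is_chart_def)
 show inj: "inj_on (snd c) (fst c)" using homeomorphic_imp_injective_map [OF hm] ts by simp
 show "\<And>p. p \<in> fst c ==> snd c p \<in> chart_image c" by (simp add: chart_image_def)
 show 1: "\<And>z. z \<in> chart_image c ==> chart_inv c z \<in> fst c"
  by (simp add: chart_image_def chart_inv_def inv_into_into)
 show 2: "\<And>z. z \<in> chart_image c ==> snd c (chart_inv c z) = z"
  by (simp add: chart_image_def chart_inv_def f_inv_into_f)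
 show 3: "\<And>p. p \<in> fst c ==> chart_inv c (snd c p) = p" using inj by (simp add: chart_inv_def)
 show "continuous_map (subtopology X (fst c)) (top_of_set (chart_image c)) (snd c)"
  using homeomorphic_imp_continuous_map [OF hm] .
 obtain g where g: "homeomorphic_maps (subtopology X (fst c)) (top_of_set (chart_image c)) (snd c) g"
  using hm homeomorphic_map_maps by blast
 then have gc: "continuous_map (top_of_set (chart_image c)) (subtopology X (fst c)) g"
  and gs: "\<And>z. z \<in> chart_image c ==> snd c (g z) = z" by (auto simp: homeomorphic_maps_def)
 have "g z \<in> fst c" if "z \<in> chart_image c" for z using gc that ts by (auto simp: continuous_map_def)
 then have "chart_inv c z = g z" if "z \<in> chart_image c" for z using 3 gs that by metis
 moreover have "continuous_map (top_of_set (chart_image c)) X g"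
  using gc continuous_map_in_subtopology by blast
 ultimately show "continuous_map (top_of_set (chart_image c)) X (chart_inv c)"
  by (metis continuous_map_eq topspace_euclidean_subtopology)
qed

text \<open>Charts of the curve arise as parametrizations \<open>p\<close> with a left inverse
  \<open>q\<close>; this turns them into the required form.\<close>

lemma chart_from_param:
 assumes V: "open V" and p: "continuous_map (top_of_set V) X p" and o: "openin X (p ` V)"
  and q: "continuous_map (subtopology X (p ` V)) euclidean q" "\<And>z. z \<in> V ==> q (p z) = z"
 shows "is_chart X (p ` V, q)" "chart_image (p ` V, q) = V" "\<And>z. z \<in> V ==> chart_inv (p ` V, q) z = p z"
proof -
 have ts: "topspace X \<inter> p ` V = p ` V" using openin_subset [OF o] by auto
 show im: "chart_image (p ` V, q) = V" using q(2) by (force simp: chart_image_def)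
 have "homeomorphic_maps (subtopology X (p ` V)) (top_of_set V) q p"
  unfolding homeomorphic_maps_def using p q ts by (auto simp: continuous_map_in_subtopology)
 then show "is_chart X (p ` V, q)" unfolding is_chart_def im using o V homeomorphic_maps_map by auto
 have "inj_on q (p ` V)" using q(2) by (auto simp: inj_on_def)
 then show "chart_inv (p ` V, q) z = p z" if "z \<in> V" for z
  using inv_into_f_f [of q "p ` V" "p z"] q(2) that by (simp add: chart_inv_def)
qed

lemma open_chart_image:
 assumes c: "is_chart X c" and W: "openin X W" "W \<subseteq> fst c"
 shows "open (snd c ` W)"
proof -
 have "openin (top_of_set (chart_image c)) {z \<in> chart_image c. chart_inv c z \<in> W}"
  using is_chartD(10) [OF c] W(1) by (auto simp: continuous_map_def)
 moreover have "{z \<in> chart_image c. chart_inv c z \<in> W} = snd c ` W"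
  using is_chartD [OF c] W(2) by (auto simp: image_iff) (metis subsetD)+
 ultimately show ?thesis using is_chartD(3) [OF c] openin_open_trans by metis
qed

lemma coord_dom_eq:
 assumes "is_chart X c"
 shows "coord_dom c f d = {z \<in> chart_image c. f (chart_inv c z) \<in> fst d}"
 unfolding coord_dom_def chart_image_def using is_chartD(4) [OF assms] by (auto simp: chart_inv_def image_iff)

lemma coord_dom_open:
 assumes "is_chart X c" "is_chart X d"
 shows "open (coord_dom c id d)"
 unfolding coord_dom_def using open_chart_image [OF assms(1), of "fst c \<inter> id -` fst d"]
  is_chartD(1) [OF assms(1)] is_chartD(1) [OF assms(2)] by auto

lemma coord_transition:
 assumes c: "is_chart X c" and d: "is_chart X d" and z: "z \<in> coord_dom c id d"
 shows "coord c id d z \<in> coord_dom d id c" "coord d id c (coord c id d z) = z"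
  "chart_inv d (coord c id d z) = chart_inv c z"
proof -
 have z': "z \<in> chart_image c" "chart_inv c z \<in> fst d" using z coord_dom_eq [OF c, of id d] by auto
 show e: "chart_inv d (coord c id d z) = chart_inv c z" using z' is_chartD(8) [OF d] by (simp add: coord_def)
 show "coord c id d z \<in> coord_dom d id c"
  unfolding coord_dom_eq [OF d] using e z' is_chartD(5) [OF d] is_chartD(6) [OF c] by (simp add: coord_def)
 show "coord d id c (coord c id d z) = z" using e z' is_chartD(7) [OF c] by (simp add: coord_def)
qed

lemma coord_inj:
 assumes c: "is_chart X c" and d: "is_chart X d"
 shows "inj_on (coord c id d) (coord_dom c id d)" "coord c id d ` coord_dom c id d = coord_dom d id c"
proof -
 show "inj_on (coord c id d) (coord_dom c id d)"
  by (rule inj_on_inverseI [of _ "coord d id c"]) (rule coord_transition(2) [OF c d])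
 show "coord c id d ` coord_dom c id d = coord_dom d id c"
 proof
  show "coord c id d ` coord_dom c id d \<subseteq> coord_dom d id c" using coord_transition(1) [OF c d] by blast
  show "coord_dom d id c \<subseteq> coord c id d ` coord_dom c id d"
  proof
   fix w assume w: "w \<in> coord_dom d id c"
   show "w \<in> coord c id d ` coord_dom c id d"
    using imageI [OF coord_transition(1) [OF d c w], of "coord c id d"] unfolding coord_transition(2) [OF d c w] .
  qed
 qed
qed

lemma inner_mult_complex: "(v * x) \<bullet> (w * x) = (cmod x)\<^sup>2 * (v \<bullet> w)" for v w x :: complex
 unfolding cmod_power2 by (simp add: inner_complex_def power2_eq_square algebra_simps)

text \<open>Membership in the maximal holomorphic atlas. One direction of the transition is
  demanded; the other follows from \<open>coord_inverse_holomorphic\<close> because an injective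
  holomorphic map has a holomorphic inverse.\<close>

definition compat :: "'a topology => 'a chart set => 'a chart => bool" where
 "compat X A c \<longleftrightarrow> is_chart X c \<and> (\<forall>a\<in>A. coord a id c holomorphic_on coord_dom a id c)"

lemma coord_inverse_holomorphic:
 assumes c: "is_chart X c" and d: "is_chart X d" and hol: "coord c id d holomorphic_on coord_dom c id d"
 shows "coord d id c holomorphic_on coord_dom d id c"
proof -
 obtain g where g: "g holomorphic_on (coord c id d ` coord_dom c id d)"
   "\<And>z. z \<in> coord_dom c id d ==> g (coord c id d z) = z"
  using holomorphic_has_inverse [OF hol coord_dom_open [OF c d] coord_inj(1) [OF c d]] by metis
 have "coord d id c w = g w" if "w \<in> coord_dom d id c" for w
  using that g(2) coord_transition [OF c d] coord_transition [OF d c] by metis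
 then show ?thesis using g(1) holomorphic_cong unfolding coord_inj(2) [OF c d] by blast
qed

text \<open>Holomorphy is local: on the part of the overlap that lies in a chart \<open>a\<close> of
  the atlas, the transition factors through \<open>a\<close>.\<close>

lemma compat_trans:
 assumes A: "\<And>a. a \<in> A ==> is_chart X a" "topspace X = (\<Union>a\<in>A. fst a)"
  and c: "compat X A c" and d: "compat X A d"
 shows "coord c id d holomorphic_on coord_dom c id d"
proof -
 have cc: "is_chart X c" and dd: "is_chart X d" using c d by (auto simp: compat_def)
 let ?D = "\<lambda>a. snd c ` (fst c \<inter> fst d \<inter> fst a)"
 have "coord_dom c id d = (\<Union>a\<in>A. ?D a)" unfolding coord_dom_def using is_chartD(2) [OF cc] A(2) by fastforce
 moreover have "coord c id d holomorphic_on (\<Union>a\<in>A. ?D a)"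
 proof (rule holomorphic_on_UN_open)
  fix a assume a: "a \<in> A"
  show "open (?D a)" using open_chart_image [OF cc] is_chartD(1) [OF cc] is_chartD(1) [OF dd] is_chartD(1) [OF A(1) [OF a]]
   by (metis Int_assoc inf_le1 openin_Int)
  have 1: "coord c id a holomorphic_on ?D a" using coord_inverse_holomorphic [OF A(1) [OF a] cc] c a
   by (auto simp: compat_def coord_dom_def elim!: holomorphic_on_subset)
  have 2: "coord a id d holomorphic_on coord_dom a id d" using d a by (auto simp: compat_def)
  have "coord c id a ` ?D a \<subseteq> coord_dom a id d"
   using is_chartD(8) [OF cc] by (auto simp: coord_def coord_dom_def)
  then have "(coord a id d \<circ> coord c id a) holomorphic_on ?D a"
   using holomorphic_on_compose_gen [OF 1 2] by blast
  moreover have "(coord a id d \<circ> coord c id a) z = coord c id d z" if "z \<in> ?D a" for z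
   using that is_chartD(8) [OF A(1) [OF a]] is_chartD(8) [OF cc] by (auto simp: coord_def)
  ultimately show "coord c id d holomorphic_on ?D a" using holomorphic_cong by blast
 qed
 ultimately show ?thesis by simp
qed

lemma riemann_surface_compat:
 assumes X: "riemann_surface X A" and B: "\<And>c. c \<in> B ==> compat X A c" "topspace X = (\<Union>c\<in>B. fst c)"
 shows "riemann_surface X B"
 using X B(2) compat_trans [of A X] B(1) unfolding riemann_surface_def compat_def by metis

lemma riemann_surface_imp_compat: "riemann_surface X A ==> c \<in> A ==> compat X A c"
 by (auto simp: riemann_surface_def compat_def)

lemma holomorphic_map_id:
 assumes X: "riemann_surface X A" and "\<And>c. c \<in> B ==> compat X A c" "\<And>c. c \<in> C ==> compat X A c"
 shows "holomorphic_map X B X C id"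
 using X compat_trans [of A X] assms(2,3) unfolding riemann_surface_def holomorphic_map_def by simp

lemma transition_deriv_nonzero:
 assumes "is_chart X c" "is_chart X d" "coord c id d holomorphic_on coord_dom c id d" "z \<in> coord_dom c id d"
 shows "deriv (coord c id d) z \<noteq> 0"
 using holomorphic_injective_imp_regular [OF assms(3) coord_dom_open [OF assms(1,2)] coord_inj(1) [OF assms(1,2)] assms(4)] .

lemma jacobian_det_holomorphic:
 assumes "f holomorphic_on W" "open W" "z \<in> W"
 shows "jacobian_det f z = (cmod (deriv f z))\<^sup>2"
 unfolding jacobian_det_def pd_holomorphic [OF assms] cmod_power2 by (simp add: power2_eq_square)

text \<open>A conformal, orientation preserving real derivative is multiplication by a complex
  number: the images \<open>P\<close> and \<open>Q\<close> of \<open>1\<close> and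
  \<open>\<i>\<close> are orthogonal of equal length, and the positive determinant excludes
  \<open>Q = - \<i> * P\<close>.\<close>

lemma conformal_imp_field_differentiable:
 fixes T :: "complex => complex"
 assumes d: "T differentiable at z" and det: "jacobian_det T z > 0"
  and conf: "\<And>v. (cmod (pd v T z))\<^sup>2 = r * (v \<bullet> v)"
 shows "T field_differentiable at z"
proof -
 define P Q where "P = pd 1 T z" and "Q = pd \<i> T z"
 have dir: "pd v T z = Re v *\<^sub>R P + Im v *\<^sub>R Q" for v unfolding P_def Q_def by (rule pd_direction [OF d])
 have P: "(Re P)\<^sup>2 + (Im P)\<^sup>2 = r" using conf [of 1] by (simp add: P_def cmod_power2 inner_complex_def)
 have Q: "(Re Q)\<^sup>2 + (Im Q)\<^sup>2 = r" using conf [of \<i>] by (simp add: Q_def cmod_power2 inner_complex_def)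
 have "(Re P + Re Q)\<^sup>2 + (Im P + Im Q)\<^sup>2 = 2 * r"
  using conf [of "1 + \<i>"] by (simp add: dir cmod_power2 inner_complex_def)
 then have PQ: "Re P * Re Q + Im P * Im Q = 0" using P Q by (simp add: power2_sum)
 define D where "D = Re P * Im Q - Im P * Re Q"
 have D0: "D > 0" using det by (simp add: jacobian_det_def D_def P_def Q_def)
 \<comment> \<open>Lagrange's identity. With \<open>P\<close> and \<open>Q\<close> orthogonal it
   gives \<open>D^2 = r^2\<close>, and \<open>D = r\<close> turns the difference of \<open>Q\<close>
   and \<open>\<i> * P\<close> into a vanishing sum of two squares.\<close>
 have "D\<^sup>2 + (Re P * Re Q + Im P * Im Q)\<^sup>2 = ((Re P)\<^sup>2 + (Im P)\<^sup>2) * ((Re Q)\<^sup>2 + (Im Q)\<^sup>2)"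
  by (simp add: D_def power2_eq_square algebra_simps)
 then have "D\<^sup>2 = r\<^sup>2" using P Q PQ by (simp add: power2_eq_square)
 moreover have "r \<ge> 0" using P by (metis add_nonneg_nonneg zero_le_power2)
 ultimately have "D = r" using D0 by (simp add: power2_eq_iff_nonneg)
 then have "(Im Q - Re P)\<^sup>2 + (Re Q + Im P)\<^sup>2 = 0"
  using P Q unfolding D_def by (simp add: power2_eq_square algebra_simps)
 then have "Im Q = Re P" "Re Q = - Im P" by (auto simp: sum_power2_eq_zero_iff)
 then have "Q = \<i> * P" by (simp add: complex_eq_iff)
 then have "pd v T z = P * v" for v unfolding dir by (simp add: complex_eq_iff algebra_simps)
 moreover have "(T has_derivative (\<lambda>v. pd v T z)) (at z)" using d by (simp add: pd_def frechet_derivative_works [symmetric])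
 ultimately have "(T has_derivative (\<lambda>v. P * v)) (at z)" by simp
 then show ?thesis by (auto simp: field_differentiable_def has_field_derivative_def)
qed

text \<open>When all metrics are multiples of the Euclidean one in the given charts, a conformal
  orientation preserving chart satisfies the Cauchy-Riemann equations against each of them, and
  conversely.\<close>

lemma conformal_charts_eq:
 assumes A: "\<And>a. a \<in> atlas_of M ==> is_chart (top_of M) a"
  and m: "\<And>c z v w. metric_of M c z v w = lam c z * (v \<bullet> w)"
  and pos: "\<And>c z. c \<in> atlas_of M ==> z \<in> chart_image c ==> lam c z > 0"
 shows "conformal_charts M = {c. compat (top_of M) (atlas_of M) c}"
proof (intro equalityI subsetI)
 fix c assume "c \<in> conformal_charts M"
 then have c: "is_chart (top_of M) c" and cd: "\<And>d. d \<in> atlas_of M ==> smooth_on (coord_dom d id c) (coord d id c) \<and>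
    (\<forall>z\<in>coord_dom d id c. jacobian_det (coord d id c) z > 0 \<and>
      (\<exists>r>0. \<forall>v. (norm (pd v (coord d id c) z))\<^sup>2 = r * metric_of M d z v v))"
  by (auto simp: conformal_charts_def)
 have "coord d id c holomorphic_on coord_dom d id c" if d: "d \<in> atlas_of M" for d
 proof -
  have "coord d id c field_differentiable at z" if z: "z \<in> coord_dom d id c" for z
  proof -
   obtain r where r: "\<And>v. (norm (pd v (coord d id c) z))\<^sup>2 = r * metric_of M d z v v" using cd [OF d] z by blast
   show ?thesis by (rule conformal_imp_field_differentiable [of _ _ "r * lam d z"])
      (use cd [OF d] z r in \<open>auto simp: m smooth_on_differentiable mult.assoc\<close>)
  qed
  then show ?thesis by (simp add: holomorphic_on_def field_differentiable_at_within)
 qed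
 then show "c \<in> {c. compat (top_of M) (atlas_of M) c}" using c by (auto simp: compat_def)
next
 fix c assume "c \<in> {c. compat (top_of M) (atlas_of M) c}"
 then have c: "is_chart (top_of M) c" and hol: "\<And>a. a \<in> atlas_of M ==> coord a id c holomorphic_on coord_dom a id c"
  by (auto simp: compat_def)
 show "c \<in> conformal_charts M" unfolding conformal_charts_def
 proof (intro CollectI conjI ballI c)
  fix d assume d: "d \<in> atlas_of M"
  have o: "open (coord_dom d id c)" using coord_dom_open [OF A [OF d] c] .
  show "smooth_on (coord_dom d id c) (coord d id c)" using smooth_on_holomorphic [OF o hol [OF d]] .
  fix z assume z: "z \<in> coord_dom d id c"
  have nz: "deriv (coord d id c) z \<noteq> 0" using transition_deriv_nonzero [OF A [OF d] c hol [OF d] z] .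
  then show "jacobian_det (coord d id c) z > 0" using jacobian_det_holomorphic [OF hol [OF d] o z] by simp
  have "z \<in> chart_image d" using z coord_dom_eq [OF A [OF d]] by blast
  then have l: "lam d z > 0" using pos d by blast
  have "(norm (pd v (coord d id c) z))\<^sup>2 = ((cmod (deriv (coord d id c) z))\<^sup>2 / lam d z) * metric_of M d z v v" for v
   using l by (simp add: pd_holomorphic [OF hol [OF d] o z] norm_mult power_mult_distrib m power2_norm_eq_inner [of v])
  moreover have "(cmod (deriv (coord d id c) z))\<^sup>2 / lam d z > 0" using l nz by simp
  ultimately show "\<exists>r>0. \<forall>v. (norm (pd v (coord d id c) z))\<^sup>2 = r * metric_of M d z v v" by blast
 qed
qed

text \<open>A nowhere vanishing one-form \<open>\<eta>\<close> and a function \<open>g\<close> that is only well defined up to unitary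
 factors (so that only \<open>G = |g|\<^sup>2\<close> and \<open>\<kappa> = |dg/\<eta>|\<^sup>2\<close> are globally defined) yield a Ricci surface.\<close>

locale weierstrass_surface =
 fixes X :: "'a topology" and A :: "'a chart set" and \<eta> :: "'a chart => complex => complex"
  and G \<kappa> :: "'a => real"
 assumes RS: "riemann_surface X A" and sc: "second_countable_space X"
  and \<eta>_hol: "c \<in> A ==> \<eta> c holomorphic_on chart_image c"
  and \<eta>_nz: "c \<in> A ==> z \<in> chart_image c ==> \<eta> c z \<noteq> 0"
  and \<eta>_trans: "c \<in> A ==> d \<in> A ==> z \<in> coord_dom c id d ==>
    \<eta> d (coord c id d z) * deriv (coord c id d) z = \<eta> c z"
  and local_g: "c \<in> A ==> \<exists>g a. g holomorphic_on chart_image c \<and> a holomorphic_on chart_image c \<and>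
    (\<forall>z\<in>chart_image c. deriv g z = a z * \<eta> c z \<and> (cmod (g z))\<^sup>2 = G (chart_inv c z) \<and>
      (cmod (a z))\<^sup>2 = \<kappa> (chart_inv c z))"
begin

definition lam :: "'a chart => complex => real" where
 "lam c z = 1/4 * (cmod (\<eta> c z))\<^sup>2 * (1 + G (chart_inv c z))\<^sup>2"

definition M :: "'a riem_surface" where
 "M = \<lparr>top_of = X, atlas_of = A, metric_of = (\<lambda>c z v w. lam c z * (v \<bullet> w))\<rparr>"

lemma A_chart: "c \<in> A ==> is_chart X c" and A_cover: "topspace X = (\<Union>c\<in>A. fst c)"
 and A_hol: "c \<in> A ==> d \<in> A ==> coord c id d holomorphic_on coord_dom c id d"
 using RS by (auto simp: riemann_surface_def)

lemma M_sel: "top_of M = X" "atlas_of M = A" "metric_of M c = (\<lambda>z v w. lam c z * (v \<bullet> w))"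
 by (simp_all add: M_def)

lemma G_nonneg: "p \<in> topspace X ==> G p \<ge> 0" and \<kappa>_nonneg: "p \<in> topspace X ==> \<kappa> p \<ge> 0"
proof -
 assume "p \<in> topspace X"
 then obtain c where c: "c \<in> A" "p \<in> fst c" using A_cover by blast
 obtain g a where "\<forall>z\<in>chart_image c. (cmod (g z))\<^sup>2 = G (chart_inv c z) \<and> (cmod (a z))\<^sup>2 = \<kappa> (chart_inv c z)"
  using local_g [OF c(1)] by blast
 then have "(cmod (g (snd c p)))\<^sup>2 = G p" "(cmod (a (snd c p)))\<^sup>2 = \<kappa> p"
  using is_chartD(5,8) [OF A_chart [OF c(1)] c(2)] by auto
 then show "G p \<ge> 0" "\<kappa> p \<ge> 0" by (metis zero_le_power2)+
qed

definition curv :: "'a => real" where "curv p = - 16 * \<kappa> p / (1 + G p) ^ 4"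

lemma local_facts:
 assumes c: "c \<in> A" and z: "z \<in> chart_image c"
 shows "smooth_on (chart_image c) (lam c)" "lam c z > 0"
  "local_gauss (metric_of M c) z = curv (chart_inv c z)"
  "(\<And>x. x \<in> chart_image c ==> K x = curv (chart_inv c x)) ==>
    K z * laplacian (metric_of M c) K z + metric_of M c z (grad (metric_of M c) K z) (grad (metric_of M c) K z) + 4 * K z ^ 3 = 0"
proof -
 obtain g a where ga: "g holomorphic_on chart_image c" "a holomorphic_on chart_image c"
  and e: "\<And>z. z \<in> chart_image c ==> deriv g z = a z * \<eta> c z"
   "\<And>z. z \<in> chart_image c ==> (cmod (g z))\<^sup>2 = G (chart_inv c z)"
   "\<And>z. z \<in> chart_image c ==> (cmod (a z))\<^sup>2 = \<kappa> (chart_inv c z)" using local_g [OF c] by blast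
 have l: "lam c z = 1/4 * (cmod (\<eta> c z))\<^sup>2 * (1 + (cmod (g z))\<^sup>2)\<^sup>2" if "z \<in> chart_image c" for z
  using that by (simp add: lam_def e)
 note W = weierstrass_metric_ricci [OF is_chartD(3) [OF A_chart [OF c]] \<eta>_hol [OF c] ga \<eta>_nz [OF c] e(1) l M_sel(3) z]
 show "smooth_on (chart_image c) (lam c)" "lam c z > 0" using W by blast+
 show "local_gauss (metric_of M c) z = curv (chart_inv c z)" using W(3) z by (simp add: curv_def e)
 assume K: "\<And>x. x \<in> chart_image c ==> K x = curv (chart_inv c x)"
 show "K z * laplacian (metric_of M c) K z + metric_of M c z (grad (metric_of M c) K z) (grad (metric_of M c) K z) + 4 * K z ^ 3 = 0"
 proof (rule W(4))
  fix x assume x: "x \<in> chart_image c"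
  show "K x = - 16 * (cmod (a x))\<^sup>2 / (1 + (cmod (g x))\<^sup>2) ^ 4" unfolding K [OF x] curv_def e(2,3) [OF x] ..
 qed
qed

lemma lam_trans:
 assumes "c \<in> A" "d \<in> A" "z \<in> coord_dom c id d"
 shows "lam c z = lam d (coord c id d z) * (cmod (deriv (coord c id d) z))\<^sup>2"
 unfolding lam_def coord_transition(3) [OF A_chart [OF assms(1)] A_chart [OF assms(2)] assms(3)]
  \<eta>_trans [OF assms, symmetric] by (simp add: norm_mult power_mult_distrib)

lemma oriented_riemannian: "oriented_riemannian_surface M"
proof -
 have bil: "bilinear (\<lambda>v w. r * (v \<bullet> w))" for r :: real using bilinear_times [where 'a = real]
  by (auto simp: bilinear_def linear_iff inner_add_left inner_add_right algebra_simps)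
 have smooth: "smooth_on (chart_image c) (\<lambda>z. lam c z * (v \<bullet> w))" if c: "c \<in> A" for c v w
 proof (cases "chart_image c = {}")
  case True
  have "C_on k {} (\<lambda>z. lam c z * (v \<bullet> w))" for k
   by (rule iffD2 [OF C_on_cong [OF open_empty] C_on_const [OF open_empty, of k 0]]) simp
  then show ?thesis unfolding True smooth_on_def by blast
 next
  case False
  then show ?thesis using local_facts(1) [OF c] is_chartD(3) [OF A_chart [OF c]]
   by (auto intro!: smooth_on_mult smooth_on_const)
 qed
 have tr: "smooth_on (coord_dom c id d) (coord c id d)" "\<And>z. z \<in> coord_dom c id d ==> jacobian_det (coord c id d) z > 0"
  if "c \<in> A" "d \<in> A" for c d
 proof -
  note o = coord_dom_open [OF A_chart [OF that(1)] A_chart [OF that(2)]] and h = A_hol [OF that]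
  show "smooth_on (coord_dom c id d) (coord c id d)" by (rule smooth_on_holomorphic [OF o h])
  fix z assume z: "z \<in> coord_dom c id d"
  show "jacobian_det (coord c id d) z > 0" unfolding jacobian_det_holomorphic [OF h o z]
   using transition_deriv_nonzero [OF A_chart [OF that(1)] A_chart [OF that(2)] h z] by simp
 qed
 have me: "lam c z * (v \<bullet> w) = lam d (coord c id d z) * (pd v (coord c id d) z \<bullet> pd w (coord c id d) z)"
  if "c \<in> A" "d \<in> A" "z \<in> coord_dom c id d" for c d z v w
 proof -
  have "pd u (coord c id d) z = u * deriv (coord c id d) z" for u
   using pd_holomorphic [OF A_hol [OF that(1,2)] coord_dom_open [OF A_chart A_chart] that(3)] that by blast
  then show ?thesis by (simp add: lam_trans [OF that] inner_mult_complex)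
 qed
 have pos: "lam c z > 0" if "c \<in> A" "z \<in> chart_image c" for c z using local_facts(2) [OF that] .
 have rs: "topspace X \<noteq> {} \<and> connected_space X \<and> Hausdorff_space X \<and> topspace X = (\<Union>c\<in>A. fst c)"
  using RS unfolding riemann_surface_def by blast
 show ?thesis unfolding oriented_riemannian_surface_def M_sel Let_def
 proof (intro conjI ballI allI impI)
  show "topspace X \<noteq> {}" "connected_space X" "Hausdorff_space X" "topspace X = (\<Union>c\<in>A. fst c)"
   using rs by blast+
  show "0 < lam c z * (v \<bullet> v)" if "c \<in> A" "z \<in> chart_image c" "v \<noteq> 0" for c z v
   using pos [OF that(1,2)] that(3) by simp
 qed (rule sc A_chart tr smooth me bil inner_commute [THEN arg_cong] | assumption)+
qed

lemma gauss_curvature_M: "p \<in> topspace X ==> gauss_curvature M p = curv p"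
proof -
 assume p: "p \<in> topspace X"
 define c where "c = (SOME c. c \<in> A \<and> p \<in> fst c)"
 have "\<exists>c. c \<in> A \<and> p \<in> fst c" using A_cover p by blast
 then have c: "c \<in> A" "p \<in> fst c" unfolding c_def by (metis (mono_tags, lifting) someI_ex)+
 have "gauss_curvature M p = local_gauss (metric_of M c) (snd c p)"
  by (simp add: gauss_curvature_def M_sel(2) c_def Let_def)
 then show ?thesis using local_facts(3) [OF c(1)] is_chartD(5,8) [OF A_chart [OF c(1)] c(2)] by simp
qed

lemma ricci: "ricci_surface M"
proof -
 have "let h = metric_of M c; K = gauss_curvature M \<circ> chart_inv c in
    K z * laplacian h K z + h z (grad h K z) (grad h K z) + 4 * K z ^ 3 = 0"
  if c: "c \<in> A" and z: "z \<in> chart_image c" for c z unfolding Let_def by (rule local_facts(4) [OF c z])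
    (use gauss_curvature_M is_chartD(2,6) [OF A_chart [OF c]] in auto)
 then show ?thesis using oriented_riemannian by (auto simp: ricci_surface_def M_sel)
qed

lemma nonpositive: "nonpositively_curved M" unfolding nonpositively_curved_def M_sel
proof
 fix p assume p: "p \<in> topspace X"
 have "0 \<le> \<kappa> p / (1 + G p) ^ 4" using \<kappa>_nonneg [OF p] G_nonneg [OF p] by simp
 then show "gauss_curvature M p \<le> 0" using gauss_curvature_M [OF p] by (simp add: curv_def)
qed

lemma conformal_charts_M: "conformal_charts M = {c. compat X A c}"
 using conformal_charts_eq [of M lam] A_chart local_facts(2) by (simp add: M_sel)

end

subsection \<open>Transporting a topology along an injection\<close>

text \<open>The compactification has its points in an option type, whereas the surface is required
  to live in the type \<open>point\<close>. The topology is therefore moved onto the image of an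
  injection.\<close>

definition transport :: "'a topology => ('a => 'b) => 'b topology" where
 "transport X e = topology (\<lambda>U. U \<subseteq> e ` topspace X \<and> openin X (topspace X \<inter> e -` U))"

lemma openin_transport:
 "openin (transport X e) U \<longleftrightarrow> U \<subseteq> e ` topspace X \<and> openin X (topspace X \<inter> e -` U)"
proof -
 have "istopology (\<lambda>U. U \<subseteq> e ` topspace X \<and> openin X (topspace X \<inter> e -` U))" unfolding istopology_def
 proof (intro conjI allI impI)
  fix U V assume "U \<subseteq> e ` topspace X \<and> openin X (topspace X \<inter> e -` U)"
   "V \<subseteq> e ` topspace X \<and> openin X (topspace X \<inter> e -` V)"
  moreover have "topspace X \<inter> e -` (U \<inter> V) = (topspace X \<inter> e -` U) \<inter> (topspace X \<inter> e -` V)" by blast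
  ultimately show "U \<inter> V \<subseteq> e ` topspace X" "openin X (topspace X \<inter> e -` (U \<inter> V))" by auto
 next
  fix K assume K: "\<forall>U\<in>K. U \<subseteq> e ` topspace X \<and> openin X (topspace X \<inter> e -` U)"
  then show "\<Union>K \<subseteq> e ` topspace X" by blast
  have "topspace X \<inter> e -` (\<Union>K) = (\<Union>U\<in>K. topspace X \<inter> e -` U)" by blast
  moreover have "openin X (\<Union>U\<in>K. topspace X \<inter> e -` U)" by (rule openin_Union) (use K in blast)
  ultimately show "openin X (topspace X \<inter> e -` (\<Union>K))" by (simp only:)
 qed
 then show ?thesis by (simp add: transport_def)
qed

lemma topspace_transport: "topspace (transport X e) = e ` topspace X"
proof
 show "topspace (transport X e) \<subseteq> e ` topspace X"
  using openin_topspace [of "transport X e"] unfolding openin_transport by blast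
 have "topspace X \<inter> e -` (e ` topspace X) = topspace X" by blast
 then have "openin (transport X e) (e ` topspace X)" unfolding openin_transport by simp
 then show "e ` topspace X \<subseteq> topspace (transport X e)" using openin_subset by blast
qed

lemma homeomorphic_map_transport:
 assumes "inj_on e (topspace X)"
 shows "homeomorphic_map X (transport X e) e"
proof (rule bijective_open_imp_homeomorphic_map)
 show "continuous_map X (transport X e) e"
 proof -
  have "{x \<in> topspace X. e x \<in> U} = topspace X \<inter> e -` U" for U by blast
  then show ?thesis unfolding continuous_map_def openin_transport topspace_transport by auto
 qed
 have "topspace X \<inter> e -` (e ` U) = U" if "openin X U" for U
  using assms openin_subset [OF that] by (auto simp: inj_on_def)
 then show "open_map X (transport X e) e"
  unfolding open_map_def openin_transport using openin_subset by (metis image_mono)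
qed (use assms in \<open>auto simp: topspace_transport\<close>)

subsection \<open>The curve\<close>

lemma holomorphic_on_compose_fun:
 assumes "f holomorphic_on S" "g holomorphic_on T" "\<And>z. z \<in> S ==> f z \<in> T"
 shows "(\<lambda>z. g (f z)) holomorphic_on S"
 using holomorphic_on_compose_gen [OF assms(1,2)] assms(3) by (simp add: o_def image_subset_iff)

lemma holomorphic_sqrt_on_ball:
 assumes "f holomorphic_on ball a r" "\<And>x. x \<in> ball a r ==> f x \<noteq> 0"
 obtains h where "h holomorphic_on ball a r" "\<And>x. x \<in> ball a r ==> (h x)\<^sup>2 = f x"
 using contractible_imp_holomorphic_sqrt [OF assms(1) convex_imp_contractible [OF convex_ball] assms(2)] by metis

text \<open>\<open>d\<close> counts the ends at finite points. Together with the end at infinity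
  this makes \<open>d + 1\<close> ends, so the theorem uses \<open>d = n - 1\<close>.\<close>

locale curve_ends =
 fixes k d :: nat
 assumes k: "k > 0"
begin

definition cf1 :: "complex => complex" where "cf1 x = (\<Prod>i=1..2*k. x + of_nat i)"
definition cf :: "complex => complex" where "cf x = x * cf1 x"
definition C :: "(complex \<times> complex) set" where "C = sqrt_curve cf UNIV"

text \<open>The function \<open>g\<close>, as a function of \<open>w = \<surd>x\<close>: its simple poles \<open>rho j\<close>, symmetric about
 \<open>0\<close>, give the ends at finite points; at infinity it has a pole of order \<open>2k - 1\<close>.\<close>

definition rho :: "nat => complex" where "rho j = of_int (2 * int j + 1 - int d)"
definition RHO :: "complex set" where "RHO = rho ` {..<d}"
definition PX :: "complex set" where "PX = (\<lambda>r. r\<^sup>2) ` RHO"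
definition gg :: "complex => complex" where "gg w = w ^ (2*k-1) + (\<Sum>j<d. 1 / (w - rho j))"

lemma in_C: "(x, y) \<in> C \<longleftrightarrow> y\<^sup>2 = cf x" by (simp add: C_def sqrt_curve_def)

lemma cf_alt: "cf x = (\<Prod>i\<le>2*k. x + of_nat i)"
proof -
 have "{..2*k} = insert 0 {1..2*k}" by auto
 then show ?thesis by (simp add: cf_def cf1_def)
qed

lemma cf1_hol [holomorphic_intros]: "cf1 holomorphic_on A" unfolding cf1_def by (intro holomorphic_intros)
lemma cf_hol [holomorphic_intros]: "cf holomorphic_on A" unfolding cf_def by (intro holomorphic_intros)

lemma cf_cont: "continuous_on A cf" using cf_hol holomorphic_on_imp_continuous_on by blast

definition roots :: "complex set" where "roots = (\<lambda>i. - of_nat i) ` {..2*k}"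

lemma cf_eq_0: "cf x = 0 \<longleftrightarrow> x \<in> roots"
 unfolding cf_alt roots_def by (auto simp: prod_zero_iff eq_neg_iff_add_eq_0 image_iff Bex_def)

lemma cf1_eq_0: "cf1 x = 0 \<longleftrightarrow> x \<in> (\<lambda>i. - of_nat i) ` {1..2*k}"
 unfolding cf1_def by (auto simp: prod_zero_iff eq_neg_iff_add_eq_0 image_iff Bex_def)

lemma finite_roots: "finite roots" by (simp add: roots_def)
lemma finite_RHO: "finite RHO" by (simp add: RHO_def)
lemma finite_PX: "finite PX" by (simp add: PX_def finite_RHO)

lemma RHO_uminus: "r \<in> RHO ==> - r \<in> RHO"
proof -
 assume "r \<in> RHO"
 then obtain j where j: "j < d" "r = rho j" by (auto simp: RHO_def)
 then have "- r = rho (d - 1 - j)" by (simp add: rho_def of_nat_diff algebra_simps)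
 then show ?thesis using j by (auto simp: RHO_def)
qed

lemma sq_in_PX: "w\<^sup>2 \<in> PX \<longleftrightarrow> w \<in> RHO" unfolding PX_def using RHO_uminus by (auto simp: power2_eq_iff)

lemma inj_rho: "inj rho" by (auto simp: inj_def rho_def simp del: of_int_diff of_int_add of_int_mult)

lemma PX_real: "x \<in> PX ==> Im x = 0 \<and> Re x \<ge> 0 \<and> Re x \<le> (real d)\<^sup>2"
proof -
 assume "x \<in> PX"
 then obtain j where j: "j < d" "x = (rho j)\<^sup>2" by (auto simp: PX_def RHO_def)
 define r where "r = real_of_int (2 * int j + 1 - int d)"
 have "x = of_real (r\<^sup>2)" by (simp add: j rho_def r_def)
 moreover have "\<bar>r\<bar> \<le> real d" using j(1) unfolding r_def by linarith
 then have "r\<^sup>2 \<le> (real d)\<^sup>2" by (metis abs_le_square_iff abs_of_nat)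
 ultimately show ?thesis by simp
qed

text \<open>The roots of \<open>cf1\<close> are negative, and the squares of the real numbers
  \<open>rho j\<close> are not.\<close>

lemma cf1_PX: "x \<in> PX ==> cf1 x \<noteq> 0" using PX_real [of x] unfolding cf1_eq_0 by auto

lemma gg_uminus: "gg (- w) = - gg w"
proof -
 have "(\<Sum>j<d. 1 / (- w - rho j)) = (\<Sum>j<d. 1 / (- w - rho (d - Suc j)))"
  by (rule sum.nat_diff_reindex [symmetric])
 also have "\<dots> = (\<Sum>j<d. - (1 / (w - rho j)))"
 proof (rule sum.cong)
  fix j assume "j \<in> {..<d}"
  then have "rho (d - Suc j) = - rho j" by (simp add: rho_def of_nat_diff algebra_simps)
  then have "- w - rho (d - Suc j) = - (w - rho j)" by simp
  then show "1 / (- w - rho (d - Suc j)) = - (1 / (w - rho j))" by (simp only: divide_minus_right)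
 qed simp
 finally have "(\<Sum>j<d. 1 / (- w - rho j)) = - (\<Sum>j<d. 1 / (w - rho j))" by (simp add: sum_negf)
 moreover have "odd (2*k-1)" using k by simp
 ultimately show ?thesis by (simp add: gg_def)
qed

lemma gg_deriv:
 assumes "w \<notin> RHO"
 shows "(gg has_field_derivative (of_nat (2*k-1) * w ^ (2*k-2) - (\<Sum>j<d. 1 / (w - rho j)\<^sup>2))) (at w)"
proof -
 have nz: "w - rho j \<noteq> 0" if "j < d" for j using assms that by (auto simp: RHO_def)
 have "((\<lambda>w. w ^ (2*k-1) + (\<Sum>j<d. 1 / (w - rho j))) has_field_derivative
   (of_nat (2*k-1) * w ^ (2*k-1-1) + (\<Sum>j<d. - 1 / (w - rho j)\<^sup>2))) (at w)"
 proof (intro DERIV_add DERIV_sum)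
  show "((\<lambda>w. w ^ (2*k-1)) has_field_derivative of_nat (2*k-1) * w ^ (2*k-1-1)) (at w)"
   by (auto intro!: derivative_eq_intros)
  show "((\<lambda>w. 1 / (w - rho j)) has_field_derivative - 1 / (w - rho j)\<^sup>2) (at w)" if "j \<in> {..<d}" for j
   using nz that by (auto intro!: derivative_eq_intros simp: power2_eq_square)
 qed
 moreover have "2*k-1-1 = 2*k-2" using k by simp
 moreover have "(\<Sum>j<d. - 1 / (w - rho j)\<^sup>2) = - (\<Sum>j<d. 1 / (w - rho j)\<^sup>2)" by (simp add: sum_negf)
 ultimately show ?thesis unfolding gg_def [abs_def] by simp
qed

lemma open_compl_RHO: "open (- RHO)" using finite_RHO finite_imp_closed by blast

lemma gg_hol: "gg holomorphic_on - RHO"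
 unfolding holomorphic_on_open [OF open_compl_RHO] using gg_deriv by blast

definition gg' :: "complex => complex" where "gg' = deriv gg"

lemma gg'_eq: "w \<notin> RHO ==> gg' w = of_nat (2*k-1) * w ^ (2*k-2) - (\<Sum>j<d. 1 / (w - rho j)\<^sup>2)"
 unfolding gg'_def using DERIV_imp_deriv [OF gg_deriv] .

lemma gg'_hol: "gg' holomorphic_on - RHO"
 unfolding gg'_def by (rule holomorphic_deriv [OF gg_hol open_compl_RHO])

lemma gg'_uminus: "w \<notin> RHO ==> gg' (- w) = gg' w"
proof -
 assume w: "w \<notin> RHO"
 then have w': "- w \<notin> RHO" using RHO_uminus [of "- w"] by auto
 have "((\<lambda>x. - gg (- x)) has_field_derivative gg' (- w)) (at w)"
  using gg_deriv [OF w'] gg'_eq [OF w'] by (auto intro!: derivative_eq_intros DERIV_chain2 [of gg])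
 moreover have "(\<lambda>x. - gg (- x)) = gg" by (simp add: gg_uminus fun_eq_iff)
 ultimately show ?thesis unfolding gg'_def using DERIV_imp_deriv by metis
qed

lemma gg_sgn: "s\<^sup>2 = 1 ==> cmod (gg (s * w)) = cmod (gg w)" by (auto simp: power2_eq_1_iff gg_uminus)

lemma gg'_sgn: "s\<^sup>2 = 1 ==> w \<notin> RHO ==> gg' (s * w) = gg' w" by (auto simp: power2_eq_1_iff gg'_uminus)

subsection \<open>The compactification\<close>

text \<open>Codes a pair of complex numbers by one complex number through an arbitrary injection and
  marks the point at infinity by the second component \<open>1\<close>.\<close>

definition e :: "(complex \<times> complex) option => point" where
 "e = (let j = (SOME j. inj (j :: complex \<times> complex => complex)) in
   (\<lambda>p. case p of None => (0, 1) | Some q => (j q, 0)))"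

lemma inj_e: "inj e"
proof -
 have "infinite (UNIV :: complex set)" by (rule infinite_UNIV_char_0)
 then have "|(UNIV :: complex set) \<times> (UNIV :: complex set)| =o |UNIV :: complex set|"
  by (rule card_of_Times_same_infinite)
 then obtain j :: "complex \<times> complex => complex" where "bij_betw j (UNIV \<times> UNIV) UNIV"
  using card_of_ordIso by blast
 then have "inj j" by (simp add: bij_betw_def)
 then have i: "inj (SOME j. inj (j :: complex \<times> complex => complex))" by (rule someI [where P = inj])
 show ?thesis unfolding e_def Let_def by (rule injI) (auto split: option.splits dest: injD [OF i])
qed

definition pt :: "complex \<times> complex => point" where "pt q = e (Some q)"
definition infp :: point where "infp = e None"
definition pc :: "point => complex \<times> complex" where "pc p = the (inv_into UNIV e p)"
definition xc :: "point => complex" where "xc p = fst (pc p)"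
definition yc :: "point => complex" where "yc p = snd (pc p)"

lemma pc_pt [simp]: "pc (pt q) = q" and pt_infp [simp]: "pt q \<noteq> infp" "infp \<noteq> pt q"
 and pt_eq [simp]: "pt q = pt q' \<longleftrightarrow> q = q'" using inj_e by (auto simp: pc_def pt_def infp_def inj_eq)

lemma xc_pt [simp]: "xc (pt (x, y)) = x" and yc_pt [simp]: "yc (pt (x, y)) = y" by (simp_all add: xc_def yc_def)

lemma inj_pt: "inj pt" by (auto simp: inj_def)

definition CC :: "(complex \<times> complex) topology" where "CC = top_of_set C"
definition SS :: "point topology" where "SS = transport (Alexandroff_compactification CC) e"

lemma closed_C: "closed C"
proof -
 have "C = {p. (snd p)\<^sup>2 = cf (fst p)}" by (auto simp: C_def sqrt_curve_def)
 moreover have "closed {p. (snd p)\<^sup>2 = cf (fst p)}"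
  by (intro closed_Collect_eq continuous_intros continuous_on_compose2 [OF cf_cont [of UNIV]]) auto
 ultimately show ?thesis by simp
qed

lemma topspace_SS: "topspace SS = insert infp (pt ` C)"
 by (auto simp: SS_def topspace_transport CC_def infp_def pt_def)

lemma homeo_e: "homeomorphic_map (Alexandroff_compactification CC) SS e"
 unfolding SS_def by (rule homeomorphic_map_transport) (rule inj_on_subset [OF inj_e], simp)

lemma compact_SS: "compact_space SS"
 using homeomorphic_compact_space [OF homeomorphic_map_imp_homeomorphic_space [OF homeo_e]] by simp

lemma Hausdorff_SS: "Hausdorff_space SS"
proof -
 have "locally_compact_space CC" unfolding CC_def
  by (rule locally_compact_space_closed_subset [OF locally_compact_space_euclidean])
    (simp add: closed_C flip: closed_closedin)
 moreover have "Hausdorff_space CC" by (simp add: CC_def Hausdorff_space_subtopology)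
 ultimately show ?thesis
  using homeomorphic_Hausdorff_space [OF homeomorphic_map_imp_homeomorphic_space [OF homeo_e]]
  by (simp add: Hausdorff_space_Alexandroff_compactification)
qed

lemma e_vimage: "topspace (Alexandroff_compactification CC) \<inter> e -` (pt ` W) = Some ` (C \<inter> W)"
 unfolding pt_def by (auto simp: CC_def inj_eq [OF inj_e])

lemma openin_pt: "W \<subseteq> C ==> openin SS (pt ` W) \<longleftrightarrow> openin (top_of_set C) W"
 unfolding SS_def openin_transport e_vimage by (auto simp: CC_def pt_def Int_absorb1)

lemma openin_inf:
 assumes "compact K" "K \<subseteq> C"
 shows "openin SS (insert infp (pt ` (C - K)))"
proof -
 have "topspace (Alexandroff_compactification CC) \<inter> e -` (insert infp (pt ` (C - K))) = insert None (Some ` (topspace CC - K))"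
  unfolding pt_def infp_def by (auto simp: CC_def inj_eq [OF inj_e])
 moreover have "compactin CC K" "closedin CC K"
  using assms by (auto simp: CC_def compactin_subtopology closed_subset compact_imp_closed)
 ultimately show ?thesis unfolding SS_def openin_transport openin_Alexandroff_compactification
  by (auto simp: CC_def pt_def infp_def)
qed

lemma homeo_pt: "homeomorphic_map (top_of_set C) (subtopology SS (pt ` C)) pt"
proof (rule bijective_open_imp_homeomorphic_map)
 have ts: "topspace (subtopology SS (pt ` C)) = pt ` C" by (auto simp: topspace_SS)
 have o: "openin SS (pt ` C)" using openin_pt [of C] by simp
 have "continuous_map (top_of_set C) SS pt"
  using continuous_map_compose [OF continuous_map_Some [of CC] homeomorphic_imp_continuous_map [OF homeo_e]]
  by (simp add: CC_def pt_def [abs_def] o_def)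
 then show "continuous_map (top_of_set C) (subtopology SS (pt ` C)) pt"
  by (auto simp: continuous_map_in_subtopology)
 show "open_map (top_of_set C) (subtopology SS (pt ` C)) pt"
  unfolding open_map_def openin_open_subtopology [OF o]
  using openin_pt by (metis image_mono openin_imp_subset)
 show "pt ` topspace (top_of_set C) = topspace (subtopology SS (pt ` C))" unfolding ts by simp
qed (use inj_pt in \<open>auto simp: inj_on_def\<close>)

lemma continuous_pt: "continuous_map (top_of_set C) SS pt"
 using homeomorphic_imp_continuous_map [OF homeo_pt] continuous_map_in_subtopology by blast

lemma continuous_pc: "continuous_map (subtopology SS (pt ` C)) (top_of_set C) pc"
proof -
 obtain g where g: "homeomorphic_maps (top_of_set C) (subtopology SS (pt ` C)) pt g"
  using homeo_pt homeomorphic_map_maps by blast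
 then have "g (pt q) = q" if "q \<in> C" for q using that by (auto simp: homeomorphic_maps_def)
 then have "g p = pc p" if "p \<in> topspace (subtopology SS (pt ` C))" for p using that by (auto simp: topspace_SS)
 then show ?thesis using g continuous_map_eq unfolding homeomorphic_maps_def by metis
qed

subsection \<open>Charts at finite points\<close>

text \<open>\<open>m\<close> is the ramification index of the projection to \<open>x\<close> at the
  centre of the chart. For \<open>m = 1\<close> the function \<open>h\<close> is a branch of
  \<open>y\<close> and the coordinate is \<open>x - a\<close>; for \<open>m = 2\<close> the centre
  is a branch point and the coordinate \<open>z\<close> satisfies \<open>x = a + z^2\<close>,
  \<open>y = z * h x\<close>.\<close>

definition fin_data :: "nat => complex => real => (complex => complex) => bool" where
 "fin_data m a r h \<longleftrightarrow> r > 0 \<and> (m = 1 \<or> m = 2) \<and> h holomorphic_on ball a r \<and>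
   (\<forall>x\<in>ball a r. h x \<noteq> 0 \<and> cf x = (x - a) ^ (m - 1) * (h x)\<^sup>2)"

definition Vd :: "nat => real => complex set" where "Vd m r = ball 0 (root m r)"
definition Xd :: "nat => complex => complex => complex" where "Xd m a z = a + z ^ m"
definition Yd :: "nat => complex => (complex => complex) => complex => complex" where
 "Yd m a h z = z ^ (m - 1) * h (a + z ^ m)"
definition phid :: "nat => complex => (complex => complex) => complex => complex \<times> complex" where
 "phid m a h z = (Xd m a z, Yd m a h z)"
definition psid :: "nat => complex => (complex => complex) => complex \<times> complex => complex" where
 "psid m a h q = (if m = 1 then fst q - a else snd q / h (fst q))"
definition fchart :: "nat => complex => real => (complex => complex) => point chart" where
 "fchart m a r h = ((pt \<circ> phid m a h) ` Vd m r, psid m a h \<circ> pc)"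

context
 fixes m a r h assumes fd: "fin_data m a r h"
begin

lemma fd_simps: "r > 0" "m = 1 \<or> m = 2" "h holomorphic_on ball a r"
 "\<And>x. x \<in> ball a r ==> h x \<noteq> 0" "\<And>x. x \<in> ball a r ==> cf x = (x - a) ^ (m - 1) * (h x)\<^sup>2"
 using fd by (auto simp: fin_data_def)

lemma open_Vd: "open (Vd m r)" "0 \<in> Vd m r" "convex (Vd m r)" using fd_simps by (auto simp: Vd_def)

lemma Xd_ball: "z \<in> Vd m r \<longleftrightarrow> Xd m a z \<in> ball a r"
proof -
 have "dist a (a + z ^ m) = cmod z ^ m" by (simp add: dist_norm norm_power)
 moreover have "cmod z < root m r \<longleftrightarrow> cmod z ^ m < r"
  using fd_simps(1,2) by (metis norm_ge_zero real_root_less_iff real_root_power_cancel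
    less_numeral_extra(1) zero_less_numeral)
 ultimately show ?thesis by (simp add: Vd_def Xd_def)
qed

lemma phid_in_C: "z \<in> Vd m r ==> phid m a h z \<in> C"
proof -
 assume "z \<in> Vd m r"
 then have "Xd m a z \<in> ball a r" using Xd_ball by blast
 then have "cf (Xd m a z) = (z ^ m) ^ (m - 1) * (h (Xd m a z))\<^sup>2" using fd_simps(5) by (simp add: Xd_def)
 also have "\<dots> = (Yd m a h z)\<^sup>2" using fd_simps(2) by (auto simp: Yd_def Xd_def power_mult_distrib power2_eq_square)
 finally show ?thesis by (simp add: phid_def in_C)
qed

lemma psid_phid: "z \<in> Vd m r ==> psid m a h (phid m a h z) = z"
 using Xd_ball fd_simps(2,4) by (auto simp: psid_def phid_def Yd_def Xd_def)

lemma h_cont: "continuous_on (ball a r) h" using fd_simps(3) holomorphic_on_imp_continuous_on by blast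

lemma Xd_hol: "Xd m a holomorphic_on A" unfolding Xd_def [abs_def] by (intro holomorphic_intros)

lemma hX_hol: "(\<lambda>z. h (Xd m a z)) holomorphic_on Vd m r"
 by (rule holomorphic_on_compose_fun [OF Xd_hol fd_simps(3)]) (simp add: Xd_ball)

lemma Yd_hol: "Yd m a h holomorphic_on Vd m r"
 using hX_hol unfolding Yd_def [abs_def] Xd_def by (intro holomorphic_intros)

lemma phid_cont: "continuous_on (Vd m r) (phid m a h)" unfolding phid_def [abs_def]
 using Xd_hol Yd_hol by (intro continuous_intros holomorphic_on_imp_continuous_on)

lemma phid_image: "phid m a h ` Vd m r = {(x, y) \<in> C. x \<in> ball a r \<and> (m = 1 \<longrightarrow> y = h x)}"
proof
 show "phid m a h ` Vd m r \<subseteq> {(x, y) \<in> C. x \<in> ball a r \<and> (m = 1 \<longrightarrow> y = h x)}"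
  using phid_in_C Xd_ball by (auto simp: phid_def Yd_def Xd_def)
 show "{(x, y) \<in> C. x \<in> ball a r \<and> (m = 1 \<longrightarrow> y = h x)} \<subseteq> phid m a h ` Vd m r"
 proof clarify
  fix x y assume xy: "(x, y) \<in> C" "x \<in> ball a r" "m = 1 \<longrightarrow> y = h x"
  define z where "z = psid m a h (x, y)"
  have "Xd m a z = x \<and> Yd m a h z = y"
  proof (cases "m = 1")
   case True
   then show ?thesis using xy by (simp add: z_def psid_def Xd_def Yd_def)
  next
   case False
   then have m: "m = 2" using fd_simps(2) by simp
   have h0: "h x \<noteq> 0" using fd_simps(4) xy by blast
   have "z\<^sup>2 = y\<^sup>2 / (h x)\<^sup>2" by (simp add: z_def psid_def m power_divide)
   also have "\<dots> = x - a" using xy fd_simps(5) [OF xy(2)] h0 by (simp add: in_C m)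
   finally show ?thesis using h0 by (simp add: Xd_def Yd_def m) (simp add: z_def psid_def m)
  qed
  moreover from this have "z \<in> Vd m r" using Xd_ball xy by simp
  ultimately show "(x, y) \<in> phid m a h ` Vd m r" by (metis image_eqI phid_def)
 qed
qed

text \<open>For \<open>m = 1\<close> the points of the curve over the ball satisfy
  \<open>y = h x\<close> or \<open>y = - h x\<close>, and the sign of \<open>Re (y / h x)\<close>
  tells these sheets apart by an open condition. For \<open>m = 2\<close> the chart contains
  everything over the ball.\<close>

lemma openin_phid: "openin (top_of_set C) (phid m a h ` Vd m r)"
proof (cases "m = 1")
 case True
 let ?B = "ball a r \<times> (UNIV :: complex set)"
 have "continuous_on ?B (\<lambda>q. Re (snd q / h (fst q)))"
  using fd_simps(4) by (auto intro!: continuous_intros continuous_on_compose2 [OF h_cont])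
 then have "open (?B \<inter> (\<lambda>q. Re (snd q / h (fst q))) -` {0<..})"
  by (intro continuous_open_preimage) (auto intro: open_Times)
 moreover have "phid m a h ` Vd m r = C \<inter> (?B \<inter> (\<lambda>q. Re (snd q / h (fst q))) -` {0<..})"
 proof -
  have "y = h x \<longleftrightarrow> Re (y / h x) > 0" if "(x, y) \<in> C" "x \<in> ball a r" for x y
  proof -
   have "y\<^sup>2 = (h x)\<^sup>2" using that fd_simps(5) [OF that(2)] by (simp add: in_C True)
   then have "y = h x \<or> y = - h x" by (simp add: power2_eq_iff)
   then show ?thesis using fd_simps(4) [OF that(2)] by auto
  qed
  moreover have "h x \<noteq> 0" if "dist a x < r" for x using fd_simps(4) that by simp
  ultimately show ?thesis unfolding phid_image using True by auto
 qed
 ultimately show ?thesis by (metis openin_open_Int)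
next
 case False
 then have "phid m a h ` Vd m r = C \<inter> (ball a r \<times> UNIV)" unfolding phid_image by auto
 then show ?thesis by (metis open_Times open_UNIV open_ball openin_open_Int)
qed

lemma psid_cont: "continuous_on (phid m a h ` Vd m r) (psid m a h)"
proof (cases "m = 1")
 case True
 then show ?thesis unfolding psid_def [abs_def] by (auto intro!: continuous_intros)
next
 case False
 then show ?thesis unfolding psid_def [abs_def] phid_image using fd_simps(4)
  by (auto intro!: continuous_intros continuous_on_compose2 [OF h_cont])
qed

lemma is_chart_fchart: "is_chart SS (fchart m a r h)" "chart_image (fchart m a r h) = Vd m r"
 "\<And>z. z \<in> Vd m r ==> chart_inv (fchart m a r h) z = pt (phid m a h z)"
proof -
 let ?U = "(pt \<circ> phid m a h) ` Vd m r"
 have U: "?U = pt ` (phid m a h ` Vd m r)" by (simp add: image_comp)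
 have sub: "phid m a h ` Vd m r \<subseteq> C" using phid_in_C by blast
 have c1: "continuous_map (top_of_set (Vd m r)) SS (pt \<circ> phid m a h)"
  using phid_cont phid_in_C by (intro continuous_map_compose [OF _ continuous_pt]) auto
 have o: "openin SS ?U" unfolding U using openin_pt [OF sub] openin_phid by blast
 have "continuous_map (subtopology SS ?U) (top_of_set C) pc"
  using continuous_map_from_subtopology_mono [OF continuous_pc, of ?U] sub unfolding U by blast
 then have "continuous_map (subtopology SS ?U) (top_of_set (phid m a h ` Vd m r)) pc"
  by (auto simp: continuous_map_in_subtopology image_subset_iff)
 then have c2: "continuous_map (subtopology SS ?U) euclidean (psid m a h \<circ> pc)"
  using psid_cont by (intro continuous_map_compose) auto
 have i: "(psid m a h \<circ> pc) ((pt \<circ> phid m a h) z) = z" if "z \<in> Vd m r" for z using psid_phid that by simp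
 note * = chart_from_param [OF open_Vd(1) c1 o c2 i]
 show "is_chart SS (fchart m a r h)" "chart_image (fchart m a r h) = Vd m r"
  unfolding fchart_def using *(1,2) by blast+
 show "chart_inv (fchart m a r h) z = pt (phid m a h z)" if "z \<in> Vd m r" for z
 proof -
  have "chart_inv ((pt \<circ> phid m a h) ` Vd m r, psid m a h \<circ> pc) z = (pt \<circ> phid m a h) z"
   by (rule *(3) [OF _ that])
  then show ?thesis unfolding fchart_def by (rule trans) (rule comp_apply)
 qed
qed

lemma fst_fchart: "fst (fchart m a r h) = pt ` (phid m a h ` Vd m r)" by (simp add: fchart_def image_comp)

text \<open>The double cover given by \<open>w^2 = x\<close>, \<open>w * v = y\<close> is trivial
  over every chart. If \<open>0\<close> is not in the ball, a branch of the square root of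
  \<open>x\<close> is \<open>w\<close>; otherwise the chart coordinate itself is \<open>w\<close>.
  The formula for the derivative says \<open>dw = (v / 2) * eta\<close>, where
  \<open>eta = (m / h) dz\<close> in this coordinate.\<close>

lemma section_fchart:
 obtains w v where "w holomorphic_on Vd m r" "v holomorphic_on Vd m r"
  "\<And>z. z \<in> Vd m r ==> (w z)\<^sup>2 = Xd m a z" "\<And>z. z \<in> Vd m r ==> w z * v z = Yd m a h z"
  "\<And>z. z \<in> Vd m r ==> (v z)\<^sup>2 = cf1 (Xd m a z)"
  "\<And>z. z \<in> Vd m r ==> deriv w z = of_nat m / h (Xd m a z) * v z / 2"
proof (cases "0 \<in> ball a r")
 case False
 obtain W where W: "W holomorphic_on ball a r" "\<And>x. x \<in> ball a r ==> (W x)\<^sup>2 = x"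
  using holomorphic_sqrt_on_ball [of "\<lambda>x. x" a r] False by (metis holomorphic_on_ident)
 define w where "w = (\<lambda>z. W (Xd m a z))"
 have w: "w holomorphic_on Vd m r" unfolding w_def
  by (rule holomorphic_on_compose_fun [OF Xd_hol W(1)]) (simp add: Xd_ball)
 have w2: "(w z)\<^sup>2 = Xd m a z" if "z \<in> Vd m r" for z using W(2) Xd_ball that by (simp add: w_def)
 have w0: "w z \<noteq> 0" if "z \<in> Vd m r" for z using w2 [OF that] False Xd_ball that by fastforce
 show ?thesis
 proof
  show "w holomorphic_on Vd m r" by (rule w)
  show "(\<lambda>z. Yd m a h z / w z) holomorphic_on Vd m r" using w Yd_hol w0 by (intro holomorphic_intros)
  fix z assume z: "z \<in> Vd m r"
  show "(w z)\<^sup>2 = Xd m a z" using w2 z by blast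
  show "w z * (Yd m a h z / w z) = Yd m a h z" using w0 [OF z] by simp
  have "(Yd m a h z)\<^sup>2 = cf (Xd m a z)" using phid_in_C [OF z] by (simp add: phid_def in_C)
  then show "(Yd m a h z / w z)\<^sup>2 = cf1 (Xd m a z)"
   using w2 [OF z] w0 [OF z] by (auto simp: power_divide cf_def)
  have h0: "h (Xd m a z) \<noteq> 0" using fd_simps(4) Xd_ball z by blast
  have "(w has_field_derivative deriv w z) (at z)" using w z open_Vd(1) holomorphic_derivI by blast
  then have "((\<lambda>z. (w z)\<^sup>2) has_field_derivative 2 * w z * deriv w z) (at z)"
   by (auto intro!: derivative_eq_intros)
  moreover have "(Xd m a has_field_derivative of_nat m * z ^ (m - 1)) (at z)"
   unfolding Xd_def [abs_def] by (auto intro!: derivative_eq_intros)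
  then have "((\<lambda>z. (w z)\<^sup>2) has_field_derivative of_nat m * z ^ (m - 1)) (at z)"
   by (rule has_field_derivative_transform_within_open [OF _ open_Vd(1) z]) (use w2 in auto)
  ultimately have "2 * w z * deriv w z = of_nat m * z ^ (m - 1)" by (rule DERIV_unique)
  then show "deriv w z = of_nat m / h (Xd m a z) * (Yd m a h z / w z) / 2"
   using w0 [OF z] h0 by (simp add: Yd_def Xd_def field_simps)
 qed
next
 case True
 \<comment> \<open>Since \<open>cf 0 = 0\<close> and \<open>h\<close> has no zero, the chart is
   branched, and its branch point must be \<open>0\<close>.\<close>
 have m2: "m = 2"
 proof (rule ccontr)
  assume "m \<noteq> 2"
  then have "cf 0 = (h 0)\<^sup>2" using fd_simps(2) fd_simps(5) [OF True] by auto
  then show False using fd_simps(4) [OF True] by (simp add: cf_def)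
 qed
 have a0: "a = 0" using fd_simps(5) [OF True] fd_simps(4) [OF True] by (auto simp: cf_def m2)
 \<comment> \<open>Cancelling \<open>x\<close> in \<open>cf x = x * (h x)^2\<close> gives this away
   from \<open>0\<close>; at \<open>0\<close> it holds by continuity.\<close>
 have hc: "(h x)\<^sup>2 = cf1 x" if x: "x \<in> ball 0 r" for x
 proof -
  have ne: "(h x)\<^sup>2 = cf1 x" if "x \<in> ball 0 r" "x \<noteq> 0" for x
   using fd_simps(5) [of x] that by (simp add: a0 m2 cf_def)
  show ?thesis
  proof (cases "x = 0")
   case True
   have "((\<lambda>x. (h x)\<^sup>2 - cf1 x) \<longlongrightarrow> (h 0)\<^sup>2 - cf1 0) (at 0)"
   proof -
    have "continuous_on (ball 0 r) (\<lambda>x. (h x)\<^sup>2 - cf1 x)"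
     using h_cont cf1_hol holomorphic_on_imp_continuous_on unfolding a0 by (intro continuous_intros) blast+
    then show ?thesis using fd_simps(1) by (simp add: continuous_on_eq_continuous_at continuous_at)
   qed
   moreover have "((\<lambda>x. (h x)\<^sup>2 - cf1 x) \<longlongrightarrow> 0) (at 0)"
   proof (rule tendsto_eventually)
    have "\<forall>\<^sub>F x in at 0. x \<in> ball 0 r - {0}" using fd_simps(1) by (intro eventually_at_in_open) auto
    then show "\<forall>\<^sub>F x in at 0. (h x)\<^sup>2 - cf1 x = 0" by eventually_elim (use ne in auto)
   qed
   ultimately have "(h 0)\<^sup>2 - cf1 0 = 0" using tendsto_unique trivial_limit_at by blast
   then show ?thesis using True by simp
  qed (use ne x in auto)
 qed
 show ?thesis
 proof
  show "(\<lambda>z. z) holomorphic_on Vd m r" by (rule holomorphic_on_ident)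
  show "(\<lambda>z. h (Xd m a z)) holomorphic_on Vd m r" by (rule hX_hol)
  fix z assume z: "z \<in> Vd m r"
  show "z\<^sup>2 = Xd m a z" "z * h (Xd m a z) = Yd m a h z" by (simp_all add: Xd_def Yd_def m2 a0)
  have "Xd m a z \<in> ball 0 r" using Xd_ball z a0 by blast
  then show "(h (Xd m a z))\<^sup>2 = cf1 (Xd m a z)" by (rule hc)
  show "deriv (\<lambda>z. z) z = of_nat m / h (Xd m a z) * h (Xd m a z) / 2"
   using fd_simps(4) Xd_ball z by (simp add: m2)
 qed
qed

end

text \<open>The radius is chosen below the distance to all other roots and punctures. On the small
  ball what remains of \<open>cf\<close> after removal of a possible root at \<open>x\<close> has no
  zero, hence has a square root.\<close>

lemma fin_data_exists:
 assumes C: "(x, y) \<in> C" and ep: "ep > 0"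
 obtains m r h where "fin_data m x r h" "r \<le> ep" "phid m x h 0 = (x, y)"
  "(ball x r - {x}) \<inter> (PX \<union> roots) = {}"
proof -
 have "finite (PX \<union> roots)" using finite_PX finite_roots by blast
 then obtain r0 where r0: "r0 > 0" "\<And>z. z \<in> PX \<union> roots ==> z \<noteq> x ==> dist x z \<ge> r0"
  using finite_set_avoid [of "PX \<union> roots" x] by metis
 define r where "r = min r0 ep"
 have r: "r > 0" "r \<le> ep" "(ball x r - {x}) \<inter> (PX \<union> roots) = {}" using r0 ep by (force simp: r_def)+
 show ?thesis
 proof (cases "x \<in> roots")
  case False
  have "cf z \<noteq> 0" if "z \<in> ball x r" for z using that r(3) False unfolding cf_eq_0 by blast
  then obtain h where h: "h holomorphic_on ball x r" "\<And>z. z \<in> ball x r ==> (h z)\<^sup>2 = cf z"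
   using holomorphic_sqrt_on_ball [OF cf_hol] by metis
  have "y\<^sup>2 = (h x)\<^sup>2" using C h(2) [of x] r by (simp add: in_C)
  \<comment> \<open>The sign selects the branch of the square root that passes through the given
    \<open>y\<close>.\<close>
  then obtain s :: complex where s: "s\<^sup>2 = 1" "y = s * h x"
   by (metis mult_1 mult_minus1 power2_eq_iff power2_minus power_one)
  define h' where "h' = (\<lambda>z. s * h z)"
  have "fin_data 1 x r h'" unfolding fin_data_def
  proof (intro conjI ballI)
   show "h' holomorphic_on ball x r" unfolding h'_def using h by (intro holomorphic_intros)
   fix z assume z: "z \<in> ball x r"
   show "cf z = (z - x) ^ (1 - 1) * (h' z)\<^sup>2" using h(2) [OF z] s by (simp add: h'_def power_mult_distrib)
   show "h' z \<noteq> 0" using h(2) [OF z] \<open>\<And>z. z \<in> ball x r ==> cf z \<noteq> 0\<close> [OF z] s by (auto simp: h'_def)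
  qed (use r in auto)
  then show ?thesis using that r s by (simp add: phid_def Xd_def Yd_def h'_def)
 next
  case True
  then obtain i where i: "i \<le> 2*k" "x = - of_nat i" by (auto simp: roots_def)
  define u where "u = (\<lambda>z::complex. \<Prod>j\<in>{..2*k}-{i}. z + of_nat j)"
  have cfu: "cf z = (z - x) * u z" for z
   unfolding cf_alt u_def i(2) using i(1) by (subst prod.remove [of _ i]) auto
  have u0: "u z \<noteq> 0" if z: "z \<in> ball x r" for z
  proof (cases "z = x")
   case True
   then show ?thesis unfolding u_def i(2) by (auto simp: prod_zero_iff)
  next
   case False
   then have "cf z \<noteq> 0" using z r(3) unfolding cf_eq_0 by blast
   then show ?thesis using cfu by auto
  qed
  have "u holomorphic_on ball x r" unfolding u_def by (intro holomorphic_intros)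
  then obtain h where h: "h holomorphic_on ball x r" "\<And>z. z \<in> ball x r ==> (h z)\<^sup>2 = u z"
   by (rule holomorphic_sqrt_on_ball [OF _ u0]) blast+
  have "fin_data 2 x r h" unfolding fin_data_def
  proof (intro conjI ballI)
   fix z assume z: "z \<in> ball x r"
   show "h z \<noteq> 0" using h(2) [OF z] u0 [OF z] by auto
   show "cf z = (z - x) ^ (2 - 1) * (h z)\<^sup>2" using h(2) [OF z] cfu [of z] by simp
  qed (use r h in auto)
  moreover have "y = 0" using C cfu [of x] by (simp add: in_C)
  ultimately show ?thesis using that [of 2 r h] r by (simp add: phid_def Xd_def Yd_def)
 qed
qed

end

lemma restrict_chart:
 assumes c: "is_chart X c" and W: "openin X W"
 defines "c' \<equiv> (fst c \<inter> W, snd c)"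
 shows "is_chart (subtopology X W) c'" "chart_image c' = snd c ` (fst c \<inter> W)"
  "\<And>z. z \<in> chart_image c' ==> chart_inv c' z = chart_inv c z"
proof -
 have o: "openin X (fst c \<inter> W)" using is_chartD(1) [OF c] W by blast
 define V where "V = snd c ` (fst c \<inter> W)"
 have V: "open V" unfolding V_def by (rule open_chart_image [OF c o]) simp
 have VI: "V \<subseteq> chart_image c" by (auto simp: V_def chart_image_def)
 have im: "chart_inv c ` V = fst c \<inter> W" using is_chartD(8) [OF c] by (force simp: V_def image_iff)
 have c1: "continuous_map (top_of_set V) (subtopology X W) (chart_inv c)"
  using continuous_map_from_subtopology_mono [OF is_chartD(10) [OF c] VI] im
  by (auto simp: continuous_map_in_subtopology)
 have o1: "openin (subtopology X W) (chart_inv c ` V)"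
  unfolding im openin_open_subtopology [OF W] using o by auto
 have "continuous_map (subtopology X (fst c)) euclidean (snd c)"
  using is_chartD(9) [OF c] continuous_map_in_subtopology by blast
 then have "continuous_map (subtopology X (fst c \<inter> W)) euclidean (snd c)"
  by (rule continuous_map_from_subtopology_mono) auto
 then have c2: "continuous_map (subtopology (subtopology X W) (chart_inv c ` V)) euclidean (snd c)"
  unfolding im by (simp add: subtopology_subtopology inf_commute inf_left_commute)
 have i: "snd c (chart_inv c z) = z" if "z \<in> V" for z using is_chartD(7) [OF c] VI that by blast
 note * = chart_from_param [OF V c1 o1 c2 i]
 have A: "is_chart (subtopology X W) c'" "chart_image c' = V" using *(1,2) unfolding im c'_def by blast+
 then show "is_chart (subtopology X W) c'" "chart_image c' = snd c ` (fst c \<inter> W)" by (simp_all add: V_def)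
 have "chart_inv (chart_inv c ` V, snd c) z = chart_inv c z" if "z \<in> V" for z by (rule *(3) [OF _ that])
 moreover note A(2)
 ultimately show "\<And>z. z \<in> chart_image c' ==> chart_inv c' z = chart_inv c z" unfolding c'_def im by blast
qed

lemma riemann_surface_restrict:
 assumes X: "riemann_surface X A" and W: "openin X W" "W \<noteq> {}" "connectedin X W"
 shows "riemann_surface (subtopology X W) (restrict_charts A W)"
proof -
 have ch: "is_chart X c" if "c \<in> A" for c using X that by (auto simp: riemann_surface_def)
 have WX: "W \<subseteq> topspace X" using openin_subset [OF W(1)] .
 have hol: "coord c' id d' holomorphic_on coord_dom c' id d'"
  if c: "c \<in> A" "c' = (fst c \<inter> W, snd c)" and d: "d \<in> A" "d' = (fst d \<inter> W, snd d)" for c d c' d'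
 proof -
  have "coord c id d holomorphic_on coord_dom c id d" using X c d by (auto simp: riemann_surface_def)
  moreover have sub: "coord_dom c' id d' \<subseteq> coord_dom c id d" by (auto simp: coord_dom_def c d)
  moreover have "coord c' id d' z = coord c id d z" if "z \<in> coord_dom c' id d'" for z
  proof -
   have "z \<in> chart_image c'" using that by (auto simp: coord_dom_def chart_image_def)
   then show ?thesis using restrict_chart(3) [OF ch [OF c(1)] W(1)] by (simp add: coord_def c(2) d(2))
  qed
  ultimately show ?thesis using holomorphic_on_subset holomorphic_cong by (metis (no_types, lifting))
 qed
 show ?thesis unfolding riemann_surface_def
 proof (intro conjI ballI)
  show "topspace (subtopology X W) \<noteq> {}" using WX W(2) by auto
  show "connected_space (subtopology X W)" using W(3) by (simp add: connectedin_def)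
  show "Hausdorff_space (subtopology X W)" using X by (simp add: riemann_surface_def Hausdorff_space_subtopology)
  show "is_chart (subtopology X W) c'" if "c' \<in> restrict_charts A W" for c'
   using that restrict_chart(1) [OF ch W(1)] by (auto simp: restrict_charts_def)
  show "topspace (subtopology X W) = \<Union> (fst ` restrict_charts A W)"
   using X WX unfolding riemann_surface_def restrict_charts_def by force
  show "coord c' id d' holomorphic_on coord_dom c' id d'"
   if "c' \<in> restrict_charts A W" "d' \<in> restrict_charts A W" for c' d'
   using that hol by (auto simp: restrict_charts_def)
 qed
qed

lemma riemann_surface_subatlas:
 assumes "riemann_surface X A" "B \<subseteq> A" "topspace X = (\<Union>c\<in>B. fst c)"
 shows "riemann_surface X B" using assms unfolding riemann_surface_def by blast

lemma connectedin_insert_limit: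
 assumes "connectedin X N" "connectedin X C" "N \<inter> C \<noteq> {}" "topspace X = N \<union> C"
 shows "connected_space X" using connectedin_Un [OF assms(1,2,3)] assms(4) by (metis connectedin_topspace)

context curve_ends
begin

subsection \<open>The chart at infinity\<close>

text \<open>Larger than the moduli of all roots (at most \<open>2k\<close>) and of all elements of
  \<open>PX\<close> (at most \<open>d^2\<close>), so that the part \<open>|x| > Rinf\<close> of the
  curve contains neither branch points nor finite punctures.\<close>

definition Rinf :: real where "Rinf = real (2*k+1) + (real d)\<^sup>2"
definition Ninf :: "complex => complex" where "Ninf s = (\<Prod>i=1..2*k. 1 + of_nat i * s)"
definition hinf :: "complex => complex" where
 "hinf = (SOME h. h holomorphic_on ball 0 (1/Rinf) \<and> (\<forall>s\<in>ball 0 (1/Rinf). (h s)\<^sup>2 = Ninf s))"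
definition Vinf :: "complex set" where "Vinf = {z. (cmod z)\<^sup>2 < 1/Rinf}"
definition qinf :: "complex => complex \<times> complex" where "qinf z = (1 / z\<^sup>2, hinf (z\<^sup>2) / z ^ (2*k+1))"
text \<open>The inverse of \<open>qinf\<close>: the coordinate satisfies \<open>x = 1/z^2\<close>
  and \<open>y = hinf (z^2) / z^(2k+1)\<close>, and replacing \<open>z^(2k)\<close> by
  \<open>1/x^k\<close> leaves an equation linear in \<open>1/z\<close>.\<close>

definition sinf :: "complex \<times> complex => complex" where "sinf q = fst q ^ k * hinf (1 / fst q) / snd q"
definition phinf :: "complex => point" where "phinf z = (if z = 0 then infp else pt (qinf z))"
definition psinf :: "point => complex" where "psinf p = (if p = infp then 0 else sinf (pc p))"
definition ichart :: "point chart" where "ichart = (phinf ` Vinf, psinf)"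

lemma Rinf_pos: "Rinf > 0" "Rinf \<ge> real (2*k+1)" "Rinf > (real d)\<^sup>2" by (auto simp: Rinf_def add_pos_nonneg)

lemma Ninf_nz: "s \<in> ball 0 (1/Rinf) ==> Ninf s \<noteq> 0"
proof
 assume s: "s \<in> ball 0 (1/Rinf)" and "Ninf s = 0"
 then obtain i where i: "i \<in> {1..2*k}" "1 + of_nat i * s = 0" by (auto simp: Ninf_def prod_zero_iff)
 then have "of_nat i * s = - 1" by (simp add: eq_neg_iff_add_eq_0 add.commute)
 then have "real i * cmod s = 1" by (metis norm_minus_cancel norm_mult norm_of_nat norm_one)
 moreover have "real i \<le> Rinf" using i Rinf_pos(2) by simp
 then have "real i * cmod s \<le> Rinf * cmod s" by (intro mult_right_mono) auto
 moreover have "Rinf * cmod s < 1" using s Rinf_pos(1) by (simp add: field_simps)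
 ultimately show False by simp
qed

lemma hinf: "hinf holomorphic_on ball 0 (1/Rinf)" "\<And>s. s \<in> ball 0 (1/Rinf) ==> (hinf s)\<^sup>2 = Ninf s"
 "\<And>s. s \<in> ball 0 (1/Rinf) ==> hinf s \<noteq> 0"
proof -
 have "Ninf holomorphic_on ball 0 (1/Rinf)" unfolding Ninf_def by (intro holomorphic_intros)
 then have "\<exists>h. h holomorphic_on ball 0 (1/Rinf) \<and> (\<forall>s\<in>ball 0 (1/Rinf). (h s)\<^sup>2 = Ninf s)"
  by (rule holomorphic_sqrt_on_ball [OF _ Ninf_nz]) blast+
 then have *: "hinf holomorphic_on ball 0 (1/Rinf) \<and> (\<forall>s\<in>ball 0 (1/Rinf). (hinf s)\<^sup>2 = Ninf s)"
  unfolding hinf_def by (rule someI_ex)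
 then show "hinf holomorphic_on ball 0 (1/Rinf)" "\<And>s. s \<in> ball 0 (1/Rinf) ==> (hinf s)\<^sup>2 = Ninf s" by auto
 then show "\<And>s. s \<in> ball 0 (1/Rinf) ==> hinf s \<noteq> 0" using Ninf_nz by fastforce
qed

lemma Vinf_ball: "Vinf = ball 0 (sqrt (1/Rinf))"
 by (auto simp: Vinf_def) (metis abs_norm_cancel real_sqrt_abs real_sqrt_less_iff real_sqrt_divide real_sqrt_one)+

lemma open_Vinf: "open Vinf" "0 \<in> Vinf" using Rinf_pos by (auto simp: Vinf_ball)

lemma Vinf_sq: "z \<in> Vinf ==> z\<^sup>2 \<in> ball 0 (1/Rinf)" by (simp add: Vinf_def norm_power)

lemma cf_inf: "x \<noteq> 0 ==> cf x = x ^ (2*k+1) * Ninf (1/x)"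
proof -
 assume x: "x \<noteq> 0"
 have "x ^ (2*k) * Ninf (1/x) = (\<Prod>i=1..2*k. x) * Ninf (1/x)" by simp
 also have "\<dots> = cf1 x" unfolding Ninf_def cf1_def prod.distrib [symmetric]
  using x by (intro prod.cong) (auto simp: field_simps)
 finally show ?thesis by (simp add: cf_def mult.assoc)
qed

lemma qinf_C: "z \<in> Vinf ==> z \<noteq> 0 ==> qinf z \<in> C"
proof -
 assume z: "z \<in> Vinf" "z \<noteq> 0"
 have "cf (1 / z\<^sup>2) = (1 / z\<^sup>2) ^ (2*k+1) * Ninf (z\<^sup>2)" using z cf_inf [of "1 / z\<^sup>2"] by simp
 also have "\<dots> = (hinf (z\<^sup>2) / z ^ (2*k+1))\<^sup>2"
  using hinf(2) [OF Vinf_sq [OF z(1)]] by (simp add: power_divide power_mult [symmetric] mult.commute del: power_Suc)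
 finally show ?thesis by (simp add: qinf_def in_C)
qed

lemma sinf_props:
 assumes "(x, y) \<in> C" "cmod x > Rinf"
 shows "(sinf (x, y))\<^sup>2 = 1 / x" "sinf (x, y) \<in> Vinf" "sinf (x, y) \<noteq> 0" "qinf (sinf (x, y)) = (x, y)" "y \<noteq> 0"
proof -
 have x0: "x \<noteq> 0" using assms Rinf_pos by auto
 have xb: "1/x \<in> ball 0 (1/Rinf)" using assms(2) Rinf_pos x0 by (simp add: norm_divide frac_less2)
 note cf = cf_inf [OF x0]
 have cf0: "cf x \<noteq> 0" using cf x0 Ninf_nz [OF xb] by simp
 have y2: "y\<^sup>2 = cf x" using assms by (simp add: in_C)
 then show y0: "y \<noteq> 0" using cf0 by auto
 let ?z = "sinf (x, y)"
 have "?z\<^sup>2 = x ^ (2*k) * Ninf (1/x) / cf x"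
  using hinf(2) [OF xb] y2 by (simp add: sinf_def power_divide power_mult_distrib power_mult [symmetric] mult.commute)
 then show z2: "?z\<^sup>2 = 1 / x" unfolding cf using x0 Ninf_nz [OF xb] by simp
 then show z0: "?z \<noteq> 0" using x0 by auto
 have "(cmod ?z)\<^sup>2 = 1 / cmod x" using z2 by (metis norm_divide norm_one norm_power)
 then show "?z \<in> Vinf" using assms(2) Rinf_pos by (simp add: Vinf_def frac_less2)
 have "?z ^ (2*k+1) = ?z * (1/x)^k" by (simp add: z2 power_mult)
 then have "hinf (?z\<^sup>2) / ?z ^ (2*k+1) = hinf (1/x) * x ^ k / ?z" using x0 by (simp add: z2 power_divide)
 also have "\<dots> = y" using y0 x0 hinf(3) [OF xb] by (simp add: sinf_def)
 finally show "qinf ?z = (x, y)" by (simp add: qinf_def z2)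
qed

lemma qinf_big: "z \<in> Vinf ==> z \<noteq> 0 ==> cmod (fst (qinf z)) > Rinf"
 using Rinf_pos by (simp add: Vinf_def qinf_def norm_divide norm_power field_simps)

lemma sinf_qinf: "z \<in> Vinf ==> z \<noteq> 0 ==> sinf (qinf z) = z"
 using hinf(3) [OF Vinf_sq] by (simp add: sinf_def qinf_def power_divide power_mult [symmetric])

lemma phinf_image: "phinf ` Vinf = insert infp (pt ` {(x, y) \<in> C. cmod x > Rinf})"
proof
 show "phinf ` Vinf \<subseteq> insert infp (pt ` {(x, y) \<in> C. cmod x > Rinf})"
  using qinf_C qinf_big by (auto simp: phinf_def case_prod_unfold)
 have "infp \<in> phinf ` Vinf" using open_Vinf by (force simp: phinf_def)
 moreover have "pt (x, y) \<in> phinf ` Vinf" if "(x, y) \<in> C" "cmod x > Rinf" for x y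
  using sinf_props [OF that] by (intro image_eqI [of _ _ "sinf (x, y)"]) (auto simp: phinf_def)
 ultimately show "insert infp (pt ` {(x, y) \<in> C. cmod x > Rinf}) \<subseteq> phinf ` Vinf" by auto
qed

text \<open>The complement is compact because \<open>y^2 = cf x\<close> is bounded where
  \<open>x\<close> is. The bound \<open>b + 1\<close> for \<open>|y|\<close> works since
  \<open>|y| > b + 1\<close> would imply \<open>|y|^2 \<ge> |y| > b\<close>.\<close>

lemma openin_big: "openin SS (insert infp (pt ` {(x, y) \<in> C. cmod x > B}))"
proof -
 have "bounded (cf ` cball 0 B)" by (intro compact_imp_bounded compact_continuous_image cf_cont compact_cball)
 then obtain b where b: "\<And>x. x \<in> cball 0 B ==> cmod (cf x) \<le> b" unfolding bounded_iff by blast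
 define K where "K = {(x, y) \<in> C. cmod x \<le> B}"
 have "cmod y \<le> b + 1" if "(x, y) \<in> K" for x y
 proof (rule ccontr)
  assume n: "\<not> cmod y \<le> b + 1"
  have l: "cmod (y\<^sup>2) \<le> b" using that b [of x] by (simp add: K_def in_C)
  have b0: "b \<ge> 0" by (rule order_trans [OF norm_ge_zero l])
  have "1 * cmod y \<le> cmod y * cmod y" by (rule mult_right_mono) (use n b0 in auto)
  then show False using l n unfolding norm_power unfolding power2_eq_square by linarith
 qed
 then have "K = C \<inter> (cball 0 B \<times> cball 0 (b + 1))" by (auto simp: K_def)
 then have "compact K" using closed_C by (simp add: closed_Int_compact compact_Times)
 from openin_inf [OF this] have "openin SS (insert infp (pt ` (C - K)))" by (auto simp: K_def)
 moreover have "C - K = {(x, y) \<in> C. cmod x > B}" by (auto simp: K_def)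
 ultimately show ?thesis by simp
qed

lemma nbhd_infp:
 assumes "openin SS U" "infp \<in> U"
 obtains B where "\<And>x y. (x, y) \<in> C ==> cmod x > B ==> pt (x, y) \<in> U"
proof -
 let ?W = "topspace (Alexandroff_compactification CC) \<inter> e -` U"
 have "openin (Alexandroff_compactification CC) ?W" using assms(1) by (simp add: SS_def openin_transport)
 moreover have "None \<in> ?W" using assms(2) by (simp add: infp_def)
 ultimately obtain K where K: "compactin CC K" "?W = insert None (Some ` (topspace CC - K))"
  unfolding openin_Alexandroff_compactification by blast
 then have "compact K" by (auto simp: CC_def compactin_subtopology)
 then obtain B where B: "\<And>q. q \<in> K ==> norm q \<le> B" using compact_imp_bounded bounded_iff by metis
 show thesis
 proof
  fix x y assume xy: "(x, y) \<in> C" "cmod x > B"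
  have "cmod x \<le> norm (x, y)" by (metis fst_conv norm_fst_le)
  then have "(x, y) \<notin> K" using B [of "(x, y)"] xy by linarith
  then have "Some (x, y) \<in> ?W" unfolding K(2) using xy by (auto simp: CC_def)
  then show "pt (x, y) \<in> U" by (simp add: pt_def)
 qed
qed

lemma qinf_hol: "(\<lambda>z. fst (qinf z)) holomorphic_on Vinf - {0}" "(\<lambda>z. snd (qinf z)) holomorphic_on Vinf - {0}"
proof -
 have "(\<lambda>z. hinf (z\<^sup>2)) holomorphic_on Vinf"
  by (rule holomorphic_on_compose_fun [OF _ hinf(1) Vinf_sq]) (intro holomorphic_intros)
 then have h: "(\<lambda>z. hinf (z\<^sup>2)) holomorphic_on Vinf - {0}" by (rule holomorphic_on_subset) auto
 show "(\<lambda>z. fst (qinf z)) holomorphic_on Vinf - {0}" by (auto simp: qinf_def intro!: holomorphic_intros)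
 show "(\<lambda>z. snd (qinf z)) holomorphic_on Vinf - {0}" using h by (auto simp: qinf_def intro!: holomorphic_intros)
qed

lemma qinf_cont: "continuous_on (Vinf - {0}) qinf"
 using continuous_on_Pair [OF qinf_hol(1) [THEN holomorphic_on_imp_continuous_on]
   qinf_hol(2) [THEN holomorphic_on_imp_continuous_on]] by simp

lemma sinf_cont: "continuous_on {(x, y) \<in> C. cmod x > Rinf} sinf"
proof -
 have "x \<noteq> 0 \<and> y \<noteq> 0 \<and> 1/x \<in> ball 0 (1/Rinf)" if "(x, y) \<in> C" "cmod x > Rinf" for x y
  using sinf_props(5) [OF that] that Rinf_pos by (auto simp: norm_divide frac_less2)
 then show ?thesis unfolding sinf_def [abs_def]
  by (auto intro!: continuous_intros continuous_on_compose2 [OF holomorphic_on_imp_continuous_on [OF hinf(1)]])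
qed

lemma continuous_phinf: "continuous_map (top_of_set Vinf) SS phinf"
proof -
 have "openin (top_of_set Vinf) {z \<in> Vinf. phinf z \<in> U}" if U: "openin SS U" for U
 proof (subst openin_subopen, intro ballI)
  fix z assume z: "z \<in> {z \<in> Vinf. phinf z \<in> U}"
  show "\<exists>T. openin (top_of_set Vinf) T \<and> z \<in> T \<and> T \<subseteq> {z \<in> Vinf. phinf z \<in> U}"
  proof (cases "z = 0")
   case True
   then have "infp \<in> U" using z by (simp add: phinf_def)
   then obtain B where B: "\<And>x y. (x, y) \<in> C ==> cmod x > B ==> pt (x, y) \<in> U" using nbhd_infp [OF U] by blast
   \<comment> \<open>Then \<open>|w|^2 < r\<close> forces
     \<open>|x| = 1 / |w|^2 > |B| + 1\<close>.\<close>
   define r where "r = 1 / (\<bar>B\<bar> + 1)"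
   have r: "r > 0" by (simp add: r_def add_nonneg_pos)
   have "phinf w \<in> U" if w: "w \<in> Vinf" "cmod w < sqrt r" for w
   proof (cases "w = 0")
    case False
    have "(cmod w)\<^sup>2 < r" using w(2) by (metis norm_ge_zero real_sqrt_abs real_sqrt_less_iff abs_of_nonneg)
    then have "(\<bar>B\<bar> + 1) * (cmod w)\<^sup>2 < 1" by (simp add: r_def field_simps add_nonneg_pos)
    moreover have "cmod (fst (qinf w)) = 1 / (cmod w)\<^sup>2" by (simp add: qinf_def norm_divide norm_power)
    ultimately have "cmod (fst (qinf w)) > B" using False pos_less_divide_eq [of "(cmod w)\<^sup>2" "\<bar>B\<bar> + 1" 1] by auto
    then show ?thesis using B [of "fst (qinf w)" "snd (qinf w)"] qinf_C [OF w(1) False] False by (simp add: phinf_def)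
   qed (use \<open>infp \<in> U\<close> in \<open>simp add: phinf_def\<close>)
   then show ?thesis using True r open_Vinf
    by (intro exI [of _ "Vinf \<inter> ball 0 (sqrt r)"]) (auto simp: openin_open_Int)
  next
   case False
   define W where "W = {q \<in> C. pt q \<in> U}"
   have "pt ` W = U \<inter> pt ` C" by (auto simp: W_def)
   then have "openin SS (pt ` W)" using U openin_pt [of C] by auto
   then have W: "openin (top_of_set C) W" using openin_pt [of W] by (auto simp: W_def)
   have "openin (top_of_set (Vinf - {0})) ((Vinf - {0}) \<inter> qinf -` W)"
    using continuous_openin_preimage [OF qinf_cont _ W] qinf_C by auto
   then have "open ((Vinf - {0}) \<inter> qinf -` W)" using open_Vinf by (meson open_delete openin_open_trans)
   moreover have "z \<in> (Vinf - {0}) \<inter> qinf -` W" using z False qinf_C by (simp add: phinf_def W_def)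
   moreover have "(Vinf - {0}) \<inter> qinf -` W \<subseteq> {z \<in> Vinf. phinf z \<in> U}" by (auto simp: phinf_def W_def)
   ultimately show ?thesis by (intro exI [of _ "(Vinf - {0}) \<inter> qinf -` W"] conjI) (auto intro!: open_subset)
  qed
 qed
 moreover have "phinf \<in> Vinf \<rightarrow> topspace SS" using qinf_C by (auto simp: phinf_def topspace_SS)
 ultimately show ?thesis by (simp add: continuous_map_def)
qed

lemma continuous_psinf: "continuous_map (subtopology SS (phinf ` Vinf)) euclidean psinf"
proof -
 have o: "openin SS (phinf ` Vinf)" unfolding phinf_image by (rule openin_big)
 have ts: "topspace SS \<inter> phinf ` Vinf = phinf ` Vinf" using openin_subset [OF o] by blast
 have "openin SS {p \<in> phinf ` Vinf. psinf p \<in> U}" if U: "open U" for U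
 proof (subst openin_subopen, intro ballI)
  fix p assume p: "p \<in> {p \<in> phinf ` Vinf. psinf p \<in> U}"
  show "\<exists>T. openin SS T \<and> p \<in> T \<and> T \<subseteq> {p \<in> phinf ` Vinf. psinf p \<in> U}"
  proof (cases "p = infp")
   case True
   then have "0 \<in> U" using p by (simp add: psinf_def)
   then obtain r where r: "r > 0" "ball 0 r \<subseteq> U" using U open_contains_ball by blast
   define B where "B = max Rinf (1/r\<^sup>2)"
   have "psinf (pt (x, y)) \<in> U" if xy: "(x, y) \<in> C" "cmod x > B" for x y
   proof -
    have R: "cmod x > Rinf" "1/r\<^sup>2 < cmod x" using xy(2) by (auto simp: B_def)
    have "(cmod (sinf (x, y)))\<^sup>2 = 1 / cmod x"
     using sinf_props(1) [OF xy(1) R(1)] by (metis norm_divide norm_one norm_power)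
    also have "\<dots> < r\<^sup>2" using R(2) Rinf_pos(1) R(1) r(1) less_trans [OF Rinf_pos(1) R(1)] by (simp add: pos_divide_less_eq mult.commute)
    finally have "cmod (sinf (x, y)) < r" using r(1) by (simp add: power2_less_imp_less)
    then show ?thesis using r(2) by (auto simp: psinf_def)
   qed
   moreover have "psinf infp \<in> U" using \<open>0 \<in> U\<close> by (simp add: psinf_def)
   ultimately show ?thesis using True openin_big [of B] unfolding phinf_image
    by (intro exI [of _ "insert infp (pt ` {(x, y) \<in> C. cmod x > B})"]) (auto simp: B_def)
  next
   case False
   let ?D = "{(x, y) \<in> C. cmod x > Rinf}"
   have D: "openin (top_of_set C) ?D"
   proof -
    have "?D = C \<inter> {q. Rinf < cmod (fst q)}" by auto
    moreover have "open {q :: complex \<times> complex. Rinf < cmod (fst q)}" by (intro open_Collect_less continuous_intros)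
    ultimately show ?thesis by (metis openin_open_Int)
   qed
   have "openin (top_of_set ?D) (?D \<inter> sinf -` U)" using continuous_openin_preimage_gen [OF sinf_cont U] .
   then have "openin (top_of_set C) (?D \<inter> sinf -` U)" using D openin_trans by blast
   then have "openin SS (pt ` (?D \<inter> sinf -` U))" using openin_pt [of "?D \<inter> sinf -` U"] by auto
   moreover have "p \<in> pt ` (?D \<inter> sinf -` U)" using p False unfolding phinf_image by (auto simp: psinf_def)
   moreover have "pt ` (?D \<inter> sinf -` U) \<subseteq> {p \<in> phinf ` Vinf. psinf p \<in> U}" unfolding phinf_image by (auto simp: psinf_def)
   ultimately show ?thesis by blast
  qed
 qed
 then show ?thesis unfolding continuous_map_def openin_open_subtopology [OF o] by (auto simp: ts)
qed

lemma is_chart_ichart: "is_chart SS ichart" "chart_image ichart = Vinf"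
 "\<And>z. z \<in> Vinf ==> chart_inv ichart z = phinf z"
proof -
 have o: "openin SS (phinf ` Vinf)" unfolding phinf_image by (rule openin_big)
 have i: "psinf (phinf z) = z" if "z \<in> Vinf" for z using sinf_qinf that by (auto simp: psinf_def phinf_def)
 note * = chart_from_param [OF open_Vinf(1) continuous_phinf o continuous_psinf i]
 show "is_chart SS ichart" "chart_image ichart = Vinf" "\<And>z. z \<in> Vinf ==> chart_inv ichart z = phinf z"
  unfolding ichart_def using *(1,2) apply blast+
  subgoal for z by (rule *(3) [OF _])
  done
qed

lemma fst_ichart: "fst ichart = insert infp (pt ` {(x, y) \<in> C. cmod x > Rinf})"
 by (simp add: ichart_def phinf_image)

subsection \<open>The compact surface and the punctures\<close>

definition P :: "point set" where "P = insert infp (pt ` {(x, y) \<in> C. x \<in> PX})"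

text \<open>One fixed chart centred at each puncture. \<open>has_order_at\<close> speaks of all
  charts of the atlas that contain the point, so with a single such chart the order has to be
  determined only there.\<close>

definition cchart :: "point => point chart" where
 "cchart p = (if p = infp then ichart else (SOME c. \<exists>m r h. c = fchart m (xc p) r h \<and> fin_data m (xc p) r h \<and>
   phid m (xc p) h 0 = pc p \<and> (ball (xc p) r - {xc p}) \<inter> (PX \<union> roots) = {}))"

definition AM :: "point chart set" where
 "AM = {fchart m a r h |m a r h. fin_data m a r h \<and> ball a r \<inter> PX = {}}"

definition AS :: "point chart set" where "AS = AM \<union> cchart ` P"

lemma cchart_fin:
 assumes "p = pt (x, y)" "(x, y) \<in> C"
 obtains m r h where "cchart p = fchart m x r h" "fin_data m x r h" "phid m x h 0 = (x, y)"
   "(ball x r - {x}) \<inter> (PX \<union> roots) = {}"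
proof -
 obtain m r h where "fin_data m x r h" "phid m x h 0 = (x, y)" "(ball x r - {x}) \<inter> (PX \<union> roots) = {}"
  by (rule fin_data_exists [OF assms(2), of 1]) auto
 then have "\<exists>c m r h. c = fchart m (xc p) r h \<and> fin_data m (xc p) r h \<and>
   phid m (xc p) h 0 = pc p \<and> (ball (xc p) r - {xc p}) \<inter> (PX \<union> roots) = {}" unfolding assms(1) by (intro exI [of _ m] exI [of _ r] exI [of _ h] exI [of _ "fchart m x r h"]) auto
 from someI_ex [OF this] show ?thesis using that assms by (auto simp: cchart_def)
qed

lemma P_C: "p \<in> P ==> p = infp \<or> (\<exists>x y. p = pt (x, y) \<and> (x, y) \<in> C \<and> x \<in> PX)" by (auto simp: P_def)

lemma AS_cases:
 assumes "c \<in> AS"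
 shows "c = ichart \<or> (\<exists>m a r h. c = fchart m a r h \<and> fin_data m a r h)"
proof -
 consider "c \<in> AM" | p where "p \<in> P" "c = cchart p" using assms by (auto simp: AS_def)
 then show ?thesis
 proof cases
  case 2
  then consider "p = infp" | x y where "p = pt (x, y)" "(x, y) \<in> C" using P_C by blast
  then show ?thesis
  proof cases
   case 1
   then show ?thesis using 2 by (simp add: cchart_def)
  next
   case (2 x y)
   then show ?thesis using cchart_fin \<open>c = cchart p\<close> by metis
  qed
 qed (auto simp: AM_def)
qed

lemma AS_chart: "c \<in> AS ==> is_chart SS c" using AS_cases is_chart_fchart(1) is_chart_ichart(1) by blast

lemma coords_hol:
 assumes "c \<in> AS"
 shows "open {z \<in> chart_image c. chart_inv c z \<noteq> infp}"
  "(xc \<circ> chart_inv c) holomorphic_on {z \<in> chart_image c. chart_inv c z \<noteq> infp}"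
  "(yc \<circ> chart_inv c) holomorphic_on {z \<in> chart_image c. chart_inv c z \<noteq> infp}"
proof -
 have "open {z \<in> chart_image c. chart_inv c z \<noteq> infp} \<and>
  (xc \<circ> chart_inv c) holomorphic_on {z \<in> chart_image c. chart_inv c z \<noteq> infp} \<and>
  (yc \<circ> chart_inv c) holomorphic_on {z \<in> chart_image c. chart_inv c z \<noteq> infp}" using AS_cases [OF assms]
 proof
  assume c: "c = ichart"
  have e: "{z \<in> chart_image c. chart_inv c z \<noteq> infp} = Vinf - {0}" by (auto simp: c is_chart_ichart phinf_def)
  have "(xc \<circ> chart_inv c) z = fst (qinf z)" "(yc \<circ> chart_inv c) z = snd (qinf z)" if "z \<in> Vinf - {0}" for z
   using that by (auto simp: c is_chart_ichart phinf_def xc_def yc_def)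
  then show ?thesis unfolding e using qinf_hol open_Vinf holomorphic_cong by (metis (no_types, lifting) open_delete)
 next
  assume "\<exists>m a r h. c = fchart m a r h \<and> fin_data m a r h"
  then obtain m a r h where c: "c = fchart m a r h" "fin_data m a r h" by blast
  note f = is_chart_fchart [OF c(2)]
  have e: "{z \<in> chart_image c. chart_inv c z \<noteq> infp} = Vd m r" by (auto simp: c(1) f)
  have "(xc \<circ> chart_inv c) z = Xd m a z" "(yc \<circ> chart_inv c) z = Yd m a h z" if "z \<in> Vd m r" for z
   using that by (auto simp: c(1) f phid_def)
  then show ?thesis unfolding e using open_Vd [OF c(2)] Xd_hol [OF c(2)] Yd_hol [OF c(2)] holomorphic_cong
   by (metis (no_types, lifting))
 qed
 then show "open {z \<in> chart_image c. chart_inv c z \<noteq> infp}"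
  "(xc \<circ> chart_inv c) holomorphic_on {z \<in> chart_image c. chart_inv c z \<noteq> infp}"
  "(yc \<circ> chart_inv c) holomorphic_on {z \<in> chart_image c. chart_inv c z \<noteq> infp}" by blast+
qed

text \<open>The functions \<open>x\<close> and \<open>y\<close> are holomorphic in every chart away
  from infinity, and each chart coordinate is a holomorphic expression in them; the chart at
  infinity meets itself only in the identity.\<close>

lemma AS_transition:
 assumes c: "c \<in> AS" and b: "b \<in> AS"
 shows "coord c id b holomorphic_on coord_dom c id b"
proof -
 note cc = AS_chart [OF c]
 let ?D = "coord_dom c id b"
 have D: "?D = {z \<in> chart_image c. chart_inv c z \<in> fst b}" using coord_dom_eq [OF cc, of id b] by simp
 have oD: "open ?D" using coord_dom_open AS_chart c b by blast
 show ?thesis using AS_cases [OF b]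
 proof
  assume "\<exists>m a r h. b = fchart m a r h \<and> fin_data m a r h"
  then obtain m a r h where b: "b = fchart m a r h" "fin_data m a r h" by blast
  have nb: "chart_inv c z \<noteq> infp \<and> xc (chart_inv c z) \<in> ball a r" if "z \<in> ?D" for z
   using that unfolding D unfolding b(1) fst_fchart [OF b(2)] phid_image [OF b(2)] by auto
  have sub: "?D \<subseteq> {z \<in> chart_image c. chart_inv c z \<noteq> infp}" using nb D by blast
  have X: "(xc \<circ> chart_inv c) holomorphic_on ?D" "(yc \<circ> chart_inv c) holomorphic_on ?D"
   using coords_hol [OF c] sub holomorphic_on_subset by blast+
  have H: "(\<lambda>z. h (xc (chart_inv c z))) holomorphic_on ?D"
   using holomorphic_on_compose_fun [OF X(1) fd_simps(3) [OF b(2)]] nb by simp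
  have "(\<lambda>z. if m = 1 then xc (chart_inv c z) - a else yc (chart_inv c z) / h (xc (chart_inv c z))) holomorphic_on ?D"
   using X H fd_simps(4) [OF b(2)] nb by (cases "m = 1") (auto simp: o_def intro!: holomorphic_intros)
  then show ?thesis
   by (rule holomorphic_transform) (auto simp: coord_def b(1) fchart_def psid_def xc_def yc_def)
 next
  assume b: "b = ichart"
  show ?thesis
  proof (cases "c = ichart")
   case True
   have "(\<lambda>z. z) holomorphic_on ?D" by (rule holomorphic_on_ident)
   then show ?thesis
    by (rule holomorphic_transform) (use is_chartD(7) [OF cc] D in \<open>auto simp: coord_def b True\<close>)
  next
   case False
   then obtain m a r h where cf: "c = fchart m a r h" "fin_data m a r h" using AS_cases [OF c] by blast
   have ne: "chart_inv c z \<noteq> infp" if "z \<in> ?D" for z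
    using that unfolding D unfolding cf(1) is_chart_fchart(2) [OF cf(2)] by (auto simp: is_chart_fchart(3) [OF cf(2)])
   have nb: "(xc (chart_inv c z), yc (chart_inv c z)) \<in> C \<and> cmod (xc (chart_inv c z)) > Rinf" if "z \<in> ?D" for z
    using that ne [OF that] unfolding D unfolding b fst_ichart by auto
   have sub: "?D \<subseteq> {z \<in> chart_image c. chart_inv c z \<noteq> infp}" using ne D by blast
   have X: "(xc \<circ> chart_inv c) holomorphic_on ?D" "(yc \<circ> chart_inv c) holomorphic_on ?D"
    using coords_hol [OF c] sub holomorphic_on_subset by blast+
   have nz: "xc (chart_inv c z) \<noteq> 0" "yc (chart_inv c z) \<noteq> 0" "1 / xc (chart_inv c z) \<in> ball 0 (1/Rinf)" if "z \<in> ?D" for z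
    using nb [OF that] sinf_props(5) Rinf_pos by (auto simp: norm_divide frac_less2)
   have I: "(\<lambda>z. 1 / xc (chart_inv c z)) holomorphic_on ?D" using X nz by (auto simp: o_def intro!: holomorphic_intros)
   have H: "(\<lambda>z. hinf (1 / xc (chart_inv c z))) holomorphic_on ?D"
    by (rule holomorphic_on_compose_fun [OF I hinf(1) nz(3)])
   have "(\<lambda>z. xc (chart_inv c z) ^ k * hinf (1 / xc (chart_inv c z)) / yc (chart_inv c z)) holomorphic_on ?D"
    using X H nz by (auto simp: o_def intro!: holomorphic_intros)
   then show ?thesis
    by (rule holomorphic_transform) (use ne in \<open>auto simp: coord_def b ichart_def psinf_def sinf_def xc_def yc_def\<close>)
  qed
 qed
qed

lemma AM_cover: "pt ` {(x, y) \<in> C. x \<notin> PX} = (\<Union>c\<in>AM. fst c)"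
proof
 show "(\<Union>c\<in>AM. fst c) \<subseteq> pt ` {(x, y) \<in> C. x \<notin> PX}"
 proof
  fix p assume "p \<in> (\<Union>c\<in>AM. fst c)"
  then obtain m a r h where f: "p \<in> fst (fchart m a r h)" "fin_data m a r h" "ball a r \<inter> PX = {}"
   unfolding AM_def by blast
  obtain q where q: "p = pt q" "q \<in> C" "fst q \<in> ball a r"
   using f(1) unfolding fst_fchart [OF f(2)] phid_image [OF f(2)] by auto
  have "fst q \<notin> PX" using f(3) q(3) by blast
  then show "p \<in> pt ` {(x, y) \<in> C. x \<notin> PX}" using q(1,2) by (cases q) auto
 qed
 show "pt ` {(x, y) \<in> C. x \<notin> PX} \<subseteq> (\<Union>c\<in>AM. fst c)"
 proof
  fix p assume "p \<in> pt ` {(x, y) \<in> C. x \<notin> PX}"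
  then obtain x y where xy: "(x, y) \<in> C" "x \<notin> PX" and p: "p = pt (x, y)" by auto
  obtain m r h where f: "fin_data m x r h" "phid m x h 0 = (x, y)" "(ball x r - {x}) \<inter> (PX \<union> roots) = {}"
   by (rule fin_data_exists [OF xy(1), of 1]) auto
  have "ball x r \<inter> PX = {}" using xy(2) f(3) by blast
  then have "fchart m x r h \<in> AM" using f(1) unfolding AM_def by blast
  moreover have "pt (x, y) \<in> fst (fchart m x r h)"
   unfolding fst_fchart [OF f(1)] using f(2) open_Vd(2) [OF f(1)] by (metis image_eqI)
  ultimately show "p \<in> (\<Union>c\<in>AM. fst c)" unfolding p by blast
 qed
qed

text \<open>At infinity this is the choice of \<open>Rinf\<close>. At a finite puncture the ball
  contains no other element of \<open>PX\<close>, and over its centre the chart has only one point: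
  for \<open>m = 1\<close> it lies on one sheet, for \<open>m = 2\<close> the sheets meet.\<close>

lemma cchart_self: "p \<in> P ==> p \<in> fst (cchart p)" "p \<in> P ==> fst (cchart p) \<inter> P = {p}"
proof -
 assume p: "p \<in> P"
 have "p \<in> fst (cchart p) \<and> fst (cchart p) \<inter> P = {p}"
 proof (cases "p = infp")
  case True
  have "x \<notin> PX" if "cmod x > Rinf" for x using PX_real [of x] that Rinf_pos(3) by (auto simp: cmod_eq_Re)
  then show ?thesis using True by (auto simp: cchart_def fst_ichart P_def)
 next
  case False
  then obtain x y where xy: "p = pt (x, y)" "(x, y) \<in> C" "x \<in> PX" using P_C [OF p] by blast
  obtain m r h where f: "cchart p = fchart m x r h" "fin_data m x r h" "phid m x h 0 = (x, y)"
   "(ball x r - {x}) \<inter> (PX \<union> roots) = {}" using cchart_fin [OF xy(1,2)] by metis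
  have 1: "p \<in> fst (cchart p)"
   unfolding f(1) unfolding fst_fchart [OF f(2)] xy(1) using f(3) open_Vd(2) [OF f(2)] by (metis image_eqI)
  moreover have "q = p" if "q \<in> fst (cchart p)" "q \<in> P" for q
  proof -
   have "q \<in> pt ` {(x', y') \<in> C. x' \<in> ball x r \<and> (m = 1 \<longrightarrow> y' = h x')}"
    using that(1) unfolding f(1) unfolding fst_fchart [OF f(2)] phid_image [OF f(2)] .
   then obtain q' where q': "q = pt q'" "q' \<in> {(x', y') \<in> C. x' \<in> ball x r \<and> (m = 1 \<longrightarrow> y' = h x')}" by blast
   obtain x' y' where e: "q' = (x', y')" by (cases q')
   have q: "q = pt (x', y')" "(x', y') \<in> C" "x' \<in> ball x r" "m = 1 \<longrightarrow> y' = h x'" using q' unfolding e by auto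
   then have "x' \<in> PX" using that(2) by (auto simp: P_def)
   then have x: "x' = x" using f(4) q(3) by blast
   have "y' = y"
   proof (cases "m = 1")
    case True
    then show ?thesis using q x f(3) by (simp add: phid_def Xd_def Yd_def)
   next
    case False
    then have "cf x = 0" using fd_simps(2,5) [OF f(2)] q(3) x by auto
    then show ?thesis using q(2) xy(2) x by (simp add: in_C)
   qed
   then show ?thesis using q xy x by simp
  qed
  ultimately show ?thesis using p by blast
 qed
 then show "p \<in> fst (cchart p)" "fst (cchart p) \<inter> P = {p}" by blast+
qed

lemma topspace_minus_P: "topspace SS - P = pt ` {(x, y) \<in> C. x \<notin> PX}" by (auto simp: topspace_SS P_def)

lemma AS_cover: "topspace SS = (\<Union>c\<in>AS. fst c)"
proof
 have "topspace SS = (topspace SS - P) \<union> P" by (auto simp: topspace_SS P_def)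
 also have "\<dots> \<subseteq> (\<Union>c\<in>AS. fst c)" unfolding topspace_minus_P AM_cover using cchart_self(1) by (auto simp: AS_def)
 finally show "topspace SS \<subseteq> (\<Union>c\<in>AS. fst c)" .
 show "(\<Union>c\<in>AS. fst c) \<subseteq> topspace SS" using is_chartD(2) [OF AS_chart] by blast
qed

lemma unique_chart: "p \<in> P ==> c \<in> AS ==> p \<in> fst c ==> c = cchart p"
proof -
 assume p: "p \<in> P" "c \<in> AS" "p \<in> fst c"
 have "c \<notin> AM" using p AM_cover topspace_minus_P by blast
 then obtain p' where p': "p' \<in> P" "c = cchart p'" using p(2) by (auto simp: AS_def)
 then show ?thesis using cchart_self(2) [OF p'(1)] p by auto
qed

lemma finite_P: "finite P" and card_P: "card P = Suc d"
proof -
 \<comment> \<open>A bijection from the poles of \<open>gg\<close> to the finite punctures: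
   \<open>r\<close> and \<open>- r\<close> give the two points over \<open>r^2\<close>, and
   \<open>r = 0\<close> gives the branch point. Injectivity uses that \<open>cf1\<close> does not
   vanish on \<open>PX\<close>.\<close>
 define v where "v = (\<lambda>r. (r\<^sup>2, r * csqrt (cf1 (r\<^sup>2))))"
 have "{(x, y) \<in> C. x \<in> PX} = v ` RHO"
 proof
  show "v ` RHO \<subseteq> {(x, y) \<in> C. x \<in> PX}" by (auto simp: v_def in_C PX_def cf_def power_mult_distrib)
  show "{(x, y) \<in> C. x \<in> PX} \<subseteq> v ` RHO"
  proof clarify
   fix x y assume xy: "(x, y) \<in> C" "x \<in> PX"
   then obtain r where r: "r \<in> RHO" "x = r\<^sup>2" by (auto simp: PX_def)
   have "y\<^sup>2 = (r * csqrt (cf1 (r\<^sup>2)))\<^sup>2" using xy r by (simp add: in_C cf_def power_mult_distrib)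
   then have "y = r * csqrt (cf1 (r\<^sup>2)) \<or> y = (- r) * csqrt (cf1 (r\<^sup>2))" by (auto simp: power2_eq_iff)
   then have "(x, y) = v r \<or> (x, y) = v (- r)" by (auto simp: v_def r)
   then show "(x, y) \<in> v ` RHO" using r RHO_uminus by blast
  qed
 qed
 moreover have inj: "inj_on v RHO"
 proof (rule inj_onI)
  fix r s assume r: "r \<in> RHO" and s: "s \<in> RHO" and e: "v r = v s"
  have sq: "r\<^sup>2 = s\<^sup>2" using e by (simp only: v_def prod.inject)
  have "r * csqrt (cf1 (s\<^sup>2)) = s * csqrt (cf1 (s\<^sup>2))" using e by (simp only: v_def prod.inject sq)
  moreover have "cf1 (s\<^sup>2) \<noteq> 0" using cf1_PX s by (auto simp: PX_def)
  ultimately show "r = s" by (simp del: csqrt.simps)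
 qed
 moreover have "card RHO = d"
  unfolding RHO_def using card_image [OF inj_on_subset [OF inj_rho subset_UNIV], of "{..<d}"] by simp
 ultimately have E: "card {(x, y) \<in> C. x \<in> PX} = d" "finite {(x, y) \<in> C. x \<in> PX}"
  using finite_RHO card_image [OF inj] by auto
 have "infp \<notin> pt ` {(x, y) \<in> C. x \<in> PX}" by auto
 then show "finite P" "card P = Suc d"
  unfolding P_def using card_image [OF inj_on_subset [OF inj_pt subset_UNIV], of "{(x, y) \<in> C. x \<in> PX}"] E by auto
qed

lemma P_sub: "P \<subseteq> topspace SS" by (auto simp: P_def topspace_SS)

end

section \<open>The compact surface: connectedness and genus\<close>

context curve_ends
begin

text \<open>The strip over the whole real line contains all \<open>2k + 1\<close> roots, which
  yields rank \<open>2k\<close>.\<close>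

lemma curve_homology:
 "H1 (top_of_set C) \<cong> free_Abelian_group {..<2 * k}" "hom_flip cf UNIV" "path_connected C"
proof -
 define R where "R = (\<lambda>i. - real i) ` {..2*k}"
 have inj: "inj_on (\<lambda>i. - real i) {..2*k}" by (auto simp: inj_on_def)
 have "(\<Prod>r\<in>R. x - complex_of_real r) = cf x" for x unfolding R_def cf_alt by (subst prod.reindex [OF inj]) simp
 then have eq: "(\<lambda>x. \<Prod>r\<in>R. x - complex_of_real r) = cf" by auto
 have "card (R \<inter> UNIV) = Suc (2*k)" unfolding R_def using card_image [OF inj] by simp
 moreover have "finite R" by (simp add: R_def)
 moreover have "{x. Re x \<in> UNIV} = UNIV" by simp
 ultimately have "H1 (top_of_set (sqrt_curve cf UNIV)) \<cong> free_Abelian_group {..<2 * k} \<and>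
   hom_flip cf UNIV \<and> path_connected (sqrt_curve cf UNIV)"
  using strip_homology [of R UNIV "2*k"] unfolding eq by simp
 then show "H1 (top_of_set C) \<cong> free_Abelian_group {..<2 * k}" "hom_flip cf UNIV" "path_connected C"
  by (auto simp: C_def)
qed

lemma connectedin_pt_C: "connectedin SS (pt ` C)"
proof (rule connectedin_continuous_map_image [OF continuous_pt])
 show "connectedin (top_of_set C) C"
  using path_connected_imp_connected [OF curve_homology(3)] by (simp add: connectedin_subtopology)
qed

lemma homeomorphic_ichart: "subtopology SS (fst ichart) homeomorphic_space top_of_set Vinf"
 using is_chart_ichart(1,2) homeomorphic_map_imp_homeomorphic_space unfolding is_chart_def by metis

lemma path_connected_ichart: "path_connected_space (subtopology SS (fst ichart))"
proof -
 have "path_connected Vinf" by (simp add: Vinf_ball convex_imp_path_connected)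
 then show ?thesis
  using homeomorphic_path_connected_space [OF homeomorphic_ichart] by (simp add: path_connected_space_top_of_set)
qed

lemma connected_SS: "connected_space SS"
proof (rule connectedin_insert_limit)
 show "connectedin SS (fst ichart)"
  using path_connected_imp_connected_space [OF path_connected_ichart] is_chartD(2) [OF is_chart_ichart(1)]
  by (simp add: connectedin_def)
 show "connectedin SS (pt ` C)" by (rule connectedin_pt_C)
 have "Vinf - {0} \<noteq> {}"
 proof
  assume "Vinf - {0} = {}"
  then have "Vinf = {0}" using open_Vinf by blast
  then show False using open_Vinf(1) by (metis not_open_singleton)
 qed
 then obtain z where "z \<in> Vinf" "z \<noteq> 0" by blast
 then have "pt (qinf z) \<in> fst ichart \<inter> pt ` C" using qinf_C by (auto simp: ichart_def phinf_def)
 then show "fst ichart \<inter> pt ` C \<noteq> {}" by blast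
 show "topspace SS = fst ichart \<union> pt ` C" unfolding fst_ichart topspace_SS by auto
qed

lemma riemann_surface_SS: "riemann_surface SS AS" unfolding riemann_surface_def
proof (intro conjI ballI)
 show "topspace SS \<noteq> {}" by (simp add: topspace_SS)
qed (rule connected_SS Hausdorff_SS AS_chart AS_cover AS_transition; assumption)+

text \<open>The affine curve is capped off by the chart disc at infinity, and
  \<open>homology_cap_disc\<close> applies to the sheet exchange. On the punctured disc that
  involution is \<open>z -> - z\<close>, which is homotopic to the identity by rotation.\<close>

lemma genus: "has_genus SS k" unfolding has_genus_def
proof (rule homology_cap_disc)
 let ?D = "fst ichart" and ?C = "pt ` C"
 let ?V0 = "Vinf - {0}"
 show "openin SS ?C" using openin_pt [of C] by simp
 show "openin SS ?D" using is_chartD(1) [OF is_chart_ichart(1)] .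
 show "?C \<union> ?D = topspace SS" unfolding fst_ichart topspace_SS by auto
 show "path_connected_space (subtopology SS ?D)" by (rule path_connected_ichart)
 have "contractible_space (top_of_set Vinf)" by (simp add: Vinf_ball convex_imp_contractible)
 then have "contractible_space (subtopology SS ?D)"
  using homeomorphic_ichart homeomorphic_imp_homotopy_equivalent_space homotopy_equivalent_space_contractibility by blast
 then have "trivial_group (reduced_homology_group 1 (subtopology SS ?D))"
  by (rule trivial_reduced_homology_group_contractible_space)
 then show "carrier (H1 (subtopology SS ?D)) = {\<one>\<^bsub>H1 (subtopology SS ?D)\<^esub>}"
  by (simp add: un_reduced_homology_group trivial_group_def)
 have A: "?D \<inter> ?C = phinf ` ?V0"
 proof (intro equalityI subsetI)
  fix p assume p: "p \<in> ?D \<inter> ?C"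
  then obtain z where z: "z \<in> Vinf" "p = phinf z" unfolding ichart_def fst_conv by blast
  obtain q where "p = pt q" using p by blast
  then have "z \<noteq> 0" using z by (auto simp: phinf_def)
  then show "p \<in> phinf ` ?V0" using z by blast
 next
  fix p assume "p \<in> phinf ` ?V0"
  then obtain z where z: "z \<in> Vinf" "z \<noteq> 0" "p = phinf z" by blast
  then have "p = pt (qinf z)" by (simp add: phinf_def)
  then show "p \<in> ?D \<inter> ?C" using z qinf_C [OF z(1,2)] unfolding ichart_def fst_conv by blast
 qed
 have cph: "continuous_map (top_of_set ?V0) (subtopology SS (?D \<inter> ?C)) phinf"
  using continuous_map_from_subtopology_mono [OF continuous_phinf, of ?V0] unfolding A
  by (auto simp: continuous_map_in_subtopology)
 show "path_connected_space (subtopology SS (?D \<inter> ?C))"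
 proof -
  have "path_connected ?V0" by (simp add: Vinf_ball path_connected_punctured_ball)
  then have "path_connectedin SS (phinf ` ?V0)"
   by (intro path_connectedin_continuous_map_image [OF continuous_map_from_subtopology_mono [OF continuous_phinf, of ?V0]])
     (auto simp: path_connectedin_subtopology)
  then show ?thesis unfolding A by (simp add: path_connectedin_def)
 qed
 have homeoC: "homeomorphic_map (top_of_set C) (subtopology SS ?C) pt" by (rule homeo_pt)
 have "H1 (top_of_set C) \<cong> H1 (subtopology SS ?C)"
  using homeomorphic_space_imp_isomorphic_homology_groups homeomorphic_map_imp_homeomorphic_space [OF homeoC] by blast
 then show "H1 (subtopology SS ?C) \<cong> free_Abelian_group {..<2 * k}"
  using curve_homology(1) by (meson group.iso_sym group_relative_homology_group iso_trans)
 define j where "j = pt \<circ> flip_sheet \<circ> pc"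
 have cflip: "continuous_map (top_of_set C) (top_of_set C) flip_sheet"
  using continuous_map_flip_sheet [of cf UNIV] by (simp add: C_def)
 have cpt: "continuous_map (top_of_set C) (subtopology SS ?C) pt" using homeomorphic_imp_continuous_map [OF homeoC] .
 show cj: "continuous_map (subtopology SS ?C) (subtopology SS ?C) j"
  unfolding j_def by (rule continuous_map_compose [OF continuous_pc continuous_map_compose [OF cflip cpt], unfolded comp_assoc [symmetric]])
 show "homotopic_with (\<lambda>_. True) (subtopology SS (?D \<inter> ?C)) (subtopology SS (?D \<inter> ?C)) j id"
 proof -
  \<comment> \<open>Rotation from angle \<open>pi\<close> down to \<open>0\<close> preserves the
    modulus, hence the punctured disc.\<close>
  have rot: "homotopic_with_canon (\<lambda>_. True) ?V0 ?V0 uminus id" unfolding homotopic_with_def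
  proof (intro exI conjI allI ballI)
   let ?h = "\<lambda>(t::real, z::complex). exp (\<i> * of_real (pi * (1 - t))) * z"
   show "continuous_map (prod_topology (top_of_set {0..1}) (top_of_set ?V0)) (top_of_set ?V0) ?h"
    by (auto simp: case_prod_unfold continuous_map_subtopology_eu prod_topology_subtopology_eu Vinf_def norm_mult
      subtopology_Times [symmetric] intro!: continuous_intros)
   show "?h (0, z) = - z" for z by (simp add: exp_pi_i')
   show "?h (1, z) = id z" for z by simp
  qed auto
  have cps: "continuous_map (subtopology SS (?D \<inter> ?C)) (top_of_set ?V0) psinf"
  proof -
   have "continuous_map (subtopology SS (?D \<inter> ?C)) euclidean psinf"
    using continuous_map_from_subtopology_mono [OF continuous_psinf] by (simp add: ichart_def)
   moreover have "psinf (phinf z) = z" if "z \<in> ?V0" for z using that sinf_qinf by (auto simp: phinf_def psinf_def)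
   ultimately show ?thesis unfolding A by (auto simp: continuous_map_in_subtopology)
  qed
  have "homotopic_with (\<lambda>_. True) (subtopology SS (?D \<inter> ?C)) (subtopology SS (?D \<inter> ?C)) (phinf \<circ> (uminus \<circ> psinf)) (phinf \<circ> (id \<circ> psinf))"
   by (intro homotopic_with_compose_continuous_map_left [OF _ cph] homotopic_with_compose_continuous_map_right [OF rot cps]) auto
  then show ?thesis
  proof (rule homotopic_with_eq)
   fix p assume "p \<in> topspace (subtopology SS (?D \<inter> ?C))"
   then obtain z where z: "z \<in> Vinf" "z \<noteq> 0" "p = phinf z" unfolding A by auto
   have ps: "psinf p = z" using z sinf_qinf by (simp add: phinf_def psinf_def)
   \<comment> \<open>The coordinate \<open>x\<close> is even in \<open>z\<close> and
     \<open>y\<close> is odd, so negating \<open>z\<close> exchanges the sheets.\<close>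
   have "(- z) ^ (2*k+1) = - (z ^ (2*k+1))" by simp
   then show "j p = (phinf \<circ> (uminus \<circ> psinf)) p"
    unfolding o_apply ps using z by (simp add: j_def phinf_def qinf_def del: power_Suc)
   show "id p = (phinf \<circ> (id \<circ> psinf)) p" using ps z by simp
  qed auto
 qed
 show "H1map (subtopology SS ?C) (subtopology SS ?C) j c = inv\<^bsub>H1 (subtopology SS ?C)\<^esub> c"
  if c: "c \<in> carrier (H1 (subtopology SS ?C))" for c
 proof -
  let ?E = "H1map (top_of_set C) (subtopology SS ?C) pt"
  interpret E: group_hom "H1 (top_of_set C)" "H1 (subtopology SS ?C)" ?E by (rule group_hom_induced)
  have "?E \<in> iso (H1 (top_of_set C)) (H1 (subtopology SS ?C))"
   by (rule homeomorphic_map_homology_iso [OF homeoC])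
  then have "?E ` carrier (H1 (top_of_set C)) = carrier (H1 (subtopology SS ?C))" by (simp add: Group.iso_iff)
  then have "c \<in> ?E ` carrier (H1 (top_of_set C))" using c by simp
  then obtain b where "c = ?E b" and "b \<in> carrier (H1 (top_of_set C))" by (rule imageE)
  then have b: "b \<in> carrier (H1 (top_of_set C))" "?E b = c" by simp_all
  have "H1map (subtopology SS ?C) (subtopology SS ?C) j c
    = H1map (top_of_set C) (subtopology SS ?C) (j \<circ> pt) b"
   using hom_induced_compose_empty [OF cpt cj, of 1] b(2) by (metis comp_apply)
  also have "H1map (top_of_set C) (subtopology SS ?C) (j \<circ> pt)
    = H1map (top_of_set C) (subtopology SS ?C) (pt \<circ> flip_sheet)" by (rule hom_induced_eq) (simp add: j_def)
  also have "H1map (top_of_set C) (subtopology SS ?C) (pt \<circ> flip_sheet) b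
    = ?E (H1map (top_of_set C) (top_of_set C) flip_sheet b)"
   using hom_induced_compose_empty [OF cflip cpt, of 1] by (metis comp_apply)
  also have "\<dots> = ?E (inv\<^bsub>H1 (top_of_set C)\<^esub> b)" using curve_homology(2) b(1) by (simp add: hom_flip_def C_def)
  also have "\<dots> = inv\<^bsub>H1 (subtopology SS ?C)\<^esub> c" using b by simp
  finally show ?thesis .
 qed
qed

end

section \<open>Connectedness and choice of signs on double covers\<close>

text \<open>A continuous function \<open>xi\<close> with finitely many values is shown to be
  constant. Its squared deviations from its value at the branch point, summed over both sheets, form
  a continuous function of \<open>x\<close> with finite range, hence a constant; at the branch point
  this constant is \<open>0\<close>, and a vanishing sum of squares has vanishing terms.\<close>

lemma connected_sqrt_curve:
 assumes W: "open W" "connected W" and f: "f holomorphic_on W" and z0: "z0 \<in> W" "f z0 = 0"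
 shows "connected (sqrt_curve f W)"
proof (rule finite_range_constant_imp_connected)
 fix xi :: "complex \<times> complex => real"
 assume xi: "continuous_on (sqrt_curve f W) xi" "finite (xi ` sqrt_curve f W)"
 define c where "c = xi (z0, 0)"
 \<comment> \<open>Symmetric in \<open>y\<close> and \<open>- y\<close>, hence independent of the
   discontinuous choice of \<open>csqrt\<close> in \<open>q\<close>.\<close>
 define F where "F = (\<lambda>x y. (xi (x, y) - c)\<^sup>2 + (xi (x, - y) - c)\<^sup>2)"
 define q where "q = (\<lambda>x. F x (csqrt (f x)))"
 have Fq: "F x y = q x" if "y\<^sup>2 = f x" for x y
 proof -
  have "y\<^sup>2 = (csqrt (f x))\<^sup>2" using that power2_csqrt by metis
  then have "y = csqrt (f x) \<or> y = - csqrt (f x)" unfolding power2_eq_iff .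
  then show ?thesis unfolding q_def F_def by (elim disjE) (simp_all del: csqrt.simps)
 qed
 have cf: "continuous_on W f" using f holomorphic_on_imp_continuous_on by blast
 have "continuous (at a within W) q" if a: "a \<in> W" for a
 proof (cases "f a = 0")
  case False
  have "open (W \<inter> f -` (- {0}))" by (rule continuous_open_preimage [OF cf W(1)]) auto
  moreover have "a \<in> W \<inter> f -` (- {0})" using a False by simp
  ultimately obtain r where r: "r > 0" "ball a r \<subseteq> W \<inter> f -` (- {0})" using open_contains_ball_eq by metis
  have fb: "f holomorphic_on ball a r" by (rule holomorphic_on_subset [OF f]) (use r in blast)
  obtain h where h: "h holomorphic_on ball a r" "\<And>x. x \<in> ball a r ==> (h x)\<^sup>2 = f x"
  proof (rule holomorphic_sqrt_on_ball [OF fb])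
   show "f x \<noteq> 0" if "x \<in> ball a r" for x using that r(2) by blast
  qed blast
  have hc: "continuous_on (ball a r) h" using h(1) holomorphic_on_imp_continuous_on by blast
  have sub: "(\<lambda>x. (x, h x)) ` ball a r \<subseteq> sqrt_curve f W" "(\<lambda>x. (x, - h x)) ` ball a r \<subseteq> sqrt_curve f W"
   using h(2) r(2) by (auto simp: sqrt_curve_def)
  have "continuous_on (ball a r) (\<lambda>x. F x (h x))" unfolding F_def
   by (intro continuous_intros continuous_on_compose2 [OF xi(1)] hc sub)
  then have "continuous_on (ball a r) q" by (rule continuous_on_eq) (use Fq h(2) in simp)
  then have "continuous (at a) q" using r(1) by (simp add: continuous_on_eq_continuous_at)
  then show ?thesis by (rule continuous_at_imp_continuous_at_within)
 next
  case True
  have "((\<lambda>x. cmod (csqrt (f x))) \<longlongrightarrow> 0) (at a within W)"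
  proof -
   have "(f \<longlongrightarrow> 0) (at a within W)" using cf a True by (auto simp: continuous_on_def)
   then have "((\<lambda>x. sqrt (cmod (f x))) \<longlongrightarrow> sqrt (cmod 0)) (at a within W)" by (intro tendsto_intros)
   then show ?thesis by (simp del: csqrt.simps)
  qed
  then have t0: "((\<lambda>x. csqrt (f x)) \<longlongrightarrow> 0) (at a within W)" by (rule tendsto_norm_zero_cancel)
  have ca: "continuous (at (a, 0) within sqrt_curve f W) xi"
   using xi(1) a True by (simp add: continuous_on_eq_continuous_within sqrt_curve_def)
  have lim: "((\<lambda>x. xi (x, s * csqrt (f x))) \<longlongrightarrow> xi (a, 0)) (at a within W)" if s: "s\<^sup>2 = 1" for s
  proof (rule continuous_within_tendsto_compose [OF ca])
   show "\<forall>\<^sub>F x in at a within W. (x, s * csqrt (f x)) \<in> sqrt_curve f W" unfolding eventually_at_filter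
    by (rule always_eventually) (use s in \<open>auto simp: sqrt_curve_def power_mult_distrib simp del: csqrt.simps\<close>)
   have "((\<lambda>x. s * csqrt (f x)) \<longlongrightarrow> s * 0) (at a within W)" by (intro tendsto_intros t0)
   then show "((\<lambda>x. (x, s * csqrt (f x))) \<longlongrightarrow> (a, 0)) (at a within W)"
    by (intro tendsto_Pair tendsto_ident_at) simp
  qed
  have "((\<lambda>x. (xi (x, 1 * csqrt (f x)) - c)\<^sup>2 + (xi (x, (-1) * csqrt (f x)) - c)\<^sup>2) \<longlongrightarrow>
    (xi (a, 0) - c)\<^sup>2 + (xi (a, 0) - c)\<^sup>2) (at a within W)" by (intro tendsto_intros lim) simp_all
  then show ?thesis using True unfolding continuous_within q_def F_def by (simp del: csqrt.simps add: csqrt_0)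
 qed
 then have "continuous_on W q" by (simp add: continuous_on_eq_continuous_within)
 moreover have "finite (q ` W)"
 proof -
  have "q ` W \<subseteq> (\<lambda>(s, t). (s - c)\<^sup>2 + (t - c)\<^sup>2) ` (xi ` sqrt_curve f W \<times> xi ` sqrt_curve f W)"
  proof clarify
   fix x assume x: "x \<in> W"
   have "(x, csqrt (f x)) \<in> sqrt_curve f W" "(x, - csqrt (f x)) \<in> sqrt_curve f W"
    using x by (auto simp: sqrt_curve_def simp del: csqrt.simps)
   then show "q x \<in> (\<lambda>(s, t). (s - c)\<^sup>2 + (t - c)\<^sup>2) ` (xi ` sqrt_curve f W \<times> xi ` sqrt_curve f W)"
    unfolding q_def F_def
    by (intro image_eqI [of _ _ "(xi (x, csqrt (f x)), xi (x, - csqrt (f x)))"]) (auto simp del: csqrt.simps)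
  qed
  then show ?thesis using xi(2) finite_subset by blast
 qed
 ultimately have "q constant_on W" using continuous_finite_range_constant W(2) by blast
 then have "q x = q z0" if "x \<in> W" for x using that z0(1) unfolding constant_on_def by metis
 moreover have "q z0 = 0" by (simp add: q_def F_def z0 c_def)
 ultimately have "q x = 0" if "x \<in> W" for x using that by simp
 then have "F x y = 0" if "(x, y) \<in> sqrt_curve f W" for x y using that Fq by (simp add: sqrt_curve_def)
 then have "xi (x, y) = c" if "(x, y) \<in> sqrt_curve f W" for x y
  using that unfolding F_def by (simp add: sum_power2_eq_zero_iff)
 then show "xi constant_on sqrt_curve f W" unfolding constant_on_def by auto
qed

text \<open>The function \<open>norm (f + g) - norm (f - g)\<close> is \<open>2 * norm g\<close>
  where \<open>f = g\<close> and \<open>- 2 * norm g\<close> where \<open>f = - g\<close>. It has no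
  zero, so by connectedness it does not change sign.\<close>

lemma sign_constant:
 fixes f g :: "'a => 'b::real_normed_vector"
 assumes C: "connectedin X C" and f: "continuous_map (subtopology X C) euclidean f"
  and g: "continuous_map (subtopology X C) euclidean g"
  and e: "\<And>y. y \<in> C ==> f y = g y \<or> f y = - g y" and nz: "\<And>y. y \<in> C ==> g y \<noteq> 0"
 shows "(\<forall>y\<in>C. f y = g y) \<or> (\<forall>y\<in>C. f y = - g y)"
proof (rule ccontr)
 assume "\<not> ?thesis"
 then obtain a b where ab: "a \<in> C" "f a = - g a" "b \<in> C" "f b = g b" using e by metis
 define p where "p = (\<lambda>y. norm (f y + g y) - norm (f y - g y))"
 have "continuous_map (subtopology X C) euclidean p" unfolding p_def
  by (intro continuous_map_diff continuous_map_norm continuous_map_add f g)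
 moreover have "connectedin (subtopology X C) C" using C by (simp add: connectedin_subtopology)
 ultimately have "connected (p ` C)" using connectedin_continuous_map_image connectedin_iff_connected by blast
 moreover have n1: "norm (x + x) = 2 * norm x" for x :: 'b by (simp add: scaleR_2 [symmetric])
 have n2: "norm (- x - x) = 2 * norm x" for x :: 'b using n1 [of "- x"] by simp
 have "p a = - (2 * norm (g a))" "p b = 2 * norm (g b)" by (simp_all add: p_def ab(2,4) n1 n2)
 then have "p a \<le> 0" "0 \<le> p b" by simp_all
 ultimately have "0 \<in> p ` C" using connectedD_interval [of "p ` C" "p a" "p b"] ab(1,3) by blast
 then obtain y where y: "y \<in> C" "p y = 0" by auto
 have "norm (g y + g y) \<noteq> 0" using nz [OF y(1)] by (simp add: scaleR_2 [symmetric])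
 then show False using y(2) e [OF y(1)] by (auto simp: p_def norm_minus_commute)
qed

subsection \<open>Lifting charts to coverings\<close>

definition lifted_charts :: "'b topology => 'a topology => 'a chart set => ('b => 'a) => 'b chart set" where
 "lifted_charts Y X A p = {(V, snd c \<circ> p) |V c. c \<in> A \<and> openin Y V \<and>
   homeomorphic_map (subtopology Y V) (subtopology X (fst c)) p}"

lemma lifted_chart:
 assumes c: "is_chart X c" and V: "openin Y V" and h: "homeomorphic_map (subtopology Y V) (subtopology X (fst c)) p"
 defines "c' \<equiv> (V, snd c \<circ> p)"
 shows "is_chart Y c'" "chart_image c' = chart_image c" "p ` V = fst c"
  "\<And>z. z \<in> chart_image c ==> p (chart_inv c' z) = chart_inv c z"
  "coord_dom c' p d = coord_dom c id d" "\<And>z. z \<in> chart_image c ==> coord c' p d z = coord c id d z"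
proof -
 have ts: "topspace Y \<inter> V = V" "topspace X \<inter> fst c = fst c"
  using openin_subset [OF V] is_chartD(2) [OF c] by auto
 show pV: "p ` V = fst c" using homeomorphic_imp_surjective_map [OF h] by (simp add: ts)
 show im: "chart_image c' = chart_image c"
  unfolding chart_image_def c'_def by (simp add: pV [symmetric] image_image)
 have "homeomorphic_map (subtopology X (fst c)) (top_of_set (chart_image c)) (snd c)"
  using c by (simp add: is_chart_def)
 then have "homeomorphic_map (subtopology Y V) (top_of_set (chart_image c)) (snd c \<circ> p)"
  by (rule homeomorphic_map_compose [OF h])
 then show ch: "is_chart Y c'" using V is_chartD(3) [OF c] im by (simp add: is_chart_def c'_def)
 show e: "p (chart_inv c' z) = chart_inv c z" if z: "z \<in> chart_image c" for z
 proof -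
  have "chart_inv c' z \<in> V" "snd c (p (chart_inv c' z)) = z"
   using is_chartD(6,7) [OF ch] z im by (auto simp: c'_def)
  moreover from this have "p (chart_inv c' z) \<in> fst c" using pV by blast
  ultimately show ?thesis using is_chartD(8) [OF c, of "p (chart_inv c' z)"] by simp
 qed
 show "coord_dom c' p d = coord_dom c id d" unfolding coord_dom_eq [OF ch] coord_dom_eq [OF c] im using e by auto
 show "\<And>z. z \<in> chart_image c ==> coord c' p d z = coord c id d z" by (simp add: coord_def e)
qed

lemma lifted_chartsE:
 assumes "c' \<in> lifted_charts Y X A p" "\<And>c. c \<in> A ==> is_chart X c"
 obtains V c where "c' = (V, snd c \<circ> p)" "c \<in> A" "is_chart X c" "openin Y V"
  "homeomorphic_map (subtopology Y V) (subtopology X (fst c)) p" using assms by (auto simp: lifted_charts_def)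

lemma lifted_coord:
 assumes c: "is_chart X c" and V: "openin Y V" and h: "homeomorphic_map (subtopology Y V) (subtopology X (fst c)) p"
  and d: "is_chart X d" and U: "openin Y U" and h': "homeomorphic_map (subtopology Y U) (subtopology X (fst d)) p"
  and z: "z \<in> coord_dom (V, snd c \<circ> p) id (U, snd d \<circ> p)"
 shows "z \<in> coord_dom c id d" "coord (V, snd c \<circ> p) id (U, snd d \<circ> p) z = coord c id d z"
proof -
 note C = lifted_chart [OF c V h] and D = lifted_chart [OF d U h']
 have z': "z \<in> chart_image c" "chart_inv (V, snd c \<circ> p) z \<in> U"
  using z unfolding coord_dom_eq [OF C(1)] C(2) by auto
 then have "p (chart_inv (V, snd c \<circ> p) z) \<in> fst d" using D(3) by blast
 then show "z \<in> coord_dom c id d" unfolding coord_dom_eq [OF c] using z'(1) C(4) by simp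
 show "coord (V, snd c \<circ> p) id (U, snd d \<circ> p) z = coord c id d z" using C(4) [OF z'(1)] by (simp add: coord_def)
qed

text \<open>Transition maps of lifted charts are restrictions of transition maps of the base, and in
  lifted charts the projection looks like a transition of the base.\<close>

lemma riemann_surface_lifted:
 assumes X: "riemann_surface X A" and Y: "topspace Y \<noteq> {}" "connected_space Y" "Hausdorff_space Y"
  and p: "continuous_map Y X p" and ev: "\<And>c. c \<in> A ==> evenly_covered Y X p (fst c)"
 shows "riemann_surface Y (lifted_charts Y X A p)" "holomorphic_map Y (lifted_charts Y X A p) X {c. compat X A c} p"
proof -
 have ch: "is_chart X c" if "c \<in> A" for c using X that by (auto simp: riemann_surface_def)
 have chl: "is_chart Y c'" if "c' \<in> lifted_charts Y X A p" for c'
  using that ch by (elim lifted_chartsE) (auto intro: lifted_chart(1))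
 show "riemann_surface Y (lifted_charts Y X A p)" unfolding riemann_surface_def
 proof (intro conjI ballI Y chl)
  show "topspace Y = \<Union> (fst ` lifted_charts Y X A p)"
  proof
   show "\<Union> (fst ` lifted_charts Y X A p) \<subseteq> topspace Y" using is_chartD(2) [OF chl] by blast
   show "topspace Y \<subseteq> \<Union> (fst ` lifted_charts Y X A p)"
   proof
    fix y assume y: "y \<in> topspace Y"
    then have "p y \<in> topspace X" using p by (auto simp: continuous_map_def)
    then obtain c where c: "c \<in> A" "p y \<in> fst c" using X by (auto simp: riemann_surface_def)
    then obtain \<V> where \<V>: "\<Union>\<V> = topspace Y \<inter> p -` fst c"
     "\<And>V. V \<in> \<V> ==> openin Y V \<and> homeomorphic_map (subtopology Y V) (subtopology X (fst c)) p"
     using ev unfolding evenly_covered_def by metis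
    then obtain V where V: "V \<in> \<V>" "y \<in> V" using y c(2) by blast
    then have "(V, snd c \<circ> p) \<in> lifted_charts Y X A p" using \<V>(2) [OF V(1)] c(1) unfolding lifted_charts_def by blast
    then show "y \<in> \<Union> (fst ` lifted_charts Y X A p)" using V(2) by force
   qed
  qed
  fix c' d' assume c': "c' \<in> lifted_charts Y X A p" and d': "d' \<in> lifted_charts Y X A p"
  obtain V c where c: "c' = (V, snd c \<circ> p)" "c \<in> A" "is_chart X c" "openin Y V"
   "homeomorphic_map (subtopology Y V) (subtopology X (fst c)) p" using lifted_chartsE [OF c' ch] by metis
  obtain U d where d: "d' = (U, snd d \<circ> p)" "d \<in> A" "is_chart X d" "openin Y U"
   "homeomorphic_map (subtopology Y U) (subtopology X (fst d)) p" using lifted_chartsE [OF d' ch] by metis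
  have "coord c id d holomorphic_on coord_dom c id d" using X c(2) d(2) by (auto simp: riemann_surface_def)
  then have "coord c id d holomorphic_on coord_dom c' id d'"
   by (rule holomorphic_on_subset) (use lifted_coord(1) [OF c(3-5) d(3-5)] c(1) d(1) in auto)
  then show "coord c' id d' holomorphic_on coord_dom c' id d'"
   by (rule holomorphic_transform) (use lifted_coord(2) [OF c(3-5) d(3-5)] c(1) d(1) in auto)
 qed
 show "holomorphic_map Y (lifted_charts Y X A p) X {c. compat X A c} p" unfolding holomorphic_map_def
 proof (intro conjI ballI p)
  fix c' d assume c': "c' \<in> lifted_charts Y X A p" and d: "d \<in> {c. compat X A c}"
  obtain V c where c: "c' = (V, snd c \<circ> p)" "c \<in> A" "is_chart X c" "openin Y V"
   "homeomorphic_map (subtopology Y V) (subtopology X (fst c)) p" using lifted_chartsE [OF c' ch] by metis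
  note C = lifted_chart [OF c(3-5), folded c(1)]
  have "coord c id d holomorphic_on coord_dom c id d"
   using compat_trans [of A X c d] X riemann_surface_imp_compat [OF X c(2)] d ch by (auto simp: riemann_surface_def)
  then show "coord c' p d holomorphic_on coord_dom c' p d"
   unfolding C(5) by (rule holomorphic_transform) (use C(6) coord_dom_eq [OF c(3), of id d] in auto)
 qed
qed

context curve_ends
begin

subsection \<open>The punctured surface\<close>

text \<open>The double cover of the punctured curve on which \<open>g\<close> is single valued: here
  \<open>w^2 = x\<close> and \<open>v = y / w\<close>, so that \<open>v^2 = cf1 (w^2)\<close>.
  Negation acts on it without fixed points because \<open>cf1 0\<close> is not zero.\<close>

definition MH :: "(complex \<times> complex) set" where "MH = sqrt_curve (\<lambda>w. cf1 (w\<^sup>2)) (- RHO)"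
definition pm :: "complex \<times> complex => complex \<times> complex" where "pm q = ((fst q)\<^sup>2, fst q * snd q)"
definition C0 :: "(complex \<times> complex) set" where "C0 = {(x, y) \<in> C. x \<notin> PX}"
definition XM :: "point topology" where "XM = subtopology SS (topspace SS - P)"

lemma in_MH: "q \<in> MH \<longleftrightarrow> fst q \<notin> RHO \<and> (snd q)\<^sup>2 = cf1 ((fst q)\<^sup>2)" by (cases q) (simp add: MH_def sqrt_curve_def)

lemma topspace_XM: "topspace XM = pt ` C0"
 unfolding XM_def topspace_minus_P C0_def [symmetric] using topspace_minus_P P_sub by (auto simp: C0_def)

lemma openin_minus_P: "openin SS (topspace SS - P)"
 using closedin_Hausdorff_finite [OF Hausdorff_SS P_sub finite_P] by blast

lemma openin_XM:
 assumes W: "W \<subseteq> C0"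
 shows "openin XM (pt ` W) \<longleftrightarrow> openin (top_of_set C) W"
proof -
 have e: "topspace SS - P = pt ` C0" unfolding topspace_minus_P C0_def ..
 have "W \<subseteq> C" using W by (auto simp: C0_def)
 moreover have "pt ` W \<subseteq> pt ` C0" using W by blast
 ultimately show ?thesis
  using openin_pt [of W] openin_open_subtopology [OF openin_minus_P, of "pt ` W"] unfolding XM_def e by simp
qed

lemma pm_C0: "pm ` MH = C0"
proof
 show "pm ` MH \<subseteq> C0" by (auto simp: in_MH pm_def C0_def in_C sq_in_PX cf_def power_mult_distrib)
 show "C0 \<subseteq> pm ` MH"
 proof clarify
  fix x y assume "(x, y) \<in> C0"
  then have xy: "y\<^sup>2 = cf x" "x \<notin> PX" by (auto simp: C0_def in_C)
  define w where "w = csqrt x"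
  define v where "v = (if x = 0 then csqrt (cf1 0) else y / w)"
  have w: "w\<^sup>2 = x" by (simp add: w_def del: csqrt.simps)
  have "v\<^sup>2 = cf1 x"
  proof (cases "x = 0")
   case False
   then show ?thesis using xy(1) w by (simp add: v_def power_divide cf_def)
  qed (simp add: v_def del: csqrt.simps)
  moreover have "w * v = y"
  proof (cases "x = 0")
   case True
   then show ?thesis using xy(1) w by (simp add: cf_def)
  next
   case False
   then show ?thesis using w by (auto simp: v_def)
  qed
  ultimately have "(w, v) \<in> MH" "pm (w, v) = (x, y)" using w xy(2) by (auto simp: in_MH pm_def sq_in_PX [symmetric])
  then show "(x, y) \<in> pm ` MH" by (metis imageI)
 qed
qed

lemma pm_in_C: "q \<in> MH ==> pm q \<in> C"
proof -
 assume "q \<in> MH"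
 then have "pm q \<in> C0" using pm_C0 by blast
 then show ?thesis by (auto simp: C0_def)
qed

lemma MH_nz: "q \<in> MH ==> q \<noteq> 0"
proof
 assume "q \<in> MH" "q = 0"
 then have "cf1 0 = 0" by (simp add: in_MH)
 then show False unfolding cf1_eq_0 by auto
qed

lemma MH_uminus: "q \<in> MH ==> - q \<in> MH" using RHO_uminus [of "- fst q"] by (auto simp: in_MH)

lemma pm_uminus [simp]: "pm (- q) = pm q" by (simp add: pm_def)

text \<open>The fibres of the double cover are the pairs \<open>q, - q\<close>. If \<open>w\<close>
  is nonzero its sign determines that of \<open>v\<close> through \<open>w * v = y\<close>; if
  \<open>w = 0\<close>, negating \<open>q\<close> only negates \<open>v\<close>.\<close>

lemma pm_eq:
 assumes "(snd q)\<^sup>2 = cf1 ((fst q)\<^sup>2)" "(snd q')\<^sup>2 = cf1 ((fst q')\<^sup>2)" "pm q = pm q'"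
 shows "q = q' \<or> q = - q'"
proof -
 have w2: "(fst q)\<^sup>2 = (fst q')\<^sup>2" and wv: "fst q * snd q = fst q' * snd q'" using assms(3) by (auto simp: pm_def)
 have v2: "(snd q)\<^sup>2 = (snd q')\<^sup>2" using assms(1,2) w2 by simp
 have w: "fst q = fst q' \<or> fst q = - fst q'" using w2 by (simp add: power2_eq_iff)
 have v: "snd q = snd q' \<or> snd q = - snd q'" using v2 by (simp add: power2_eq_iff)
 show ?thesis
 proof (cases "fst q' = 0")
  case True
  then show ?thesis using w v by (auto simp: prod_eq_iff)
 next
  case False
  show ?thesis using w
  proof
   assume "fst q = fst q'"
   then show ?thesis using wv False by (simp add: prod_eq_iff)
  next
   assume e: "fst q = - fst q'"
   have "fst q' * snd q' = - (fst q' * snd q)" using wv unfolding e by simp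
   then have "fst q' * (snd q + snd q') = 0" by (simp add: distrib_left)
   then have "snd q = - snd q'" using False by (simp add: eq_neg_iff_add_eq_0)
   then show ?thesis using e by (intro disjI2) (simp add: prod_eq_iff)
  qed
 qed
qed

lemma continuous_pm: "continuous_on A pm" unfolding pm_def by (intro continuous_intros)

lemma RHO_real: "r \<in> RHO ==> Im r = 0" by (auto simp: RHO_def rho_def)

text \<open>The two sheets over the \<open>w\<close>-plane meet at \<open>w = \<i>\<close>, where
  \<open>w^2 = - 1\<close> is a root of \<open>cf1\<close>. This point is not removed since all
  elements of \<open>RHO\<close> are real.\<close>

lemma connected_MH: "connected MH" unfolding MH_def
proof (rule connected_sqrt_curve)
 show "open (- RHO)" by (rule open_compl_RHO)
 have "connected (UNIV - RHO)" by (rule connected_open_delete_finite) (use finite_RHO in auto)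
 then show "connected (- RHO)" by (simp add: Compl_eq_Diff_UNIV)
 show "(\<lambda>w. cf1 (w\<^sup>2)) holomorphic_on - RHO" unfolding cf1_def by (intro holomorphic_intros)
 show "\<i> \<in> - RHO" using RHO_real by force
 show "cf1 (\<i>\<^sup>2) = 0" unfolding cf1_eq_0 using k by (auto intro!: image_eqI [of _ _ 1])
qed

lemma continuous_pt_pm: "continuous_map (top_of_set MH) XM (pt \<circ> pm)"
proof -
 have "continuous_map (top_of_set MH) (top_of_set C) pm" using continuous_pm pm_in_C by auto
 then have "continuous_map (top_of_set MH) SS (pt \<circ> pm)" by (rule continuous_map_compose [OF _ continuous_pt])
 moreover have "(pt \<circ> pm) ` MH \<subseteq> topspace SS - P"
  using pm_C0 unfolding topspace_minus_P C0_def [symmetric] by auto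
 ultimately show ?thesis by (auto simp: XM_def continuous_map_in_subtopology)
qed

lemma connected_XM: "connected_space XM"
proof -
 have "connectedin XM ((pt \<circ> pm) ` MH)"
  by (rule connectedin_continuous_map_image [OF continuous_pt_pm]) (use connected_MH in \<open>simp add: connectedin_subtopology\<close>)
 moreover have "(pt \<circ> pm) ` MH = topspace XM" unfolding topspace_XM pm_C0 [symmetric] by (simp add: image_comp)
 ultimately show ?thesis by (simp add: connectedin_topspace)
qed

lemma C0_ne: "C0 \<noteq> {}"
proof -
 have "(- 1, 0) \<in> C0"
  using PX_real [of "- 1"] k cf_eq_0 [of "- 1"] by (auto simp: C0_def in_C roots_def image_iff intro!: bexI [of _ 1])
 then show ?thesis by blast
qed

lemma riemann_surface_restricted: "riemann_surface XM (restrict_charts AS (topspace SS - P))" unfolding XM_def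
proof (rule riemann_surface_restrict [OF riemann_surface_SS openin_minus_P])
 show "topspace SS - P \<noteq> {}" using C0_ne unfolding topspace_minus_P C0_def [symmetric] by blast
 show "connectedin SS (topspace SS - P)" using connected_XM by (simp add: XM_def connectedin_def)
qed

lemma AM_sub: "AM \<subseteq> restrict_charts AS (topspace SS - P)"
proof
 fix c assume c: "c \<in> AM"
 then have "fst c \<subseteq> topspace SS - P" using AM_cover unfolding topspace_minus_P by blast
 then have "c = (fst c \<inter> (topspace SS - P), snd c)" by (simp add: prod_eq_iff Int_absorb2)
 then show "c \<in> restrict_charts AS (topspace SS - P)" using c unfolding restrict_charts_def AS_def by blast
qed

lemma riemann_surface_XM: "riemann_surface XM AM"
 by (rule riemann_surface_subatlas [OF riemann_surface_restricted AM_sub])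
   (use AM_cover topspace_XM in \<open>simp add: C0_def\<close>)

lemma second_countable_XM: "second_countable_space XM"
proof -
 obtain \<B> :: "(complex \<times> complex) set set" where \<B>: "countable \<B>" "topological_basis \<B>" using ex_countable_basis by blast
 have oC0: "openin (top_of_set C) C0" using openin_XM [of C0] topspace_XM by (metis openin_topspace order_refl)
 show ?thesis unfolding second_countable_space_def
 proof (intro exI [of _ "(\<lambda>B. pt ` (C0 \<inter> B)) ` \<B>"] conjI ballI allI impI)
  show "countable ((\<lambda>B. pt ` (C0 \<inter> B)) ` \<B>)" using \<B>(1) by blast
  fix V assume "V \<in> (\<lambda>B. pt ` (C0 \<inter> B)) ` \<B>"
  then obtain B where B: "B \<in> \<B>" "V = pt ` (C0 \<inter> B)" by blast
  have "openin (top_of_set C) (C0 \<inter> (C \<inter> B))"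
   using oC0 topological_basis_open [OF \<B>(2) B(1)] by (intro openin_Int openin_open_Int)
  moreover have "C0 \<inter> (C \<inter> B) = C0 \<inter> B" by (auto simp: C0_def)
  ultimately show "openin XM V" using openin_XM [of "C0 \<inter> B"] B(2) by simp
 next
  fix U x assume U: "openin XM U \<and> x \<in> U"
  then have "U \<subseteq> pt ` C0" using openin_subset topspace_XM by metis
  then obtain W where W: "W \<subseteq> C0" "U = pt ` W" by (metis subset_image_iff)
  then have "openin (top_of_set C) W" using U openin_XM by simp
  then obtain T where T: "open T" "W = C \<inter> T" by (auto simp: openin_open)
  obtain q where q: "x = pt q" "q \<in> W" using U W(2) by blast
  then obtain B where B: "B \<in> \<B>" "q \<in> B" "B \<subseteq> T" using topological_basisE [OF \<B>(2) T(1), of q] T(2) by blast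
  show "\<exists>V\<in>(\<lambda>B. pt ` (C0 \<inter> B)) ` \<B>. x \<in> V \<and> V \<subseteq> U"
  proof (intro bexI conjI)
   show "x \<in> pt ` (C0 \<inter> B)" using q W(1) B(2) by blast
   show "pt ` (C0 \<inter> B) \<subseteq> U" unfolding W(2) T(2) using B(3) by (auto simp: C0_def)
  qed (use B(1) in blast)
 qed
qed

subsection \<open>The one-form\<close>

text \<open>The form \<open>dx/y\<close>, which equals \<open>2 dy/f'(x)\<close> at the branch points.\<close>

definition form :: "(complex => complex) => (complex => complex) => complex => complex" where
 "form x y z = (if y z \<noteq> 0 then deriv x z / y z else 2 * deriv y z / deriv cf (x z))"

text \<open>The map \<open>p\<close> is the identity for charts of the compact surface and the
  covering projection for charts of the universal cover, so the form and its pullback share one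
  definition.\<close>

definition eta :: "'b chart => ('b => point) => complex => complex" where
 "eta c p = form (xc \<circ> p \<circ> chart_inv c) (yc \<circ> p \<circ> chart_inv c)"

lemma form_cong:
 assumes "open W" "z \<in> W" "\<And>u. u \<in> W ==> x u = x' u" "\<And>u. u \<in> W ==> y u = y' u"
 shows "form x y z = form x' y' z"
proof -
 have "\<forall>\<^sub>F u in nhds z. u \<in> W" using assms(1,2) eventually_nhds by blast
 then have "\<forall>\<^sub>F u in nhds z. x u = x' u" "\<forall>\<^sub>F u in nhds z. y u = y' u"
  by (auto elim!: eventually_mono simp: assms(3,4))
 then have "deriv x z = deriv x' z" "deriv y z = deriv y' z" by (auto intro: deriv_cong_ev)
 then show ?thesis using assms by (simp add: form_def)
qed

lemma form_chain:
 assumes "x field_differentiable at (T z)" "y field_differentiable at (T z)" "T field_differentiable at z"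
 shows "form (x \<circ> T) (y \<circ> T) z = form x y (T z) * deriv T z"
 using deriv_chain [OF assms(3,1)] deriv_chain [OF assms(3,2)] by (simp add: form_def)

text \<open>Away from the branch point \<open>dx/y\<close> is
  \<open>m z^(m-1) / (z^(m-1) h)\<close>. At a branch point the second branch of \<open>form\<close>
  is \<open>2 h(a) / cf'(a)\<close>, and the factorization \<open>cf x = (x - a) * (h x)^2\<close>
  gives \<open>cf'(a) = h(a)^2\<close>, so both values agree with \<open>m / h\<close>.\<close>

lemma eta_fchart:
 assumes f: "fin_data m a r h" and z: "z \<in> Vd m r"
 shows "eta (fchart m a r h) id z = of_nat m / h (Xd m a z)" "eta (fchart m a r h) id z \<noteq> 0"
proof -
 have h0: "h (Xd m a z) \<noteq> 0" using fd_simps(4) [OF f] Xd_ball [OF f] z by blast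
 have "eta (fchart m a r h) id z = form (Xd m a) (Yd m a h) z"
  unfolding eta_def by (rule form_cong [OF open_Vd(1) [OF f] z]) (auto simp: is_chart_fchart(3) [OF f] phid_def)
 also have "\<dots> = of_nat m / h (Xd m a z)"
 proof (cases "Yd m a h z = 0")
  case False
  have "(Xd m a has_field_derivative of_nat m * z ^ (m - 1)) (at z)"
   unfolding Xd_def [abs_def] by (auto intro!: derivative_eq_intros)
  then have "deriv (Xd m a) z = of_nat m * z ^ (m - 1)" by (rule DERIV_imp_deriv)
  then show ?thesis using False by (simp add: form_def Yd_def Xd_def)
 next
  case True
  then have m: "m = 2" "z = 0" using h0 fd_simps(2) [OF f] by (auto simp: Yd_def Xd_def)
  have a: "a \<in> ball a r" using fd_simps(1) [OF f] by simp
  have hd: "h field_differentiable at a"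
   using fd_simps(3) [OF f] a by (auto intro: holomorphic_on_imp_differentiable_at)
  have "((\<lambda>x. (x - a) * (h x)\<^sup>2) has_field_derivative (h a)\<^sup>2) (at a)"
   using hd by (auto simp: field_differentiable_def intro!: derivative_eq_intros)
  then have "(cf has_field_derivative (h a)\<^sup>2) (at a)"
   by (rule has_field_derivative_transform_within_open [OF _ open_ball a])
     (use fd_simps(5) [OF f] m in auto)
  then have 1: "deriv cf a = (h a)\<^sup>2" by (rule DERIV_imp_deriv)
  obtain D where D: "(h has_field_derivative D) (at (a + 0\<^sup>2))" using hd by (auto simp: field_differentiable_def)
  have "((\<lambda>z. a + z\<^sup>2) has_field_derivative 0) (at 0)" by (auto intro!: derivative_eq_intros)
  from DERIV_mult [OF DERIV_ident DERIV_chain2 [OF D this]]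
  have "((\<lambda>z. z * h (a + z\<^sup>2)) has_field_derivative h a) (at 0)" by simp
  moreover have "Yd m a h = (\<lambda>z. z * h (a + z\<^sup>2))" by (auto simp: Yd_def m)
  ultimately have 2: "deriv (Yd m a h) 0 = h a" by (simp add: DERIV_imp_deriv)
  have "Yd m a h z = 0" "Xd m a z = a" using True by (simp_all add: m Xd_def)
  then show ?thesis using h0 by (simp add: form_def 1 m(1) 2 [folded m(2), unfolded m(1)] power2_eq_square)
 qed
 finally show "eta (fchart m a r h) id z = of_nat m / h (Xd m a z)" .
 then show "eta (fchart m a r h) id z \<noteq> 0" using h0 fd_simps(2) [OF f] by auto
qed

lemma eta_fchart_hol:
 assumes f: "fin_data m a r h"
 shows "eta (fchart m a r h) id holomorphic_on Vd m r"
proof -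
 have "(\<lambda>z. of_nat m / h (Xd m a z)) holomorphic_on Vd m r"
  using hX_hol [OF f] fd_simps(4) [OF f] Xd_ball [OF f] by (intro holomorphic_intros) auto
 then show ?thesis by (rule holomorphic_transform) (simp add: eta_fchart [OF f])
qed

lemma hinf_sq_hol: "(\<lambda>z. hinf (z\<^sup>2)) holomorphic_on Vinf"
 by (rule holomorphic_on_compose_fun [OF _ hinf(1) Vinf_sq]) (intro holomorphic_intros)

text \<open>Inserting \<open>x = z^(-2)\<close> and \<open>y = hinf / z^(2k+1)\<close> into
  \<open>dx/y\<close> shows a zero of order \<open>2k - 2\<close> at infinity; the formula is
  claimed off \<open>z = 0\<close> only, which is all the ends require.\<close>

lemma eta_ichart:
 assumes z: "z \<in> Vinf - {0}"
 shows "eta ichart id z = - 2 * z ^ (2 * k - 2) / hinf (z\<^sup>2)"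
proof -
 have z0: "z \<noteq> 0" and h0: "hinf (z\<^sup>2) \<noteq> 0" using z hinf(3) [OF Vinf_sq] by auto
 have o: "open (Vinf - {0})" using open_Vinf by (simp add: open_delete)
 have "eta ichart id z = form (\<lambda>z. fst (qinf z)) (\<lambda>z. snd (qinf z)) z"
  unfolding eta_def by (rule form_cong [OF o z]) (auto simp: is_chart_ichart(3) phinf_def xc_def yc_def)
 also have "\<dots> = deriv (\<lambda>z. 1 / z\<^sup>2) z / (hinf (z\<^sup>2) / z ^ (2*k+1))"
  using z0 h0 by (simp add: form_def qinf_def)
 also have "deriv (\<lambda>z. 1 / z\<^sup>2) z = - 2 / z ^ 3"
  by (rule DERIV_imp_deriv) (use z0 in \<open>auto intro!: derivative_eq_intros simp: field_simps power2_eq_square power3_eq_cube\<close>)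
 also have "- 2 / z ^ 3 / (hinf (z\<^sup>2) / z ^ (2*k+1)) = - 2 * z ^ (2*k - 2) / hinf (z\<^sup>2)"
 proof -
  have "2*k+1 = (2*k-2) + 3" using k by simp
  then have "z ^ (2*k+1) = z ^ (2*k-2) * z ^ 3" by (metis power_add)
  then show ?thesis using z0 h0 by (simp add: field_simps)
 qed
 finally show ?thesis .
qed

lemma eta_hol:
 assumes c: "c \<in> AS"
 shows "eta c id holomorphic_on {z \<in> chart_image c. chart_inv c z \<noteq> infp}" using AS_cases [OF c]
proof
 assume "\<exists>m a r h. c = fchart m a r h \<and> fin_data m a r h"
 then obtain m a r h where c: "c = fchart m a r h" "fin_data m a r h" by blast
 show ?thesis by (rule holomorphic_on_subset [OF eta_fchart_hol [OF c(2), folded c(1)]])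
   (use is_chart_fchart(2) [OF c(2)] c(1) in auto)
next
 assume c: "c = ichart"
 have "(\<lambda>z. - 2 * z ^ (2 * k - 2) / hinf (z\<^sup>2)) holomorphic_on Vinf - {0}"
  using hinf(3) [OF Vinf_sq] by (intro holomorphic_intros holomorphic_on_subset [OF hinf_sq_hol]) auto
 then have "eta ichart id holomorphic_on Vinf - {0}" by (rule holomorphic_transform) (simp add: eta_ichart)
 then show ?thesis unfolding c by (rule holomorphic_on_subset) (auto simp: is_chart_ichart(2,3) phinf_def)
qed

lemma eta_trans:
 assumes c: "c \<in> AS" and b: "b \<in> AS" and z: "z \<in> coord_dom c id b" "chart_inv c z \<noteq> infp"
 shows "eta b id (coord c id b z) * deriv (coord c id b) z = eta c id z"
proof -
 note cc = AS_chart [OF c] and dd = AS_chart [OF b]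
 let ?T = "coord c id b"
 note t = coord_transition [OF cc dd z(1)]
 have Tz: "?T z \<in> {w \<in> chart_image b. chart_inv b w \<noteq> infp}"
  using t(1,3) z coord_dom_eq [OF dd, of id c] by auto
 have fd: "(xc \<circ> id \<circ> chart_inv b) field_differentiable at (?T z)" "(yc \<circ> id \<circ> chart_inv b) field_differentiable at (?T z)"
  using coords_hol [OF b] Tz holomorphic_on_imp_differentiable_at by auto
 have Td: "?T field_differentiable at z"
  using AS_transition [OF c b] coord_dom_open [OF cc dd] z(1) holomorphic_on_imp_differentiable_at by blast
 have "eta c id z = form ((xc \<circ> id \<circ> chart_inv b) \<circ> ?T) ((yc \<circ> id \<circ> chart_inv b) \<circ> ?T) z" unfolding eta_def
  by (rule form_cong [OF coord_dom_open [OF cc dd] z(1)]) (use coord_transition(3) [OF cc dd] in auto)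
 then show ?thesis unfolding eta_def using form_chain [OF fd Td] by simp
qed

end

context curve_ends
begin

subsection \<open>Sections of the double cover\<close>

text \<open>A section of \<open>pm\<close> over a chart. The last clause is
  \<open>dw = (v / 2) * eta\<close>, the relation behind all later formulas for
  \<open>dg\<close>.\<close>

definition sect :: "nat => complex => real => (complex => complex) => (complex => complex) => (complex => complex) => bool" where
 "sect m a r h w v \<longleftrightarrow> fin_data m a r h \<and> w holomorphic_on Vd m r \<and> v holomorphic_on Vd m r \<and>
   (\<forall>z\<in>Vd m r. (w z)\<^sup>2 = Xd m a z \<and> w z * v z = Yd m a h z \<and> (v z)\<^sup>2 = cf1 (Xd m a z) \<and>
    deriv w z = of_nat m / h (Xd m a z) * v z / 2)"

lemma sectD:
 assumes "sect m a r h w v"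
 shows "fin_data m a r h" "w holomorphic_on Vd m r" "v holomorphic_on Vd m r"
  "\<And>z. z \<in> Vd m r ==> (w z)\<^sup>2 = Xd m a z" "\<And>z. z \<in> Vd m r ==> w z * v z = Yd m a h z"
  "\<And>z. z \<in> Vd m r ==> (v z)\<^sup>2 = cf1 (Xd m a z)"
  "\<And>z. z \<in> Vd m r ==> deriv w z = of_nat m / h (Xd m a z) * v z / 2" using assms unfolding sect_def by blast+

lemma sect_exists: "fin_data m a r h ==> \<exists>w v. sect m a r h w v"
 unfolding sect_def using section_fchart [of m a r h] by metis

lemma sect_uminus:
 assumes s: "sect m a r h w v"
 shows "sect m a r h (\<lambda>z. - w z) (\<lambda>z. - v z)"
proof -
 note S = sectD [OF s]
 have "deriv (\<lambda>z. - w z) z = - deriv w z" if z: "z \<in> Vd m r" for z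
 proof -
  have "(w has_field_derivative deriv w z) (at z)" using holomorphic_derivI [OF S(2) open_Vd(1) [OF S(1)] z] .
  then show ?thesis by (intro DERIV_imp_deriv DERIV_minus)
 qed
 moreover have "(\<lambda>z. - w z) holomorphic_on Vd m r" "(\<lambda>z. - v z) holomorphic_on Vd m r"
  using S(2,3) by (auto intro: holomorphic_on_minus)
 ultimately show ?thesis using S by (simp add: sect_def)
qed

lemma fin_data_mono: "fin_data m a r h ==> 0 < r' ==> r' \<le> r ==> fin_data m a r' h"
 using subset_ball [of r' r a] unfolding fin_data_def by (meson holomorphic_on_subset subset_iff)

lemma sect_mono:
 assumes s: "sect m a r h w v" and r: "0 < r'" "r' \<le> r"
 shows "sect m a r' h w v"
proof -
 note S = sectD [OF s]
 have f: "fin_data m a r' h" using fin_data_mono S(1) r by blast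
 have "Vd m r' \<subseteq> Vd m r" using Xd_ball [OF f] Xd_ball [OF S(1)] subset_ball [OF r(2), of a] by blast
 then show ?thesis using S f holomorphic_on_subset unfolding sect_def by blast
qed

lemma sect_pm:
 assumes s: "sect m a r h w v" and z: "z \<in> Vd m r"
 shows "pm (w z, v z) = phid m a h z" "(v z)\<^sup>2 = cf1 ((w z)\<^sup>2)"
  "ball a r \<inter> PX = {} ==> (w z, v z) \<in> MH"
proof -
 note S = sectD [OF s]
 show "pm (w z, v z) = phid m a h z" "(v z)\<^sup>2 = cf1 ((w z)\<^sup>2)"
  using S(4-6) [OF z] by (simp_all add: pm_def phid_def)
 then show "(w z, v z) \<in> MH" if "ball a r \<inter> PX = {}"
  using that Xd_ball [OF S(1), of z] z S(4) [OF z] by (auto simp: in_MH sq_in_PX [symmetric])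
qed

text \<open>The sheets of the double cover over charts that avoid the punctures. They are the basis
  of simply connected open sets from which the universal cover is built.\<close>

definition UH :: "(complex \<times> complex) set set" where
 "UH = {(\<lambda>z. (w z, v z)) ` Vd m r |m a r h w v. sect m a r h w v \<and> ball a r \<inter> PX = {}}"

lemma sect_cont: "sect m a r h w v ==> continuous_on (Vd m r) (\<lambda>z. (w z, v z))"
 by (intro continuous_intros holomorphic_on_imp_continuous_on) (auto dest: sectD)

lemma sect_homeomorphism:
 assumes s: "sect m a r h w v"
 shows "homeomorphism (Vd m r) ((\<lambda>z. (w z, v z)) ` Vd m r) (\<lambda>z. (w z, v z)) (psid m a h \<circ> pm)"
proof -
 let ?si = "\<lambda>z. (w z, v z)"
 note S = sectD [OF s]
 have i: "(psid m a h \<circ> pm) (?si z) = z" if "z \<in> Vd m r" for z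
  using sect_pm(1) [OF s that] psid_phid [OF S(1) that] by simp
 have "continuous_on (?si ` Vd m r) (psid m a h \<circ> pm)" using sect_pm(1) [OF s]
  by (intro continuous_on_compose continuous_pm continuous_on_subset [OF psid_cont [OF S(1)]]) auto
 then show ?thesis unfolding homeomorphism_def using sect_cont [OF s] i by (auto simp: image_iff)
qed

text \<open>Over a chart the double cover splits into the image of a section and its negative. That
  each is open comes from comparing the distances of a point to the section and to its
  negative.\<close>

lemma sect_image:
 assumes s: "sect m a r h w v" and PX: "ball a r \<inter> PX = {}"
 defines "U \<equiv> (\<lambda>z. (w z, v z)) ` Vd m r" and "U' \<equiv> (\<lambda>z. (- w z, - v z)) ` Vd m r"
 shows "openin (top_of_set MH) U" "simply_connected U" "U \<inter> U' = {}"
  "{q \<in> MH. pm q \<in> phid m a h ` Vd m r} = U \<union> U'"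
proof -
 note S = sectD [OF s]
 let ?si = "\<lambda>z. (w z, v z)"
 have sze: "psid m a h (pm (?si z)) = z" if "z \<in> Vd m r" for z
  using sect_pm(1) [OF s that] psid_phid [OF S(1) that] by simp
 have MH: "?si z \<in> MH" if "z \<in> Vd m r" for z using sect_pm(3) [OF s that PX] .
 have "Vd m r homeomorphic U" unfolding U_def using sect_homeomorphism [OF s] homeomorphic_def by blast
 moreover have "simply_connected (Vd m r)" using convex_imp_simply_connected open_Vd(3) [OF S(1)] .
 ultimately show "simply_connected U" using homeomorphic_simply_connected_eq by blast
 have U': "U' = uminus ` U" by (auto simp: U_def U'_def image_image)
 show D: "{q \<in> MH. pm q \<in> phid m a h ` Vd m r} = U \<union> U'"
 proof
  show "U \<union> U' \<subseteq> {q \<in> MH. pm q \<in> phid m a h ` Vd m r}"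
  proof -
   have "pm (- w z, - v z) = pm (w z, v z)" for z by (simp add: pm_def)
   then show ?thesis unfolding U' using MH MH_uminus sect_pm(1) [OF s] by (auto simp: U_def)
  qed
  show "{q \<in> MH. pm q \<in> phid m a h ` Vd m r} \<subseteq> U \<union> U'"
  proof clarify
   fix x y z assume q: "(x, y) \<in> MH" "pm (x, y) = phid m a h z" "z \<in> Vd m r" "(x, y) \<notin> U'"
   have "(x, y) = ?si z \<or> (x, y) = - ?si z"
    using q(1,2) sect_pm(1,2) [OF s q(3)] by (intro pm_eq) (auto simp: in_MH)
   moreover have "- ?si z \<in> U'" using q(3) by (auto simp: U'_def)
   ultimately show "(x, y) \<in> U" using q(3,4) by (auto simp: U_def)
  qed
 qed
 \<comment> \<open>If the sheets met, projecting would give \<open>z = z'\<close>, and the point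
   would be its own negative; but \<open>0\<close> does not lie on \<open>MH\<close>.\<close>
 have neg: "?si z \<noteq> - ?si z'" if "z \<in> Vd m r" "z' \<in> Vd m r" for z z'
 proof
  assume e: "?si z = - ?si z'"
  then have "pm (?si z) = pm (?si z')" using pm_uminus by metis
  then have "z = z'" using sze that by metis
  then have "?si z = 0" using e by (simp add: prod_eq_iff)
  then show False using MH_nz [OF MH [OF that(1)]] by blast
 qed
 then show dis: "U \<inter> U' = {}" unfolding U' U_def by blast
 let ?D = "{q \<in> MH. pm q \<in> phid m a h ` Vd m r}"
 let ?ze = "\<lambda>q. ?si (psid m a h (pm q))"
 \<comment> \<open>Positive on \<open>U\<close> and nonpositive on \<open>U'\<close>: the point is
   the section value on the former and its negative on the latter.\<close>
 let ?p = "\<lambda>q. norm (q + ?ze q) - norm (q - ?ze q)"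
 have oD: "openin (top_of_set MH) ?D"
 proof -
  have "continuous_on MH pm" "pm \<in> MH \<rightarrow> C" using continuous_pm pm_in_C by auto
  from continuous_openin_preimage [OF this openin_phid [OF S(1)]] show ?thesis
   by (simp add: vimage_def Int_def)
 qed
 have cq: "continuous_on ?D (\<lambda>q. psid m a h (pm q))"
  by (rule continuous_on_compose2 [OF psid_cont [OF S(1)] continuous_pm]) auto
 have cz: "continuous_on ?D ?ze"
  by (rule continuous_on_compose2 [OF sect_cont [OF s] cq]) (use psid_phid [OF S(1)] in auto)
 have "continuous_on ?D ?p"
  by (intro continuous_on_diff continuous_on_norm continuous_on_add continuous_on_id cz)
 then have "openin (top_of_set ?D) (?D \<inter> ?p -` {0<..})" by (rule continuous_openin_preimage_gen) auto
 then have "openin (top_of_set MH) (?D \<inter> ?p -` {0<..})" using oD openin_trans by blast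
 moreover have "?D \<inter> ?p -` {0<..} = U"
 proof -
  have 1: "?p q > 0" if "q \<in> U" for q
  proof -
   obtain z where z: "z \<in> Vd m r" "q = ?si z" using \<open>q \<in> U\<close> by (auto simp: U_def)
   have "q + q \<noteq> 0" using MH_nz [OF MH [OF z(1)]] z(2) unfolding scaleR_2 [symmetric] scaleR_eq_0_iff by simp
   then show ?thesis using sze z by simp
  qed
  have 2: "\<not> ?p q > 0" if "q \<in> U'" for q
  proof -
   obtain z where z: "z \<in> Vd m r" "q = - ?si z" using \<open>q \<in> U'\<close> unfolding U' U_def by blast
   then have "q + ?ze q = 0" using sze pm_uminus by (metis add.left_inverse)
   then show ?thesis by simp
  qed
  show ?thesis unfolding D using 1 2 dis by auto
 qed
 ultimately show "openin (top_of_set MH) U" by simp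
qed

text \<open>A section over a chart centred at the image of \<open>q\<close> passes through
  \<open>q\<close> or \<open>- q\<close>; negating it if necessary makes it pass through
  \<open>q\<close>, and shrinking the chart puts its image inside \<open>W\<close>.\<close>

lemma UH_basis:
 assumes W: "openin (top_of_set MH) W" and q: "q \<in> W"
 shows "\<exists>U\<in>UH. q \<in> U \<and> U \<subseteq> W"
proof -
 obtain T where T: "open T" "W = MH \<inter> T" using W by (auto simp: openin_open)
 have qM: "q \<in> MH" "q \<in> T" using q T by auto
 obtain x y where xy: "pm q = (x, y)" by fastforce
 have "pm q \<in> C0" using pm_C0 qM(1) by blast
 then have C: "(x, y) \<in> C" "x \<notin> PX" by (auto simp: C0_def xy)
 obtain m r h where f: "fin_data m x r h" "phid m x h 0 = (x, y)" "(ball x r - {x}) \<inter> (PX \<union> roots) = {}"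
  by (rule fin_data_exists [OF C(1), of 1]) auto
 have PX: "ball x r \<inter> PX = {}" using f(3) C(2) by blast
 obtain w0 v0 where s0: "sect m x r h w0 v0" using sect_exists [OF f(1)] by blast
 note o = open_Vd [OF f(1)]
 have "q = (w0 0, v0 0) \<or> q = - (w0 0, v0 0)"
  using qM(1) sect_pm(1,2) [OF s0 o(2)] f(2) xy by (intro pm_eq) (auto simp: in_MH)
 then obtain w v where s: "sect m x r h w v" and q0: "q = (w 0, v 0)"
  using s0 sect_uminus [OF s0] by (metis uminus_Pair)
 have "open (Vd m r \<inter> (\<lambda>z. (w z, v z)) -` T)"
  by (rule continuous_open_preimage [OF sect_cont [OF s] o(1) T(1)])
 moreover have "0 \<in> Vd m r \<inter> (\<lambda>z. (w z, v z)) -` T" using o(2) q0 qM(2) by simp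
 ultimately obtain de where de: "de > 0" "ball 0 de \<subseteq> Vd m r \<inter> (\<lambda>z. (w z, v z)) -` T"
  using open_contains_ball_eq by metis
 have m: "m > 0" and r: "r > 0" using fd_simps(1,2) [OF f(1)] by auto
 \<comment> \<open>The coordinate disc has radius \<open>root m r'\<close>, so
   \<open>r' \<le> de ^ m\<close> is what puts it inside the ball of radius
   \<open>de\<close>.\<close>
 define r' where "r' = min r (de ^ m)"
 have r': "0 < r'" "r' \<le> r" using r de(1) by (auto simp: r'_def)
 have "root m r' \<le> root m (de ^ m)" using m by (simp add: r'_def)
 then have "root m r' \<le> de" using m de(1) by (simp add: real_root_power_cancel)
 then have "Vd m r' \<subseteq> ball 0 de" by (auto simp: Vd_def)
 then have T': "(\<lambda>z. (w z, v z)) ` Vd m r' \<subseteq> T" using de(2) by blast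
 have s': "sect m x r' h w v" by (rule sect_mono [OF s r'])
 have PX': "ball x r' \<inter> PX = {}" using PX subset_ball [OF r'(2), of x] by blast
 have 1: "(\<lambda>z. (w z, v z)) ` Vd m r' \<in> UH" unfolding UH_def using s' PX' by blast
 have 2: "q \<in> (\<lambda>z. (w z, v z)) ` Vd m r'" using q0 open_Vd(2) [OF sectD(1) [OF s']] by blast
 have "(\<lambda>z. (w z, v z)) ` Vd m r' \<subseteq> W"
 proof -
  have "(w z, v z) \<in> MH" if "z \<in> Vd m r'" for z by (rule sect_pm(3) [OF s' that PX'])
  then show ?thesis using T' unfolding T(2) by blast
 qed
 with 2 show ?thesis by (intro bexI [OF _ 1] conjI)
qed

lemma UH_sets: "U \<in> UH ==> openin (top_of_set MH) U" "U \<in> UH ==> simply_connected U"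
 unfolding UH_def using sect_image(1,2) by blast+

text \<open>Connectedness suffices because the sheets in \<open>UH\<close> make \<open>MH\<close>
  locally path connected.\<close>

lemma path_connected_MH: "path_connected MH"
proof -
 have "locally path_connected MH" unfolding locally_path_connected
  using UH_basis UH_sets simply_connected_imp_path_connected by meson
 then have "path_component_set MH x = connected_component_set MH x" for x
  by (rule path_component_eq_connected_component_set)
 then show ?thesis
  using connected_MH unfolding path_connected_component connected_iff_connected_component by blast
qed

text \<open>Homotopy classes are labelled by sets of paths in the surface itself.\<close>

definition Lab :: "(real => complex \<times> complex) => (real => point) set" where
 "Lab g = (\<lambda>h. pt \<circ> h) ` {h. homotopic_paths MH g h}"

lemma Lab_eq:
 assumes "path g" "path_image g \<subseteq> MH"
 shows "Lab g = Lab h \<longleftrightarrow> homotopic_paths MH g h"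
proof
 assume "Lab g = Lab h"
 moreover have "pt \<circ> g \<in> Lab g" using assms by (auto simp: Lab_def)
 ultimately obtain h' where "homotopic_paths MH h h'" "pt \<circ> g = pt \<circ> h'" by (auto simp: Lab_def)
 moreover from this have "g = h'" by (auto simp: fun_eq_iff)
 ultimately show "homotopic_paths MH g h" using homotopic_paths_sym by blast
next
 assume "homotopic_paths MH g h"
 then have "homotopic_paths MH g r \<longleftrightarrow> homotopic_paths MH h r" for r
  using homotopic_paths_sym homotopic_paths_trans by blast
 then show "Lab g = Lab h" by (simp add: Lab_def)
qed

lemma base_MH: "(\<i>, 0) \<in> MH"
proof -
 have "cf1 (- 1) = 0" unfolding cf1_eq_0 using k by (auto intro!: image_eqI [of _ _ 1])
 then show ?thesis using RHO_real by (force simp: in_MH)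
qed

sublocale cov: path_cover MH "(\<i>, 0)" UH Lab
proof
 show "(\<i>, 0) \<in> MH" by (rule base_MH)
 show "path_connected MH" by (rule path_connected_MH)
 show "openin (top_of_set MH) U" "simply_connected U" if "U \<in> UH" for U using UH_sets that by blast+
 show "\<exists>U\<in>UH. x \<in> U \<and> U \<subseteq> W" if "openin (top_of_set MH) W" "x \<in> W" for W x using UH_basis that .
qed (rule Lab_eq)

subsection \<open>The metric\<close>

text \<open>Any square root of \<open>x\<close> may be used, since \<open>gg\<close> is odd and only
  its modulus enters; likewise \<open>gg'\<close> is even in \<open>KK\<close>. There
  \<open>dg / eta = gg' w * v / 2\<close> by \<open>dw = (v / 2) * eta\<close>, and
  \<open>|v|^2 = |cf1 x|\<close>.\<close>

definition GG :: "point => real" where "GG p = (cmod (gg (csqrt (xc p))))\<^sup>2"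
definition KK :: "point => real" where "KK p = (cmod (gg' (csqrt (xc p))))\<^sup>2 * cmod (cf1 (xc p)) / 4"

lemma csqrt_sgn: "\<exists>s. s\<^sup>2 = 1 \<and> csqrt (w\<^sup>2) = s * w"
proof -
 have "(csqrt (w\<^sup>2))\<^sup>2 = w\<^sup>2" by (rule power2_csqrt)
 then have "csqrt (w\<^sup>2) = 1 * w \<or> csqrt (w\<^sup>2) = (- 1) * w" unfolding power2_eq_iff by simp
 then show ?thesis by (metis power2_minus power_one)
qed

lemma GG_KK:
 assumes "pm q = (x, y)" "q \<in> MH"
 shows "GG (pt (x, y)) = (cmod (gg (fst q)))\<^sup>2" "KK (pt (x, y)) = (cmod (gg' (fst q) * snd q / 2))\<^sup>2"
proof -
 have x: "x = (fst q)\<^sup>2" using assms(1) by (simp add: pm_def)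
 obtain s where s: "s\<^sup>2 = 1" "csqrt x = s * fst q" using csqrt_sgn x by metis
 show "GG (pt (x, y)) = (cmod (gg (fst q)))\<^sup>2" by (simp add: GG_def s gg_sgn del: csqrt.simps)
 have "cmod (cf1 x) = (cmod (snd q))\<^sup>2" using assms(2) unfolding in_MH x by (metis norm_power)
 moreover have "gg' (csqrt x) = gg' (fst q)" using s assms(2) by (simp add: gg'_sgn in_MH)
 ultimately show "KK (pt (x, y)) = (cmod (gg' (fst q) * snd q / 2))\<^sup>2"
  by (simp add: KK_def norm_mult norm_divide power_mult_distrib power_divide del: csqrt.simps)
qed

lemma AM_E:
 assumes "c \<in> AM"
 obtains m a r h w v where "c = fchart m a r h" "fin_data m a r h" "ball a r \<inter> PX = {}" "sect m a r h w v"
 using assms sect_exists unfolding AM_def by blast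

lemma sect_notin_RHO: "sect m a r h w v ==> ball a r \<inter> PX = {} ==> z \<in> Vd m r ==> w z \<notin> RHO"
 using sect_pm(3) by (force simp: in_MH)

lemma gg_sect:
 assumes s: "sect m a r h w v" and w: "\<And>z. z \<in> V ==> w z \<notin> RHO" and V: "V \<subseteq> Vd m r" "open V"
 shows "(\<lambda>z. gg (w z)) holomorphic_on V" "(\<lambda>z. gg' (w z)) holomorphic_on V"
  "\<And>z. z \<in> V ==> deriv (\<lambda>z. gg (w z)) z = gg' (w z) * deriv w z"
proof -
 note S = sectD [OF s]
 have wV: "w holomorphic_on V" using S(2) V(1) by (rule holomorphic_on_subset)
 show "(\<lambda>z. gg (w z)) holomorphic_on V" "(\<lambda>z. gg' (w z)) holomorphic_on V"
  by (rule holomorphic_on_compose_fun [OF wV gg_hol], simp add: w)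
    (rule holomorphic_on_compose_fun [OF wV gg'_hol], simp add: w)
 fix z assume z: "z \<in> V"
 have "(gg has_field_derivative gg' (w z)) (at (w z))"
  using holomorphic_derivI [OF gg_hol open_compl_RHO, of "w z"] w [OF z] by (simp add: gg'_def)
 moreover have "(w has_field_derivative deriv w z) (at z)" using holomorphic_derivI [OF wV V(2) z] .
 ultimately show "deriv (\<lambda>z. gg (w z)) z = gg' (w z) * deriv w z" by (intro DERIV_imp_deriv DERIV_chain2)
qed

text \<open>In each chart a section \<open>(w, v)\<close> of the double cover supplies the local
  functions \<open>gg (w z)\<close> and \<open>gg' (w z) * v z / 2\<close>. The opposite section
  changes only their signs, so \<open>GG\<close> and \<open>KK\<close> are their squared
  moduli.\<close>

sublocale ws: weierstrass_surface XM AM "\<lambda>c. eta c id" GG KK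
proof
 show "riemann_surface XM AM" by (rule riemann_surface_XM)
 show "second_countable_space XM" by (rule second_countable_XM)
 fix c assume c: "c \<in> AM"
 obtain m a r h w v where f: "c = fchart m a r h" "fin_data m a r h" "ball a r \<inter> PX = {}" "sect m a r h w v"
  using AM_E [OF c] .
 note im = is_chart_fchart(2) [OF f(2), folded f(1)] and S = sectD [OF f(4)]
 show "eta c id holomorphic_on chart_image c" unfolding im using eta_fchart_hol [OF f(2)] f(1) by simp
 show "eta c id z \<noteq> 0" if "z \<in> chart_image c" for z using that unfolding im using eta_fchart(2) [OF f(2)] f(1) by simp
 show "eta d id (coord c id d z) * deriv (coord c id d) z = eta c id z"
  if d: "d \<in> AM" and z: "z \<in> coord_dom c id d" for d z
 proof (rule eta_trans)
  show "c \<in> AS" "d \<in> AS" using c d by (auto simp: AS_def)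
  have "z \<in> Vd m r" using z coord_dom_eq [OF AS_chart, of c id d] c im by (auto simp: AS_def)
  then show "chart_inv c z \<noteq> infp" using is_chart_fchart(3) [OF f(2)] f(1) by simp
 qed (rule z)
 have g: "(\<lambda>z. gg (w z)) holomorphic_on Vd m r" "(\<lambda>z. gg' (w z)) holomorphic_on Vd m r"
  "\<And>z. z \<in> Vd m r ==> deriv (\<lambda>z. gg (w z)) z = gg' (w z) * deriv w z"
  by (rule gg_sect [OF f(4) _ order_refl open_Vd(1) [OF f(2)]]; use sect_notin_RHO [OF f(4,3)] in blast)+
 show "\<exists>g a. g holomorphic_on chart_image c \<and> a holomorphic_on chart_image c \<and>
    (\<forall>z\<in>chart_image c. deriv g z = a z * eta c id z \<and> (cmod (g z))\<^sup>2 = GG (chart_inv c z) \<and>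
      (cmod (a z))\<^sup>2 = KK (chart_inv c z))"
 proof (intro exI conjI ballI)
  show "(\<lambda>z. gg (w z)) holomorphic_on chart_image c" unfolding im by (rule g(1))
  show "(\<lambda>z. gg' (w z) * v z / 2) holomorphic_on chart_image c"
   unfolding im using g(2) S(3) by (intro holomorphic_intros) auto
  fix z assume "z \<in> chart_image c"
  then have z: "z \<in> Vd m r" by (simp add: im)
  show "deriv (\<lambda>z. gg (w z)) z = gg' (w z) * v z / 2 * eta c id z"
   unfolding g(3) [OF z] S(7) [OF z] f(1) eta_fchart(1) [OF f(2) z] by (simp add: ac_simps)
  have "pm (w z, v z) = (Xd m a z, Yd m a h z)" using sect_pm(1) [OF f(4) z] by (simp add: phid_def)
  note GG_KK [OF this sect_pm(3) [OF f(4) z f(3)]]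
  moreover have "chart_inv c z = pt (Xd m a z, Yd m a h z)" using is_chart_fchart(3) [OF f(2) z] f(1) by (simp add: phid_def)
  ultimately show "(cmod (gg (w z)))\<^sup>2 = GG (chart_inv c z)"
   "(cmod (gg' (w z) * v z / 2))\<^sup>2 = KK (chart_inv c z)" by simp_all
 qed
qed

subsection \<open>The universal cover\<close>

definition cpi :: "(real => point) set => point" where "cpi y = pt (pm (cov.proj y))"
definition BY :: "(real => point) set chart set" where "BY = lifted_charts cov.Cov XM AM cpi"

lemma proj_MH: "y \<in> topspace cov.Cov ==> cov.proj y \<in> MH"
 using cov.continuous_proj by (auto simp: continuous_map_def)

lemma continuous_cpi: "continuous_map cov.Cov XM cpi"
 using continuous_map_compose [OF cov.continuous_proj continuous_pt_pm] by (simp add: cpi_def [abs_def] o_def)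

lemma subtopology_XM: "c \<in> AM ==> subtopology XM (fst c) = subtopology SS (fst c)"
proof -
 assume "c \<in> AM"
 then have "fst c \<subseteq> topspace SS - P" using AM_cover unfolding topspace_minus_P by blast
 then show ?thesis by (simp add: XM_def subtopology_subtopology Int_absorb1)
qed

text \<open>The projection is a composition of two coverings. A chart has two disjoint sheets in
  \<open>MH\<close>, each evenly covered by the universal cover of \<open>MH\<close>; the union of
  both families of sheets works.\<close>

lemma evenly_covered_AM:
 assumes c: "c \<in> AM"
 shows "evenly_covered cov.Cov XM cpi (fst c)"
proof -
 obtain m a r h w v where f: "c = fchart m a r h" "fin_data m a r h" "ball a r \<inter> PX = {}" "sect m a r h w v"
  using AM_E [OF c] .
 define U where "U = (\<lambda>z. (w z, v z)) ` Vd m r"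
 define U' where "U' = (\<lambda>z. (- w z, - v z)) ` Vd m r"
 have UU: "U \<in> UH" "U' \<in> UH" unfolding UH_def U_def U'_def mem_Collect_eq
  by (intro exI conjI, rule refl, rule f(4) sect_uminus [OF f(4)], rule f(3))+
 note I = sect_image [OF f(4,3), folded U_def U'_def]
 have hm: "homeomorphic_map (subtopology (top_of_set MH) W) (subtopology XM (fst c)) (\<lambda>q. pt (pm q))"
  if s: "sect m a r h w v" and W: "W = (\<lambda>z. (w z, v z)) ` Vd m r" for W w v
 proof -
  let ?si = "\<lambda>z. (w z, v z)"
  have WM: "W \<subseteq> MH" unfolding W using sect_pm(3) [OF s _ f(3)] by blast
  then have sub: "subtopology (top_of_set MH) W = top_of_set W" by (simp add: subtopology_subtopology Int_absorb1)
  have snd: "snd c (pt (phid m a h z)) = z" if "z \<in> Vd m r" for z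
   using psid_phid [OF f(2) that] by (simp add: f(1) fchart_def)
  have fc: "fst c = pt ` phid m a h ` Vd m r" using fst_fchart [OF f(2)] f(1) by simp
  have cc: "is_chart SS c" using AS_chart c by (simp add: AS_def)
  have "continuous_map (top_of_set W) XM (\<lambda>q. pt (pm q))"
   using continuous_map_from_subtopology_mono [OF continuous_pt_pm WM] by (simp add: o_def)
  moreover have "(\<lambda>q. pt (pm q)) ` W \<subseteq> fst c" unfolding W fc using sect_pm(1) [OF s] by auto
  ultimately have 1: "continuous_map (top_of_set W) (subtopology XM (fst c)) (\<lambda>q. pt (pm q))"
   by (auto simp: continuous_map_in_subtopology)
  have "continuous_map (top_of_set (Vd m r)) (top_of_set W) ?si" using sect_cont [OF s] W by auto
  moreover have "continuous_map (subtopology SS (fst c)) (top_of_set (Vd m r)) (snd c)"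
   using is_chartD(9) [OF cc] is_chart_fchart(2) [OF f(2)] f(1) by simp
  ultimately have 2: "continuous_map (subtopology XM (fst c)) (top_of_set W) (?si \<circ> snd c)"
   unfolding subtopology_XM [OF c] by (intro continuous_map_compose)
  have "homeomorphic_maps (top_of_set W) (subtopology XM (fst c)) (\<lambda>q. pt (pm q)) (?si \<circ> snd c)"
   unfolding homeomorphic_maps_def
  proof (intro conjI ballI 1 2)
   fix q assume "q \<in> topspace (top_of_set W)"
   then obtain z where z: "z \<in> Vd m r" "q = ?si z" by (auto simp: W)
   show "(?si \<circ> snd c) (pt (pm q)) = q" using sect_pm(1) [OF s z(1)] snd [OF z(1)] z(2) by simp
  next
   fix p assume "p \<in> topspace (subtopology XM (fst c))"
   then obtain z where z: "z \<in> Vd m r" "p = pt (phid m a h z)" unfolding fc by auto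
   show "pt (pm ((?si \<circ> snd c) p)) = p" using sect_pm(1) [OF s z(1)] snd [OF z(1)] z(2) by simp
  qed
  then show ?thesis unfolding sub using homeomorphic_maps_map by blast
 qed
 have hmU: "homeomorphic_map (subtopology (top_of_set MH) U) (subtopology XM (fst c)) (\<lambda>q. pt (pm q))"
  "homeomorphic_map (subtopology (top_of_set MH) U') (subtopology XM (fst c)) (\<lambda>q. pt (pm q))"
  using hm [OF f(4) U_def] hm [OF sect_uminus [OF f(4)] U'_def] .
 obtain \<V> where \<V>: "\<Union>\<V> = topspace cov.Cov \<inter> cov.proj -` U" "pairwise disjnt \<V>"
  "\<And>V. V \<in> \<V> ==> openin cov.Cov V \<and> homeomorphic_map (subtopology cov.Cov V) (subtopology (top_of_set MH) U) cov.proj"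
  using cov.evenly_covered_\<U> [OF UU(1)] unfolding evenly_covered_def by metis
 obtain \<V>' where \<V>': "\<Union>\<V>' = topspace cov.Cov \<inter> cov.proj -` U'" "pairwise disjnt \<V>'"
  "\<And>V. V \<in> \<V>' ==> openin cov.Cov V \<and> homeomorphic_map (subtopology cov.Cov V) (subtopology (top_of_set MH) U') cov.proj"
  using cov.evenly_covered_\<U> [OF UU(2)] unfolding evenly_covered_def by metis
 show ?thesis unfolding evenly_covered_def
 proof (intro conjI exI [of _ "\<V> \<union> \<V>'"] ballI)
  show "openin XM (fst c)" using is_chartD(1) ws.A_chart c by blast
  have "cpi y \<in> fst c \<longleftrightarrow> cov.proj y \<in> U \<union> U'" if "y \<in> topspace cov.Cov" for y
   using proj_MH [OF that] unfolding I(4) [symmetric] cpi_def f(1) fst_fchart [OF f(2)] by auto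
  then show "\<Union> (\<V> \<union> \<V>') = topspace cov.Cov \<inter> cpi -` fst c" unfolding Union_Un_distrib \<V>(1) \<V>'(1) by blast
  have "disjnt V V'" if "V \<in> \<V>" "V' \<in> \<V>'" for V V' using \<V>(1) \<V>'(1) that I(3) unfolding disjnt_def by blast
  then show "pairwise disjnt (\<V> \<union> \<V>')" using \<V>(2) \<V>'(2) unfolding pairwise_def by (metis UnE disjnt_sym)
  fix V assume V: "V \<in> \<V> \<union> \<V>'"
  then show "openin cov.Cov V" using \<V>(3) \<V>'(3) by blast
  have "homeomorphic_map (subtopology cov.Cov V) (subtopology XM (fst c)) ((\<lambda>q. pt (pm q)) \<circ> cov.proj)"
   using V \<V>(3) \<V>'(3) hmU homeomorphic_map_compose by blast
  then show "homeomorphic_map (subtopology cov.Cov V) (subtopology XM (fst c)) cpi"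
   by (simp add: cpi_def [abs_def] o_def)
 qed
qed

lemma proj_surj: "cov.proj ` topspace cov.Cov = MH"
proof
 show "cov.proj ` topspace cov.Cov \<subseteq> MH" using proj_MH by blast
 show "MH \<subseteq> cov.proj ` topspace cov.Cov"
 proof
  fix q assume "q \<in> MH"
  then obtain g where "path g" "path_image g \<subseteq> MH" "pathstart g = (\<i>, 0)" "pathfinish g = q"
   using path_connected_MH base_MH unfolding path_connected_def by metis
  then have "g \<in> cov.PB" "cov.proj (Lab g) = q" using cov.proj_L by (auto simp: cov.PB_def)
  then show "q \<in> cov.proj ` topspace cov.Cov" unfolding cov.topspace_Cov by blast
 qed
qed

lemma covering_cpi: "covering cov.Cov XM cpi" unfolding covering_def
proof (intro conjI ballI)
 show "continuous_map cov.Cov XM cpi" by (rule continuous_cpi)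
 have "cpi ` topspace cov.Cov = pt ` pm ` (cov.proj ` topspace cov.Cov)" by (simp add: image_image cpi_def)
 then show "cpi ` topspace cov.Cov = topspace XM" unfolding proj_surj pm_C0 topspace_XM .
 fix x assume "x \<in> topspace XM"
 then obtain c where c: "c \<in> AM" "x \<in> fst c" using ws.A_cover by blast
 then show "\<exists>U. openin XM U \<and> x \<in> U \<and>
      (\<exists>\<V>. \<Union>\<V> = topspace cov.Cov \<inter> cpi -` U \<and> pairwise disjnt \<V> \<and>
         (\<forall>V\<in>\<V>. openin cov.Cov V \<and> homeomorphic_map (subtopology cov.Cov V) (subtopology XM U) cpi))"
  using c(2) evenly_covered_AM [OF c(1)] unfolding evenly_covered_def by (intro exI [of _ "fst c"]) simp
qed

lemma Cov_ne: "topspace cov.Cov \<noteq> {}" using proj_surj base_MH by blast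

lemma riemann_surface_Cov: "riemann_surface cov.Cov BY"
 and holomorphic_cpi: "holomorphic_map cov.Cov BY XM {c. compat XM AM c} cpi" unfolding BY_def
 using riemann_surface_lifted [OF riemann_surface_XM Cov_ne path_connected_imp_connected_space [OF cov.path_connected_Cov]
   cov.Hausdorff_Cov continuous_cpi evenly_covered_AM] by blast+

lemma universal: "universal_cover cov.Cov BY XM {c. compat XM AM c} cpi" unfolding universal_cover_def
 using riemann_surface_Cov cov.simply_connected_Cov covering_cpi holomorphic_cpi by blast

text \<open>In a lifted chart the point of \<open>MH\<close> is one of the two values of a section
  over the chart. Since the chart image is connected the sign is constant, and it is absorbed into
  the section.\<close>

lemma BY_E:
 assumes c': "c' \<in> BY"
 obtains V m a r h w v where "c' = (V, snd (fchart m a r h) \<circ> cpi)" "fchart m a r h \<in> AM" "ball a r \<inter> PX = {}"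
  "sect m a r h w v" "openin cov.Cov V"
  "homeomorphic_map (subtopology cov.Cov V) (subtopology XM (fst (fchart m a r h))) cpi"
  "chart_image c' = Vd m r" "\<And>z. z \<in> Vd m r ==> cov.proj (chart_inv c' z) = (w z, v z)"
proof -
 obtain V c where c: "c' = (V, snd c \<circ> cpi)" "c \<in> AM" "is_chart XM c" "openin cov.Cov V"
   "homeomorphic_map (subtopology cov.Cov V) (subtopology XM (fst c)) cpi"
  using lifted_chartsE [OF c' [unfolded BY_def] ws.A_chart] by metis
 obtain m a r h w v where f: "c = fchart m a r h" "fin_data m a r h" "ball a r \<inter> PX = {}" "sect m a r h w v"
  using AM_E [OF c(2)] .
 note L = lifted_chart [OF c(3-5), folded c(1)]
 have im: "chart_image c = Vd m r" using is_chart_fchart(2) [OF f(2)] f(1) by simp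
 have inv: "chart_inv c' z \<in> topspace cov.Cov" if "z \<in> Vd m r" for z
  using is_chartD(2,6) [OF L(1)] that L(2) im by blast
 have pz: "pm (cov.proj (chart_inv c' z)) = phid m a h z" if "z \<in> Vd m r" for z
  using L(4) [of z] is_chart_fchart(3) [OF f(2) that] that im f(1) by (simp add: cpi_def)
 have "(\<forall>z\<in>Vd m r. (cov.proj \<circ> chart_inv c') z = (w z, v z)) \<or> (\<forall>z\<in>Vd m r. (cov.proj \<circ> chart_inv c') z = - (w z, v z))"
 proof (rule sign_constant)
  show "connectedin euclidean (Vd m r)" using open_Vd(3) [OF f(2)] by (simp add: convex_connected)
  have "continuous_map (top_of_set (Vd m r)) (top_of_set MH) (cov.proj \<circ> chart_inv c')"
   using continuous_map_compose [OF is_chartD(10) [OF L(1)] cov.continuous_proj] L(2) im by simp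
  then show "continuous_map (top_of_set (Vd m r)) euclidean (cov.proj \<circ> chart_inv c')"
   using continuous_map_in_subtopology by blast
  show "continuous_map (top_of_set (Vd m r)) euclidean (\<lambda>z. (w z, v z))" using sect_cont [OF f(4)] by simp
  fix z assume z: "z \<in> Vd m r"
  show "(cov.proj \<circ> chart_inv c') z = (w z, v z) \<or> (cov.proj \<circ> chart_inv c') z = - (w z, v z)"
   using proj_MH [OF inv [OF z]] sect_pm(1,2) [OF f(4) z] pz [OF z] by (intro pm_eq) (auto simp: in_MH)
  show "(w z, v z) \<noteq> 0" using MH_nz sect_pm(3) [OF f(4) z f(3)] by blast
 qed
 then obtain w' v' where s: "sect m a r h w' v'" "\<And>z. z \<in> Vd m r ==> cov.proj (chart_inv c' z) = (w' z, v' z)"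
 proof
  assume "\<forall>z\<in>Vd m r. (cov.proj \<circ> chart_inv c') z = - (w z, v z)"
  then show thesis by (intro that [OF sect_uminus [OF f(4)]]) simp
 qed (use f(4) that in auto)
 show thesis by (rule that [OF _ _ f(3) s(1) c(4) _ _ s(2)]) (use c f(1) L(2) im in auto)
qed

lemma etaY:
 assumes c: "is_chart X c" and V: "openin Y V" and h: "homeomorphic_map (subtopology Y V) (subtopology X (fst c)) p"
  and z: "z \<in> chart_image c"
 shows "eta (V, snd c \<circ> p) p z = eta c id z" unfolding eta_def
 by (rule form_cong [OF is_chartD(3) [OF c] z]) (simp_all add: lifted_chart(4) [OF c V h])

text \<open>\<open>T\<close> need only agree with the projection read in the charts. The lemma then
  serves coordinate changes upstairs, the projection itself, and deck transformations, all of which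
  have the same expression below.\<close>

lemma etaY_trans:
 assumes c': "c' \<in> BY" and b: "b \<in> AS" and z: "z \<in> chart_image c'" "cpi (chart_inv c' z) \<in> fst b"
  and T: "\<And>u. u \<in> chart_image c' ==> T u = snd b (cpi (chart_inv c' u))"
 shows "eta b id (T z) * deriv T z = eta c' cpi z"
proof -
 obtain V c where c: "c' = (V, snd c \<circ> cpi)" "c \<in> AM" "is_chart XM c" "openin cov.Cov V"
   "homeomorphic_map (subtopology cov.Cov V) (subtopology XM (fst c)) cpi"
  using lifted_chartsE [OF c' [unfolded BY_def] ws.A_chart] by metis
 note L = lifted_chart [OF c(3-5), folded c(1)]
 have cS: "c \<in> AS" using c(2) by (simp add: AS_def)
 have Te: "T u = coord c id b u" if "u \<in> chart_image c" for u
  using T [of u] L(2,4) that by (simp add: coord_def)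
 have zc: "z \<in> chart_image c" using z L(2) by simp
 have "chart_inv c z \<in> fst b" using z(2) L(4) [OF zc] by simp
 then have zd: "z \<in> coord_dom c id b" unfolding coord_dom_eq [OF AS_chart [OF cS]] using zc by simp
 have "\<forall>\<^sub>F u in nhds z. u \<in> chart_image c" using is_chartD(3) [OF c(3)] zc eventually_nhds by blast
 then have "\<forall>\<^sub>F u in nhds z. T u = coord c id b u" by eventually_elim (rule Te)
 then have D: "deriv T z = deriv (coord c id b) z" by (rule deriv_cong_ev) simp
 have "chart_inv c z \<in> pt ` {(x, y) \<in> C. x \<notin> PX}"
  unfolding AM_cover using is_chartD(6) [OF c(3) zc] c(2) by blast
 then have "chart_inv c z \<noteq> infp" by auto
 from eta_trans [OF cS b zd this] show ?thesis unfolding D Te [OF zc] using etaY [OF c(3-5) zc] c(1) by simp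
qed

text \<open>The poles of \<open>gg\<close> have been removed from \<open>MH\<close>, so this
  function is holomorphic on the whole universal cover.\<close>

definition gY :: "(real => point) set => complex" where "gY y = gg (fst (cov.proj y))"

lemma gY_hol:
 assumes c': "c' \<in> BY"
 shows "open (chart_image c')" "(gY \<circ> chart_inv c') holomorphic_on chart_image c'"
  "\<And>z. z \<in> chart_image c' ==> deriv (gY \<circ> chart_inv c') z =
    gg' (fst (cov.proj (chart_inv c' z))) * snd (cov.proj (chart_inv c' z)) / 2 * eta c' cpi z"
  "eta c' cpi holomorphic_on chart_image c'" "\<And>z. z \<in> chart_image c' ==> eta c' cpi z \<noteq> 0"
  "(\<lambda>z. gg' (fst (cov.proj (chart_inv c' z))) * snd (cov.proj (chart_inv c' z)) / 2) holomorphic_on chart_image c'"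
proof -
 obtain V m a r h w v where B: "c' = (V, snd (fchart m a r h) \<circ> cpi)" "fchart m a r h \<in> AM" "ball a r \<inter> PX = {}"
  "sect m a r h w v" "openin cov.Cov V"
  "homeomorphic_map (subtopology cov.Cov V) (subtopology XM (fst (fchart m a r h))) cpi"
  "chart_image c' = Vd m r" "\<And>z. z \<in> Vd m r ==> cov.proj (chart_inv c' z) = (w z, v z)"
  using BY_E [OF c'] by blast
 note S = sectD [OF B(4)] and o = open_Vd(1) [OF sectD(1) [OF B(4)]]
 have g: "(\<lambda>z. gg (w z)) holomorphic_on Vd m r" "(\<lambda>z. gg' (w z)) holomorphic_on Vd m r"
  "\<And>z. z \<in> Vd m r ==> deriv (\<lambda>z. gg (w z)) z = gg' (w z) * deriv w z"
  by (rule gg_sect [OF B(4) _ order_refl o]; use sect_notin_RHO [OF B(4,3)] in blast)+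
 show "open (chart_image c')" unfolding B(7) by (rule o)
 have e: "eta c' cpi z = eta (fchart m a r h) id z" if "z \<in> Vd m r" for z
  unfolding B(1) by (rule etaY [OF ws.A_chart [OF B(2)] B(5,6)]) (simp add: is_chart_fchart(2) [OF S(1)] that)
 show "eta c' cpi holomorphic_on chart_image c'"
  unfolding B(7) by (rule holomorphic_transform [OF eta_fchart_hol [OF S(1)]]) (simp add: e)
 show "eta c' cpi z \<noteq> 0" if "z \<in> chart_image c'" for z using that e eta_fchart(2) [OF S(1)] B(7) by simp
 have gy: "(gY \<circ> chart_inv c') z = gg (w z)" if "z \<in> Vd m r" for z by (simp add: gY_def B(8) [OF that])
 show gh: "(gY \<circ> chart_inv c') holomorphic_on chart_image c'"
  unfolding B(7) by (rule holomorphic_transform [OF g(1) gy [symmetric]])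
 have "(\<lambda>z. gg' (w z) * v z / 2) holomorphic_on Vd m r" using g(2) S(3) by (intro holomorphic_intros) auto
 then show "(\<lambda>z. gg' (fst (cov.proj (chart_inv c' z))) * snd (cov.proj (chart_inv c' z)) / 2) holomorphic_on chart_image c'"
  unfolding B(7) by (rule holomorphic_transform) (simp add: B(8))
 fix z assume "z \<in> chart_image c'"
 then have z: "z \<in> Vd m r" by (simp add: B(7))
 have "deriv (gY \<circ> chart_inv c') z = deriv (\<lambda>z. gg (w z)) z"
  by (rule complex_derivative_transform_within_open [OF gh [unfolded B(7)] g(1) o z]) (rule gy)
 then show "deriv (gY \<circ> chart_inv c') z =
    gg' (fst (cov.proj (chart_inv c' z))) * snd (cov.proj (chart_inv c' z)) / 2 * eta c' cpi z"
  unfolding g(3) [OF z] S(7) [OF z] e [OF z] eta_fchart(1) [OF S(1) z] B(8) [OF z] by (simp add: ac_simps)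
qed

text \<open>Substitution of \<open>dg = (gg' w * v / 2) * eta\<close>. The product is analytic, so
  \<open>remove_sings\<close> does not change it.\<close>

lemma hopf_eq:
 assumes c': "c' \<in> BY" and z: "z \<in> chart_image c'"
 shows "hopf_differential gY (\<lambda>c. eta c cpi) c' z =
    gg' (fst (cov.proj (chart_inv c' z))) * snd (cov.proj (chart_inv c' z)) / 2 * (eta c' cpi z)\<^sup>2"
proof -
 note g = gY_hol [OF c']
 have "(\<lambda>z. deriv (gY \<circ> chart_inv c') z * eta c' cpi z) holomorphic_on chart_image c'"
  by (rule holomorphic_on_mult [OF holomorphic_deriv [OF g(2,1)] g(4)])
 then have "(\<lambda>z. deriv (gY \<circ> chart_inv c') z * eta c' cpi z) analytic_on {z}" using g(1) z analytic_at by blast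
 then show ?thesis unfolding hopf_differential_def using g(3) [OF z] by (simp add: power2_eq_square)
qed

lemma coord_BY:
 assumes c': "c' \<in> BY" and b: "is_chart XM b" "coord_dom c' cpi b \<noteq> {}" and comp: "compat XM AM b"
 shows "coord c' cpi b holomorphic_on coord_dom c' cpi b" "open (coord_dom c' cpi b)"
  "coord_dom c' cpi b = {z \<in> chart_image c'. cpi (chart_inv c' z) \<in> fst b}"
proof -
 show "coord c' cpi b holomorphic_on coord_dom c' cpi b"
  using holomorphic_cpi c' comp unfolding holomorphic_map_def by blast
 obtain V c where c: "c' = (V, snd c \<circ> cpi)" "c \<in> AM" "is_chart XM c" "openin cov.Cov V"
   "homeomorphic_map (subtopology cov.Cov V) (subtopology XM (fst c)) cpi"
  using lifted_chartsE [OF c' [unfolded BY_def] ws.A_chart] by metis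
 note L = lifted_chart [OF c(3-5), folded c(1)]
 show "open (coord_dom c' cpi b)" unfolding L(5) by (rule coord_dom_open [OF c(3) b(1)])
 show "coord_dom c' cpi b = {z \<in> chart_image c'. cpi (chart_inv c' z) \<in> fst b}" by (rule coord_dom_eq [OF L(1)])
qed

lemma BY_chart: "c' \<in> BY ==> is_chart cov.Cov c'" using riemann_surface_Cov by (auto simp: riemann_surface_def)

text \<open>The pole case is vacuous because \<open>gY\<close> is holomorphic, and
  \<open>eta\<close> has no zero over \<open>M\<close>. The metric formula follows from the
  transformation rule of \<open>eta\<close> and from \<open>GG\<close> being \<open>|gY|^2\<close>
  upstairs.\<close>

lemma weierstrass_data: "weierstrass_data ws.M cov.Cov BY cpi gY (\<lambda>c. eta c cpi)"
 unfolding weierstrass_data_def ws.M_sel ws.conformal_charts_M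
proof (intro conjI ballI)
 show "universal_cover cov.Cov BY XM {c. compat XM AM c} cpi" by (rule universal)
next
 fix c' assume c': "c' \<in> BY"
 have "(gY \<circ> chart_inv c') analytic_on chart_image c'"
  using gY_hol(1,2) [OF c'] by (simp add: analytic_on_open)
 then show "(gY \<circ> chart_inv c') nicely_meromorphic_on chart_image c'" by (rule analytic_on_imp_nicely_meromorphic_on)
next
 show "holomorphic_differential 1 BY (topspace cov.Cov) (\<lambda>c. eta c cpi)"
  unfolding holomorphic_differential_def pullback_on_def
 proof (intro conjI ballI)
  fix c' assume c': "c' \<in> BY"
  show "eta c' cpi holomorphic_on snd c' ` (fst c' \<inter> topspace cov.Cov)"
   by (rule holomorphic_on_subset [OF gY_hol(4) [OF c']]) (auto simp: chart_image_def)
  fix d' z assume d': "d' \<in> BY" and z: "z \<in> snd c' ` (fst c' \<inter> topspace cov.Cov \<inter> id -` fst d')"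
  obtain U d where d: "d' = (U, snd d \<circ> cpi)" "d \<in> AM" "is_chart XM d" "openin cov.Cov U"
   "homeomorphic_map (subtopology cov.Cov U) (subtopology XM (fst d)) cpi"
   using lifted_chartsE [OF d' [unfolded BY_def] ws.A_chart] by metis
  note L = lifted_chart [OF d(3-5), folded d(1)]
  obtain x where x: "x \<in> fst c'" "x \<in> U" "z = snd c' x" using z d(1) by auto
  have zi: "z \<in> chart_image c'" "chart_inv c' z = x" using x is_chartD(5,8) [OF BY_chart [OF c'] x(1)] by auto
  have px: "cpi x \<in> fst d" using L(3) x(2) by blast
  have T: "coord c' id d' u = snd d (cpi (chart_inv c' u))" for u by (simp add: coord_def d(1))
  have "eta d id (coord c' id d' z) * deriv (coord c' id d') z = eta c' cpi z"
   by (rule etaY_trans [OF c' _ zi(1) _ T]) (use d(2) zi(2) px in \<open>auto simp: AS_def\<close>)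
  moreover have "coord c' id d' z \<in> chart_image d" unfolding T zi(2) by (rule is_chartD(5) [OF d(3) px])
  ultimately show "eta d' cpi (coord c' id d' z) * deriv (coord c' id d') z ^ 1 = eta c' cpi z"
   using etaY [OF d(3-5)] d(1) by simp
 qed
next
 fix c' z assume c': "c' \<in> BY" and z: "z \<in> chart_image c'"
 have "\<not> is_pole (gY \<circ> chart_inv c') z" using not_is_pole_holomorphic gY_hol(1,2) [OF c'] z by blast
 then show "if is_pole (gY \<circ> chart_inv c') z
    then eta c' cpi z = 0 \<and> zorder (eta c' cpi) z = 2 * (- zorder (gY \<circ> chart_inv c') z)
    else eta c' cpi z \<noteq> 0" using gY_hol(5) [OF c' z] by simp
next
 fix c' d z assume c': "c' \<in> BY" and d: "d \<in> AM" and z: "z \<in> coord_dom c' cpi d"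
 let ?T = "coord c' cpi d"
 have dd: "is_chart XM d" "compat XM AM d" using ws.A_chart d riemann_surface_imp_compat [OF riemann_surface_XM] by auto
 note co = coord_BY [OF c' dd(1) _ dd(2)]
 have ne: "coord_dom c' cpi d \<noteq> {}" using z by blast
 have zi: "z \<in> chart_image c'" "cpi (chart_inv c' z) \<in> fst d" using z co(3) [OF ne] by auto
 have pd: "pd u ?T z = u * deriv ?T z" for u by (rule pd_holomorphic [OF co(1) [OF ne] co(2) [OF ne] z])
 have tr: "eta d id (?T z) * deriv ?T z = eta c' cpi z"
  by (rule etaY_trans [OF c' _ zi]) (use d in \<open>auto simp: AS_def coord_def\<close>)
 have inv: "chart_inv d (?T z) = cpi (chart_inv c' z)" using is_chartD(8) [OF dd(1) zi(2)] by (simp add: coord_def)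
 have "cov.proj (chart_inv c' z) \<in> MH" using proj_MH is_chartD(2,6) [OF BY_chart [OF c']] zi(1) by blast
 then have G: "GG (chart_inv d (?T z)) = (cmod (gY (chart_inv c' z)))\<^sup>2"
  unfolding inv cpi_def gY_def using GG_KK(1) [of "cov.proj (chart_inv c' z)"] by (metis surj_pair)
 show "\<not> is_pole (gY \<circ> chart_inv c') z \<longrightarrow> (\<forall>u w. ws.lam d (?T z) * (pd u ?T z \<bullet> pd w ?T z)
      = 1/4 * (norm (eta c' cpi z))\<^sup>2 * (1 + (norm (gY (chart_inv c' z)))\<^sup>2)\<^sup>2 * (u \<bullet> w))"
  unfolding pd inner_mult_complex ws.lam_def G tr [symmetric] by (simp add: norm_mult power_mult_distrib)
qed

text \<open>The conformal charts of \<open>M\<close> and the restricted charts of the compact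
  surface belong to one maximal atlas, so the identity is holomorphic both ways.\<close>

lemma biholomorphic_id:
 "biholomorphism XM {c. compat XM AM c} XM (restrict_charts AS (topspace SS - P)) id"
proof -
 note comp = riemann_surface_imp_compat [OF riemann_surface_XM]
 have cov: "topspace XM = (\<Union>c\<in>{c. compat XM AM c}. fst c)"
 proof
  show "topspace XM \<subseteq> (\<Union>c\<in>{c. compat XM AM c}. fst c)" unfolding ws.A_cover using comp by blast
  show "(\<Union>c\<in>{c. compat XM AM c}. fst c) \<subseteq> topspace XM" using is_chartD(2) by (auto simp: compat_def)
 qed
 have rs: "compat XM AM c" if "c \<in> restrict_charts AS (topspace SS - P)" for c
  using riemann_surface_imp_compat [OF riemann_surface_restricted that] AM_sub by (auto simp: compat_def)
 have "riemann_surface XM {c. compat XM AM c}"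
  by (rule riemann_surface_compat [OF riemann_surface_XM _ cov]) simp
 moreover have "holomorphic_map XM {c. compat XM AM c} XM (restrict_charts AS (topspace SS - P)) id"
  "holomorphic_map XM (restrict_charts AS (topspace SS - P)) XM {c. compat XM AM c} id"
  using rs by (auto intro!: holomorphic_map_id [OF riemann_surface_XM])
 ultimately show ?thesis unfolding biholomorphism_def using riemann_surface_restricted
  by (intro conjI exI [of _ id]) (auto simp: homeomorphic_maps_def)
qed

end

context curve_ends
begin

subsection \<open>The ends\<close>

text \<open>At a finite puncture \<open>w\<close> takes a value \<open>rho j0\<close> and is a local
  coordinate of the double cover, because \<open>dw = (v / 2) * eta\<close> and \<open>v\<close>
  does not vanish there. Hence \<open>gg' w\<close> has a double pole in the chart coordinate, while
  \<open>v\<close> and \<open>eta\<close> have neither zero nor pole.\<close>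

lemma end_data_fin:
 assumes xy: "(x, y) \<in> C" "x \<in> PX" and f: "fin_data m x r h" "(ball x r - {x}) \<inter> (PX \<union> roots) = {}"
 obtains w v H where "sect m x r h w v" "\<And>z. z \<in> Vd m r - {0} ==> (w z, v z) \<in> MH"
  "H holomorphic_on Vd m r" "H 0 \<noteq> 0"
  "\<And>z. z \<in> Vd m r - {0} ==> gg' (w z) * v z / 2 * (of_nat m / h (Xd m x z))\<^sup>2 = H z * z powi (- 2)"
proof -
 obtain w v where s: "sect m x r h w v" using sect_exists [OF f(1)] by blast
 note S = sectD [OF s] and o = open_Vd [OF f(1)]
 have m0: "m > 0" using fd_simps(2) [OF f(1)] by auto
 have nR: "w z \<notin> RHO" if "z \<in> Vd m r" "z \<noteq> 0" for z
 proof -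
  have "Xd m x z \<in> ball x r - {x}" using Xd_ball [OF f(1)] that m0 by (auto simp: Xd_def)
  then have "Xd m x z \<notin> PX" using f(2) by blast
  then show ?thesis using S(4) [OF that(1)] sq_in_PX by metis
 qed
 have X0: "Xd m x 0 = x" using m0 by (simp add: Xd_def)
 have "w 0 \<in> RHO" using S(4) [OF o(2)] xy(2) sq_in_PX X0 by metis
 then obtain j0 where j0: "j0 < d" "w 0 = rho j0" by (auto simp: RHO_def)
 have h0: "h (Xd m x z) \<noteq> 0" if "z \<in> Vd m r" for z using fd_simps(4) [OF f(1)] Xd_ball [OF f(1)] that by blast
 have v0: "v 0 \<noteq> 0" using S(6) [OF o(2)] cf1_PX [OF xy(2)] X0 by auto
 \<comment> \<open>\<open>w - w 0 = z * u\<close> with \<open>u\<close> holomorphic and without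
   zeros: at \<open>0\<close> it is \<open>w'(0)\<close>, which is nonzero, and elsewhere
   \<open>w\<close> avoids \<open>RHO\<close>.\<close>
 define u where "u = (\<lambda>z. if z = 0 then deriv w 0 else (w z - w 0) / (z - 0))"
 have uh: "u holomorphic_on Vd m r" unfolding u_def by (rule pole_lemma_open [OF S(2) o(1)])
 have u0: "u z \<noteq> 0" if "z \<in> Vd m r" for z
 proof (cases "z = 0")
  case True
  then show ?thesis using S(7) [OF o(2)] m0 h0 [OF o(2)] v0 by (simp add: u_def)
 next
  case False
  then have "w z \<noteq> w 0" using nR [OF that False] \<open>w 0 \<in> RHO\<close> by auto
  then show ?thesis using False by (simp add: u_def)
 qed
 \<comment> \<open>\<open>(w - rho j0)^2 * gg' w\<close> with the singular term already cancelled to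
   \<open>- 1\<close>, hence holomorphic across the pole with value \<open>- 1\<close>
   there.\<close>
 define B where "B = (\<lambda>w. of_nat (2*k-1) * w ^ (2*k-2) * (w - rho j0)\<^sup>2 - 1
   - (w - rho j0)\<^sup>2 * (\<Sum>j\<in>{..<d} - {j0}. 1 / (w - rho j)\<^sup>2))"
 have nj: "w z \<noteq> rho j" if "z \<in> Vd m r" "j \<in> {..<d} - {j0}" for z j
 proof
  assume e: "w z = rho j"
  then have "w z \<in> RHO" using that(2) by (auto simp: RHO_def)
  then have "z = 0" using nR that(1) by blast
  then have "rho j = rho j0" using e j0(2) by simp
  then show False using inj_rho that(2) by (auto simp: inj_eq)
 qed
 have Bh: "(\<lambda>z. B (w z)) holomorphic_on Vd m r"
  unfolding B_def using nj by (intro holomorphic_intros S(2)) auto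
 have Bg: "gg' u * (u - rho j0)\<^sup>2 = B u" if u: "u \<notin> RHO" for u
 proof -
  have "u - rho j0 \<noteq> 0" using u j0(1) by (auto simp: RHO_def)
  moreover have "(\<Sum>j<d. 1 / (u - rho j)\<^sup>2) = 1 / (u - rho j0)\<^sup>2 + (\<Sum>j\<in>{..<d} - {j0}. 1 / (u - rho j)\<^sup>2)"
   using j0(1) by (intro sum.remove) auto
  ultimately show ?thesis unfolding gg'_eq [OF u] B_def by (simp add: algebra_simps)
 qed
 define H where "H = (\<lambda>z. B (w z) / (u z)\<^sup>2 * v z / 2 * (of_nat m / h (Xd m x z))\<^sup>2)"
 show thesis
 proof
  show "sect m x r h w v" by (rule s)
  show "H holomorphic_on Vd m r"
   unfolding H_def using u0 h0 by (intro holomorphic_intros Bh uh S(3) hX_hol [OF f(1)]) auto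
  have "B (w 0) = - 1" by (simp add: B_def j0(2))
  then show "H 0 \<noteq> 0" using u0 [OF o(2)] h0 [OF o(2)] v0 m0 by (simp add: H_def)
  fix z assume "z \<in> Vd m r - {0}"
  then have z: "z \<in> Vd m r" "z \<noteq> 0" by auto
  show "(w z, v z) \<in> MH" using nR [OF z] sect_pm(2) [OF s z(1)] by (simp add: in_MH)
  have "w z - rho j0 = z * u z" using z(2) j0(2) by (simp add: u_def)
  then have "gg' (w z) = B (w z) / (z * u z)\<^sup>2"
   using Bg [OF nR [OF z]] z(2) u0 [OF z(1)] by (simp add: field_simps)
  then show "gg' (w z) * v z / 2 * (of_nat m / h (Xd m x z))\<^sup>2 = H z * z powi (- 2)"
   using z(2) by (simp add: H_def power_int_minus field_simps power2_eq_square)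
 qed
qed

text \<open>With \<open>w = 1/z\<close> the factors have orders \<open>- (2k - 2)\<close> for
  \<open>gg'\<close>, \<open>- 2k\<close> for \<open>v\<close> and \<open>2 (2k - 2)\<close> for the
  square of the form, which add up to \<open>- 2\<close>.\<close>

lemma end_data_inf:
 obtains H where "\<And>z. z \<in> Vinf - {0} ==> (1 / z, hinf (z\<^sup>2) / z ^ (2*k)) \<in> MH"
  "\<And>z. z \<in> Vinf - {0} ==> pm (1 / z, hinf (z\<^sup>2) / z ^ (2*k)) = qinf z"
  "H holomorphic_on Vinf" "H 0 \<noteq> 0"
  "\<And>z. z \<in> Vinf - {0} ==>
    gg' (1 / z) * (hinf (z\<^sup>2) / z ^ (2*k)) / 2 * (- 2 * z ^ (2 * k - 2) / hinf (z\<^sup>2))\<^sup>2 = H z * z powi (- 2)"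
proof -
 \<comment> \<open>The product multiplied by \<open>z^2\<close>, with all negative powers of
   \<open>z\<close> cleared. Its value at \<open>0\<close> is
   \<open>2 (2k - 1) / hinf 0\<close>.\<close>
 define H where "H = (\<lambda>z. 2 * (of_nat (2*k-1) - z ^ (2*k) * (\<Sum>j<d. 1 / (1 - rho j * z)\<^sup>2)) / hinf (z\<^sup>2))"
 have nR: "1 / z \<notin> RHO" if "z \<in> Vinf" "z \<noteq> 0" for z
 proof
  assume "1 / z \<in> RHO"
  then have "(1 / z)\<^sup>2 \<in> PX" by (simp only: sq_in_PX)
  then have "fst (qinf z) \<in> PX" by (simp add: qinf_def power_divide)
  from PX_real [OF this] have "cmod (fst (qinf z)) \<le> (real d)\<^sup>2" by (simp add: cmod_eq_Re)
  then show False using qinf_big [OF that] Rinf_pos(3) by simp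
 qed
 have nz: "1 - rho j * z \<noteq> 0" if "z \<in> Vinf" "j < d" for z j
 proof
  assume "1 - rho j * z = 0"
  then have e: "rho j * z = 1" by simp
  then have z: "z \<noteq> 0" by auto
  then have "1 / z = rho j" using e by (simp add: divide_eq_eq)
  then have "1 / z \<in> RHO" using that(2) by (simp add: RHO_def)
  then show False using nR [OF that(1) z] by blast
 qed
 have h0: "hinf (z\<^sup>2) \<noteq> 0" if "z \<in> Vinf" for z using hinf(3) [OF Vinf_sq [OF that]] .
 show thesis
 proof
  show "H holomorphic_on Vinf" unfolding H_def using nz h0 by (intro holomorphic_intros hinf_sq_hol) auto
  have "of_nat (2*k-1) \<noteq> (0::complex)" using k by (simp only: of_nat_eq_0_iff)
  then show "H 0 \<noteq> 0" using k h0 [OF open_Vinf(2)] by (simp add: H_def zero_power)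
  fix z assume "z \<in> Vinf - {0}"
  then have z: "z \<in> Vinf" "z \<noteq> 0" by auto
  show q: "pm (1 / z, hinf (z\<^sup>2) / z ^ (2*k)) = qinf z" using z(2) by (simp add: pm_def qinf_def power_divide)
  have "qinf z \<in> C" by (rule qinf_C [OF z])
  then have "(hinf (z\<^sup>2) / z ^ (2*k))\<^sup>2 = cf1 ((1 / z)\<^sup>2)"
   unfolding q [symmetric] using z(2) by (simp add: pm_def in_C cf_def power_mult_distrib power_divide field_simps)
  then show "(1 / z, hinf (z\<^sup>2) / z ^ (2*k)) \<in> MH" using nR [OF z] by (simp add: in_MH)
  define Z where "Z = z ^ (2*k-2)"
  have Z0: "Z \<noteq> 0" using z by (simp add: Z_def)
  have Z2: "z ^ (2*k) = Z * z\<^sup>2"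
  proof -
   have "2*k = (2*k-2) + 2" using k by simp
   then show ?thesis unfolding Z_def by (metis power_add)
  qed
  define T where "T = (\<Sum>j<d. 1 / (1 - rho j * z)\<^sup>2)"
  have "(\<Sum>j<d. 1 / (1 / z - rho j)\<^sup>2) = (\<Sum>j<d. z\<^sup>2 * (1 / (1 - rho j * z)\<^sup>2))"
  proof (rule sum.cong)
   fix j assume "j \<in> {..<d}"
   have "1 / z - rho j = (1 - rho j * z) / z" using z(2) by (simp add: field_simps)
   then show "1 / (1 / z - rho j)\<^sup>2 = z\<^sup>2 * (1 / (1 - rho j * z)\<^sup>2)" by (simp add: power_divide)
  qed simp
  then have "gg' (1 / z) = of_nat (2*k-1) / Z - z\<^sup>2 * T"
   unfolding gg'_eq [OF nR [OF z]] by (simp add: T_def sum_distrib_left Z_def power_divide)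
  moreover have "(of_nat (2*k-1) / Z - z\<^sup>2 * T) * (hh / (Z * z\<^sup>2)) / 2 * (- 2 * Z / hh)\<^sup>2
    = 2 * (of_nat (2*k-1) - Z * z\<^sup>2 * T) / hh * z powi (- 2)" if "hh \<noteq> 0" for hh
   using that Z0 z(2) by (simp add: power_int_minus field_simps power2_eq_square del: of_nat_diff)
  ultimately show "gg' (1 / z) * (hinf (z\<^sup>2) / z ^ (2*k)) / 2 * (- 2 * z ^ (2 * k - 2) / hinf (z\<^sup>2))\<^sup>2 = H z * z powi (- 2)"
   using h0 [OF z(1)] unfolding H_def Z2 T_def [symmetric] Z_def [symmetric] by simp
 qed
qed

text \<open>Both kinds of ends in one form: a coordinate disc centred at the puncture, a section
  \<open>(om, up)\<close> of the double cover over the punctured disc, and the Hopf differential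
  equal to \<open>z^(-2)\<close> times a holomorphic function that does not vanish at the
  centre.\<close>

lemma end_data:
 assumes p: "p \<in> P"
 obtains R om up H where "R > 0" "chart_image (cchart p) = ball 0 R" "snd (cchart p) p = 0"
  "om holomorphic_on ball 0 R - {0}" "up holomorphic_on ball 0 R - {0}"
  "\<And>z. z \<in> ball 0 R - {0} ==> (om z, up z) \<in> MH"
  "\<And>z. z \<in> ball 0 R - {0} ==> chart_inv (cchart p) z = pt (pm (om z, up z))"
  "H holomorphic_on ball 0 R" "H 0 \<noteq> 0"
  "\<And>z. z \<in> ball 0 R - {0} ==> gg' (om z) * up z / 2 * (eta (cchart p) id z)\<^sup>2 = H z * z powi (- 2)"
proof (cases "p = infp")
 case True
 then have c: "cchart p = ichart" by (simp add: cchart_def)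
 obtain H where H: "\<And>z. z \<in> Vinf - {0} ==> (1 / z, hinf (z\<^sup>2) / z ^ (2*k)) \<in> MH"
  "\<And>z. z \<in> Vinf - {0} ==> pm (1 / z, hinf (z\<^sup>2) / z ^ (2*k)) = qinf z"
  "H holomorphic_on Vinf" "H 0 \<noteq> 0"
  "\<And>z. z \<in> Vinf - {0} ==>
    gg' (1 / z) * (hinf (z\<^sup>2) / z ^ (2*k)) / 2 * (- 2 * z ^ (2 * k - 2) / hinf (z\<^sup>2))\<^sup>2 = H z * z powi (- 2)"
  using end_data_inf by blast
 note V = Vinf_ball [symmetric]
 show thesis
 proof (rule that [of "sqrt (1/Rinf)" "\<lambda>z. 1 / z" "\<lambda>z. hinf (z\<^sup>2) / z ^ (2*k)" H], unfold V c)
  show "sqrt (1 / Rinf) > 0" using Rinf_pos by simp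
  show "chart_image ichart = Vinf" by (rule is_chart_ichart(2))
  show "snd ichart p = 0" using True by (simp add: ichart_def psinf_def)
  show "(\<lambda>z. 1 / z) holomorphic_on Vinf - {0}" by (intro holomorphic_intros) auto
  show "(\<lambda>z. hinf (z\<^sup>2) / z ^ (2*k)) holomorphic_on Vinf - {0}"
   by (intro holomorphic_intros holomorphic_on_subset [OF hinf_sq_hol]) auto
  fix z assume z: "z \<in> Vinf - {0}"
  show "(1 / z, hinf (z\<^sup>2) / z ^ (2*k)) \<in> MH" by (rule H(1) [OF z])
  show "chart_inv ichart z = pt (pm (1 / z, hinf (z\<^sup>2) / z ^ (2*k)))"
   using z H(2) [OF z] is_chart_ichart(3) by (simp add: phinf_def)
  show "gg' (1 / z) * (hinf (z\<^sup>2) / z ^ (2*k)) / 2 * (eta ichart id z)\<^sup>2 = H z * z powi (- 2)"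
   using H(5) [OF z] unfolding eta_ichart [OF z] .
 qed (use H in auto)
next
 case False
 then obtain x y where xy: "p = pt (x, y)" "(x, y) \<in> C" "x \<in> PX" using P_C [OF p] by blast
 obtain m r h where c: "cchart p = fchart m x r h" "fin_data m x r h" "phid m x h 0 = (x, y)"
   "(ball x r - {x}) \<inter> (PX \<union> roots) = {}" using cchart_fin [OF xy(1,2)] by metis
 obtain w v H where H: "sect m x r h w v" "\<And>z. z \<in> Vd m r - {0} ==> (w z, v z) \<in> MH"
  "H holomorphic_on Vd m r" "H 0 \<noteq> 0"
  "\<And>z. z \<in> Vd m r - {0} ==> gg' (w z) * v z / 2 * (of_nat m / h (Xd m x z))\<^sup>2 = H z * z powi (- 2)"
  using end_data_fin [OF xy(2,3) c(2,4)] by blast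
 note S = sectD [OF H(1)]
 have V: "ball 0 (root m r) = Vd m r" by (simp add: Vd_def)
 show thesis
 proof (rule that [of "root m r" w v H], unfold V c(1))
  show "root m r > 0" using fd_simps(1,2) [OF c(2)] by auto
  show "chart_image (fchart m x r h) = Vd m r" by (rule is_chart_fchart(2) [OF c(2)])
  show "snd (fchart m x r h) p = 0"
   using psid_phid [OF c(2) open_Vd(2) [OF c(2)]] c(3) xy(1) by (simp add: fchart_def)
  show "w holomorphic_on Vd m r - {0}" "v holomorphic_on Vd m r - {0}"
   using S(2,3) by (auto elim: holomorphic_on_subset)
  fix z assume z: "z \<in> Vd m r - {0}"
  show "(w z, v z) \<in> MH" by (rule H(2) [OF z])
  show "chart_inv (fchart m x r h) z = pt (pm (w z, v z))"
   using is_chart_fchart(3) [OF c(2)] sect_pm(1) [OF H(1)] z by simp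
  show "gg' (w z) * v z / 2 * (eta (fchart m x r h) id z)\<^sup>2 = H z * z powi (- 2)"
   using H(5) [OF z] eta_fchart(1) [OF c(2)] z by simp
 qed (use H in auto)
qed

lemma has_order_at_unique:
 assumes c: "\<And>c. c \<in> A ==> p \<in> fst c ==> c = c0" and p: "snd c0 p = 0"
  and R: "R > 0" "H holomorphic_on ball 0 R" "H 0 \<noteq> 0"
  and q: "\<And>z. z \<in> ball 0 R - {0} ==> q c0 z = H z * z powi n"
 shows "has_order_at A q p n" unfolding has_order_at_def
proof (intro ballI impI)
 fix c assume "c \<in> A" "p \<in> fst c"
 then have c0: "c = c0" by (rule c)
 have ev: "\<forall>\<^sub>F z in at 0. z \<in> ball 0 R - {0}" using R(1) by (intro eventually_at_in_open) auto
 then have e: "\<forall>\<^sub>F z in at 0. q c0 z = H z * z powi n" by eventually_elim (rule q)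
 have an: "H analytic_on {0}" using R(1,2) analytic_at by (metis centre_in_ball open_ball)
 then have "(\<lambda>z. H z * z powi n) meromorphic_on {0}"
  by (intro meromorphic_intros analytic_on_imp_meromorphic_on)
 then have 1: "q c0 meromorphic_on {0}" using meromorphic_on_cong [of "{0}" "q c0" "\<lambda>z. H z * z powi n" "{0}"] e by simp
 have "continuous (at 0) H" using an analytic_at_imp_isCont by blast
 then have "\<forall>\<^sub>F z in at 0. H z \<noteq> 0" using R(3) tendsto_imp_eventually_ne unfolding continuous_at by blast
 then have "\<forall>\<^sub>F z in at 0. q c0 z \<noteq> 0" using e ev by eventually_elim auto
 then have 2: "\<exists>\<^sub>F z in at 0. q c0 z \<noteq> 0" by (intro eventually_frequently) auto
 have 3: "zorder (q c0) 0 = n" by (rule zorder_eqI [of "ball 0 R" 0 H]) (use R q in auto)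
 show "q c meromorphic_on {snd c p} \<and> (\<exists>\<^sub>F z in at (snd c p). q c z \<noteq> 0) \<and> zorder (q c) (snd c p) = n"
  unfolding c0 p using 1 2 3 by blast
qed

text \<open>The sign ambiguity of the Hopf differential is resolved on a connected component
  \<open>CO\<close> over the punctured disc: there the lift differs from the section of the double
  cover by a constant sign, so the differential is the pullback of a single valued one.\<close>

lemma catenoidal:
 assumes p: "p \<in> P"
 shows "catenoidal_end ws.M SS AS P id p"
proof -
 define cp where "cp = cchart p"
 obtain R om v H where R: "R > 0" "chart_image cp = ball 0 R" "snd cp p = 0"
  and om: "om holomorphic_on ball 0 R - {0}" "v holomorphic_on ball 0 R - {0}"
  "\<And>z. z \<in> ball 0 R - {0} ==> (om z, v z) \<in> MH"
  "\<And>z. z \<in> ball 0 R - {0} ==> chart_inv cp z = pt (pm (om z, v z))"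
  and H: "H holomorphic_on ball 0 R" "H 0 \<noteq> 0"
  "\<And>z. z \<in> ball 0 R - {0} ==> gg' (om z) * v z / 2 * (eta cp id z)\<^sup>2 = H z * z powi (- 2)"
  using end_data [OF p] unfolding cp_def by blast
 define N where "N = fst cp"
 let ?D = "ball 0 R - {0::complex}"
 have cpA: "cp \<in> AS" using p by (auto simp: cp_def AS_def)
 note ch = AS_chart [OF cpA] and CD = is_chartD [OF AS_chart [OF cpA]]
 have pN: "p \<in> N" "N \<inter> P = {p}" using cchart_self p by (auto simp: N_def cp_def)
 have oN: "openin SS N" using CD(1) by (simp add: N_def)
 have NW: "N - {p} \<subseteq> topspace SS - P" using openin_subset [OF oN] pN by blast
 have psi: "snd cp x \<in> ?D" if "x \<in> N - {p}" for x
 proof -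
  have "snd cp x \<noteq> snd cp p" using that pN(1) CD(4) by (auto simp: N_def inj_on_def)
  then show ?thesis using that CD(5) [of x] R(2,3) by (auto simp: N_def)
 qed
 have Nim: "N - {p} = chart_inv cp ` ?D"
 proof
  show "N - {p} \<subseteq> chart_inv cp ` ?D"
  proof
   fix x assume x: "x \<in> N - {p}"
   then have "x = chart_inv cp (snd cp x)" using CD(8) by (simp add: N_def)
   then show "x \<in> chart_inv cp ` ?D" using psi [OF x] by blast
  qed
  show "chart_inv cp ` ?D \<subseteq> N - {p}"
  proof
   fix x assume "x \<in> chart_inv cp ` ?D"
   then obtain z where z: "z \<in> ball 0 R" "z \<noteq> 0" "x = chart_inv cp z" by blast
   then have zi: "z \<in> chart_image cp" by (simp add: R(2))
   have "chart_inv cp z \<noteq> p" using CD(7) [OF zi] R(3) z(2) by auto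
   then show "x \<in> N - {p}" using CD(6) [OF zi] by (simp add: N_def z(3))
  qed
 qed
 have conN: "connectedin SS (N - {p})" unfolding Nim
 proof (rule connectedin_continuous_map_image [OF CD(10)])
  show "connectedin (top_of_set (chart_image cp)) ?D"
   unfolding R(2) using connected_punctured_ball [of "0::complex" R] by (auto simp: connectedin_subtopology)
 qed
 let ?Y' = "{y \<in> topspace cov.Cov. cpi y \<in> N - {p}}"
 have "N - {p} \<noteq> {}"
 proof -
  have "of_real (R / 2) \<in> ?D" using R(1) by simp
  then show ?thesis unfolding Nim by blast
 qed
 then obtain x0 where x0: "x0 \<in> N - {p}" by blast
 have "cpi ` topspace cov.Cov = topspace XM" using covering_cpi by (simp add: covering_def)
 moreover have "topspace XM = topspace SS - P" by (auto simp: XM_def)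
 ultimately have "x0 \<in> cpi ` topspace cov.Cov" using NW x0 by blast
 then obtain y0 where y0: "y0 \<in> ?Y'" using x0 by blast
 define CO where "CO = connected_component_of_set (subtopology cov.Cov ?Y') y0"
 have CO: "CO \<in> connected_components_of (subtopology cov.Cov ?Y')"
  unfolding CO_def connected_component_in_connected_components_of using y0 by simp
 have cCO: "connectedin cov.Cov CO" and CY: "CO \<subseteq> ?Y'"
  using connectedin_connected_components_of [OF CO] by (auto simp: connectedin_subtopology)
 let ?ps = "\<lambda>y. snd cp (cpi y)"
 have psiC: "?ps y \<in> ?D" if "y \<in> CO" for y using psi CY that by blast
 \<comment> \<open>Both sides have the same image under \<open>pm\<close>, so they agree up to sign
   at each point; \<open>CO\<close> is connected and the section does not vanish.\<close>
 have "(\<forall>y\<in>CO. cov.proj y = (om (?ps y), v (?ps y))) \<or> (\<forall>y\<in>CO. cov.proj y = - (om (?ps y), v (?ps y)))"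
 proof (rule sign_constant [OF cCO])
  show "continuous_map (subtopology cov.Cov CO) euclidean cov.proj"
   using cov.continuous_proj continuous_map_from_subtopology continuous_map_in_subtopology by blast
  have "continuous_map (subtopology cov.Cov CO) SS cpi"
   using continuous_cpi unfolding XM_def by (meson continuous_map_from_subtopology continuous_map_in_subtopology)
  then have 1: "continuous_map (subtopology cov.Cov CO) (subtopology SS (fst cp)) cpi"
   using CY by (auto simp: continuous_map_in_subtopology N_def)
  have "continuous_map (subtopology cov.Cov CO) (top_of_set (chart_image cp)) ?ps"
   using continuous_map_compose [OF 1 CD(9)] by (simp add: o_def)
  then have 2: "continuous_map (subtopology cov.Cov CO) (top_of_set ?D) ?ps"
   using psiC by (auto simp: continuous_map_in_subtopology)
  have "continuous_map (top_of_set ?D) euclidean (\<lambda>z. (om z, v z))"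
   using om(1,2) by (auto intro!: continuous_intros holomorphic_on_imp_continuous_on)
  from continuous_map_compose [OF 2 this]
  show "continuous_map (subtopology cov.Cov CO) euclidean (\<lambda>y. (om (?ps y), v (?ps y)))" by (simp add: o_def)
  fix y assume y: "y \<in> CO"
  note M = om(3) [OF psiC [OF y]]
  show "(om (?ps y), v (?ps y)) \<noteq> 0" using MH_nz M by blast
  have "cpi y \<in> N" using CY y by blast
  then have "chart_inv cp (?ps y) = cpi y" using CD(8) [of "cpi y"] by (simp add: N_def)
  then have "pm (cov.proj y) = pm (om (?ps y), v (?ps y))" using om(4) [OF psiC [OF y]] by (simp add: cpi_def)
  moreover have "cov.proj y \<in> MH" using proj_MH CY y by blast
  ultimately show "cov.proj y = (om (?ps y), v (?ps y)) \<or> cov.proj y = - (om (?ps y), v (?ps y))"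
   using M by (intro pm_eq) (auto simp: in_MH)
 qed
 then obtain s :: complex where s: "s\<^sup>2 = 1"
  and sC: "\<And>y. y \<in> CO ==> cov.proj y = (s * om (?ps y), s * v (?ps y))"
 proof
  assume "\<forall>y\<in>CO. cov.proj y = (om (?ps y), v (?ps y))"
  then show thesis by (intro that [of 1]) auto
 next
  assume "\<forall>y\<in>CO. cov.proj y = - (om (?ps y), v (?ps y))"
  then show thesis by (intro that [of "- 1"]) auto
 qed
 \<comment> \<open>The quotient of the Hopf differential by the square of the form, as a function on
   the punctured coordinate disc. The factor \<open>s\<close> comes from \<open>v\<close>;
   \<open>gg'\<close> is even.\<close>
 define a where "a = (\<lambda>w. s * (gg' (om w) * v w / 2))"
 define q where "q = (\<lambda>(c :: point chart) z. a (snd cp (chart_inv c z)) * (eta c id z)\<^sup>2)"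
 have s0: "s \<noteq> 0" using s by auto
 have hopf: "hopf_differential gY (\<lambda>c. eta c cpi) c' z = a (?ps (chart_inv c' z)) * (eta c' cpi z)\<^sup>2"
  if c': "c' \<in> BY" and z: "z \<in> chart_image c'" "chart_inv c' z \<in> CO" for c' z
 proof -
  let ?y = "chart_inv c' z"
  have "om (?ps ?y) \<notin> RHO" using om(3) [OF psiC [OF z(2)]] by (simp add: in_MH)
  then have "gg' (s * om (?ps ?y)) = gg' (om (?ps ?y))" using gg'_sgn [OF s] by blast
  then show ?thesis unfolding hopf_eq [OF c' z(1)] sC [OF z(2)] by (simp add: a_def)
 qed
 have ah: "a holomorphic_on ?D"
 proof -
  have "(\<lambda>z. gg' (om z)) holomorphic_on ?D"
   by (rule holomorphic_on_compose_fun [OF om(1) gg'_hol]) (use om(3) in \<open>auto simp: in_MH\<close>)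
  then show ?thesis unfolding a_def using om(2) by (intro holomorphic_intros) auto
 qed
 have qd: "holomorphic_differential 2 AS (N - {p}) q" unfolding holomorphic_differential_def pullback_on_def
 proof (intro conjI ballI)
  fix c assume c: "c \<in> AS"
  note cc = AS_chart [OF c]
  let ?O = "snd c ` (fst c \<inter> (N - {p}))"
  have O: "z \<in> chart_image c \<and> chart_inv c z \<in> N - {p}" if "z \<in> ?O" for z
   using that is_chartD(5,8) [OF cc] by auto
  have sub: "?O \<subseteq> coord_dom c id cp" using O unfolding coord_dom_eq [OF cc] by (auto simp: N_def)
  have T: "coord c id cp holomorphic_on ?O" using AS_transition [OF c cpA] sub holomorphic_on_subset by blast
  have "coord c id cp z \<in> ?D" if "z \<in> ?O" for z using O [OF that] psi by (simp add: coord_def)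
  from holomorphic_on_compose_fun [OF T ah this]
  have 1: "(\<lambda>z. a (snd cp (chart_inv c z))) holomorphic_on ?O" by (simp add: coord_def)
  have "infp \<notin> N - {p}" using NW unfolding topspace_minus_P by auto
  then have "?O \<subseteq> {z \<in> chart_image c. chart_inv c z \<noteq> infp}" using O by force
  then have "eta c id holomorphic_on ?O" using eta_hol [OF c] holomorphic_on_subset by blast
  then show "q c holomorphic_on ?O" unfolding q_def using 1 by (intro holomorphic_intros)
  fix d z assume d: "d \<in> AS" and z: "z \<in> snd c ` (fst c \<inter> (N - {p}) \<inter> id -` fst d)"
  have z': "z \<in> chart_image c" "chart_inv c z \<in> N - {p}" "chart_inv c z \<in> fst d"
   using z is_chartD(5,8) [OF cc] by auto
  have zd: "z \<in> coord_dom c id d" using z' coord_dom_eq [OF cc, of id d] by simp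
  have "chart_inv c z \<noteq> infp" using z'(2) \<open>infp \<notin> N - {p}\<close> by metis
  from eta_trans [OF c d zd this]
  show "q d (coord c id d z) * deriv (coord c id d) z ^ 2 = q c z"
   unfolding q_def coord_transition(3) [OF cc AS_chart [OF d] zd] by (simp add: power_mult_distrib [symmetric] mult.assoc)
 qed
 have pb: "pullback_on 2 BY AS cpi CO q (hopf_differential gY (\<lambda>c. eta c cpi))" unfolding pullback_on_def
 proof (intro ballI)
  fix c' d z assume c': "c' \<in> BY" and d: "d \<in> AS" and z: "z \<in> snd c' ` (fst c' \<inter> CO \<inter> cpi -` fst d)"
  have z': "z \<in> chart_image c'" "chart_inv c' z \<in> CO" "cpi (chart_inv c' z) \<in> fst d"
   using z is_chartD(5,8) [OF BY_chart [OF c']] by auto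
  have "eta d id (coord c' cpi d z) * deriv (coord c' cpi d) z = eta c' cpi z"
   by (rule etaY_trans [OF c' d z'(1,3)]) (simp add: coord_def)
  moreover have "chart_inv d (coord c' cpi d z) = cpi (chart_inv c' z)"
   using is_chartD(8) [OF AS_chart [OF d] z'(3)] by (simp add: coord_def)
  ultimately show "q d (coord c' cpi d z) * deriv (coord c' cpi d) z ^ 2 = hopf_differential gY (\<lambda>c. eta c cpi) c' z"
   unfolding q_def hopf [OF c' z'(1,2)] by (simp add: power_mult_distrib [symmetric] mult.assoc)
 qed
 \<comment> \<open>On \<open>CO\<close> the coefficient depends only on the projected point and on
   \<open>eta\<close>. A deck transformation that preserves \<open>CO\<close> changes
   neither.\<close>
 have deck: "pullback_on 2 BY BY g CO (hopf_differential gY (\<lambda>c. eta c cpi)) (hopf_differential gY (\<lambda>c. eta c cpi))"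
  if g: "deck_transformation cov.Cov cpi g" "g ` CO = CO" for g unfolding pullback_on_def
 proof (intro ballI)
  fix c' d' z assume c': "c' \<in> BY" and d': "d' \<in> BY" and z: "z \<in> snd c' ` (fst c' \<inter> CO \<inter> g -` fst d')"
  define x where "x = chart_inv c' z"
  have z': "z \<in> chart_image c'" "x \<in> CO" "g x \<in> fst d'"
   using z is_chartD(5,8) [OF BY_chart [OF c']] by (auto simp: x_def)
  have gx: "g x \<in> CO" using g(2) z'(2) by blast
  have pg: "cpi (g y) = cpi y" if "y \<in> topspace cov.Cov" for y using g(1) that by (simp add: deck_transformation_def)
  have px: "cpi (g x) = cpi x" using pg CY z'(2) by blast
  obtain U d where d: "d' = (U, snd d \<circ> cpi)" "d \<in> AM" "is_chart XM d" "openin cov.Cov U"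
   "homeomorphic_map (subtopology cov.Cov U) (subtopology XM (fst d)) cpi"
   using lifted_chartsE [OF d' [unfolded BY_def] ws.A_chart] by metis
  note L = lifted_chart [OF d(3-5), folded d(1)]
  have "cpi (g x) \<in> cpi ` U" using z'(3) d(1) by auto
  then have dx: "cpi x \<in> fst d" using L(3) px by simp
  have T: "coord c' g d' u = snd d (cpi (chart_inv c' u))" if "u \<in> chart_image c'" for u
  proof -
   have "chart_inv c' u \<in> topspace cov.Cov" using is_chartD(2,6) [OF BY_chart [OF c']] that by blast
   then show ?thesis using pg by (simp add: coord_def d(1))
  qed
  have e: "eta d id (coord c' g d' z) * deriv (coord c' g d') z = eta c' cpi z"
   by (rule etaY_trans [OF c' _ z'(1) _ T]) (use d(2) dx in \<open>auto simp: AS_def x_def\<close>)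
  have Tz: "coord c' g d' z = snd d' (g x)" by (simp add: coord_def x_def)
  have i: "coord c' g d' z \<in> chart_image d'" "chart_inv d' (coord c' g d' z) = g x"
   unfolding Tz using is_chartD(5,8) [OF BY_chart [OF d'] z'(3)] .
  have "eta d' cpi (coord c' g d' z) = eta d id (coord c' g d' z)"
   using etaY [OF d(3-5)] i(1) L(2) d(1) by simp
  then show "hopf_differential gY (\<lambda>c. eta c cpi) d' (coord c' g d' z) * deriv (coord c' g d') z ^ 2
    = hopf_differential gY (\<lambda>c. eta c cpi) c' z"
   using hopf [OF d' i(1)] hopf [OF c' z'(1)] gx z'(2) unfolding i(2) e [symmetric]
   by (simp add: px x_def [symmetric] power_mult_distrib mult.assoc)
 qed
 have ord: "has_order_at AS q p (- 2)"
 proof (rule has_order_at_unique [of AS p cp R "\<lambda>z. s * H z"])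
  show "c = cp" if "c \<in> AS" "p \<in> fst c" for c using unique_chart [OF p that] by (simp add: cp_def)
  show "(\<lambda>z. s * H z) holomorphic_on ball 0 R" using H(1) by (intro holomorphic_intros)
  show "s * H 0 \<noteq> 0" using s0 H(2) by simp
  fix z assume z: "z \<in> ?D"
  have "snd cp (chart_inv cp z) = z" using CD(7) z R(2) by simp
  then show "q cp z = s * H z * z powi (- 2)" using H(3) [OF z] by (simp add: q_def a_def mult.assoc)
 qed (use R in auto)
 show ?thesis unfolding catenoidal_end_def
 proof (intro exI conjI)
  show "weierstrass_data ws.M cov.Cov BY cpi gY (\<lambda>c. eta c cpi)" by (rule weierstrass_data)
  show "CO \<in> connected_components_of (subtopology cov.Cov {y \<in> topspace cov.Cov. id (cpi y) \<in> N - {p}})"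
   using CO by simp
  show "pullback_on 2 BY AS (id \<circ> cpi) CO q (hopf_differential gY (\<lambda>c. eta c cpi))" using pb by simp
 qed (use oN pN conN qd ord deck in auto)
qed

end

lemma continuous_map_borel_preimage:
 fixes f :: "'c::topological_space => 'b"
 assumes V: "open V" and f: "continuous_map (top_of_set V) X f" and B: "B \<in> sigma_sets (topspace X) {U. openin X U}"
 shows "{z \<in> V. f z \<in> B} \<in> sets borel" using B
proof induction
 case (Basic U)
 then have "openin (top_of_set V) {z \<in> V. f z \<in> U}" using openin_continuous_map_preimage [OF f, of U] by simp
 then show ?case by (intro borel_open openin_open_trans [OF _ V])
next
 case Empty
 then show ?case by simp
next
 case (Compl A)
 have "f z \<in> topspace X" if "z \<in> V" for z using f that by (auto simp: continuous_map_def)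
 then have "{z \<in> V. f z \<in> topspace X - A} = V - {z \<in> V. f z \<in> A}" by auto
 then show ?case using Compl.IH V by simp
next
 case (Union A)
 have "{z \<in> V. f z \<in> (\<Union>i. A i)} = (\<Union>i. {z \<in> V. f z \<in> A i})" by auto
 then show ?case using Union.IH by auto
qed

lemma gram_det_scalar: "gram_det (\<lambda>z v w. l z * (v \<bullet> w)) z = (l z)\<^sup>2"
 by (simp add: gram_det_def inner_complex_def power2_eq_square)

context curve_ends
begin

subsection \<open>Total curvature\<close>

definition BM :: "point measure" where "BM = sigma (topspace XM) {U. openin XM U}"

lemma space_BM: "space BM = topspace XM" and sets_BM: "sets BM = sigma_sets (topspace XM) {U. openin XM U}"
proof -
 have "{U. openin XM U} \<subseteq> Pow (topspace XM)" using openin_subset by auto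
 then show "space BM = topspace XM" "sets BM = sigma_sets (topspace XM) {U. openin XM U}"
  unfolding BM_def by (simp_all add: space_measure_of sets_measure_of)
qed

text \<open>Parametrizes the curve by two copies of the \<open>x\<close>-plane. The finite set
  \<open>PX\<close> is a null set; it is sent to the branch point over \<open>- 1\<close> only so
  that all values lie in \<open>M\<close>.\<close>

definition TT :: "complex \<times> bool => point" where
 "TT p = (if fst p \<in> PX then pt (- 1, 0) else pt (fst p, (if snd p then 1 else - 1) * csqrt (cf (fst p))))"

definition PM :: "(complex \<times> bool) measure" where "PM = lborel \<Otimes>\<^sub>M count_space UNIV"

text \<open>The area density in the coordinate \<open>x\<close>, where the form is
  \<open>dx/y\<close> and \<open>|y|^2 = |cf x|\<close>.\<close>

definition rhox :: "complex => real" where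
 "rhox x = (1 + (cmod (gg (csqrt x)))\<^sup>2)\<^sup>2 / (4 * cmod (cf x))"

text \<open>The area measure is obtained globally, as an image measure from two planes, instead of
  by gluing measures of charts.\<close>

definition mu :: "point measure" where "mu = distr (density PM (\<lambda>p. ennreal (rhox (fst p)))) BM TT"

lemma cf_meas [measurable]: "cf \<in> borel_measurable borel" and cf1_meas [measurable]: "cf1 \<in> borel_measurable borel"
 using cf_cont [of UNIV] cf1_hol [of UNIV] by (auto intro: borel_measurable_continuous_onI holomorphic_on_imp_continuous_on)

lemma gg_meas [measurable]: "gg \<in> borel_measurable borel" unfolding gg_def [abs_def] by measurable

lemma rhox_meas [measurable]: "rhox \<in> borel_measurable borel" unfolding rhox_def [abs_def] by measurable

lemma base_C0: "(- 1, 0) \<in> C0"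
 using PX_real [of "- 1"] k cf_eq_0 [of "- 1"] by (auto simp: C0_def in_C roots_def image_iff intro!: bexI [of _ 1])

lemma TT_C0: "TT p \<in> pt ` C0"
proof (cases "fst p \<in> PX")
 case True
 then show ?thesis using base_C0 by (simp add: TT_def)
next
 case False
 have "((if snd p then 1 else - 1) * csqrt (cf (fst p)))\<^sup>2 = cf (fst p)" by (simp add: power_mult_distrib del: csqrt.simps)
 then show ?thesis using False by (simp add: TT_def C0_def in_C del: csqrt.simps)
qed

lemma TT_meas [measurable]: "TT \<in> PM \<rightarrow>\<^sub>M BM" unfolding BM_def
proof (rule measurable_measure_of)
 show "{U. openin XM U} \<subseteq> Pow (topspace XM)" using openin_subset by auto
 show "TT \<in> space PM \<rightarrow> topspace XM" using TT_C0 by (simp add: topspace_XM)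
 fix U assume "U \<in> {U. openin XM U}"
 then have U: "openin XM U" by simp
 then have "U \<subseteq> pt ` C0" using openin_subset topspace_XM by metis
 then obtain W where W: "W \<subseteq> C0" "U = pt ` W" by (metis subset_image_iff)
 then have "openin (top_of_set C) W" using U openin_XM by simp
 then obtain T where T: "open T" "W = C \<inter> T" by (auto simp: openin_open)
 define f where "f = (\<lambda>p::complex \<times> bool. (fst p, (if snd p then 1 else - 1) * csqrt (cf (fst p))))"
 have f: "f \<in> borel_measurable PM" unfolding f_def PM_def by measurable
 have F: "fst \<in> borel_measurable PM" unfolding PM_def by measurable
 have PXb: "PX \<in> sets borel" "- PX \<in> sets borel"
  using borel_closed [OF finite_imp_closed] borel_open [OF open_Compl [OF finite_imp_closed]] finite_PX by blast+
 have "TT -` U \<inter> space PM = ((fst -` (- PX) \<inter> space PM) \<inter> (f -` T \<inter> space PM))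
   \<union> (if pt (- 1, 0) \<in> U then fst -` PX \<inter> space PM else {})"
 proof -
  have A: "TT p \<in> U \<longleftrightarrow> f p \<in> T" if "fst p \<notin> PX" for p
  proof -
   have e: "TT p = pt (f p)" using that by (simp add: TT_def f_def del: csqrt.simps)
   then have "f p \<in> C" using TT_C0 [of p] by (auto simp: C0_def)
   then show ?thesis unfolding e W(2) T(2) by auto
  qed
  have B: "TT p = pt (- 1, 0)" if "fst p \<in> PX" for p using that by (simp add: TT_def)
  show ?thesis
  proof (rule Set.set_eqI)
   fix p show "p \<in> TT -` U \<inter> space PM \<longleftrightarrow> p \<in> ((fst -` (- PX) \<inter> space PM) \<inter> (f -` T \<inter> space PM))
     \<union> (if pt (- 1, 0) \<in> U then fst -` PX \<inter> space PM else {})"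
    by (cases "fst p \<in> PX"; simp add: A B; blast)
  qed
 qed
 then show "TT -` U \<inter> space PM \<in> sets PM"
  using measurable_sets [OF f borel_open [OF T(1)]] measurable_sets [OF F PXb(1)] measurable_sets [OF F PXb(2)] by auto
qed

lemma nn_integral_mu:
 assumes [measurable]: "f \<in> borel_measurable BM"
 shows "(\<integral>\<^sup>+p. f p \<partial>mu) = (\<integral>\<^sup>+x. ennreal (rhox x) * (f (TT (x, True)) + f (TT (x, False))) \<partial>lborel)"
proof -
 interpret sigma_finite_measure "count_space (UNIV :: bool set)"
  by (rule sigma_finite_measure_count_space_finite) simp
 have r [measurable]: "(\<lambda>p. ennreal (rhox (fst p))) \<in> borel_measurable PM" unfolding PM_def by measurable
 have "(\<integral>\<^sup>+p. f p \<partial>mu) = (\<integral>\<^sup>+p. ennreal (rhox (fst p)) * f (TT p) \<partial>PM)"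
  unfolding mu_def by (subst nn_integral_distr) (auto simp: nn_integral_density)
 also have "\<dots> = (\<integral>\<^sup>+x. \<integral>\<^sup>+b. ennreal (rhox x) * f (TT (x, b)) \<partial>count_space UNIV \<partial>lborel)"
 proof -
  have "(\<lambda>p. ennreal (rhox (fst p)) * f (TT p)) \<in> borel_measurable PM" by measurable
  from nn_integral_fst [OF this [unfolded PM_def]] show ?thesis by (simp add: PM_def)
 qed
 also have "\<dots> = (\<integral>\<^sup>+x. ennreal (rhox x) * (f (TT (x, True)) + f (TT (x, False))) \<partial>lborel)"
  by (simp add: nn_integral_count_space_finite UNIV_bool distrib_left add.commute)
 finally show ?thesis .
qed

lemma PX_null: "AE x in lborel. x \<notin> PX"
 using finite_PX by (intro AE_not_in) (auto intro: finite_imp_null_set_lborel)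

text \<open>The sum over both sheets does not depend on the discontinuous branch
  \<open>csqrt\<close> in \<open>TT\<close>, so in a chart it may be computed with the local root
  \<open>y\<close>.\<close>

lemma TT_sum:
 assumes "y\<^sup>2 = cf x" "x \<notin> PX"
 shows "F (TT (x, True)) + F (TT (x, False)) = F (pt (x, y)) + (F (pt (x, - y)) :: ennreal)"
proof -
 have "y\<^sup>2 = (csqrt (cf x))\<^sup>2" using assms(1) power2_csqrt by metis
 then have "y = csqrt (cf x) \<or> y = - csqrt (cf x)" unfolding power2_eq_iff .
 then show ?thesis using assms(2) by (elim disjE) (simp_all add: TT_def add.commute del: csqrt.simps)
qed

text \<open>An unbranched chart is a translation of the \<open>x\<close>-plane and meets one sheet.
  A branched chart is \<open>x = a + z^2\<close>, with Jacobian \<open>4 |z|^2\<close>, and contains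
  both points over \<open>x\<close>. In either case the density \<open>rhox\<close> turns into the
  conformal factor.\<close>

lemma area: "area_measure ws.M mu" unfolding area_measure_def ws.M_sel
proof (intro conjI ballI impI)
 show "space mu = topspace XM" by (simp add: mu_def space_BM)
 show "sets mu = sigma_sets (topspace XM) {U. openin XM U}" by (simp add: mu_def sets_BM)
 fix c B assume c: "c \<in> AM" and B: "B \<in> sets mu" and Bc: "B \<subseteq> fst c"
 obtain m a r h where f: "c = fchart m a r h" "fin_data m a r h" "ball a r \<inter> PX = {}" using AM_E [OF c] by metis
 have BB: "B \<in> sets BM" using B by (simp add: mu_def)
 note im = is_chart_fchart(2) [OF f(2), folded f(1)] and inv = is_chart_fchart(3) [OF f(2), folded f(1)]
 have cc: "is_chart XM c" using ws.A_chart [OF c] .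
 define E where "E = {z \<in> Vd m r. pt (phid m a h z) \<in> B}"
 have E: "snd c ` B = E"
 proof
  show "snd c ` B \<subseteq> E" using Bc is_chartD(5,8) [OF cc] inv by (force simp: E_def im [symmetric])
  show "E \<subseteq> snd c ` B" using is_chartD(7) [OF cc] inv by (force simp: E_def im image_iff)
 qed
 have Eb [measurable]: "E \<in> sets borel"
 proof -
  have "{z \<in> Vd m r. chart_inv c z \<in> B} \<in> sets borel"
   using continuous_map_borel_preimage [OF _ is_chartD(10) [OF cc], of B] is_chartD(3) [OF cc] BB im
   by (simp add: sets_BM)
  moreover have "{z \<in> Vd m r. chart_inv c z \<in> B} = E" using inv by (auto simp: E_def)
  ultimately show ?thesis by simp
 qed
 have EV: "z \<in> Vd m r" if "z \<in> E" for z using that by (simp add: E_def)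
 have lam: "ws.lam c z = (cmod (of_nat m / h (Xd m a z)))\<^sup>2 * (1 + (cmod (gg (csqrt (Xd m a z))))\<^sup>2)\<^sup>2 / 4"
  if "z \<in> Vd m r" for z
  using eta_fchart(1) [OF f(2) that] inv [OF that] by (simp add: ws.lam_def GG_def phid_def f(1) del: csqrt.simps)
 have lam0: "ws.lam c z \<ge> 0" if "z \<in> Vd m r" for z using ws.local_facts(2) [OF c, of z] that im by simp
 have h0: "h x \<noteq> 0" if "x \<in> ball a r" for x using fd_simps(4) [OF f(2) that] .
 have inball: "x \<in> ball a r" if "TT (x, b) \<in> B" "x \<notin> PX" for x b
 proof -
  have "pt (x, (if b then 1 else - 1) * csqrt (cf x)) \<in> fst c"
   using that Bc by (auto simp: TT_def simp del: csqrt.simps)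
  then show ?thesis unfolding f(1) fst_fchart [OF f(2)] phid_image [OF f(2)] by auto
 qed
 have "emeasure mu B = (\<integral>\<^sup>+p. indicator B p \<partial>mu)" using B by simp
 also have "\<dots> = (\<integral>\<^sup>+x. ennreal (rhox x) * (indicator B (TT (x, True)) + indicator B (TT (x, False))) \<partial>lborel)"
  using BB by (intro nn_integral_mu) simp
 also have "\<dots> = (\<integral>\<^sup>+z. ennreal (ws.lam c z) * indicator E z \<partial>lborel)"
 proof (cases "m = 1")
  case True
  define T where "T = (\<lambda>z::complex. a + z)"
  have dT: "deriv T z = 1" for z unfolding T_def by (rule DERIV_imp_deriv) (auto intro!: derivative_eq_intros)
  have TV: "T ` Vd m r = ball a r"
  proof -
   have "x \<in> T ` Vd m r" if "x \<in> ball a r" for x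
    using that Xd_ball [OF f(2), of "x - a"] by (intro image_eqI [of _ _ "x - a"]) (auto simp: T_def Xd_def True)
   then show ?thesis using Xd_ball [OF f(2)] by (auto simp: T_def Xd_def True)
  qed
  have pw: "ennreal (rhox x) * (indicator B (TT (x, True)) + indicator B (TT (x, False)))
    = (ennreal (rhox x) * indicator E (x - a)) * indicator (T ` Vd m r) x" if x: "x \<notin> PX" for x
  proof (cases "x \<in> ball a r")
   case False
   then show ?thesis using inball x unfolding TV by (auto simp: indicator_def)
  next
   case b: True
   have cfh: "(h x)\<^sup>2 = cf x" using fd_simps(5) [OF f(2) b] True by simp
   have "phid m a h (x - a) = (x, h x)" by (simp add: phid_def Xd_def Yd_def True)
   moreover have "x - a \<in> Vd m r" using b Xd_ball [OF f(2), of "x - a"] by (simp add: Xd_def True)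
   ultimately have "pt (x, h x) \<in> B \<longleftrightarrow> x - a \<in> E" by (simp add: E_def)
   \<comment> \<open>The domain of an unbranched chart contains only the sheet
     \<open>y = h x\<close>, so the other indicator vanishes.\<close>
   moreover have "pt (x, - h x) \<notin> B"
   proof
    assume "pt (x, - h x) \<in> B"
    then have "- h x = h x" using Bc True unfolding f(1) fst_fchart [OF f(2)] phid_image [OF f(2)] by auto
    then show False using h0 [OF b] by simp
   qed
   ultimately show ?thesis
    using TT_sum [OF cfh x, of "indicator B"] b unfolding TV by (simp add: indicator_def)
  qed
  have "(\<integral>\<^sup>+x. ennreal (rhox x) * (indicator B (TT (x, True)) + indicator B (TT (x, False))) \<partial>lborel)
    = (\<integral>\<^sup>+x. (ennreal (rhox x) * indicator E (x - a)) * indicator (T ` Vd m r) x \<partial>lborel)"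
   using PX_null by (intro nn_integral_cong_AE) (auto simp: pw)
  also have "\<dots> = (\<integral>\<^sup>+z. (ennreal (rhox (T z)) * indicator E (T z - a)) * (ennreal ((cmod (deriv T z))\<^sup>2) * indicator (Vd m r) z) \<partial>lborel)"
  proof (rule nn_integral_holomorphic_substitution)
   show "T holomorphic_on Vd m r" unfolding T_def by (intro holomorphic_intros)
  qed (use open_Vd(1) [OF f(2)] in \<open>auto simp: T_def inj_on_def\<close>)
  also have "\<dots> = (\<integral>\<^sup>+z. ennreal (ws.lam c z) * indicator E z \<partial>lborel)"
  proof (rule nn_integral_cong)
   fix z
   show "(ennreal (rhox (T z)) * indicator E (T z - a)) * (ennreal ((cmod (deriv T z))\<^sup>2) * indicator (Vd m r) z)
     = ennreal (ws.lam c z) * indicator E z"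
   proof (cases "z \<in> E")
    case z: True
    then have "T z \<in> ball a r" using EV TV by blast
    then have "cmod (cf (T z)) = (cmod (h (T z)))\<^sup>2" using fd_simps(5) [OF f(2)] True by (simp add: norm_power)
    then have "rhox (T z) = ws.lam c z" unfolding rhox_def lam [OF EV [OF z]]
     by (simp add: T_def Xd_def True norm_divide power_divide field_simps del: csqrt.simps)
    then show ?thesis using z EV [OF z] by (simp add: dT T_def)
   qed (simp add: T_def)
  qed
  finally show ?thesis .
 next
  case False
  then have m: "m = 2" using fd_simps(2) [OF f(2)] by simp
  \<comment> \<open>The two square roots of \<open>x - a\<close> are the coordinates of the two
    points over \<open>x\<close>, so the sum over sheets becomes the sum over roots in
    \<open>nn_integral_complex_square\<close>.\<close>
  define ph where "ph = (\<lambda>z. ennreal (rhox (a + z\<^sup>2)) * indicator E z :: ennreal)"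
  have ph [measurable]: "ph \<in> borel_measurable borel" unfolding ph_def by measurable
  have pw: "ennreal (rhox x) * (indicator B (TT (x, True)) + indicator B (TT (x, False)))
    = ph (csqrt (x - a)) + ph (- csqrt (x - a))" if x: "x \<notin> PX" for x
  proof -
   define ze where "ze = csqrt (x - a)"
   have ze: "ze\<^sup>2 = x - a" "(- ze)\<^sup>2 = x - a" by (simp_all add: ze_def del: csqrt.simps)
   have X: "Xd m a ze = x" "Xd m a (- ze) = x" using ze by (simp_all add: Xd_def m)
   show ?thesis unfolding ze_def [symmetric]
   proof (cases "x \<in> ball a r")
    case False
    then have "ze \<notin> E" "- ze \<notin> E" using EV Xd_ball [OF f(2)] X by metis+
    then show "ennreal (rhox x) * (indicator B (TT (x, True)) + indicator B (TT (x, False))) = ph ze + ph (- ze)"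
     using inball x False by (auto simp: indicator_def ph_def)
   next
    case b: True
    have V: "ze \<in> Vd m r" "- ze \<in> Vd m r" using b Xd_ball [OF f(2)] X by simp_all
    have "phid m a h ze = (x, ze * h x)" "phid m a h (- ze) = (x, - (ze * h x))"
     using X ze by (simp_all add: phid_def Yd_def m)
    then have i: "pt (x, ze * h x) \<in> B \<longleftrightarrow> ze \<in> E" "pt (x, - (ze * h x)) \<in> B \<longleftrightarrow> - ze \<in> E"
     using V by (simp_all add: E_def)
    have "(ze * h x)\<^sup>2 = cf x" using fd_simps(5) [OF f(2) b] ze by (simp add: m power_mult_distrib)
    from TT_sum [OF this x, of "indicator B"]
    have "indicator B (TT (x, True)) + indicator B (TT (x, False)) = indicator E ze + (indicator E (- ze) :: ennreal)"
     using i by (simp add: indicator_def)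
    then show "ennreal (rhox x) * (indicator B (TT (x, True)) + indicator B (TT (x, False))) = ph ze + ph (- ze)"
     using ze by (simp add: ph_def distrib_left)
   qed
  qed
  have "(\<integral>\<^sup>+x. ennreal (rhox x) * (indicator B (TT (x, True)) + indicator B (TT (x, False))) \<partial>lborel)
    = (\<integral>\<^sup>+x. ph (csqrt (x - a)) + ph (- csqrt (x - a)) \<partial>lborel)"
   using PX_null by (intro nn_integral_cong_AE) (auto simp: pw simp del: csqrt.simps)
  also have "\<dots> = (\<integral>\<^sup>+z. ph z * ennreal (4 * (cmod z)\<^sup>2) \<partial>lborel)"
   by (rule nn_integral_complex_square [OF ph, symmetric])
  also have "\<dots> = (\<integral>\<^sup>+z. ennreal (ws.lam c z) * indicator E z \<partial>lborel)"
  proof (rule nn_integral_cong_AE)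
   have "AE z in lborel. z \<notin> {0::complex}" by (intro AE_not_in finite_imp_null_set_lborel) simp
   then show "AE z in lborel. ph z * ennreal (4 * (cmod z)\<^sup>2) = ennreal (ws.lam c z) * indicator E z"
   proof eventually_elim
    case (elim z)
    then have z0: "z \<noteq> 0" by simp
    show ?case
    proof (cases "z \<in> E")
     case z: True
     then have b: "Xd m a z \<in> ball a r" using EV Xd_ball [OF f(2)] by blast
     have X: "Xd m a z = a + z\<^sup>2" by (simp add: Xd_def m)
     have "cmod (cf (Xd m a z)) = (cmod z)\<^sup>2 * (cmod (h (Xd m a z)))\<^sup>2"
      unfolding fd_simps(5) [OF f(2) b] by (simp add: X [unfolded m] m norm_mult norm_power)
     then have "rhox (Xd m a z) * (4 * (cmod z)\<^sup>2) = ws.lam c z"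
      unfolding rhox_def lam [OF EV [OF z]] using z0 h0 [OF b, unfolded m]
      by (simp add: m X [unfolded m] norm_power norm_divide power_divide field_simps del: csqrt.simps)
     then have "ennreal (rhox (a + z\<^sup>2)) * ennreal (4 * (cmod z)\<^sup>2) = ennreal (ws.lam c z)"
      unfolding X by (simp add: rhox_def flip: ennreal_mult')
     then show ?thesis using z by (simp add: ph_def)
    qed (simp add: ph_def)
   qed
  qed
  finally show ?thesis .
 qed
 also have "\<dots> = (\<integral>\<^sup>+z\<in>snd c ` B. ennreal (sqrt (gram_det (\<lambda>z v w. ws.lam c z * (v \<bullet> w)) z)) \<partial>lborel)"
  unfolding gram_det_scalar E using lam0 EV by (intro nn_integral_cong) (auto simp: indicator_def)
 finally show "emeasure mu B = (\<integral>\<^sup>+z\<in>snd c ` B. ennreal (sqrt (gram_det (\<lambda>z v w. ws.lam c z * (v \<bullet> w)) z)) \<partial>lborel)" .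
qed

text \<open>The derivative of \<open>gg\<close>, given by its formula also at the poles, where it is measurable.\<close>

definition gp :: "complex => complex" where
 "gp w = of_nat (2*k-1) * w ^ (2*k-2) - (\<Sum>j<d. 1 / (w - rho j)\<^sup>2)"

lemma gp_meas [measurable]: "gp \<in> borel_measurable borel" unfolding gp_def [abs_def] by measurable

text \<open>The left side is the spherical derivative of a rational function. It extends
  continuously across the poles, hence is bounded on a disc, and outside the disc the term
  \<open>w^(2k-1)\<close> dominates.\<close>

lemma gp_bound: "\<exists>B. \<forall>w. w \<notin> RHO \<longrightarrow> cmod (gp w) / (1 + (cmod (gg w))\<^sup>2) \<le> B / (1 + (cmod w)\<^sup>2)"
proof -
 \<comment> \<open>Common denominator \<open>D\<close>, with \<open>Nn = gg * D\<close> and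
   \<open>Mm = gp * D^2\<close>. The spherical derivative becomes
   \<open>|Mm| / (|D|^2 + |Nn|^2)\<close>, an expression without singularities.\<close>
 define D where "D = (\<lambda>w. \<Prod>j<d. w - rho j)"
 define Dj where "Dj = (\<lambda>j w. \<Prod>i\<in>{..<d} - {j}. w - rho i)"
 define Nn where "Nn = (\<lambda>w. w ^ (2*k-1) * D w + (\<Sum>j<d. Dj j w))"
 define Mm where "Mm = (\<lambda>w. of_nat (2*k-1) * w ^ (2*k-2) * (D w)\<^sup>2 - (\<Sum>j<d. (Dj j w)\<^sup>2))"
 have DD: "D w = (w - rho j) * Dj j w" if "j < d" for j w
  unfolding D_def Dj_def using that by (intro prod.remove) auto
 have D0: "D w \<noteq> 0" if "w \<notin> RHO" for w using that by (auto simp: D_def RHO_def prod_zero_iff)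
 have nz: "w - rho j \<noteq> 0" if "w \<notin> RHO" "j < d" for w j using that by (auto simp: RHO_def)
 have gD: "gg w * D w = Nn w" if w: "w \<notin> RHO" for w
 proof -
  have "(\<Sum>j<d. 1 / (w - rho j)) * D w = (\<Sum>j<d. Dj j w)"
   unfolding sum_distrib_right using DD nz [OF w] by (intro sum.cong) auto
  then show ?thesis by (simp add: gg_def Nn_def distrib_right)
 qed
 have pD: "gp w * (D w)\<^sup>2 = Mm w" if w: "w \<notin> RHO" for w
 proof -
  have "(\<Sum>j<d. 1 / (w - rho j)\<^sup>2) * (D w)\<^sup>2 = (\<Sum>j<d. (Dj j w)\<^sup>2)" unfolding sum_distrib_right
  proof (rule sum.cong)
   fix j assume "j \<in> {..<d}"
   then show "1 / (w - rho j)\<^sup>2 * (D w)\<^sup>2 = (Dj j w)\<^sup>2"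
    using DD [of j w] nz [OF w, of j] by (simp add: power_mult_distrib)
  qed simp
  then show ?thesis by (simp add: gp_def Mm_def left_diff_distrib)
 qed
 \<comment> \<open>Numerator and denominator have no common zero: at a pole only the term of that
   pole survives in \<open>Nn\<close>, and it is nonzero because the \<open>rho j\<close> are
   distinct.\<close>
 have pos: "(cmod (D w))\<^sup>2 + (cmod (Nn w))\<^sup>2 > 0" for w
 proof (cases "w \<in> RHO")
  case False
  then show ?thesis using D0 by (simp add: add_pos_nonneg)
 next
  case True
  then obtain j where j: "j < d" "w = rho j" by (auto simp: RHO_def)
  have Dw: "D w = 0" using DD [OF j(1), of w] j(2) by simp
  have "Dj i w = 0" if "i \<in> {..<d} - {j}" for i using j that unfolding Dj_def by (intro prod_zero) auto
  then have "(\<Sum>i\<in>{..<d} - {j}. Dj i w) = 0" by simp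
  then have "Nn w = Dj j w" using j(1) Dw by (simp add: Nn_def sum.remove [of _ j])
  moreover have "Dj j w \<noteq> 0" unfolding Dj_def j(2) using inj_rho by (auto simp: prod_zero_iff inj_eq)
  ultimately show ?thesis by (simp add: add_nonneg_pos)
 qed
 have ratio: "cmod (gp w) / (1 + (cmod (gg w))\<^sup>2) = cmod (Mm w) / ((cmod (D w))\<^sup>2 + (cmod (Nn w))\<^sup>2)" if w: "w \<notin> RHO" for w
 proof -
  have "cmod (Mm w) = cmod (gp w) * (cmod (D w))\<^sup>2" by (metis pD [OF w] norm_mult norm_power)
  moreover have "(cmod (D w))\<^sup>2 + (cmod (Nn w))\<^sup>2 = (1 + (cmod (gg w))\<^sup>2) * (cmod (D w))\<^sup>2"
   unfolding gD [OF w, symmetric] by (simp add: norm_mult power_mult_distrib algebra_simps)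
  ultimately show ?thesis using D0 [OF w] by simp
 qed
 \<comment> \<open>Since \<open>|rho j| \<le> d\<close>, beyond this radius every
   \<open>|w - rho j|\<close> is at least \<open>1\<close>, so the fractions sum to at most
   \<open>d\<close>, which is at most half of \<open>|w|\<close>.\<close>
 define R where "R = 2 * real d + 2"
 let ?F = "\<lambda>w. (1 + (cmod w)\<^sup>2) * (cmod (Mm w) / ((cmod (D w))\<^sup>2 + (cmod (Nn w))\<^sup>2))"
 have "continuous_on (cball 0 R) ?F"
 proof -
  have D: "continuous_on (cball 0 R) D" "\<And>j. continuous_on (cball 0 R) (Dj j)"
   unfolding D_def Dj_def by (intro continuous_intros)+
  then have MN: "continuous_on (cball 0 R) Mm" "continuous_on (cball 0 R) Nn"
   unfolding Mm_def Nn_def by (intro continuous_intros D)+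
  have "(cmod (D w))\<^sup>2 + (cmod (Nn w))\<^sup>2 \<noteq> 0" for w using pos [of w] by linarith
  then show ?thesis by (intro continuous_intros ballI D MN)
 qed
 then have "bounded (?F ` cball 0 R)" by (intro compact_imp_bounded compact_continuous_image) auto
 then obtain B1 where B1: "\<And>w. w \<in> cball 0 R ==> norm (?F w) \<le> B1" unfolding bounded_iff by blast
 \<comment> \<open>The factor \<open>8\<close> is \<open>4\<close> from
   \<open>|gg w| \<ge> |w|^(2k-1) / 2\<close> squared, times \<open>2\<close> from
   \<open>1 + |w|^2 \<le> 2 |w|^2\<close>.\<close>
 define B2 where "B2 = 8 * (real (2*k-1) + real d)"
 have big: "cmod (gp w) / (1 + (cmod (gg w))\<^sup>2) \<le> B2 / (1 + (cmod w)\<^sup>2)" if w: "cmod w > R" for w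
 proof -
  let ?t = "cmod w"
  have t1: "?t \<ge> 1" and td: "?t \<ge> 2 * real d" using w by (auto simp: R_def)
  have rho: "cmod (rho j) \<le> real d" if "j < d" for j
  proof -
   have "cmod (rho j) = \<bar>real_of_int (2 * int j + 1 - int d)\<bar>" unfolding rho_def by (rule norm_of_int)
   then show ?thesis using that by linarith
  qed
  have w1: "cmod (w - rho j) \<ge> 1" if "j < d" for j
   using rho [OF that] w norm_triangle_ineq2 [of w "rho j"] by (simp add: R_def)
  have "cmod (\<Sum>j<d. 1 / (w - rho j)\<^sup>2) \<le> (\<Sum>j<d. 1)"
   by (rule sum_norm_le) (use w1 in \<open>auto simp: norm_divide norm_power divide_le_eq\<close>)
  then have "cmod (gp w) \<le> real (2*k-1) * ?t ^ (2*k-2) + real d"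
   unfolding gp_def by (intro order_trans [OF norm_triangle_ineq4]) (simp add: norm_mult norm_power)
  also have "\<dots> \<le> (real (2*k-1) + real d) * ?t ^ (2*k-2)"
  proof -
   have "real d * 1 \<le> real d * ?t ^ (2*k-2)" using t1 by (intro mult_left_mono) (auto simp: one_le_power)
   then show ?thesis by (simp add: distrib_right)
  qed
  finally have up: "cmod (gp w) \<le> (real (2*k-1) + real d) * ?t ^ (2*k-2)" .
  have "cmod (\<Sum>j<d. 1 / (w - rho j)) \<le> (\<Sum>j<d. 1)"
   by (rule sum_norm_le) (use w1 in \<open>auto simp: norm_divide divide_le_eq\<close>)
  then have "cmod (gg w) \<ge> ?t ^ (2*k-1) - real d"
   unfolding gg_def using norm_triangle_ineq2 [of "w ^ (2*k-1)" "- (\<Sum>j<d. 1 / (w - rho j))"]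
   by (simp add: norm_power)
  moreover have "?t ^ 1 \<le> ?t ^ (2*k-1)" using t1 k by (intro power_increasing) auto
  ultimately have "cmod (gg w) \<ge> ?t ^ (2*k-1) / 2" using td by simp
  then have "(?t ^ (2*k-1) / 2)\<^sup>2 \<le> (cmod (gg w))\<^sup>2" by (intro power_mono) auto
  then have lo: "(?t ^ (2*k-1))\<^sup>2 / 4 \<le> 1 + (cmod (gg w))\<^sup>2" by (simp add: power_divide)
  \<comment> \<open>The exponents satisfy \<open>2k \<le> 2 (2k - 1)\<close> because
    \<open>k\<close> is positive.\<close>
  have "?t ^ (2*k-2) * (1 + ?t\<^sup>2) \<le> 2 * (?t ^ (2*k-1))\<^sup>2"
  proof -
   have "1 + ?t\<^sup>2 \<le> 2 * ?t\<^sup>2" using t1 by (simp add: one_le_power)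
   then have "?t ^ (2*k-2) * (1 + ?t\<^sup>2) \<le> ?t ^ (2*k-2) * (2 * ?t\<^sup>2)" by (intro mult_left_mono) auto
   also have "\<dots> = 2 * ?t ^ (2*k-2+2)" by (simp add: power_add power2_eq_square)
   also have "\<dots> \<le> 2 * ?t ^ ((2*k-1)*2)" using t1 k by (intro mult_left_mono power_increasing) auto
   finally show ?thesis by (simp add: power_mult)
  qed
  have "cmod (gp w) * (1 + ?t\<^sup>2) \<le> (real (2*k-1) + real d) * (?t ^ (2*k-2) * (1 + ?t\<^sup>2))"
   using mult_right_mono [OF up, of "1 + ?t\<^sup>2"] by (simp add: mult.assoc)
  also have "\<dots> \<le> (real (2*k-1) + real d) * (2 * (?t ^ (2*k-1))\<^sup>2)"
   using \<open>?t ^ (2*k-2) * (1 + ?t\<^sup>2) \<le> _\<close> by (intro mult_left_mono) auto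
  also have "\<dots> = B2 * ((?t ^ (2*k-1))\<^sup>2 / 4)" by (simp add: B2_def)
  also have "\<dots> \<le> B2 * (1 + (cmod (gg w))\<^sup>2)" using lo by (intro mult_left_mono) (auto simp: B2_def)
  finally show ?thesis by (simp add: pos_divide_le_eq pos_le_divide_eq add_pos_nonneg)
 qed
 show ?thesis
 proof (intro exI [of _ "max B1 B2"] allI impI)
  fix w assume w: "w \<notin> RHO"
  have p: "0 < 1 + (cmod w)\<^sup>2" by (simp add: add_pos_nonneg)
  have "cmod (gp w) / (1 + (cmod (gg w))\<^sup>2) \<le> B1 / (1 + (cmod w)\<^sup>2)" if "w \<in> cball 0 R"
  proof -
   have "(1 + (cmod w)\<^sup>2) * (cmod (gp w) / (1 + (cmod (gg w))\<^sup>2)) \<le> B1"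
    unfolding ratio [OF w] by (rule order_trans [OF abs_ge_self B1 [OF that, unfolded real_norm_def]])
   then show ?thesis using p by (simp add: pos_le_divide_eq mult.commute)
  qed
  moreover have "B1 / (1 + (cmod w)\<^sup>2) \<le> max B1 B2 / (1 + (cmod w)\<^sup>2)" "B2 / (1 + (cmod w)\<^sup>2) \<le> max B1 B2 / (1 + (cmod w)\<^sup>2)"
   using p by (auto intro!: divide_right_mono)
  ultimately show "cmod (gp w) / (1 + (cmod (gg w))\<^sup>2) \<le> max B1 B2 / (1 + (cmod w)\<^sup>2)"
   using big [of w] by (cases "w \<in> cball 0 R") (auto intro: order_trans)
 qed
qed

text \<open>Squaring the bound compares the integrand with a multiple of the density of the round
  sphere.\<close>

lemma area_density_finite:
 "(\<integral>\<^sup>+z. ennreal ((cmod (gp z))\<^sup>2 / (1 + (cmod (gg z))\<^sup>2)\<^sup>2) \<partial>lborel) < \<infinity>"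
proof -
 obtain B where B: "\<And>w. w \<notin> RHO ==> cmod (gp w) / (1 + (cmod (gg w))\<^sup>2) \<le> B / (1 + (cmod w)\<^sup>2)"
  using gp_bound by blast
 have "(\<integral>\<^sup>+z. ennreal ((cmod (gp z))\<^sup>2 / (1 + (cmod (gg z))\<^sup>2)\<^sup>2) \<partial>lborel)
   \<le> (\<integral>\<^sup>+z. ennreal (B\<^sup>2) * ennreal (1 / (1 + (cmod z)\<^sup>2)\<^sup>2) \<partial>lborel)"
 proof (rule nn_integral_mono_AE)
  have "AE z in lborel. z \<notin> RHO" using finite_RHO by (intro AE_not_in finite_imp_null_set_lborel)
  then show "AE z in lborel. ennreal ((cmod (gp z))\<^sup>2 / (1 + (cmod (gg z))\<^sup>2)\<^sup>2)
    \<le> ennreal (B\<^sup>2) * ennreal (1 / (1 + (cmod z)\<^sup>2)\<^sup>2)"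
  proof eventually_elim
   case (elim z)
   have "(cmod (gp z) / (1 + (cmod (gg z))\<^sup>2))\<^sup>2 \<le> (B / (1 + (cmod z)\<^sup>2))\<^sup>2"
    using B [OF elim] by (intro power_mono) auto
   then have "ennreal ((cmod (gp z))\<^sup>2 / (1 + (cmod (gg z))\<^sup>2)\<^sup>2) \<le> ennreal (B\<^sup>2 * (1 / (1 + (cmod z)\<^sup>2)\<^sup>2))"
    by (intro ennreal_leI) (simp add: power_divide)
   also have "\<dots> = ennreal (B\<^sup>2) * ennreal (1 / (1 + (cmod z)\<^sup>2)\<^sup>2)" by (rule ennreal_mult) auto
   finally show ?case .
  qed
 qed
 also have "\<dots> = ennreal (B\<^sup>2) * (\<integral>\<^sup>+z. ennreal (1 / (1 + (cmod z)\<^sup>2)\<^sup>2) \<partial>lborel)"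
  by (rule nn_integral_cmult) measurable
 also have "\<dots> < \<infinity>" using nn_integral_spherical_area_finite by (simp add: ennreal_mult_less_top)
 finally show ?thesis .
qed

definition kx :: "complex => real" where
 "kx x = - 16 * ((cmod (gp (csqrt x)))\<^sup>2 * cmod (cf1 x) / 4) / (1 + (cmod (gg (csqrt x)))\<^sup>2) ^ 4"

lemma kx_meas [measurable]: "kx \<in> borel_measurable borel" unfolding kx_def [abs_def] by measurable

lemma curvature_kx: "p \<in> topspace XM ==> gauss_curvature ws.M p = kx (xc p)"
proof -
 assume p: "p \<in> topspace XM"
 then have "xc p \<notin> PX" unfolding topspace_XM by (auto simp: C0_def)
 then have "csqrt (xc p) \<notin> RHO" using sq_in_PX [of "csqrt (xc p)"] by (simp del: csqrt.simps)
 then have "gg' (csqrt (xc p)) = gp (csqrt (xc p))" by (simp add: gg'_eq gp_def del: csqrt.simps)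
 then show ?thesis
  unfolding ws.gauss_curvature_M [OF p] by (simp add: ws.curv_def KK_def GG_def kx_def del: csqrt.simps)
qed

lemma xc_meas [measurable]: "xc \<in> borel_measurable BM"
proof -
 have "continuous_map XM euclidean xc"
 proof -
  have "XM = subtopology (subtopology SS (pt ` C)) (pt ` C0)"
   unfolding XM_def topspace_minus_P C0_def [symmetric] by (auto simp: subtopology_subtopology C0_def intro!: arg_cong [where f = "subtopology SS"])
  then have "continuous_map XM (top_of_set C) pc" using continuous_pc continuous_map_from_subtopology by metis
  then have "continuous_map XM euclidean pc" using continuous_map_in_subtopology by blast
  moreover have "continuous_map euclidean euclidean (fst :: complex \<times> complex => complex)" by (simp add: continuous_on_fst)
  ultimately have "continuous_map XM euclidean (fst \<circ> pc)" by (rule continuous_map_compose)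
  then show ?thesis by (simp add: xc_def [abs_def] o_def)
 qed
 then have "xc -` U \<inter> space BM \<in> sets BM" if "open U" for U
 proof -
  have "openin XM {p \<in> topspace XM. xc p \<in> U}"
   using \<open>continuous_map XM euclidean xc\<close> that by (auto simp: continuous_map_def)
  moreover have "{p \<in> topspace XM. xc p \<in> U} = xc -` U \<inter> space BM" by (auto simp: space_BM)
  ultimately show ?thesis by (simp add: sets_BM sigma_sets.Basic)
 qed
 then show ?thesis by (rule borel_measurableI)
qed

text \<open>In the coordinate \<open>x\<close> the factor \<open>|cf1 x|\<close> cancels between
  curvature and area density. Passing to \<open>w\<close> with \<open>x = w^2\<close> leaves a
  multiple of the spherical area covered by \<open>gg\<close>.\<close>

lemma finite_curvature: "finite_total_curvature ws.M" unfolding finite_total_curvature_def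
proof (intro exI conjI)
 show "area_measure ws.M mu" by (rule area)
 have sp: "space mu = topspace XM" "sets mu = sets BM" by (simp_all add: mu_def space_BM)
 have m: "borel_measurable mu = borel_measurable BM" by (rule measurable_cong_sets [OF sp(2) refl])
 have km: "(\<lambda>p. kx (xc p)) \<in> borel_measurable BM" by measurable
 have xT: "xc (TT (x, b)) = x" if "x \<notin> PX" for x b using that by (simp add: TT_def del: csqrt.simps)
 \<comment> \<open>The division by \<open>|w|^2\<close> prepares for the Jacobian
   \<open>4 |w|^2\<close> of \<open>x = w^2\<close>. At \<open>w = 0\<close> the value is
   \<open>0\<close> by the convention for division.\<close>
 define ph where "ph = (\<lambda>w. ennreal ((cmod (gp w))\<^sup>2 / (1 + (cmod (gg w))\<^sup>2)\<^sup>2 / (cmod w)\<^sup>2))"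
 have ph [measurable]: "ph \<in> borel_measurable borel" unfolding ph_def by measurable
 \<comment> \<open>Where \<open>cf x = 0\<close> the left side is \<open>0\<close>, because
   \<open>rhox\<close> then divides by zero.\<close>
 have pw: "ennreal (rhox x) * ennreal \<bar>kx x\<bar> \<le> ph (csqrt (x - 0))" for x
 proof -
  let ?w = "csqrt x"
  let ?g = "1 + (cmod (gg ?w))\<^sup>2"
  have g: "?g > 0" by (simp add: add_pos_nonneg)
  have w2: "(cmod ?w)\<^sup>2 = cmod x" by (metis norm_power power2_csqrt)
  have "rhox x * \<bar>kx x\<bar> \<le> (cmod (gp ?w))\<^sup>2 / ?g\<^sup>2 / (cmod ?w)\<^sup>2"
  proof (cases "cf x = 0")
   case True
   then show ?thesis by (simp add: rhox_def)
  next
   case False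
   then have nz: "cmod x > 0" "cmod (cf1 x) > 0" by (auto simp: cf_def)
   have "\<bar>kx x\<bar> = 4 * ((cmod (gp ?w))\<^sup>2 * cmod (cf1 x)) / ?g ^ 4"
    unfolding kx_def using g by (simp add: abs_mult abs_divide del: csqrt.simps)
   then have "rhox x * \<bar>kx x\<bar> = ?g\<^sup>2 / (4 * (cmod x * cmod (cf1 x))) * (4 * ((cmod (gp ?w))\<^sup>2 * cmod (cf1 x)) / ?g ^ 4)"
    by (simp add: rhox_def cf_def norm_mult del: csqrt.simps)
   also have "\<dots> = (cmod (gp ?w))\<^sup>2 / ?g\<^sup>2 / cmod x"
   proof -
    have "G\<^sup>2 / (4 * (t * f)) * (4 * (p * f) / G ^ 4) = p / G\<^sup>2 / t" if "G > 0" "t > 0" "f > 0" for G t f p :: real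
     using that by (simp add: field_simps power2_eq_square eval_nat_numeral)
    then show ?thesis using g nz by blast
   qed
   finally show ?thesis unfolding w2 by simp
  qed
  then have "ennreal (rhox x * \<bar>kx x\<bar>) \<le> ph ?w" unfolding ph_def by (rule ennreal_leI)
  moreover have "ennreal (rhox x * \<bar>kx x\<bar>) = ennreal (rhox x) * ennreal \<bar>kx x\<bar>"
   by (rule ennreal_mult) (auto simp: rhox_def)
  ultimately show ?thesis by simp
 qed
 have "(\<integral>\<^sup>+p. ennreal (norm (kx (xc p))) \<partial>mu)
   = (\<integral>\<^sup>+x. ennreal (rhox x) * (ennreal (norm (kx (xc (TT (x, True))))) + ennreal (norm (kx (xc (TT (x, False)))))) \<partial>lborel)"
  by (rule nn_integral_mu) measurable
 also have "\<dots> = (\<integral>\<^sup>+x. ennreal (rhox x) * (ennreal \<bar>kx x\<bar> + ennreal \<bar>kx x\<bar>) \<partial>lborel)"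
  using PX_null by (intro nn_integral_cong_AE) (auto simp: xT)
 \<comment> \<open>The term for the second square root is nonnegative and is added to match the
   substitution rule.\<close>
 also have "\<dots> \<le> (\<integral>\<^sup>+x. 2 * (ph (csqrt (x - 0)) + ph (- csqrt (x - 0))) \<partial>lborel)"
 proof (rule nn_integral_mono)
  fix x
  have "ennreal (rhox x) * (ennreal \<bar>kx x\<bar> + ennreal \<bar>kx x\<bar>) = 2 * (ennreal (rhox x) * ennreal \<bar>kx x\<bar>)"
   by (simp add: mult_2 distrib_left)
  also have "\<dots> \<le> 2 * (ph (csqrt (x - 0)) + ph (- csqrt (x - 0)))"
   using pw [of x] by (intro mult_left_mono) (auto intro: add_increasing2 simp del: csqrt.simps)
  finally show "ennreal (rhox x) * (ennreal \<bar>kx x\<bar> + ennreal \<bar>kx x\<bar>) \<le> 2 * (ph (csqrt (x - 0)) + ph (- csqrt (x - 0)))" .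
 qed
 also have "\<dots> = 2 * (\<integral>\<^sup>+x. ph (csqrt (x - 0)) + ph (- csqrt (x - 0)) \<partial>lborel)"
  by (rule nn_integral_cmult) measurable
 also have "(\<integral>\<^sup>+x. ph (csqrt (x - 0)) + ph (- csqrt (x - 0)) \<partial>lborel) = (\<integral>\<^sup>+z. ph z * ennreal (4 * (cmod z)\<^sup>2) \<partial>lborel)"
  by (rule nn_integral_complex_square [OF ph, symmetric])
 also have "\<dots> \<le> (\<integral>\<^sup>+z. 4 * ennreal ((cmod (gp z))\<^sup>2 / (1 + (cmod (gg z))\<^sup>2)\<^sup>2) \<partial>lborel)"
 proof (rule nn_integral_mono)
  fix z
  show "ph z * ennreal (4 * (cmod z)\<^sup>2) \<le> 4 * ennreal ((cmod (gp z))\<^sup>2 / (1 + (cmod (gg z))\<^sup>2)\<^sup>2)"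
  proof (cases "z = 0")
   case False
   have "ph z * ennreal (4 * (cmod z)\<^sup>2) = ennreal ((cmod (gp z))\<^sup>2 / (1 + (cmod (gg z))\<^sup>2)\<^sup>2 / (cmod z)\<^sup>2 * (4 * (cmod z)\<^sup>2))"
    unfolding ph_def by (rule ennreal_mult [symmetric]) auto
   also have "\<dots> = ennreal (4 * ((cmod (gp z))\<^sup>2 / (1 + (cmod (gg z))\<^sup>2)\<^sup>2))" using False by (simp add: field_simps)
   also have "\<dots> = 4 * ennreal ((cmod (gp z))\<^sup>2 / (1 + (cmod (gg z))\<^sup>2)\<^sup>2)" by (subst ennreal_mult) auto
   finally show ?thesis by simp
  qed simp
 qed
 also have "\<dots> = 4 * (\<integral>\<^sup>+z. ennreal ((cmod (gp z))\<^sup>2 / (1 + (cmod (gg z))\<^sup>2)\<^sup>2) \<partial>lborel)"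
  by (rule nn_integral_cmult) measurable
 finally have "(\<integral>\<^sup>+p. ennreal (norm (kx (xc p))) \<partial>mu)
   \<le> 2 * (4 * (\<integral>\<^sup>+z. ennreal ((cmod (gp z))\<^sup>2 / (1 + (cmod (gg z))\<^sup>2)\<^sup>2) \<partial>lborel))"
  by (meson mult_left_mono order_trans zero_le)
 also have "\<dots> < \<infinity>" using area_density_finite by (simp add: ennreal_mult_less_top)
 finally have "integrable mu (\<lambda>p. kx (xc p))"
  using km unfolding m [symmetric] by (rule integrableI_bounded [rotated])
 moreover have "integrable mu (gauss_curvature ws.M) \<longleftrightarrow> integrable mu (\<lambda>p. kx (xc p))"
  by (rule Bochner_Integration.integrable_cong [OF refl]) (simp add: sp(1) curvature_kx)
 ultimately show "integrable mu (gauss_curvature ws.M)" by blast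
qed

end

theorem theorem7p4:
 fixes k n :: nat
 assumes "k > 0" and "n > 0"
 shows "\<exists>(S :: point topology) A P (M :: point riem_surface) F.
      riemann_surface S A \<and> compact_space S \<and> has_genus S k \<and>
      P \<subseteq> topspace S \<and> finite P \<and> card P = n \<and>
      ricci_surface M \<and> nonpositively_curved M \<and> finite_total_curvature M \<and>
      biholomorphism (top_of M) (conformal_charts M)
       (subtopology S (topspace S - P)) (restrict_charts A (topspace S - P)) F \<and>
      (\<forall>p\<in>P. catenoidal_end M S A P F p)"
proof -
 interpret curve_ends k "n - 1" by unfold_locales (rule assms(1))
 have "card P = n" using card_P assms(2) by simp
 moreover have "biholomorphism (top_of ws.M) (conformal_charts ws.M)
   (subtopology SS (topspace SS - P)) (restrict_charts AS (topspace SS - P)) id"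
  using biholomorphic_id unfolding ws.M_sel ws.conformal_charts_M unfolding XM_def .
 ultimately show ?thesis
  using riemann_surface_SS compact_SS genus P_sub finite_P ws.ricci ws.nonpositive finite_curvature catenoidal
  by (intro exI [of _ SS] exI [of _ AS] exI [of _ P] exI [of _ ws.M] exI [of _ id] conjI ballI)
qed

end
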